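(* Let $0<a<b<\infty$, let $\mathbb{X}=\{x\in\mathbb{R}^2: a<|x|<b\}$ and let $k\in\mathbb{Z}$. Let $u_k(x)=Q[g](|x|)\,x$ be the twist map with angle of rotation function $$g(r)=2\pi k\,\frac{\log(r/a)}{\log(b/a)},\qquad a\le r\le b .$$ Then $u_k\in A_k$ and $u_k$ minimises $\mathbb{F}$ over the homotopy class $A_k$, i.e. $$\mathbb{F}[u_k;\mathbb{X}]=\inf_{v\in A_k}\mathbb{F}[v;\mathbb{X}].$$ Moreover $u_k$ is an $L^1$-local minimiser of $\mathbb{F}$ over $\mathcal{A}_\phi(\mathbb{X})$: there exists $\delta>0$ such that $\mathbb{F}[u_k;\mathbb{X}]\le\mathbb{F}[v;\mathbb{X}]$ for all $v\in\mathcal{A}_\phi(\mathbb{X})$ with $\|v-u_k\|_{L^1(\mathbb{X})}<\delta$.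
   Context: The energy is $\mathbb{F}[u;\mathbb{X}]=\frac12\int_{\mathbb{X}}\frac{|\nabla u|^2}{|u|^2}\,dx$, where $|\nabla u|$ is the Hilbert-Schmidt norm. The admissible class is $\mathcal{A}_\phi(\mathbb{X})=\{u\in W^{1,2}(\mathbb{X},\mathbb{R}^2):\det\nabla u=1\text{ a.e. in }\mathbb{X},\ u(x)=x\text{ on }\partial\mathbb{X}\text{ in the sense of traces}\}$. It is known that every $u\in\mathcal{A}_\phi(\mathbb{X})$ has a representative (again denoted $u$) that is a continuous map of $\overline{\mathbb{X}}$ into $\overline{\mathbb{X}}$ and equals the identity on $\partial\mathbb{X}$. For a continuous $f:\overline{\mathbb{X}}\to\overline{\mathbb{X}}$ equal to the identity on $\partial\mathbb{X}$, $\mathbf{deg}(f|f|^{-1})\in\mathbb{Z}$ is the winding number about the origin of the closed curve $[a,b]\ni r\mapsto f/|f|$ evaluated at the point with polar coordinates $(r,\theta)$, for fixed $\theta$ (independent of $\theta$). For $k\in\mathbb{Z}$ the homotopy class is $A_k=\{u\in\mathcal{A}_\phi(\mathbb{X}):\mathbf{deg}(u|u|^{-1})=k\}$. For a function $g:[a,b]\to\mathbb{R}$, $Q[g](r)$ is the $2\times2$ matrix of anticlockwise rotation by the angle $g(r)$, i.e. $\begin{bmatrix}\cos g(r)&-\sin g(r)\\ \sin g(r)&\cos g(r)\end{bmatrix}$. *)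

theory Defs
  imports "HOL-Complex_Analysis.Complex_Analysis"
begin

section \<open>Sobolev functions\<close>

definition square_integrable :: "'a measure \<Rightarrow> ('a \<Rightarrow> 'b::euclidean_space) \<Rightarrow> bool" where
  "square_integrable M f \<longleftrightarrow> f \<in> borel_measurable M \<and> integrable M (\<lambda>x. (norm (f x))\<^sup>2)"

text \<open>Meant for open \<^term>\<open>U\<close>.\<close>

primrec Ck_on :: "nat \<Rightarrow> 'a::euclidean_space set \<Rightarrow> ('a \<Rightarrow> 'b::euclidean_space) \<Rightarrow> bool" where
  "Ck_on 0 U f \<longleftrightarrow> continuous_on U f"
| "Ck_on (Suc n) U f \<longleftrightarrow> (\<forall>x\<in>U. f differentiable (at x)) \<and>
     (\<forall>e\<in>Basis. Ck_on n U (\<lambda>x. frechet_derivative f (at x) e))"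

definition test_function :: "'a::euclidean_space set \<Rightarrow> ('a \<Rightarrow> real) \<Rightarrow> bool" where
  "test_function \<Omega> \<phi> \<longleftrightarrow> (\<forall>n. Ck_on n UNIV \<phi>) \<and>
     compact (closure {x. \<phi> x \<noteq> 0}) \<and> closure {x. \<phi> x \<noteq> 0} \<subseteq> \<Omega>"

text \<open>Row \<^term>\<open>i\<close> of \<^term>\<open>G x\<close> is the weak gradient of the \<^term>\<open>i\<close>-th component of \<^term>\<open>u\<close>.\<close>

definition has_L2_gradient ::
    "(real^'n) set \<Rightarrow> (real^'n \<Rightarrow> real^'m) \<Rightarrow> (real^'n \<Rightarrow> real^'n^'m) \<Rightarrow> bool" where
  "has_L2_gradient \<Omega> u G \<longleftrightarrow> square_integrable (lebesgue_on \<Omega>) G \<and>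
     (\<forall>\<phi>. test_function \<Omega> \<phi> \<longrightarrow> (\<forall>i j.
        (LINT x|lebesgue_on \<Omega>. u x $ i * frechet_derivative \<phi> (at x) (axis j 1))
          = - (LINT x|lebesgue_on \<Omega>. G x $ i $ j * \<phi> x)))"

definition W12 :: "(real^'n) set \<Rightarrow> (real^'n \<Rightarrow> real^'m) set" where
  "W12 \<Omega> = {u. square_integrable (lebesgue_on \<Omega>) u \<and> (\<exists>G. has_L2_gradient \<Omega> u G)}"

text \<open>The gradient is determined only up to a null set; everything below is insensitive to
  the choice.\<close>

definition wgrad :: "(real^'n) set \<Rightarrow> (real^'n \<Rightarrow> real^'m) \<Rightarrow> real^'n \<Rightarrow> real^'n^'m" where
  "wgrad \<Omega> u = (SOME G. has_L2_gradient \<Omega> u G)"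

definition W12_norm :: "(real^'n) set \<Rightarrow> (real^'n \<Rightarrow> real^'m) \<Rightarrow> real" where
  "W12_norm \<Omega> u = sqrt ((LINT x|lebesgue_on \<Omega>. (norm (u x))\<^sup>2) +
                        (LINT x|lebesgue_on \<Omega>. (norm (wgrad \<Omega> u x))\<^sup>2))"


section \<open>The annulus and traces on its boundary\<close>

definition annulus :: "real \<Rightarrow> real \<Rightarrow> (real^2) set" where
  "annulus a b = {x. a < norm x \<and> norm x < b}"

definition polar :: "real \<Rightarrow> real \<Rightarrow> real^2" where
  "polar r \<theta> = vector [r * cos \<theta>, r * sin \<theta>]"

text \<open>The \<open>L\<^sup>2\<close> norm with respect to arc length on the two boundary circles.\<close>

definition boundary_L2_norm :: "real \<Rightarrow> real \<Rightarrow> (real^2 \<Rightarrow> real^2) \<Rightarrow> real" where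
  "boundary_L2_norm a b h =
     sqrt (\<Sum>\<rho>\<in>{a, b}. \<rho> * (LINT \<theta>|lebesgue_on {0..2*pi}. (norm (h (polar \<rho> \<theta>)))\<^sup>2))"

text \<open>The trace operator is the continuous extension, from \<open>W\<^sup>1\<^sup>,\<^sup>2\<close> to \<open>L\<^sup>2\<close> of the boundary, of the
  restriction map on functions that are \<open>C\<^sup>1\<close> up to the boundary. The predicate below is its graph.\<close>

definition has_trace :: "real \<Rightarrow> real \<Rightarrow> (real^2 \<Rightarrow> real^2) \<Rightarrow> (real^2 \<Rightarrow> real^2) \<Rightarrow> bool" where
  "has_trace a b u h \<longleftrightarrow>
     (\<forall>\<rho>\<in>{a, b}. square_integrable (lebesgue_on {0..2*pi}) (\<lambda>\<theta>. h (polar \<rho> \<theta>))) \<and>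
     (\<exists>w :: nat \<Rightarrow> real^2 \<Rightarrow> real^2.
        (\<forall>n. \<exists>U. open U \<and> closure (annulus a b) \<subseteq> U \<and> Ck_on 1 U (w n)) \<and>
        (\<lambda>n. W12_norm (annulus a b) (\<lambda>x. w n x - u x)) \<longlonglongrightarrow> 0 \<and>
        (\<lambda>n. boundary_L2_norm a b (\<lambda>x. w n x - h x)) \<longlonglongrightarrow> 0)"


section \<open>Energy, admissible maps and homotopy classes\<close>

text \<open>The norm on \<^typ>\<open>real^2^2\<close> is the Hilbert-Schmidt norm. Division is that of
  \<^typ>\<open>ennreal\<close>, so the integrand is infinite where the map vanishes but its gradient does not.\<close>

definition energy :: "(real^2) set \<Rightarrow> (real^2 \<Rightarrow> real^2) \<Rightarrow> ennreal" where
  "energy \<Omega> u = (1/2) * (\<integral>\<^sup>+ x. ennreal ((norm (wgrad \<Omega> u x))\<^sup>2) / ennreal ((norm (u x))\<^sup>2)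
                            \<partial>lebesgue_on \<Omega>)"

definition admissible :: "real \<Rightarrow> real \<Rightarrow> (real^2 \<Rightarrow> real^2) set" where
  "admissible a b = {u \<in> W12 (annulus a b).
     (AE x in lebesgue_on (annulus a b). det (wgrad (annulus a b) u x) = 1) \<and>
     has_trace a b u (\<lambda>x. x)}"

definition continuous_representative ::
    "real \<Rightarrow> real \<Rightarrow> (real^2 \<Rightarrow> real^2) \<Rightarrow> (real^2 \<Rightarrow> real^2) \<Rightarrow> bool" where
  "continuous_representative a b u f \<longleftrightarrow>
     (AE x in lebesgue_on (annulus a b). f x = u x) \<and>
     continuous_on (closure (annulus a b)) f \<and>
     f ` closure (annulus a b) \<subseteq> closure (annulus a b) \<and>
     (\<forall>x\<in>frontier (annulus a b). f x = x)"

definition to_complex :: "real^2 \<Rightarrow> complex" where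
  "to_complex y = Complex (y $ 1) (y $ 2)"

text \<open>The curve traced by \<open>f / |f|\<close> along the ray of angle \<^term>\<open>\<theta>\<close>, with \<open>r = a + t (b - a)\<close> and
  \<open>t\<close> in the unit interval.\<close>

definition ray_curve :: "real \<Rightarrow> real \<Rightarrow> (real^2 \<Rightarrow> real^2) \<Rightarrow> real \<Rightarrow> real \<Rightarrow> complex" where
  "ray_curve a b f \<theta> t =
     (let y = f (polar (a + t * (b - a)) \<theta>) in to_complex (y /\<^sub>R norm y))"

text \<open>For continuous \<^term>\<open>f\<close> as in \<^const>\<open>continuous_representative\<close> the winding number does not
  depend on the ray, so all rays may be required to give the same value.\<close>

definition has_degree :: "real \<Rightarrow> real \<Rightarrow> (real^2 \<Rightarrow> real^2) \<Rightarrow> int \<Rightarrow> bool" where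
  "has_degree a b f k \<longleftrightarrow> (\<forall>\<theta>. winding_number (ray_curve a b f \<theta>) 0 = of_int k)"

definition homotopy_class :: "real \<Rightarrow> real \<Rightarrow> int \<Rightarrow> (real^2 \<Rightarrow> real^2) set" where
  "homotopy_class a b k =
     {u \<in> admissible a b. \<exists>f. continuous_representative a b u f \<and> has_degree a b f k}"


section \<open>Twist maps\<close>

definition rotation :: "real \<Rightarrow> real^2^2" where
  "rotation t = vector [vector [cos t, - sin t], vector [sin t, cos t]]"

definition twist :: "(real \<Rightarrow> real) \<Rightarrow> real^2 \<Rightarrow> real^2" where
  "twist g x = rotation (g (norm x)) *v x"

definition twist_angle :: "real \<Rightarrow> real \<Rightarrow> int \<Rightarrow> real \<Rightarrow> real" where
  "twist_angle a b k r = 2 * pi * of_int k * (ln (r / a) / ln (b / a))"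

end

theory Submission
  imports Defs
begin

text \<open>An admissible map of finite energy is read as a complex function \<open>V\<close> of the angle \<open>t\<close> and the radius \<open>r\<close>,
  and the energy becomes half the integral of \<open>r |V\<^sub>r / V|\<^sup>2 + |V\<^sub>t / V|\<^sup>2 / r\<close>. Finite energy and \<open>det = 1\<close> force
  \<open>V \<noteq> 0\<close> almost everywhere. Two integrals of the logarithmic derivative are determined by the boundary values:
  \<open>Im (V\<^sub>t / V) / r\<close> has integral \<open>2 \<pi> L\<close> with \<open>L = ln (b / a)\<close>, and along almost every ray \<open>V\<^sub>r / V\<close> has integral
  \<open>L + 2 \<pi> i m\<close> with a single integer \<open>m\<close>, which is the degree. For smooth maps both are Green's formula for
  \<open>log V\<close>; in general \<open>1 / V\<close> is regularised to \<open>cnj V / (|V|\<^sup>2 + \<epsilon>)\<close>, the formula is applied to \<open>C\<^sup>1\<close>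
  approximations corrected to have exact boundary values, and \<open>\<epsilon>\<close> tends to \<open>0\<close>. Completing squares gives the lower
  bound \<open>\<pi> L (2 + (2 \<pi> m / L)\<^sup>2)\<close>, which the twist map attains.

  For the local statement, a competitor of smaller energy must have \<open>m \<noteq> k\<close>. On almost every ray its argument relative to
  the twist map then runs through a full turn, while the energy bounds how fast it can do so; hence it stays
  near a half turn on a set of radii of definite length, and the \<open>L\<^sup>1\<close> distance is bounded below.\<close>

section \<open>Test functions\<close>

text \<open>A map of class \<open>W12\<close> has no continuous logarithm, and \<open>V\<close> may
  come arbitrarily close to 0, so \<open>dV / V\<close> cannot be treated as a closed form directly.
  With the regularised inverse the form fails to be closed by a Jacobian term, weighted by an
  approximate point mass at 0. This defect is at most \<open>|Vr / V| |Vt / V|\<close>, integrable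
  by finite energy, and so vanishes in the limit by dominated convergence. Green's formula carries a
  radial weight \<psi>: \<open>\<psi> = ln\<close> on the full circle gives the angular integral,
  and \<open>\<psi> = 1\<close> on a sector shows that the ray integral is the same on almost all
  rays. Its terms on the two circles contain tangential derivatives, which convergence of traces in
  L2 does not control; hence the correction to exact boundary values, paid for by a Poincare
  estimate in thin strips. The lower bound is a calibration: the density lies above its tangent
  plane at the twist map, and the two integrals are exactly what is needed to integrate that plane.
  Test functions enter because \<open>wgrad\<close> is picked by choice: only uniqueness of weak
  gradients connects it with derivatives that can be computed.\<close>

definition flat_exp :: "real poly \<Rightarrow> real \<Rightarrow> real" where
  "flat_exp p t = (if t \<le> 0 then 0 else poly p (1/t) * exp (-(1/t)))"

lemma poly_times_exp_minus_at_top: "((\<lambda>x. poly p x * exp (-x)) \<longlongrightarrow> (0::real)) at_top"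
proof -
  have "((\<lambda>x. \<Sum>i\<le>degree p. coeff p i * (x ^ i / exp x)) \<longlongrightarrow> (\<Sum>i\<le>degree p. coeff p i * 0)) at_top"
    by (intro tendsto_intros tendsto_power_div_exp_0)
  then show ?thesis
    by (simp add: poly_altdef exp_minus sum_distrib_right divide_inverse mult.assoc)
qed

lemma flat_exp_tendsto_0: "(flat_exp p \<longlongrightarrow> 0) (at 0)"
proof (rule filterlim_split_at)
  have "((\<lambda>t::real. 0) \<longlongrightarrow> 0) (at_left (0::real))" by simp
  moreover have "eventually (\<lambda>t. 0 = flat_exp p t) (at_left 0)"
    by (rule eventually_at_leftI[of "-1"]) (auto simp: flat_exp_def)
  ultimately show "(flat_exp p \<longlongrightarrow> 0) (at_left 0)"
    by (rule Lim_transform_eventually)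
  have "((\<lambda>t. poly p (inverse t) * exp (-(inverse t))) \<longlongrightarrow> 0) (at_right (0::real))"
    by (rule filterlim_compose[OF poly_times_exp_minus_at_top filterlim_inverse_at_top_right])
  moreover have "eventually (\<lambda>t. poly p (inverse t) * exp (-(inverse t)) = flat_exp p t) (at_right 0)"
    by (rule eventually_at_rightI[of _ 1]) (auto simp: flat_exp_def inverse_eq_divide)
  ultimately show "(flat_exp p \<longlongrightarrow> 0) (at_right 0)"
    by (rule Lim_transform_eventually)
qed

text \<open>For \<open>t > 0\<close> differentiation turns \<open>p(1/t) exp(-1/t)\<close> into
  \<open>(1/t)^2 (p - p')(1/t) exp(-1/t)\<close>, and \<open>[:0,0,1:]\<close> supplies the factor
  \<open>(1/t)^2\<close>. The family is thus closed under differentiation, and smoothness follows by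
  induction over all \<open>p\<close> at once. At 0 the difference quotient is again a member,
  \<open>flat_exp (pCons 0 p)\<close>, and tends to 0.\<close>

lemma has_real_derivative_flat_exp:
  "(flat_exp p has_real_derivative flat_exp ([:0,0,1:] * (p - pderiv p)) t) (at t)"
proof (cases t "0::real" rule: linorder_cases)
  case less
  have "((\<lambda>x::real. 0) has_real_derivative 0) (at t)" by simp
  moreover have "\<forall>\<^sub>F x in nhds t. flat_exp p x = 0"
    using eventually_nhds_in_open[of "{..<0}" t] less
    by (auto simp: flat_exp_def elim!: eventually_mono)
  ultimately show ?thesis
    using less DERIV_cong_ev[of t t "flat_exp p" "\<lambda>_. 0" 0 0] by (simp add: flat_exp_def)
next
  case equal
  have "(\<lambda>h. flat_exp p (0 + h) / h) = flat_exp (pCons 0 p)"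
    by (auto simp: fun_eq_iff flat_exp_def)
  then show ?thesis
    using flat_exp_tendsto_0[of "pCons 0 p"] equal unfolding DERIV_def by (simp add: flat_exp_def)
next
  case greater
  have "((\<lambda>t. poly p (1/t) * exp (-(1/t))) has_real_derivative
      poly ([:0,0,1:] * (p - pderiv p)) (1/t) * exp (-(1/t))) (at t)"
  proof -
    have "((\<lambda>t. 1/t) has_real_derivative (- ((1/t)^2))) (at t)"
      using greater by (auto intro!: derivative_eq_intros simp: power2_eq_square)
    then have "((\<lambda>t. poly p (1/t) * exp (-(1/t))) has_real_derivative
      (poly (pderiv p) (1/t) * (- ((1/t)^2))) * exp (-(1/t)) + (exp (-(1/t)) * (-(- ((1/t)^2)))) * poly p (1/t)) (at t)"
      by (intro DERIV_mult DERIV_chain2[OF poly_DERIV] DERIV_chain2[OF DERIV_exp] DERIV_minus)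
    then show ?thesis
      by (rule back_subst[of "\<lambda>D. (_ has_real_derivative D) (at t)"]) (simp add: algebra_simps power2_eq_square)
  qed
  moreover have "\<forall>\<^sub>F x in nhds t. flat_exp p x = poly p (1/x) * exp (-(1/x))"
    using eventually_nhds_in_open[of "{0<..}" t] greater
    by (auto simp: flat_exp_def elim!: eventually_mono)
  ultimately show ?thesis
    using greater DERIV_cong_ev[of t t "flat_exp p" "\<lambda>t. poly p (1/t) * exp (-(1/t))"] by (simp add: flat_exp_def)
qed

lemma frechet_derivative_apply_eq:
  "(f has_derivative f') (at x) \<Longrightarrow> frechet_derivative f (at x) e = f' e"
  using frechet_derivative_at[of f f' x] by simp

lemma Ck_on_Suc_imp: "Ck_on (Suc n) U f \<Longrightarrow> Ck_on n U f"
proof (induction n arbitrary: f)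
  case 0
  then have "\<forall>x\<in>U. continuous (at x) f"
    by (simp add: differentiable_imp_continuous_within)
  then show ?case by (simp add: continuous_at_imp_continuous_on)
qed simp

lemma Ck_on_const: "Ck_on n U (\<lambda>x. c)"
  by (induction n arbitrary: c) auto

lemma Ck_on_add:
  assumes "Ck_on n UNIV f" "Ck_on n UNIV g"
  shows "Ck_on n UNIV (\<lambda>x. f x + g x)"
  using assms
proof (induction n arbitrary: f g)
  case 0 then show ?case by (auto intro: continuous_intros)
next
  case (Suc n)
  then have "frechet_derivative (\<lambda>x. f x + g x) (at x) e =
      frechet_derivative f (at x) e + frechet_derivative g (at x) e" for x e
    by (intro frechet_derivative_apply_eq[of _ "\<lambda>e. frechet_derivative f (at x) e + frechet_derivative g (at x) e"]
        has_derivative_add) (simp_all add: frechet_derivative_works[symmetric])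
  with Suc show ?case by (auto intro: differentiable_add)
qed

lemma Ck_on_mult:
  fixes f g :: "'a::euclidean_space \<Rightarrow> real"
  assumes "Ck_on n UNIV f" "Ck_on n UNIV g"
  shows "Ck_on n UNIV (\<lambda>x. f x * g x)"
  using assms
proof (induction n arbitrary: f g)
  case 0 then show ?case by (auto intro: continuous_intros)
next
  case (Suc n)
  have D: "f differentiable at x" "g differentiable at x" for x using Suc.prems by auto
  have "frechet_derivative (\<lambda>x. f x * g x) (at x) e =
      f x * frechet_derivative g (at x) e + frechet_derivative f (at x) e * g x" for x e
    by (rule frechet_derivative_apply_eq[OF has_derivative_mult])
      (simp_all add: frechet_derivative_works[symmetric] D)
  moreover have "Ck_on n UNIV (\<lambda>x. f x * frechet_derivative g (at x) e + frechet_derivative f (at x) e * g x)" if "e \<in> Basis" for e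
    using Suc.prems that by (intro Ck_on_add Suc.IH Ck_on_Suc_imp[of n _ f] Ck_on_Suc_imp[of n _ g]) auto
  ultimately show ?case using D by auto
qed

lemma Ck_on_prod:
  fixes f :: "'i \<Rightarrow> 'a::euclidean_space \<Rightarrow> real"
  assumes "\<And>i. i \<in> I \<Longrightarrow> Ck_on n UNIV (f i)"
  shows "Ck_on n UNIV (\<lambda>x. \<Prod>i\<in>I. f i x)"
  using assms by (induction I rule: infinite_finite_induct) (auto simp: Ck_on_const intro: Ck_on_mult)

lemma Ck_on_flat_exp_inner:
  fixes v :: "'a::euclidean_space"
  shows "Ck_on n UNIV (\<lambda>x. flat_exp p (x \<bullet> v + s))"
proof (induction n arbitrary: p)
  have D: "((\<lambda>x. flat_exp p (x \<bullet> v + s)) has_derivative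
     (\<lambda>h. (h \<bullet> v) * flat_exp ([:0,0,1:] * (p - pderiv p)) (x \<bullet> v + s))) (at x)" for p x
  proof -
    have "((\<lambda>x. x \<bullet> v + s) has_derivative (\<lambda>h. h \<bullet> v)) (at x)"
      by (auto intro!: derivative_eq_intros)
    from has_derivative_compose[OF this has_real_derivative_flat_exp[of p "x \<bullet> v + s", unfolded has_field_derivative_def]]
    show ?thesis by (simp only: mult.commute)
  qed
  case 0 then show ?case
    using D by (auto intro!: continuous_at_imp_continuous_on has_derivative_continuous)
  case (Suc n)
  have "frechet_derivative (\<lambda>x. flat_exp p (x \<bullet> v + s)) (at x) e
      = (e \<bullet> v) * flat_exp ([:0,0,1:] * (p - pderiv p)) (x \<bullet> v + s)" for x e
    by (rule frechet_derivative_apply_eq[OF D])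
  moreover have "(\<lambda>x. flat_exp p (x \<bullet> v + s)) differentiable at x" for x
    using D differentiable_def by blast
  ultimately show ?case using Suc by (auto intro!: Ck_on_mult Ck_on_const simp del: mult_pCons_left)
qed

text \<open>The positive and the negative part of \<open>g\<close>, taken as densities, define
  measures that agree on boxes, an intersection-stable generator, hence everywhere. Uniqueness of
  densities gives \<open>ennreal (g x) = ennreal (- g x)\<close> almost everywhere. One of the two
  sides is always 0, so \<open>g x = 0\<close>.\<close>

lemma AE_zero_if_box_integrals_zero:
  fixes g :: "'a::euclidean_space \<Rightarrow> real"
  assumes g: "integrable lborel g"
    and z: "\<And>c d. (LINT x|lborel. g x * indicator (box c d) x) = 0"
  shows "AE x in lborel. g x = 0"
proof -
  have [measurable]: "g \<in> borel_measurable borel" using g by auto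
  let ?N = "\<lambda>g. density lborel (\<lambda>x. ennreal (g x))"
  have em: "emeasure (?N f) (box c d) = (\<integral>\<^sup>+x. ennreal (f x * indicator (box c d) x) \<partial>lborel)"
    if [measurable]: "f \<in> borel_measurable borel" for f :: "'a \<Rightarrow> real" and c d
    by (auto simp: emeasure_density indicator_def intro!: nn_integral_cong)
  have fin: "emeasure (?N f) (box c d) < \<infinity>" if "integrable lborel f" for f :: "'a \<Rightarrow> real" and c d
  proof -
    have "integrable lborel (\<lambda>x. f x * indicator (box c d) x)"
      using that by (intro integrable_real_mult_indicator) auto
    then have "(\<integral>\<^sup>+x. ennreal (f x * indicator (box c d) x) \<partial>lborel) \<noteq> \<infinity>"
      by (simp add: real_integrable_def)
    with that show ?thesis
      by (subst em) (auto simp: less_top)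
  qed
  have "?N g = ?N (\<lambda>x. - g x)"
  proof (rule measure_eqI_generator_eq[where E="range (\<lambda>(c, d). box c d)" and \<Omega>=UNIV
        and A="\<lambda>n. box (- (real n *\<^sub>R One)) (real n *\<^sub>R One)"])
    show "Int_stable (range (\<lambda>(c, d). box c d :: 'a set))"
      by (auto simp: Int_stable_def box_Int_box)
    show "sets (?N g) = sigma_sets UNIV (range (\<lambda>(c, d). box c d))"
      "sets (?N (\<lambda>x. - g x)) = sigma_sets UNIV (range (\<lambda>(c, d). box c d))"
      by (simp_all add: borel_eq_box)
    fix X :: "'a set" assume "X \<in> range (\<lambda>(c, d). box c d)"
    then obtain c d where X: "X = box c d" by auto
    let ?h = "\<lambda>x. g x * indicator (box c d) x"
    have i: "integrable lborel ?h"
      using g by (intro integrable_real_mult_indicator) auto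
    have f: "(\<integral>\<^sup>+x. ennreal (?h x) \<partial>lborel) \<noteq> \<infinity>" "(\<integral>\<^sup>+x. ennreal (- ?h x) \<partial>lborel) \<noteq> \<infinity>"
      using i unfolding real_integrable_def by auto
    have "enn2real (\<integral>\<^sup>+x. ennreal (?h x) \<partial>lborel) = enn2real (\<integral>\<^sup>+x. ennreal (- ?h x) \<partial>lborel)"
      using z[of c d] unfolding real_lebesgue_integral_def[OF i] by linarith
    moreover have "x = y" if "enn2real x = enn2real y" "x \<noteq> \<infinity>" "y \<noteq> \<infinity>" for x y
      using that by (cases x; cases y) auto
    ultimately have "(\<integral>\<^sup>+x. ennreal (?h x) \<partial>lborel) = (\<integral>\<^sup>+x. ennreal (- ?h x) \<partial>lborel)"
      using f by blast
    then show "emeasure (?N g) X = emeasure (?N (\<lambda>x. - g x)) X"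
      by (simp add: X em)
  next
    fix i show "emeasure (?N g) (box (- (real i *\<^sub>R One)) (real i *\<^sub>R One)) \<noteq> \<infinity>"
      by (rule less_imp_neq[OF fin[OF g]])
  qed (auto simp: UN_box_eq_UNIV)
  then have "AE x in lborel. ennreal (g x) = ennreal (- g x)"
    by (intro sigma_finite_measure.density_unique[OF sigma_finite_lborel]) auto
  then show ?thesis
    by eventually_elim (smt (verit) ennreal_eq_0_iff ennreal_neg)
qed

text \<open>A smooth approximation from below of the indicator of \<open>box c d\<close>. Each
  coordinate contributes \<open>exp (-1/s)\<close> with \<open>s\<close> equal to \<open>k\<close>
  times the distance to either face, so the product vanishes outside the box for
  \<open>k > 0\<close> and tends to 1 inside as \<open>k\<close> grows.\<close>

definition box_test :: "real \<Rightarrow> 'a::euclidean_space \<Rightarrow> 'a \<Rightarrow> 'a \<Rightarrow> real" where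
  "box_test k c d x = (\<Prod>i\<in>Basis. flat_exp 1 (x \<bullet> (k *\<^sub>R i) + - (k * (c \<bullet> i))) * flat_exp 1 (x \<bullet> (- k *\<^sub>R i) + k * (d \<bullet> i)))"

lemma flat_exp_1_bounds: "0 \<le> flat_exp 1 t" "flat_exp 1 t \<le> 1"
  by (auto simp: flat_exp_def)

lemma box_test_eq_0:
  assumes "x \<notin> box c d" "k > 0" shows "box_test k c d x = 0"
proof -
  obtain i where i: "i \<in> Basis" "\<not> (c \<bullet> i < x \<bullet> i \<and> x \<bullet> i < d \<bullet> i)" using assms by (auto simp: mem_box)
  have "k * (x \<bullet> i) \<le> k * (c \<bullet> i) \<or> k * (d \<bullet> i) \<le> k * (x \<bullet> i)"
    using i \<open>k > 0\<close> by auto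
  then have "flat_exp 1 (x \<bullet> (k *\<^sub>R i) + - (k * (c \<bullet> i))) * flat_exp 1 (x \<bullet> (- k *\<^sub>R i) + k * (d \<bullet> i)) = 0"
    by (auto simp: flat_exp_def)
  then show ?thesis unfolding box_test_def using i(1) by (intro prod_zero) auto
qed

lemma box_test_bounds: "0 \<le> box_test k c d x" "box_test k c d x \<le> 1"
  unfolding box_test_def by (auto intro!: prod_nonneg prod_le_1 mult_nonneg_nonneg mult_le_one flat_exp_1_bounds)

lemma test_function_box_test:
  assumes "cbox c d \<subseteq> \<Omega>" "k > 0" shows "test_function \<Omega> (box_test k c d)"
proof -
  have sub: "closure {x. box_test k c d x \<noteq> 0} \<subseteq> cbox c d"
    using box_test_eq_0[OF _ \<open>k > 0\<close>] box_subset_cbox by (intro closure_minimal) blast+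
  moreover have "Ck_on n UNIV (box_test k c d)" for n
    unfolding box_test_def by (intro Ck_on_prod Ck_on_mult Ck_on_flat_exp_inner)
  moreover have "compact (closure {x. box_test k c d x \<noteq> 0})"
    using sub bounded_subset[OF bounded_cbox] by (auto simp: compact_eq_bounded_closed)
  ultimately show ?thesis using assms by (auto simp: test_function_def)
qed

lemma flat_exp_1_tendsto_1:
  assumes "s > 0" shows "(\<lambda>n. flat_exp 1 (real (Suc n) * s)) \<longlonglongrightarrow> 1"
proof -
  have "(\<lambda>n. exp (- (inverse (real (Suc n)) * (1/s)))) \<longlonglongrightarrow> exp (- (0 * (1/s)))"
    by (intro tendsto_intros LIMSEQ_inverse_real_of_nat)
  moreover have "flat_exp 1 (real (Suc n) * s) = exp (- (inverse (real (Suc n)) * (1/s)))" for n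
    using assms by (simp add: flat_exp_def divide_inverse mult_le_0_iff del: of_nat_Suc)
  ultimately show ?thesis by simp
qed

lemma box_test_tendsto:
  "(\<lambda>n. box_test (real (Suc n)) c d x) \<longlonglongrightarrow> indicator (box c d) x"
proof (cases "x \<in> box c d")
  case True
  have "(\<lambda>n. box_test (real (Suc n)) c d x) \<longlonglongrightarrow> (\<Prod>i\<in>(Basis::'a set). 1 * 1)"
    unfolding box_test_def
  proof (intro tendsto_prod tendsto_mult)
    fix i :: 'a assume "i \<in> Basis"
    then have i: "x \<bullet> i - c \<bullet> i > 0" "d \<bullet> i - x \<bullet> i > 0" using True by (auto simp: mem_box)
    show "(\<lambda>n. flat_exp 1 (x \<bullet> (real (Suc n) *\<^sub>R i) + - (real (Suc n) * (c \<bullet> i)))) \<longlonglongrightarrow> 1"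
      using flat_exp_1_tendsto_1[OF i(1)] by (simp add: right_diff_distrib del: of_nat_Suc)
    show "(\<lambda>n. flat_exp 1 (x \<bullet> (- real (Suc n) *\<^sub>R i) + real (Suc n) * (d \<bullet> i))) \<longlonglongrightarrow> 1"
      using flat_exp_1_tendsto_1[OF i(2)] by (simp add: right_diff_distrib add.commute del: of_nat_Suc)
  qed
  then show ?thesis using True by simp
next
  case False then show ?thesis by (simp add: box_test_eq_0)
qed

lemma test_function_continuous: "test_function \<Omega> \<phi> \<Longrightarrow> continuous_on UNIV \<phi>"
  by (metis Ck_on.simps(1) test_function_def)

lemma test_function_bounded:
  assumes "test_function \<Omega> \<phi>" obtains B where "\<And>x. \<bar>\<phi> x\<bar> \<le> B"
proof -
  let ?K = "closure {x. \<phi> x \<noteq> 0}"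
  have "compact (\<phi> ` ?K)"
    using assms test_function_continuous[OF assms]
    by (intro compact_continuous_image) (auto simp: test_function_def intro: continuous_on_subset)
  then obtain B where B: "\<And>x. x \<in> ?K \<Longrightarrow> \<bar>\<phi> x\<bar> \<le> B" "B > 0"
    by (fastforce dest!: compact_imp_bounded simp: bounded_pos)
  have "\<bar>\<phi> x\<bar> \<le> B" for x
    using B(1)[of x] B(2) closure_subset[of "{x. \<phi> x \<noteq> 0}"] by (cases "\<phi> x = 0") auto
  then show thesis by (rule that)
qed

text \<open>By dominated convergence the tests \<open>box_test\<close> turn the hypothesis into
  vanishing integrals over boxes whose closure lies in \<open>\<Omega>\<close>. The rest is
  localisation, carried out on a Borel representative \<open>g'\<close> of \<open>g\<close> extended
  by 0.\<close>

lemma fundamental_lemma_of_variations: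
  fixes g :: "'a::euclidean_space \<Rightarrow> real"
  assumes "open \<Omega>" and g: "integrable (lebesgue_on \<Omega>) g"
    and z: "\<And>\<phi>. test_function \<Omega> \<phi> \<Longrightarrow> (LINT x|lebesgue_on \<Omega>. g x * \<phi> x) = 0"
  shows "AE x in lebesgue_on \<Omega>. g x = 0"
proof -
  have \<Omega>: "\<Omega> \<in> sets lebesgue" using \<open>open \<Omega>\<close> by auto
  let ?G = "\<lambda>x. indicator \<Omega> x * g x"
  have iG: "integrable lebesgue ?G"
    using g \<Omega> by (simp add: integrable_restrict_space)
  obtain g' where g'[measurable]: "g' \<in> borel_measurable borel" and ae0: "AE x in lborel. ?G x = g' x"
    using completion_ex_borel_measurable_real[of ?G lborel] iG by auto
  then have ae: "AE x in lebesgue. ?G x = g' x" by (simp add: AE_completion)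
  have ig': "integrable lborel g'"
    using integrable_cong_AE_imp[OF iG _ ae] g' by (simp add: integrable_completion measurable_completion AE_symmetric)
  have zero: "(LINT x|lborel. g' x * \<phi> x) = 0" if \<phi>: "test_function \<Omega> \<phi>" for \<phi>
  proof -
    have [measurable]: "\<phi> \<in> borel_measurable borel"
      using test_function_continuous[OF \<phi>] by (simp add: borel_measurable_continuous_onI)
    have "(LINT x|lborel. g' x * \<phi> x) = (LINT x|lebesgue. g' x * \<phi> x)"
      by (simp add: integral_completion)
    also have "\<dots> = (LINT x|lebesgue. ?G x * \<phi> x)"
      using ae by (intro integral_cong_AE borel_measurable_times borel_measurable_integrable[OF iG] measurable_completion)
        (auto elim!: eventually_mono)
    also have "\<dots> = (LINT x|lebesgue_on \<Omega>. g x * \<phi> x)"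
      using \<Omega> by (simp add: integral_restrict_space mult.assoc)
    finally show ?thesis using z[OF \<phi>] by simp
  qed
  have box0: "(LINT x|lborel. g' x * indicator (box c d) x) = 0" if "cbox c d \<subseteq> \<Omega>" for c d
  proof -
    have [measurable]: "box_test (real (Suc n)) c d \<in> borel_measurable borel" for n
      using test_function_continuous[OF test_function_box_test[OF that, of "real (Suc n)"]]
      by (simp add: borel_measurable_continuous_onI)
    have "(\<lambda>n. LINT x|lborel. g' x * box_test (real (Suc n)) c d x) \<longlonglongrightarrow> (LINT x|lborel. g' x * indicator (box c d) x)"
      by (rule integral_dominated_convergence[where w="\<lambda>x. \<bar>g' x\<bar>"])
        (use ig' box_test_bounds[where 'a='a] in \<open>auto intro!: tendsto_intros box_test_tendsto mult_left_le simp: abs_mult simp del: of_nat_Suc\<close>)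
    then show ?thesis
      using zero[OF test_function_box_test[OF that]] by (simp add: LIMSEQ_const_iff del: of_nat_Suc)
  qed
  \<comment> \<open>The criterion asks for all boxes, including those that leave
    \<open>\<Omega>\<close>. Cutting \<open>g'\<close> off to one box inside reduces them to
    intersections, which are again boxes.\<close>
  have loc: "AE x in lborel. x \<in> box c d \<longrightarrow> g' x = 0" if sub: "cbox c d \<subseteq> \<Omega>" for c d
  proof -
    have "AE x in lborel. g' x * indicator (box c d) x = 0"
    proof (rule AE_zero_if_box_integrals_zero)
      show "integrable lborel (\<lambda>x. g' x * indicator (box c d) x)"
        using ig' by (intro integrable_real_mult_indicator) auto
      fix c' d' :: 'a
      obtain e f where ef: "box c d \<inter> box c' d' = box e f" by (auto simp: box_Int_box)
      have "(LINT x|lborel. g' x * indicator (box e f) x) = 0"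
      proof (cases "box e f = {}")
        case False
        \<comment> \<open>Nonemptiness matters: when \<open>box e f\<close> is empty, a degenerate
          \<open>cbox e f\<close> need not lie in \<open>cbox c d\<close>.\<close>
        then have "cbox e f = closure (box e f)" by (simp add: closure_box)
        also have "\<dots> \<subseteq> cbox c d"
          using ef box_subset_cbox by (intro closure_minimal) blast+
        finally show ?thesis using sub box0 by blast
      qed simp
      moreover have "g' x * indicator (box c d) x * indicator (box c' d') x = g' x * indicator (box e f) x" for x
        unfolding ef[symmetric] by (simp add: indicator_inter_arith)
      ultimately show "(LINT x|lborel. g' x * indicator (box c d) x * indicator (box c' d') x) = 0" by (simp only:)
    qed
    then show ?thesis by eventually_elim (auto simp: indicator_def split: if_splits)
  qed
  obtain D where D: "countable D" "D \<subseteq> Pow \<Omega>" "\<And>X. X \<in> D \<Longrightarrow> \<exists>c d. X = cbox c d" "\<Union>D = \<Omega>"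
    using open_countable_Union_open_cbox[OF \<open>open \<Omega>\<close>] by metis
  \<comment> \<open>Countably many closed boxes exhaust \<open>\<Omega>\<close>; each differs by a
    null set from the open box treated in \<open>loc\<close>.\<close>
  have "AE x in lborel. \<forall>X\<in>D. x \<in> X \<longrightarrow> g' x = 0"
  proof (subst AE_ball_countable[OF D(1)], intro ballI)
    fix X assume X: "X \<in> D"
    then obtain c d where cd: "X = cbox c d" using D(3) by blast
    have "cbox c d - box c d \<in> null_sets lborel"
      using emeasure_lborel_cbox_eq[of c d] emeasure_lborel_box_eq[of c d]
      by (intro null_setsI) (auto simp: emeasure_Diff box_subset_cbox emeasure_lborel_cbox_finite)
    then have "AE x in lborel. x \<notin> cbox c d - box c d" by (rule AE_not_in)
    moreover have "AE x in lborel. x \<in> box c d \<longrightarrow> g' x = 0"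
      using loc cd X D(2) by blast
    ultimately show "AE x in lborel. x \<in> X \<longrightarrow> g' x = 0"
      by eventually_elim (auto simp: cd)
  qed
  then have "AE x in lborel. x \<in> \<Omega> \<longrightarrow> g' x = 0"
    by eventually_elim (use D(4) in blast)
  with ae0 have "AE x in lborel. x \<in> \<Omega> \<longrightarrow> g x = 0" by eventually_elim auto
  then show ?thesis using \<Omega> by (simp add: AE_restrict_space_iff AE_completion)
qed

section \<open>Weak gradients\<close>

lemma continuous_on_compact_bounded:
  fixes f :: "'a::topological_space \<Rightarrow> 'b::real_normed_vector"
  assumes "compact K" "continuous_on K f"
  obtains B where "\<And>x. x \<in> K \<Longrightarrow> norm (f x) \<le> B"
  using compact_imp_bounded[OF compact_continuous_image[OF assms(2,1)]] unfolding bounded_iff by blast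

lemma finite_measure_lebesgue_on:
  assumes "bounded \<Omega>" "\<Omega> \<in> sets lebesgue" shows "finite_measure (lebesgue_on \<Omega>)"
proof
  have "\<Omega> \<in> lmeasurable" using assms by (simp add: bounded_set_imp_lmeasurable)
  then show "emeasure (lebesgue_on \<Omega>) (space (lebesgue_on \<Omega>)) \<noteq> \<infinity>"
    by (auto simp: emeasure_restrict_space fmeasurable_def)
qed

lemma square_integrable_imp_integrable:
  assumes "finite_measure M" "square_integrable M f"
  shows "integrable M f"
proof -
  interpret finite_measure M by fact
  have [measurable]: "f \<in> borel_measurable M" and i: "integrable M (\<lambda>x. (norm (f x))\<^sup>2)"
    using assms by (auto simp: square_integrable_def)
  have "norm (f x) \<le> norm (1 + (norm (f x))\<^sup>2)" for x
    using zero_le_power2[of "norm (f x) - 1"] by (simp add: power2_eq_square algebra_simps) (smt (verit) norm_ge_zero zero_le_square)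
  then show ?thesis
    using i by (intro Bochner_Integration.integrable_bound[of M "\<lambda>x. 1 + (norm (f x))\<^sup>2" f]) auto
qed

lemma integrable_mult_test_function:
  fixes g :: "'a::euclidean_space \<Rightarrow> real"
  assumes "open \<Omega>" and g: "integrable (lebesgue_on \<Omega>) g" and \<phi>: "test_function \<Omega> \<phi>"
  shows "integrable (lebesgue_on \<Omega>) (\<lambda>x. g x * \<phi> x)"
proof -
  obtain B where B: "\<And>x. \<bar>\<phi> x\<bar> \<le> B" using test_function_bounded[OF \<phi>] by blast
  have m: "\<phi> \<in> borel_measurable (lebesgue_on \<Omega>)"
    using assms by (intro continuous_imp_measurable_on_sets_lebesgue continuous_on_subset[OF test_function_continuous[OF \<phi>]]) auto
  show ?thesis
  proof (rule Bochner_Integration.integrable_bound[of _ "\<lambda>x. B * \<bar>g x\<bar>"])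
    show "AE x in lebesgue_on \<Omega>. norm (g x * \<phi> x) \<le> norm (B * \<bar>g x\<bar>)"
    proof (intro AE_I2)
      fix x
      have "B \<ge> 0" using B[of x] by linarith
      then show "norm (g x * \<phi> x) \<le> norm (B * \<bar>g x\<bar>)"
        using mult_right_mono[OF B[of x], of "\<bar>g x\<bar>"] by (simp add: abs_mult mult.commute)
    qed
  qed (use g m in auto)
qed

text \<open>Allows \<open>wgrad\<close>, an arbitrary choice, to be replaced almost everywhere by
  any gradient computed by hand. The entries of the difference of two gradients integrate to 0
  against every test function.\<close>

lemma has_L2_gradient_unique:
  fixes u :: "real^'n \<Rightarrow> real^'m"
  assumes \<Omega>: "open \<Omega>" "bounded \<Omega>" and G: "has_L2_gradient \<Omega> u G" and H: "has_L2_gradient \<Omega> u H"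
  shows "AE x in lebesgue_on \<Omega>. G x = H x"
proof -
  have fin: "finite_measure (lebesgue_on \<Omega>)" using \<Omega> by (intro finite_measure_lebesgue_on) auto
  have "AE x in lebesgue_on \<Omega>. G x $ i $ j - H x $ i $ j = 0" for i j
  proof (rule fundamental_lemma_of_variations[OF \<Omega>(1)])
    have i: "integrable (lebesgue_on \<Omega>) (\<lambda>x. K x $ i $ j)" if "has_L2_gradient \<Omega> u K" for K
    proof -
      have "integrable (lebesgue_on \<Omega>) K"
        using that fin by (intro square_integrable_imp_integrable) (auto simp: has_L2_gradient_def)
      moreover have "bounded_linear (\<lambda>A::real^'n^'m. A $ i $ j)"
        using bounded_linear_compose[OF bounded_linear_vec_nth bounded_linear_vec_nth] .
      ultimately show ?thesis by (rule integrable_bounded_linear[rotated])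
    qed
    show "integrable (lebesgue_on \<Omega>) (\<lambda>x. G x $ i $ j - H x $ i $ j)"
      using i[OF G] i[OF H] by auto
    fix \<phi> assume \<phi>: "test_function \<Omega> \<phi>"
    have "(LINT x|lebesgue_on \<Omega>. (G x $ i $ j - H x $ i $ j) * \<phi> x)
       = (LINT x|lebesgue_on \<Omega>. G x $ i $ j * \<phi> x) - (LINT x|lebesgue_on \<Omega>. H x $ i $ j * \<phi> x)"
      by (subst Bochner_Integration.integral_diff[symmetric])
        (auto simp: left_diff_distrib intro!: integrable_mult_test_function[OF \<Omega>(1) _ \<phi>] i[OF G] i[OF H])
    also have "\<dots> = 0"
      using G H \<phi> by (auto simp: has_L2_gradient_def dest!: spec[of _ \<phi>])
    finally show "(LINT x|lebesgue_on \<Omega>. (G x $ i $ j - H x $ i $ j) * \<phi> x) = 0" .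
  qed
  then have "AE x in lebesgue_on \<Omega>. \<forall>i\<in>UNIV. \<forall>j\<in>UNIV. G x $ i $ j - H x $ i $ j = 0"
    by (intro AE_finite_allI) auto
  then show ?thesis by eventually_elim (auto simp: vec_eq_iff)
qed

section \<open>Integration by parts for continuously differentiable functions\<close>

lemma has_derivative_zero_on_open:
  assumes "open S" "x \<in> S" "\<And>y. y \<in> S \<Longrightarrow> f y = 0"
  shows "(f has_derivative (\<lambda>h. 0)) (at x)"
  by (rule has_derivative_transform_within_open[OF has_derivative_const assms(1,2)])
    (simp add: assms(3))

lemma integrable_indicator_compact_mult:
  fixes K :: "'a::euclidean_space set" and M :: real
  assumes "compact K" shows "integrable lborel (\<lambda>x. indicator K x * M)"
  using emeasure_compact_finite[OF assms] assms
  by (intro integrable_mult_left integrable_real_indicator) (auto simp: borel_compact)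

text \<open>Difference quotients with steps \<open>1/(n+1)\<close> have integral 0 by translation
  invariance, and they converge to \<open>D x e\<close>, dominated by a constant on the ball
  \<open>C\<close>. Its radius \<open>R + norm e\<close> accommodates all shifts because every step
  is at most 1.\<close>

lemma integral_derivative_compact_support:
  fixes \<psi> :: "'a::euclidean_space \<Rightarrow> real"
  assumes der: "\<And>x. (\<psi> has_derivative D x) (at x)"
    and cont: "continuous_on UNIV (\<lambda>x. D x e)"
    and K: "compact K" "\<And>x. x \<notin> K \<Longrightarrow> \<psi> x = 0"
  shows "(LINT x|lborel. D x e) = 0"
proof -
  obtain R where "R > 0" "\<forall>x\<in>K. norm x \<le> R"
    using compact_imp_bounded[OF K(1)] unfolding bounded_pos by blast
  then have R: "R > 0" "K \<subseteq> cball 0 R" by auto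
  have c\<psi>: "continuous_on UNIV \<psi>"
    by (intro continuous_at_imp_continuous_on ballI has_derivative_continuous[OF der])
  have D0: "D x e = 0" if "x \<notin> K" for x
  proof -
    have "(\<psi> has_derivative (\<lambda>h. 0)) (at x)"
      by (rule has_derivative_zero_on_open[of "- K"]) (use K that in \<open>simp_all add: compact_imp_closed open_Compl\<close>)
    then have "D x = (\<lambda>h. 0)" using der has_derivative_unique by blast
    then show ?thesis by simp
  qed
  obtain B0 where B0: "\<And>x. x \<in> K \<Longrightarrow> norm (D x e) \<le> B0"
    using continuous_on_compact_bounded[OF K(1) continuous_on_subset[OF cont]] by blast
  define B where "B = max B0 0"
  have B: "\<bar>D x e\<bar> \<le> B" for x using B0[of x] D0[of x] by (cases "x \<in> K") (auto simp: B_def)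
  have [measurable]: "\<psi> \<in> borel_measurable borel" "(\<lambda>x. D x e) \<in> borel_measurable borel"
    using c\<psi> cont by (auto intro: borel_measurable_continuous_onI)
  define q where "q n x = (\<psi> (x + inverse (real (Suc n)) *\<^sub>R e) - \<psi> x) / inverse (real (Suc n))" for n x
  define C :: "'a set" where "C = cball 0 (R + norm e)"
  have i\<psi>: "integrable lborel \<psi>"
  proof -
    obtain M where M: "\<And>x. x \<in> K \<Longrightarrow> norm (\<psi> x) \<le> M"
      using continuous_on_compact_bounded[OF K(1) continuous_on_subset[OF c\<psi>]] by blast
    have "\<bar>\<psi> x\<bar> \<le> \<bar>indicator K x * M\<bar>" for x
      using M[of x] K(2)[of x] by (cases "x \<in> K") auto
    moreover have "integrable lborel (\<lambda>x. indicator K x * M)"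
      by (rule integrable_indicator_compact_mult[OF K(1)])
    ultimately show ?thesis
      by (intro Bochner_Integration.integrable_bound[of lborel "\<lambda>x. indicator K x * M" \<psi>]) auto
  qed
  have q0: "(LINT x|lborel. q n x) = 0" for n
  proof -
    let ?c = "inverse (real (Suc n)) *\<^sub>R e"
    have i2: "integrable lborel (\<lambda>x. \<psi> (?c + x))"
      using i\<psi> integrable_distr_eq[of "(+) ?c" lborel borel \<psi>] by (simp add: lborel_distr_plus)
    have "(LINT x|lborel. \<psi> (?c + x)) = (LINT x|lborel. \<psi> x)"
      using integral_distr[of "(+) ?c" lborel borel \<psi>] by (simp add: lborel_distr_plus)
    then show ?thesis
      using i2 i\<psi> by (simp add: q_def add.commute del: of_nat_Suc)
  qed
  have qlim: "(\<lambda>n. q n x) \<longlonglongrightarrow> D x e" for x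
  proof -
    have "((\<lambda>t. \<psi> (x + t *\<^sub>R e)) has_derivative (\<lambda>t. D x (t *\<^sub>R e))) (at 0)"
      by (rule has_derivative_compose[where f="\<lambda>t. x + t *\<^sub>R e" and g=\<psi>]) (auto intro!: derivative_eq_intros der)
    then have "((\<lambda>t. \<psi> (x + t *\<^sub>R e)) has_real_derivative D x e) (at 0)"
      unfolding has_field_derivative_def
      by (rule back_subst[of "\<lambda>D. (_ has_derivative D) _"]) (simp add: fun_eq_iff linear_cmul[OF has_derivative_linear[OF der]])
    then have "((\<lambda>t. (\<psi> (x + t *\<^sub>R e) - \<psi> x) / t) \<longlongrightarrow> D x e) (at 0)"
      by (simp add: DERIV_def)
    moreover have "filterlim (\<lambda>n. inverse (real (Suc n))) (at 0) sequentially"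
      using LIMSEQ_inverse_real_of_nat by (auto simp: filterlim_at)
    ultimately show ?thesis
      unfolding q_def by (rule filterlim_compose)
  qed
  have qb: "\<bar>q n x\<bar> \<le> indicator C x * B" for n x
  proof (cases "x \<in> C")
    case True
    let ?t = "inverse (real (Suc n))"
    have "norm (\<psi> (x + ?t *\<^sub>R e) - \<psi> (x + 0 *\<^sub>R e)) \<le> B * norm (?t - 0)"
    proof (rule differentiable_bound[where S=UNIV and f="\<lambda>t. \<psi> (x + t *\<^sub>R e)" and f'="\<lambda>t h. D (x + t *\<^sub>R e) (h *\<^sub>R e)"])
      fix t :: real
      show "((\<lambda>t. \<psi> (x + t *\<^sub>R e)) has_derivative (\<lambda>h. D (x + t *\<^sub>R e) (h *\<^sub>R e))) (at t within UNIV)"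
        by (rule has_derivative_compose[where f="\<lambda>t. x + t *\<^sub>R e" and g=\<psi>]) (auto intro!: derivative_eq_intros der)
      show "onorm (\<lambda>h. D (x + t *\<^sub>R e) (h *\<^sub>R e)) \<le> B"
        using has_derivative_linear[OF der] B[of "x + t *\<^sub>R e"]
        by (intro onorm_bound) (auto simp: linear_cmul abs_mult B_def mult.commute intro!: mult_left_mono)
    qed auto
    then show ?thesis using True by (simp add: q_def abs_mult divide_simps)
  next
    case False
    have "norm (inverse (real (Suc n)) *\<^sub>R e) \<le> norm e"
      using mult_right_mono[of "inverse (real (Suc n))" 1 "norm e"] by (simp add: inverse_le_1_iff)
    moreover have "norm x > R + norm e" using False by (simp add: C_def)
    moreover have "norm x \<le> norm (x + inverse (real (Suc n)) *\<^sub>R e) + norm (inverse (real (Suc n)) *\<^sub>R e)"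
      using norm_triangle_ineq4[of "x + inverse (real (Suc n)) *\<^sub>R e" "inverse (real (Suc n)) *\<^sub>R e"]
      by (simp only: add_diff_cancel_right')
    ultimately have "R < norm (x + inverse (real (Suc n)) *\<^sub>R e)" "R < norm x"
      using norm_ge_zero[of e] by linarith+
    then have "x + inverse (real (Suc n)) *\<^sub>R e \<notin> K" "x \<notin> K"
      using R(2) by force+
    then show ?thesis using K(2) False by (simp add: q_def del: of_nat_Suc)
  qed
  have "(\<lambda>n. LINT x|lborel. q n x) \<longlonglongrightarrow> (LINT x|lborel. D x e)"
  proof (rule integral_dominated_convergence[where w="\<lambda>x. indicator C x * B"])
    show "integrable lborel (\<lambda>x. indicator C x * B)"
      by (rule integrable_indicator_compact_mult) (simp add: C_def)
    show "q n \<in> borel_measurable lborel" for n unfolding q_def by measurable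
  qed (use qlim qb in auto)
  then show ?thesis by (simp add: q0 LIMSEQ_const_iff)
qed

lemma square_integrable_continuous:
  fixes f :: "'a::euclidean_space \<Rightarrow> 'b::euclidean_space"
  assumes \<Omega>: "open \<Omega>" "bounded \<Omega>" and f: "continuous_on (closure \<Omega>) f"
  shows "square_integrable (lebesgue_on \<Omega>) f"
proof -
  interpret finite_measure "lebesgue_on \<Omega>" using \<Omega> by (intro finite_measure_lebesgue_on) auto
  have m: "f \<in> borel_measurable (lebesgue_on \<Omega>)"
    using \<Omega> closure_subset by (intro continuous_imp_measurable_on_sets_lebesgue continuous_on_subset[OF f]) auto
  obtain B where B: "\<And>x. x \<in> closure \<Omega> \<Longrightarrow> norm (f x) \<le> B"
    using continuous_on_compact_bounded[OF _ f] \<Omega>(2) by (auto simp: compact_closure)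
  have "norm ((norm (f x))\<^sup>2) \<le> B\<^sup>2" if "x \<in> \<Omega>" for x
    using B[of x] closure_subset[of \<Omega>] that by (auto intro!: power_mono)
  then have "integrable (lebesgue_on \<Omega>) (\<lambda>x. (norm (f x))\<^sup>2)"
    using m by (intro integrable_const_bound[where B="B\<^sup>2"] AE_I2) auto
  with m show ?thesis by (simp add: square_integrable_def)
qed

lemma Ck_on_1D:
  fixes f :: "real^'n \<Rightarrow> 'b::euclidean_space"
  assumes "Ck_on 1 U f"
  shows "x \<in> U \<Longrightarrow> (f has_derivative frechet_derivative f (at x)) (at x)"
    and "continuous_on U (\<lambda>x. frechet_derivative f (at x) (axis j 1))"
    and "continuous_on U f"
proof -
  have "\<forall>x\<in>U. f differentiable (at x)" "\<forall>e\<in>Basis. continuous_on U (\<lambda>x. frechet_derivative f (at x) e)"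
    using assms by simp_all
  moreover have "axis j (1::real) \<in> Basis" by (simp add: axis_in_Basis_iff)
  ultimately show "x \<in> U \<Longrightarrow> (f has_derivative frechet_derivative f (at x)) (at x)"
    "continuous_on U (\<lambda>x. frechet_derivative f (at x) (axis j 1))"
    by (simp_all add: frechet_derivative_works)
  show "continuous_on U f" using Ck_on_Suc_imp[of 0 U f] assms by simp
qed

lemma continuous_on_matrix_frechet_derivative:
  fixes w :: "real^'n \<Rightarrow> real^'m"
  assumes "Ck_on 1 U w"
  shows "continuous_on U (\<lambda>x. matrix (frechet_derivative w (at x)))"
  unfolding matrix_def
  by (intro continuous_on_vec_lambda bounded_linear.continuous_on[OF bounded_linear_vec_nth] Ck_on_1D(2)[OF assms])

text \<open>A component of \<open>w\<close> times a test function, extended by 0, is C1 on the whole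
  space, so the integral of its partial derivative vanishes; the product rule turns this into the
  defining identity. Regularity on a neighbourhood of the closure makes the classical gradient
  bounded on \<open>\<Omega>\<close>, hence square integrable.\<close>

lemma has_L2_gradient_C1:
  fixes w :: "real^'n \<Rightarrow> real^'m"
  assumes \<Omega>: "open \<Omega>" "bounded \<Omega>" and U: "open U" "closure \<Omega> \<subseteq> U" and w: "Ck_on 1 U w"
  shows "has_L2_gradient \<Omega> w (\<lambda>x. matrix (frechet_derivative w (at x)))"
  unfolding has_L2_gradient_def
proof (intro conjI allI impI)
  show "square_integrable (lebesgue_on \<Omega>) (\<lambda>x. matrix (frechet_derivative w (at x)))"
    by (intro square_integrable_continuous \<Omega> continuous_on_subset[OF continuous_on_matrix_frechet_derivative[OF w] U(2)])
  fix \<phi> i and j :: 'n assume \<phi>: "test_function \<Omega> \<phi>"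
  let ?e = "axis j 1 :: real^'n"
  define K where "K = closure {x. \<phi> x \<noteq> 0}"
  have K: "compact K" "K \<subseteq> \<Omega>" using \<phi> by (auto simp: test_function_def K_def)
  have oK: "open (- K)" unfolding K_def by (rule open_Compl[OF closed_closure])
  have \<phi>K: "\<phi> y = 0" if "y \<in> - K" for y
  proof (rule ccontr)
    assume "\<phi> y \<noteq> 0"
    then have "y \<in> K" unfolding K_def by (intro subsetD[OF closure_subset]) simp
    with that show False by simp
  qed
  have "Ck_on 1 UNIV \<phi>" using \<phi> by (auto simp: test_function_def)
  note \<phi>0 = Ck_on_1D(1)[OF this UNIV_I] and \<phi>2 = Ck_on_1D(2)[OF this, of j] 
  note w1 = Ck_on_1D(1)[OF w] and w2 = Ck_on_1D(2)[OF w, of j] and w0 = Ck_on_1D(3)[OF w]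
  have sub: "\<Omega> \<subseteq> U" using U closure_subset by blast
  define \<psi> where "\<psi> x = (if x \<in> \<Omega> then w x $ i * \<phi> x else 0)" for x
  define D where "D x h = (if x \<in> \<Omega> then w x $ i * frechet_derivative \<phi> (at x) h + frechet_derivative w (at x) h $ i * \<phi> x else 0)" for x h
  have out: "\<phi> x = 0" "frechet_derivative \<phi> (at x) h = 0" if "x \<notin> K" for x h
  proof -
    show "\<phi> x = 0" using that \<phi>K by simp
    have "(\<phi> has_derivative (\<lambda>h. 0)) (at x)"
      using that \<phi>K oK by (intro has_derivative_zero_on_open[of "- K"]) simp_all
    then show "frechet_derivative \<phi> (at x) h = 0" by (rule frechet_derivative_apply_eq)
  qed
  have der: "(\<psi> has_derivative D x) (at x)" for x
  proof (cases "x \<in> \<Omega>")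
    case True
    have "((\<lambda>x. w x $ i) has_derivative (\<lambda>h. frechet_derivative w (at x) h $ i)) (at x)"
      using True sub by (intro bounded_linear.has_derivative[OF bounded_linear_vec_nth] w1) auto
    from has_derivative_mult[OF this \<phi>0]
    have "((\<lambda>x. w x $ i * \<phi> x) has_derivative D x) (at x)"
      using True by (simp add: D_def[abs_def])
    then show ?thesis
      using \<Omega>(1) True by (rule has_derivative_transform_within_open) (simp add: \<psi>_def)
  next
    case False
    then have x: "x \<in> - K" using K by blast
    have \<psi>K: "\<psi> y = 0" if "y \<in> - K" for y using that out(1) by (auto simp: \<psi>_def)
    have "(\<psi> has_derivative (\<lambda>h. 0)) (at x)"
      using x \<psi>K oK by (intro has_derivative_zero_on_open[of "- K"]) simp_all
    then show ?thesis using False by (simp add: D_def[abs_def])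
  qed
  \<comment> \<open>\<open>\<Omega>\<close> and the complement of the support \<open>K\<close> are
    open and cover the space, so continuity can be checked on each of them; on the second the
    function is 0.\<close>
  have "continuous_on (\<Omega> \<union> - K) (\<lambda>x. D x ?e)"
  proof (rule continuous_on_open_Un)
    have "continuous_on \<Omega> (\<lambda>x. w x $ i * frechet_derivative \<phi> (at x) ?e + frechet_derivative w (at x) ?e $ i * \<phi> x)"
      by (intro continuous_intros continuous_on_subset[OF w0 sub] continuous_on_subset[OF w2 sub]
            continuous_on_subset[OF \<phi>2] continuous_on_subset[OF test_function_continuous[OF \<phi>]]) auto
    then show "continuous_on \<Omega> (\<lambda>x. D x ?e)" by (rule continuous_on_eq) (auto simp: D_def)
    show "continuous_on (- K) (\<lambda>x. D x ?e)"
      by (rule continuous_on_eq[of _ "\<lambda>_. 0"]) (auto simp: D_def out)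
  qed (use \<Omega> oK in auto)
  moreover have "\<Omega> \<union> - K = UNIV" using K by blast
  ultimately have cD: "continuous_on UNIV (\<lambda>x. D x ?e)" by simp
  have "(LINT x|lborel. D x ?e) = 0"
    using integral_derivative_compact_support[OF der cD K(1)] out(1) by (auto simp: \<psi>_def)
  moreover have "(LINT x|lborel. D x ?e) = (LINT x|lebesgue_on \<Omega>. w x $ i * frechet_derivative \<phi> (at x) ?e + frechet_derivative w (at x) ?e $ i * \<phi> x)"
  proof -
    have "(LINT x|lborel. D x ?e) = (LINT x|lebesgue. D x ?e)"
      using cD by (intro integral_completion[symmetric]) (simp add: borel_measurable_continuous_onI)
    also have "\<dots> = (LINT x|lebesgue. indicator \<Omega> x *\<^sub>R (w x $ i * frechet_derivative \<phi> (at x) ?e + frechet_derivative w (at x) ?e $ i * \<phi> x))"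
      by (intro Bochner_Integration.integral_cong) (auto simp: D_def)
    finally show ?thesis using \<Omega> by (simp add: integral_restrict_space)
  qed
  moreover have int: "integrable (lebesgue_on \<Omega>) f" if "continuous_on (closure \<Omega>) f" for f :: "real^'n \<Rightarrow> real"
    using \<Omega> that by (intro square_integrable_imp_integrable finite_measure_lebesgue_on square_integrable_continuous) auto
  moreover have "integrable (lebesgue_on \<Omega>) (\<lambda>x. w x $ i * frechet_derivative \<phi> (at x) ?e)"
    by (intro int continuous_intros continuous_on_subset[OF w0 U(2)] continuous_on_subset[OF \<phi>2 subset_UNIV])
  moreover have "integrable (lebesgue_on \<Omega>) (\<lambda>x. frechet_derivative w (at x) ?e $ i * \<phi> x)"
    by (intro int continuous_intros continuous_on_subset[OF w2 U(2)]
          continuous_on_subset[OF test_function_continuous[OF \<phi>] subset_UNIV])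
  ultimately show "(LINT x|lebesgue_on \<Omega>. w x $ i * frechet_derivative \<phi> (at x) ?e)
      = - (LINT x|lebesgue_on \<Omega>. matrix (frechet_derivative w (at x)) $ i $ j * \<phi> x)"
    by (simp add: matrix_def)
qed

section \<open>Green's formula for the regularised argument\<close>

lemma has_vector_derivative_withinI_quotient:
  fixes f :: "real \<Rightarrow> 'b::real_normed_vector"
  assumes "((\<lambda>y. (f y - f x) /\<^sub>R (y - x)) \<longlongrightarrow> D) (at x within S)"
  shows "(f has_vector_derivative D) (at x within S)"
  unfolding has_vector_derivative_def has_derivative_iff_norm
proof
  show "bounded_linear (\<lambda>h. h *\<^sub>R D)" by (rule bounded_linear_scaleR_left)
  have lim: "((\<lambda>y. norm ((f y - f x) /\<^sub>R (y - x) - D)) \<longlongrightarrow> 0) (at x within S)"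
    using assms by (intro tendsto_norm_zero) (simp add: LIM_zero_iff)
  have eq: "norm ((f y - f x) /\<^sub>R (y - x) - D) = norm (f y - f x - (y - x) *\<^sub>R D) / norm (y - x)"
    if "y \<noteq> x" for y
  proof -
    have "f y - f x - (y - x) *\<^sub>R D = (y - x) *\<^sub>R ((f y - f x) /\<^sub>R (y - x) - D)"
      using that by (simp add: scaleR_diff_right)
    then show ?thesis using that by simp
  qed
  have ev: "\<forall>\<^sub>F y in at x within S. norm ((f y - f x) /\<^sub>R (y - x) - D) = norm (f y - f x - (y - x) *\<^sub>R D) / norm (y - x)"
    unfolding eventually_at_filter by (intro always_eventually allI impI eq)
  show "((\<lambda>y. norm (f y - f x - (y - x) *\<^sub>R D) / norm (y - x)) \<longlongrightarrow> 0) (at x within S)"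
    by (rule Lim_transform_eventually[OF lim ev])
qed

lemma has_vector_derivative_quotient_LIMSEQ:
  fixes f :: "real \<Rightarrow> 'b::real_normed_vector"
  assumes "(f has_vector_derivative D) (at x within S)"
    and X: "\<And>n. X n \<in> S - {x}" "X \<longlonglongrightarrow> x"
  shows "(\<lambda>n. (f (X n) - f x) /\<^sub>R (X n - x)) \<longlonglongrightarrow> D"
proof -
  have "((\<lambda>y. norm (f y - f x - (y - x) *\<^sub>R D) / norm (y - x)) \<longlongrightarrow> 0) (at x within S)"
    using assms(1) unfolding has_vector_derivative_def has_derivative_iff_norm by blast
  then have "(\<lambda>n. norm (f (X n) - f x - (X n - x) *\<^sub>R D) / norm (X n - x)) \<longlonglongrightarrow> 0"
    using X unfolding tendsto_at_iff_sequentially by (auto simp: o_def)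
  moreover have "norm (f (X n) - f x - (X n - x) *\<^sub>R D) / norm (X n - x) = norm ((f (X n) - f x) /\<^sub>R (X n - x) - D)" for n
  proof -
    have "X n - x \<noteq> 0" using X(1)[of n] by auto
    then have "f (X n) - f x - (X n - x) *\<^sub>R D = (X n - x) *\<^sub>R ((f (X n) - f x) /\<^sub>R (X n - x) - D)"
      by (simp add: scaleR_diff_right)
    then show ?thesis using \<open>X n - x \<noteq> 0\<close> by simp
  qed
  ultimately have "(\<lambda>n. norm ((f (X n) - f x) /\<^sub>R (X n - x) - D)) \<longlonglongrightarrow> 0" by simp
  then show ?thesis by (simp add: tendsto_norm_zero_iff LIM_zero_iff)
qed

lemma vector_derivative_quotient_bound:
  fixes f :: "real \<Rightarrow> 'b::real_normed_vector"
  assumes "\<And>x. x \<in> {a..b} \<Longrightarrow> (f has_vector_derivative f' x) (at x within {a..b})"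
    and "\<And>x. x \<in> {a..b} \<Longrightarrow> norm (f' x) \<le> B" and "x \<in> {a..b}" "y \<in> {a..b}"
  shows "norm ((f y - f x) /\<^sub>R (y - x)) \<le> B"
proof (cases "y = x")
  case True
  have "0 \<le> norm (f' x)" by simp
  also have "\<dots> \<le> B" using assms by blast
  finally show ?thesis using True by simp
next
  case False
  have "norm (f y - f x) \<le> B * norm (y - x)"
  proof (rule differentiable_bound[where S="{a..b}" and f'="\<lambda>x h. h *\<^sub>R f' x"])
    fix x assume "x \<in> {a..b}"
    then show "(f has_derivative (\<lambda>h. h *\<^sub>R f' x)) (at x within {a..b})" "onorm (\<lambda>h. h *\<^sub>R f' x) \<le> B"
      using assms(1,2)[of x] by (auto simp: has_vector_derivative_def onorm_scaleR_left[OF bounded_linear_ident] onorm_id)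
  qed (use assms in auto)
  then show ?thesis using False by (simp add: divide_simps mult.commute)
qed

text \<open>Green's formula for a pair of merely \<open>C\<^sup>1\<close> functions: integrating by parts in \<open>t\<close> before passing
  to the limit in the difference quotient avoids mixed second derivatives.\<close>

lemma has_vector_derivative_integral_times_derivative:
  fixes A Z Ar At Zr Zt :: "real \<Rightarrow> real \<Rightarrow> complex"
  assumes "c \<le> d"
    and Ar: "\<And>r t. r \<in> {a..b} \<Longrightarrow> t \<in> {c..d} \<Longrightarrow> ((\<lambda>r. A r t) has_vector_derivative Ar r t) (at r within {a..b})"
    and At: "\<And>r t. r \<in> {a..b} \<Longrightarrow> t \<in> {c..d} \<Longrightarrow> ((\<lambda>t. A r t) has_vector_derivative At r t) (at t within {c..d})"
    and Zr: "\<And>r t. r \<in> {a..b} \<Longrightarrow> t \<in> {c..d} \<Longrightarrow> ((\<lambda>r. Z r t) has_vector_derivative Zr r t) (at r within {a..b})"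
    and Zt: "\<And>r t. r \<in> {a..b} \<Longrightarrow> t \<in> {c..d} \<Longrightarrow> ((\<lambda>t. Z r t) has_vector_derivative Zt r t) (at t within {c..d})"
    and cA: "continuous_on ({a..b} \<times> {c..d}) (\<lambda>(r,t). A r t)"
    and cAr: "continuous_on ({a..b} \<times> {c..d}) (\<lambda>(r,t). Ar r t)"
    and cAt: "continuous_on ({a..b} \<times> {c..d}) (\<lambda>(r,t). At r t)"
    and cZ: "continuous_on ({a..b} \<times> {c..d}) (\<lambda>(r,t). Z r t)"
    and cZr: "continuous_on ({a..b} \<times> {c..d}) (\<lambda>(r,t). Zr r t)"
    and cZt: "continuous_on ({a..b} \<times> {c..d}) (\<lambda>(r,t). Zt r t)"
    and x: "x \<in> {a..b}"
  shows "((\<lambda>r. integral {c..d} (\<lambda>t. A r t * Zt r t)) has_vector_derivative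
     (A x d * Zr x d - A x c * Zr x c + integral {c..d} (\<lambda>t. Ar x t * Zt x t - At x t * Zr x t))) (at x within {a..b})"
proof (rule has_vector_derivative_withinI_quotient, unfold tendsto_at_iff_sequentially, intro allI impI)
  let ?K = "{a..b} \<times> {c..d}"
  fix X assume X: "\<forall>i. X i \<in> {a..b} - {x}" "X \<longlonglongrightarrow> x"
  have cmp: "compact ?K" by (intro compact_Times compact_Icc)
  have slice: "continuous_on {c..d} (f r)" if "continuous_on ?K (\<lambda>(r,t). f r t)" "r \<in> {a..b}"
    for f :: "real \<Rightarrow> real \<Rightarrow> complex" and r
  proof -
    have "continuous_on {c..d} ((\<lambda>(r,t). f r t) \<circ> (\<lambda>t. (r, t)))"
      using that by (intro continuous_on_compose continuous_intros continuous_on_subset[OF that(1)]) auto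
    then show ?thesis by (simp add: o_def)
  qed
  have bd: "\<exists>B. \<forall>r\<in>{a..b}. \<forall>t\<in>{c..d}. norm (f r t) \<le> B" if f: "continuous_on ?K (\<lambda>(r,t). f r t)" for f :: "real \<Rightarrow> real \<Rightarrow> complex"
  proof -
    obtain B where "\<And>p. p \<in> ?K \<Longrightarrow> norm (case p of (r,t) \<Rightarrow> f r t) \<le> B"
      using continuous_on_compact_bounded[OF cmp f] by blast
    then show ?thesis by (intro exI[of _ B]) force
  qed
  obtain B1 where B1: "\<And>r t. r\<in>{a..b} \<Longrightarrow> t\<in>{c..d} \<Longrightarrow> norm (Ar r t) \<le> B1" using bd[OF cAr] by blast
  obtain B2 where B2: "\<And>r t. r\<in>{a..b} \<Longrightarrow> t\<in>{c..d} \<Longrightarrow> norm (Zr r t) \<le> B2" using bd[OF cZr] by blast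
  obtain B3 where B3: "\<And>r t. r\<in>{a..b} \<Longrightarrow> t\<in>{c..d} \<Longrightarrow> norm (Zt r t) \<le> B3" using bd[OF cZt] by blast
  obtain B4 where B4: "\<And>r t. r\<in>{a..b} \<Longrightarrow> t\<in>{c..d} \<Longrightarrow> norm (At r t) \<le> B4" using bd[OF cAt] by blast
  define p where "p n t = (A (X n) t - A x t) /\<^sub>R (X n - x)" for n t
  define q where "q n t = (Z (X n) t - Z x t) /\<^sub>R (X n - x)" for n t
  have Xn: "X n \<in> {a..b}" "X n \<noteq> x" for n using X(1) by auto
  have plim: "(\<lambda>n. p n t) \<longlonglongrightarrow> Ar x t" and qlim: "(\<lambda>n. q n t) \<longlonglongrightarrow> Zr x t" if "t \<in> {c..d}" for t
    unfolding p_def q_def using X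
    by (auto intro!: has_vector_derivative_quotient_LIMSEQ[where S="{a..b}"] Ar Zr x that)
  have pb: "norm (p n t) \<le> B1" if t: "t \<in> {c..d}" for n t
    unfolding p_def by (rule vector_derivative_quotient_bound[OF Ar B1 x Xn(1)]) (use t in simp_all)
  have qb: "norm (q n t) \<le> B2" if t: "t \<in> {c..d}" for n t
    unfolding q_def by (rule vector_derivative_quotient_bound[OF Zr B2 x Xn(1)]) (use t in simp_all)
  have pc: "continuous_on {c..d} (p n)" and qc: "continuous_on {c..d} (q n)" for n
    unfolding p_def q_def by (intro continuous_intros slice cA cZ x Xn(1))+
  have ci: "f integrable_on {c..d}" if "continuous_on {c..d} f" for f :: "real \<Rightarrow> complex"
    using that by (rule integrable_continuous_real)
  note cs = slice[OF cA x] slice[OF cZ x] slice[OF cAt x] slice[OF cZt x]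
  have quot: "(integral {c..d} (\<lambda>t. A (X n) t * Zt (X n) t) - integral {c..d} (\<lambda>t. A x t * Zt x t)) /\<^sub>R (X n - x)
     = A x d * q n d - A x c * q n c + integral {c..d} (\<lambda>t. p n t * Zt (X n) t - At x t * q n t)" for n
  proof -
    note cn = slice[OF cA Xn(1)[of n]] slice[OF cZ Xn(1)[of n]] slice[OF cZt Xn(1)[of n]]
    let ?h = "X n - x"
    \<comment> \<open>Only this summand contains a radial difference of \<open>Zt\<close>.
      Integration in \<open>t\<close> moves the difference onto \<open>Z\<close>, whose quotient
      \<open>q\<close> converges, and the values at \<open>c\<close> and \<open>d\<close> become the
      boundary terms of the claim.\<close>
    have parts: "((\<lambda>t. A x t * (Zt (X n) t - Zt x t) + At x t * (Z (X n) t - Z x t)) has_integral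
        (A x d * (Z (X n) d - Z x d) - A x c * (Z (X n) c - Z x c))) {c..d}"
    proof (rule fundamental_theorem_of_calculus[OF \<open>c \<le> d\<close>])
      fix t assume t: "t \<in> {c..d}"
      show "((\<lambda>t. A x t * (Z (X n) t - Z x t)) has_vector_derivative A x t * (Zt (X n) t - Zt x t) + At x t * (Z (X n) t - Z x t)) (at t within {c..d})"
        by (intro has_vector_derivative_mult has_vector_derivative_diff At Zt t x Xn)
    qed
    have "integral {c..d} (\<lambda>t. A (X n) t * Zt (X n) t) - integral {c..d} (\<lambda>t. A x t * Zt x t)
       = integral {c..d} (\<lambda>t. A (X n) t * Zt (X n) t - A x t * Zt x t)"
      by (intro Henstock_Kurzweil_Integration.integral_diff[symmetric] ci continuous_intros cs cn)
    also have "\<dots> = integral {c..d} (\<lambda>t. (A x t * (Zt (X n) t - Zt x t) + At x t * (Z (X n) t - Z x t)) +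
         ((A (X n) t - A x t) * Zt (X n) t - At x t * (Z (X n) t - Z x t)))"
      by (intro Henstock_Kurzweil_Integration.integral_cong) (simp add: algebra_simps)
    also have "\<dots> = (A x d * (Z (X n) d - Z x d) - A x c * (Z (X n) c - Z x c)) +
         integral {c..d} (\<lambda>t. (A (X n) t - A x t) * Zt (X n) t - At x t * (Z (X n) t - Z x t))"
      unfolding integral_unique[OF parts, symmetric]
      by (intro Henstock_Kurzweil_Integration.integral_add ci continuous_intros cs cn)
    finally have eq: "integral {c..d} (\<lambda>t. A (X n) t * Zt (X n) t) - integral {c..d} (\<lambda>t. A x t * Zt x t) = \<dots>" .
    have "(integral {c..d} (\<lambda>t. (A (X n) t - A x t) * Zt (X n) t - At x t * (Z (X n) t - Z x t))) /\<^sub>R ?h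
      = integral {c..d} (\<lambda>t. p n t * Zt (X n) t - At x t * q n t)"
      unfolding integral_cmul[symmetric] p_def q_def
      by (intro Henstock_Kurzweil_Integration.integral_cong) (simp add: scaleR_diff_right left_diff_distrib right_diff_distrib)
    then show ?thesis
      unfolding eq scaleR_add_right by (simp add: q_def scaleR_diff_right right_diff_distrib)
  qed
  have Zt_lim: "(\<lambda>n. Zt (X n) t) \<longlonglongrightarrow> Zt x t" if t: "t \<in> {c..d}" for t
  proof -
    have "(\<lambda>n. (X n, t)) \<longlonglongrightarrow> (x, t)" by (intro tendsto_intros X(2))
    then have "(\<lambda>n. (\<lambda>(r,t). Zt r t) (X n, t)) \<longlonglongrightarrow> (\<lambda>(r,t). Zt r t) (x, t)"
      using Xn(1) t x by (intro continuous_on_tendsto_compose[OF cZt]) auto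
    then show ?thesis by simp
  qed
  have "(\<lambda>n. integral {c..d} (\<lambda>t. p n t * Zt (X n) t - At x t * q n t)) \<longlonglongrightarrow> integral {c..d} (\<lambda>t. Ar x t * Zt x t - At x t * Zr x t)"
  proof (rule dominated_convergence(2)[where h="\<lambda>t. B1 * B3 + B4 * B2"])
    show "(\<lambda>t. p n t * Zt (X n) t - At x t * q n t) integrable_on {c..d}" for n
      by (intro ci continuous_intros pc qc cs slice[OF cZt Xn(1)[of n]])
    fix n t assume t: "t \<in> {c..d}"
    have "norm (p n t * Zt (X n) t - At x t * q n t) \<le> norm (p n t) * norm (Zt (X n) t) + norm (At x t) * norm (q n t)"
      by (metis norm_mult norm_triangle_ineq4)
    also have "\<dots> \<le> B1 * B3 + B4 * B2"
      using pb[OF t, of n] qb[OF t, of n] B3[OF Xn(1)[of n] t] B4[OF x t] norm_ge_zero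
      by (intro add_mono mult_mono) (auto intro: order_trans[OF norm_ge_zero])
    finally show "norm (p n t * Zt (X n) t - At x t * q n t) \<le> B1 * B3 + B4 * B2" .
  next
    fix t assume t: "t \<in> {c..d}"
    show "(\<lambda>n. p n t * Zt (X n) t - At x t * q n t) \<longlonglongrightarrow> Ar x t * Zt x t - At x t * Zr x t"
      by (intro tendsto_intros plim qlim Zt_lim t)
  qed auto
  moreover have "c \<in> {c..d}" "d \<in> {c..d}" using \<open>c \<le> d\<close> by auto
  ultimately have "(\<lambda>n. A x d * q n d - A x c * q n c + integral {c..d} (\<lambda>t. p n t * Zt (X n) t - At x t * q n t))
     \<longlonglongrightarrow> A x d * Zr x d - A x c * Zr x c + integral {c..d} (\<lambda>t. Ar x t * Zt x t - At x t * Zr x t)"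
    by (intro tendsto_intros qlim)
  then show "((\<lambda>y. (integral {c..d} (\<lambda>t. A y t * Zt y t) - integral {c..d} (\<lambda>t. A x t * Zt x t)) /\<^sub>R (y - x)) \<circ> X)
     \<longlonglongrightarrow> A x d * Zr x d - A x c * Zr x c + integral {c..d} (\<lambda>t. Ar x t * Zt x t - At x t * Zr x t)"
    by (simp only: o_def quot)
qed

section \<open>The regularised inverse and its Jacobian defect\<close>

definition reg_inv :: "real \<Rightarrow> complex \<Rightarrow> complex" where
  "reg_inv e w = cnj w / (w * cnj w + of_real e)"

text \<open>The pullback of the density \<open>2 e / (|w|^2 + e)^2\<close> under a map with value
  \<open>w\<close> and partial derivatives \<open>x\<close> and \<open>y\<close>, whose Jacobian is
  \<open>Im (cnj x * y)\<close>. The density has total mass 2 pi on the plane and concentrates at 0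
  as \<open>e\<close> tends to 0: it regularises the curl of the argument.\<close>

definition reg_jac :: "real \<Rightarrow> complex \<Rightarrow> complex \<Rightarrow> complex \<Rightarrow> real" where
  "reg_jac e w x y = 2 * e * Im (cnj x * y) / ((norm w)\<^sup>2 + e)\<^sup>2"

lemma reg_inv_denom: "w * cnj w + of_real e = of_real ((norm w)\<^sup>2 + e)"
  by (simp only: complex_norm_square of_real_add)

lemma reg_inv_denom_neq_0: "e > 0 \<Longrightarrow> w * cnj w + of_real e \<noteq> 0"
  unfolding reg_inv_denom of_real_eq_0_iff by (metis add_pos_nonneg add.commute less_irrefl zero_le_power2)

lemma reg_inv_derivative_aux:
  fixes Q :: complex
  assumes Q: "Q = w * v + c" "Q \<noteq> 0"
  shows "- v * (inverse Q * (w * (h * x) + (h * y) * v) * inverse Q) + (h * x) / Q = h * ((c * x - v\<^sup>2 * y) / Q\<^sup>2)"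
proof -
  have "- v * (inverse Q * (w * (h * x) + (h * y) * v) * inverse Q) + (h * x) / Q
     = (- v * (w * (h * x) + (h * y) * v) + h * x * Q) / Q\<^sup>2"
    using Q(2) by (simp add: divide_simps power2_eq_square)
  also have "- v * (w * (h * x) + (h * y) * v) + h * x * Q = h * (c * x - v\<^sup>2 * y)"
    unfolding Q(1) by (simp add: algebra_simps power2_eq_square)
  finally show ?thesis by simp
qed

lemma has_vector_derivative_reg_inv:
  assumes e: "e > 0" and z: "(z has_vector_derivative z') (at t within S)"
  shows "((\<lambda>t. reg_inv e (z t)) has_vector_derivative
     (of_real e * cnj z' - (cnj (z t))\<^sup>2 * z') / (z t * cnj (z t) + of_real e)\<^sup>2) (at t within S)"
proof -
  have z0: "(z has_derivative (\<lambda>h. h *\<^sub>R z')) (at t within S)"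
    using z by (simp add: has_vector_derivative_def)
  have c0: "((\<lambda>t. cnj (z t)) has_derivative (\<lambda>h. h *\<^sub>R cnj z')) (at t within S)"
    using bounded_linear.has_derivative[OF bounded_linear_cnj z0] by simp
  let ?q = "z t * cnj (z t) + of_real e"
  have d0: "((\<lambda>t. z t * cnj (z t) + of_real e) has_derivative (\<lambda>h. z t * (h *\<^sub>R cnj z') + (h *\<^sub>R z') * cnj (z t))) (at t within S)"
    using has_derivative_add[OF has_derivative_mult[OF z0 c0] has_derivative_const[of "of_real e"]] by simp
  have "((\<lambda>t. reg_inv e (z t)) has_derivative
    (\<lambda>h. - cnj (z t) * (inverse ?q * (z t * (h *\<^sub>R cnj z') + (h *\<^sub>R z') * cnj (z t)) * inverse ?q) + (h *\<^sub>R cnj z') / ?q)) (at t within S)"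
    unfolding reg_inv_def by (rule has_derivative_divide[OF c0 d0 reg_inv_denom_neq_0[OF e]])
  moreover have "- cnj (z t) * (inverse ?q * (z t * (h *\<^sub>R cnj z') + (h *\<^sub>R z') * cnj (z t)) * inverse ?q) + (h *\<^sub>R cnj z') / ?q
     = h *\<^sub>R ((of_real e * cnj z' - (cnj (z t))\<^sup>2 * z') / ?q\<^sup>2)" for h
    unfolding scaleR_conv_of_real
    by (rule reg_inv_derivative_aux[OF refl reg_inv_denom_neq_0[OF e]])
  ultimately show ?thesis unfolding has_vector_derivative_def by simp
qed

text \<open>The terms with \<open>(cnj w)^2\<close> are symmetric in \<open>x\<close> and
  \<open>y\<close> and cancel, as they would for a holomorphic coefficient. What survives is the
  antiholomorphic part, and it carries the factor \<open>e\<close>.\<close>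

lemma Im_reg_inv_green:
  "Im ((of_real e * cnj x - (cnj w)\<^sup>2 * x) / (w * cnj w + of_real e)\<^sup>2 * y
     - (of_real e * cnj y - (cnj w)\<^sup>2 * y) / (w * cnj w + of_real e)\<^sup>2 * x) = reg_jac e w x y"
proof -
  let ?Q = "((norm w)\<^sup>2 + e)\<^sup>2"
  have "(of_real e * cnj x - (cnj w)\<^sup>2 * x) / (w * cnj w + of_real e)\<^sup>2 * y
     - (of_real e * cnj y - (cnj w)\<^sup>2 * y) / (w * cnj w + of_real e)\<^sup>2 * x
     = (of_real e * (cnj x * y - cnj y * x)) / of_real ?Q"
    unfolding reg_inv_denom by (simp add: divide_inverse algebra_simps)
  moreover have "Im (of_real e * (cnj x * y - cnj y * x) / of_real ?Q) = e * Im (cnj x * y - cnj y * x) / ?Q"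
    by (simp only: Im_divide_of_real) simp
  moreover have "Im (cnj x * y - cnj y * x) = 2 * Im (cnj x * y)" by simp
  ultimately show ?thesis unfolding reg_jac_def by simp
qed

lemma continuous_on_reg_inv: "e > 0 \<Longrightarrow> continuous_on S (reg_inv e)"
  unfolding reg_inv_def[abs_def] by (intro continuous_intros) (simp add: reg_inv_denom_neq_0)

lemma norm_reg_inv_le:
  assumes "e > 0" shows "norm (reg_inv e w) \<le> 1 / sqrt e"
proof -
  have e: "sqrt e > 0" "(sqrt e)\<^sup>2 = e" using assms by auto
  have "0 \<le> (norm w - sqrt e)\<^sup>2" by simp
  then have "norm w * (2 * sqrt e) \<le> (norm w)\<^sup>2 + e" using e by (simp add: power2_diff algebra_simps)
  moreover have "norm w * sqrt e \<le> norm w * (2 * sqrt e)" using e by (intro mult_left_mono) auto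
  ultimately have "norm w * sqrt e \<le> (norm w)\<^sup>2 + e" by linarith
  moreover have "0 < (norm w)\<^sup>2 + e" using assms by (simp add: add_nonneg_pos)
  ultimately show ?thesis
    using e unfolding reg_inv_def reg_inv_denom norm_divide norm_of_real by (simp add: divide_simps)
qed

lemma reg_inv_mult_cis:
  assumes "r > 0"
  shows "reg_inv e (of_real r * cis t) * (of_real r * (\<i> * cis t)) = \<i> * of_real (r\<^sup>2 / (r\<^sup>2 + e))"
proof -
  have "cnj (cis t) * cis t = 1" by (simp add: cis_cnj cis_mult)
  then have "cnj (of_real r * cis t) * (of_real r * (\<i> * cis t)) = \<i> * of_real (r\<^sup>2)"
    by (simp add: power2_eq_square mult.left_commute mult.assoc)
  moreover have "(norm (of_real r * cis t))\<^sup>2 = r\<^sup>2" by (simp add: norm_mult)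
  ultimately show ?thesis unfolding reg_inv_def reg_inv_denom by (simp only: of_real_divide times_divide_eq_left times_divide_eq_right)
qed

section \<open>The rectangle of polar coordinates\<close>

abbreviation ivl :: "real \<Rightarrow> real \<Rightarrow> real measure" where
  "ivl a b \<equiv> restrict_space lborel {a..b}"

text \<open>Built from \<open>lborel\<close>, so that Fubini's theorem acts on Borel functions. Maps
  that are merely Lebesgue measurable on the annulus enter through Borel representatives.\<close>

abbreviation polar_rect :: "real \<Rightarrow> real \<Rightarrow> (real \<times> real) measure" where
  "polar_rect a b \<equiv> ivl 0 (2*pi) \<Otimes>\<^sub>M ivl a b"

text \<open>These functions take the radius before the angle, opposite to the points of
  \<open>polar_rect\<close>. Derivatives are one-sided on the edges, and no second derivatives occur
  because the approximants come from maps that are only C1.\<close>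

definition C1_polar :: "real \<Rightarrow> real \<Rightarrow> (real \<Rightarrow> real \<Rightarrow> complex) \<Rightarrow> (real \<Rightarrow> real \<Rightarrow> complex) \<Rightarrow> (real \<Rightarrow> real \<Rightarrow> complex) \<Rightarrow> bool" where
  "C1_polar a b Z Zr Zt \<longleftrightarrow>
     continuous_on ({a..b} \<times> {0..2*pi}) (\<lambda>(r,t). Z r t) \<and>
     continuous_on ({a..b} \<times> {0..2*pi}) (\<lambda>(r,t). Zr r t) \<and>
     continuous_on ({a..b} \<times> {0..2*pi}) (\<lambda>(r,t). Zt r t) \<and>
     (\<forall>r\<in>{a..b}. \<forall>t\<in>{0..2*pi}. ((\<lambda>r. Z r t) has_vector_derivative Zr r t) (at r within {a..b}) \<and>
        ((\<lambda>t. Z r t) has_vector_derivative Zt r t) (at t within {0..2*pi}))"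

lemma finite_measure_ivl: "finite_measure (ivl a b)"
  using emeasure_compact_finite[of "{a..b}"] by (intro finite_measureI) (simp add: emeasure_restrict_space)

lemma pair_sigma_finite_ivl: "pair_sigma_finite (ivl a b) (ivl c d)"
proof -
  interpret A: finite_measure "ivl a b" by (rule finite_measure_ivl)
  interpret B: finite_measure "ivl c d" by (rule finite_measure_ivl)
  show ?thesis ..
qed

interpretation ivl_pair: pair_sigma_finite "ivl a b" "ivl c d" for a b c d
  by (rule pair_sigma_finite_ivl)

lemma finite_measure_pair_ivl: "finite_measure (ivl a b \<Otimes>\<^sub>M ivl c d)"
proof
  have sf: "sigma_finite_measure (ivl c d)"
    using finite_measure_ivl by (simp add: finite_measure_def)
  have "emeasure (ivl a b \<Otimes>\<^sub>M ivl c d) (space (ivl a b) \<times> space (ivl c d)) = emeasure (ivl a b) (space (ivl a b)) * emeasure (ivl c d) (space (ivl c d))"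
    using sets.top[of "ivl a b"] sets.top[of "ivl c d"]
    by (intro sigma_finite_measure.emeasure_pair_measure_Times[OF sf]) simp_all
  then show "emeasure (ivl a b \<Otimes>\<^sub>M ivl c d) (space (ivl a b \<Otimes>\<^sub>M ivl c d)) \<noteq> \<infinity>"
    using finite_measure.finite_emeasure_space[OF finite_measure_ivl, of a b]
      finite_measure.finite_emeasure_space[OF finite_measure_ivl, of c d]
    by (simp add: space_pair_measure ennreal_mult_eq_top_iff)
qed

lemma space_ivl [simp]: "space (ivl a b) = {a..b}"
  by (simp add: space_restrict_space)

lemma id_measurable_polar_rect:
  "(\<lambda>p. p) \<in> measurable (ivl c d \<Otimes>\<^sub>M ivl a b) (restrict_space borel ({c..d} \<times> {a..b}))"
proof (rule measurable_restrict_space2)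
  have "fst \<in> measurable (ivl c d \<Otimes>\<^sub>M ivl a b) borel"
    by (rule measurable_compose[OF measurable_fst]) (auto intro: measurable_restrict_space1)
  moreover have "snd \<in> measurable (ivl c d \<Otimes>\<^sub>M ivl a b) borel"
    by (rule measurable_compose[OF measurable_snd]) (auto intro: measurable_restrict_space1)
  ultimately have "(\<lambda>p. (fst p, snd p)) \<in> measurable (ivl c d \<Otimes>\<^sub>M ivl a b) borel"
    by (rule borel_measurable_Pair)
  then show "(\<lambda>p. p) \<in> measurable (ivl c d \<Otimes>\<^sub>M ivl a b) borel" by simp
qed (simp add: space_pair_measure)

lemma borel_measurable_polar_rect_continuous:
  fixes f :: "real \<Rightarrow> real \<Rightarrow> 'b::euclidean_space"
  assumes "continuous_on ({a..b} \<times> {c..d}) (\<lambda>(r,t). f r t)"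
  shows "(\<lambda>(t,r). f r t) \<in> borel_measurable (ivl c d \<Otimes>\<^sub>M ivl a b)"
proof -
  have "continuous_on ({c..d} \<times> {a..b}) ((\<lambda>(r,t). f r t) \<circ> (\<lambda>p. (snd p, fst p)))"
    by (intro continuous_on_compose continuous_intros continuous_on_subset[OF assms]) auto
  then have "(\<lambda>(t,r). f r t) \<in> borel_measurable (restrict_space borel ({c..d} \<times> {a..b}))"
    by (intro borel_measurable_continuous_on_restrict) (simp add: o_def case_prod_beta)
  from measurable_compose[OF id_measurable_polar_rect this] show ?thesis .
qed

lemma bounded_polar_rect_continuous:
  fixes f :: "real \<Rightarrow> real \<Rightarrow> 'b::euclidean_space"
  assumes "continuous_on ({a..b} \<times> {c..d}) (\<lambda>(r,t). f r t)"
  obtains B where "\<And>r t. r \<in> {a..b} \<Longrightarrow> t \<in> {c..d} \<Longrightarrow> norm (f r t) \<le> B"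
proof -
  have "compact ({a..b} \<times> {c..d})" by (intro compact_Times compact_Icc)
  from continuous_on_compact_bounded[OF this assms] obtain B where
    B: "\<And>p. p \<in> {a..b} \<times> {c..d} \<Longrightarrow> norm (case p of (r,t) \<Rightarrow> f r t) \<le> B" by blast
  show thesis
  proof (rule that)
    fix r t assume "r \<in> {a..b}" "t \<in> {c..d}"
    then show "norm (f r t) \<le> B" using B[of "(r,t)"] by simp
  qed
qed

lemma integrable_polar_rect_bounded:
  fixes f :: "real \<times> real \<Rightarrow> 'b::euclidean_space"
  assumes "f \<in> borel_measurable (ivl c d \<Otimes>\<^sub>M ivl a b)"
    and "\<And>r t. r \<in> {a..b} \<Longrightarrow> t \<in> {c..d} \<Longrightarrow> norm (f (t,r)) \<le> B"
  shows "integrable (ivl c d \<Otimes>\<^sub>M ivl a b) f"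
  using assms
  by (intro finite_measure.integrable_const_bound[OF finite_measure_pair_ivl, where B=B] AE_I2)
    (auto simp: space_pair_measure)

lemma indicator_fst_measurable [measurable]:
  "(\<lambda>p. indicator {c..d} (fst p) :: real) \<in> borel_measurable (ivl x y \<Otimes>\<^sub>M ivl a b)"
proof -
  have "(indicator {c..d} :: real \<Rightarrow> real) \<in> borel_measurable (ivl x y)"
    by (intro measurable_restrict_space1) simp
  then show ?thesis by (rule measurable_compose[OF measurable_fst])
qed

lemma integral_ivl_continuous:
  fixes f :: "real \<Rightarrow> 'b::euclidean_space"
  assumes "continuous_on {a..b} f"
  shows "(LINT r|ivl a b. f r) = integral {a..b} f" and "integrable (ivl a b) f"
proof -
  have i: "set_integrable lborel {a..b} f" by (rule borel_integrable_atLeastAtMost'[OF assms])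
  have "(LINT r|ivl a b. f r) = (LINT r:{a..b}|lborel. f r)"
    by (simp add: integral_restrict_space set_lebesgue_integral_def)
  then show "(LINT r|ivl a b. f r) = integral {a..b} f"
    using set_borel_integral_eq_integral(2)[OF i] by simp
  show "integrable (ivl a b) f"
    using i by (simp add: integrable_restrict_space set_integrable_def)
qed

lemma integral_ivl_indicator_continuous:
  fixes f :: "real \<Rightarrow> 'b::euclidean_space"
  assumes "continuous_on {c..d} f" "x \<le> c" "d \<le> y"
  shows "(LINT t|ivl x y. indicator {c..d} t *\<^sub>R f t) = integral {c..d} f"
proof -
  have "(LINT t|ivl x y. indicator {c..d} t *\<^sub>R f t) = (LINT t|lborel. indicator {x..y} t *\<^sub>R (indicator {c..d} t *\<^sub>R f t))"
    by (simp add: integral_restrict_space)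
  also have "\<dots> = (LINT t|lborel. indicator {c..d} t *\<^sub>R f t)"
    using assms by (intro Bochner_Integration.integral_cong) (auto simp: indicator_def)
  also have "\<dots> = (LINT t|ivl c d. f t)"
    by (simp add: integral_restrict_space)
  finally show ?thesis using integral_ivl_continuous(1)[OF assms(1)] by simp
qed

lemma polar_rect_iterated:
  fixes F :: "real \<Rightarrow> real \<Rightarrow> 'b::euclidean_space"
  assumes F: "continuous_on ({a..b} \<times> {0..2*pi}) (\<lambda>(r,t). F r t)" and cd: "0 \<le> c" "d \<le> 2*pi"
  shows "(LINT p|polar_rect a b. indicator {c..d} (fst p) *\<^sub>R F (snd p) (fst p)) = integral {a..b} (\<lambda>r. integral {c..d} (F r))"
    and "integrable (polar_rect a b) (\<lambda>p. indicator {c..d} (fst p) *\<^sub>R F (snd p) (fst p))"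
proof -
  obtain B where B: "\<And>r t. r \<in> {a..b} \<Longrightarrow> t \<in> {0..2*pi} \<Longrightarrow> norm (F r t) \<le> B"
    using bounded_polar_rect_continuous[OF F] by blast
  let ?f = "\<lambda>t r. indicator {c..d} t *\<^sub>R F r t"
  have m: "(\<lambda>p. F (snd p) (fst p)) \<in> borel_measurable (polar_rect a b)"
    using borel_measurable_polar_rect_continuous[OF F] by (simp add: case_prod_beta)
  show i: "integrable (polar_rect a b) (\<lambda>p. ?f (fst p) (snd p))"
  proof (rule integrable_polar_rect_bounded[where B=B])
    show "(\<lambda>p. ?f (fst p) (snd p)) \<in> borel_measurable (polar_rect a b)" using m by measurable
    fix r t :: real assume rt: "r \<in> {a..b}" "t \<in> {0..2*pi}"
    have "0 \<le> B" using B[OF rt] norm_ge_zero order_trans by blast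
    then show "norm (?f (fst (t,r)) (snd (t,r))) \<le> B"
      using B[OF rt] by (simp add: indicator_def)
  qed
  have sub: "continuous_on ({a..b} \<times> cbox c d) (\<lambda>(r,t). F r t)"
    by (rule continuous_on_subset[OF F]) (use cd in auto)
  have slice: "continuous_on {c..d} (F r)" if "r \<in> {a..b}" for r
  proof -
    have "continuous_on {c..d} ((\<lambda>(r,t). F r t) \<circ> (\<lambda>t. (r, t)))"
      using that cd by (intro continuous_on_compose continuous_intros continuous_on_subset[OF F]) auto
    then show ?thesis by (simp add: o_def)
  qed
  have i': "integrable (polar_rect a b) (case_prod ?f)"
    using i by (simp add: case_prod_unfold)
  have "(LINT p|polar_rect a b. ?f (fst p) (snd p)) = (LINT t|ivl 0 (2*pi). LINT r|ivl a b. ?f t r)"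
    using ivl_pair.integral_fst'[OF i] by simp
  also have "\<dots> = (LINT r|ivl a b. LINT t|ivl 0 (2*pi). ?f t r)"
    by (rule ivl_pair.Fubini_integral[OF i', symmetric])
  also have "\<dots> = (LINT r|ivl a b. integral {c..d} (F r))"
    by (intro Bochner_Integration.integral_cong refl integral_ivl_indicator_continuous slice) (use cd in auto)
  also have "\<dots> = integral {a..b} (\<lambda>r. integral {c..d} (F r))"
    using integral_continuous_on_param[OF sub] by (intro integral_ivl_continuous(1)) simp
  finally show "(LINT p|polar_rect a b. indicator {c..d} (fst p) *\<^sub>R F (snd p) (fst p)) = integral {a..b} (\<lambda>r. integral {c..d} (F r))" .
qed

lemma continuous_on_polar_slice:
  assumes "continuous_on ({a..b} \<times> S) (\<lambda>(r,t). f r t)" "t \<in> S"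
  shows "continuous_on {a..b} (\<lambda>r. f r t)"
proof -
  have "continuous_on {a..b} ((\<lambda>(r,t). f r t) \<circ> (\<lambda>r. (r, t)))"
    using assms(2) by (intro continuous_on_compose continuous_intros continuous_on_subset[OF assms(1)]) auto
  then show ?thesis by (simp add: o_def)
qed

lemma continuous_on_polar_angle_slice:
  assumes "continuous_on ({a..b} \<times> S) (\<lambda>(r,t). f r t)" "r \<in> {a..b}"
  shows "continuous_on S (f r)"
proof -
  have "continuous_on S ((\<lambda>(r,t). f r t) \<circ> (\<lambda>t. (r, t)))"
    using assms(2) by (intro continuous_on_compose continuous_intros continuous_on_subset[OF assms(1)]) auto
  then show ?thesis by (simp add: o_def)
qed

lemma has_vector_derivative_cis: "(cis has_vector_derivative \<i> * cis t) (at t within S)"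
proof -
  have "((\<lambda>z. exp (\<i> * z)) has_field_derivative \<i> * exp (\<i> * of_real t)) (at (of_real t))"
    by (auto intro!: derivative_eq_intros)
  from has_vector_derivative_real_field[OF this] show ?thesis
    by (simp add: cis_conv_exp[abs_def])
qed

text \<open>Let \<open>H r\<close> be the integral of \<open>reg_inv e Z * Zt\<close> over
  \<open>[c, d]\<close>. Green's formula expresses the derivative of \<open>Im H\<close> by the two
  ray terms and the integral of \<open>reg_jac\<close>, and the fundamental theorem is then applied
  to \<open>\<psi> * Im H\<close>. The weight stays free so that one identity serves both integrals
  of the logarithmic derivative.\<close>

lemma regularised_green:
  fixes \<psi> \<psi>' :: "real \<Rightarrow> real"
  assumes ab: "0 < a" "a < b" and Z: "C1_polar a b Z Zr Zt" and cd: "0 \<le> c" "c \<le> d" "d \<le> 2*pi" and e: "e > 0"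
    and bd: "\<And>t. t \<in> {0..2*pi} \<Longrightarrow> Z a t = of_real a * cis t" "\<And>t. t \<in> {0..2*pi} \<Longrightarrow> Z b t = of_real b * cis t"
    and \<psi>: "\<And>r. r \<in> {a..b} \<Longrightarrow> (\<psi> has_vector_derivative \<psi>' r) (at r within {a..b})" "continuous_on {a..b} \<psi>'"
  shows "(LINT p|polar_rect a b. indicator {c..d} (fst p) *\<^sub>R (\<psi>' (snd p) * Im (reg_inv e (Z (snd p) (fst p)) * Zt (snd p) (fst p))))
    = (d - c) * (\<psi> b * (b\<^sup>2 / (b\<^sup>2 + e)) - \<psi> a * (a\<^sup>2 / (a\<^sup>2 + e)))
      - (LINT r|ivl a b. \<psi> r * (Im (reg_inv e (Z r d) * Zr r d) - Im (reg_inv e (Z r c) * Zr r c)))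
      - (LINT p|polar_rect a b. indicator {c..d} (fst p) *\<^sub>R (\<psi> (snd p) * reg_jac e (Z (snd p) (fst p)) (Zr (snd p) (fst p)) (Zt (snd p) (fst p))))"
proof -
  let ?K = "{a..b} \<times> {0..2*pi}"
  have cZ: "continuous_on ?K (\<lambda>(r,t). Z r t)" and cZr: "continuous_on ?K (\<lambda>(r,t). Zr r t)" and cZt: "continuous_on ?K (\<lambda>(r,t). Zt r t)"
    and dr: "\<And>r t. r \<in> {a..b} \<Longrightarrow> t \<in> {0..2*pi} \<Longrightarrow> ((\<lambda>r. Z r t) has_vector_derivative Zr r t) (at r within {a..b})"
    and dt: "\<And>r t. r \<in> {a..b} \<Longrightarrow> t \<in> {0..2*pi} \<Longrightarrow> ((\<lambda>t. Z r t) has_vector_derivative Zt r t) (at t within {0..2*pi})"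
    using Z unfolding C1_polar_def by blast+
  define A where "A r t = reg_inv e (Z r t)" for r t
  define D where "D w x = (of_real e * cnj x - (cnj w)\<^sup>2 * x) / (w * cnj w + of_real e)\<^sup>2" for w x :: complex
  define Ar where "Ar r t = D (Z r t) (Zr r t)" for r t
  define At where "At r t = D (Z r t) (Zt r t)" for r t
  have cZ': "continuous_on ?K (\<lambda>p. Z (fst p) (snd p))" and cZr': "continuous_on ?K (\<lambda>p. Zr (fst p) (snd p))" and cZt': "continuous_on ?K (\<lambda>p. Zt (fst p) (snd p))"
    using cZ cZr cZt by (simp_all add: case_prod_beta)
  have cA: "continuous_on ?K (\<lambda>(r,t). A r t)"
    unfolding case_prod_beta A_def by (rule continuous_on_compose2[OF continuous_on_reg_inv[OF e, of UNIV] cZ']) simp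
  have cAr: "continuous_on ?K (\<lambda>(r,t). Ar r t)"
    unfolding case_prod_beta Ar_def D_def by (intro continuous_intros cZ' cZr') (simp add: reg_inv_denom_neq_0[OF e])
  have cAt: "continuous_on ?K (\<lambda>(r,t). At r t)"
    unfolding case_prod_beta At_def D_def by (intro continuous_intros cZ' cZt') (simp add: reg_inv_denom_neq_0[OF e])
  have sub: "{a..b} \<times> {c..d} \<subseteq> ?K" and sub2: "{c..d} \<subseteq> {0..2*pi}" using cd by auto
  note cs = continuous_on_subset[OF cA sub] continuous_on_subset[OF cAr sub] continuous_on_subset[OF cAt sub]
    continuous_on_subset[OF cZ sub] continuous_on_subset[OF cZr sub] continuous_on_subset[OF cZt sub]
  have dA: "((\<lambda>r. A r t) has_vector_derivative Ar r t) (at r within {a..b})" if "r \<in> {a..b}" "t \<in> {0..2*pi}" for r t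
    unfolding A_def Ar_def D_def by (rule has_vector_derivative_reg_inv[OF e dr[OF that]])
  have dA2: "((\<lambda>t. A r t) has_vector_derivative At r t) (at t within {0..2*pi})" if "r \<in> {a..b}" "t \<in> {0..2*pi}" for r t
    unfolding A_def At_def D_def by (rule has_vector_derivative_reg_inv[OF e dt[OF that]])
  define H where "H r = integral {c..d} (\<lambda>t. A r t * Zt r t)" for r
  define J where "J r t = reg_jac e (Z r t) (Zr r t) (Zt r t)" for r t
  have J: "J r t = Im (Ar r t * Zt r t - At r t * Zr r t)" for r t
    unfolding J_def Ar_def At_def D_def by (rule Im_reg_inv_green[symmetric])
  define B where "B r = Im (A r d * Zr r d) - Im (A r c * Zr r c)" for r
  have cJ: "continuous_on ?K (\<lambda>(r,t). J r t)"
    unfolding J case_prod_beta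
    by (intro continuous_intros cZr' cZt' cAr[unfolded case_prod_beta] cAt[unfolded case_prod_beta])
  have cAZ: "continuous_on ?K (\<lambda>(r,t). A r t * Zt r t)"
    unfolding case_prod_beta by (intro continuous_intros cZt' cA[unfolded case_prod_beta])
  have dH: "(H has_vector_derivative (A r d * Zr r d - A r c * Zr r c + integral {c..d} (\<lambda>t. Ar r t * Zt r t - At r t * Zr r t))) (at r within {a..b})"
    if "r \<in> {a..b}" for r
    unfolding H_def
    by (rule has_vector_derivative_integral_times_derivative[OF cd(2) _ _ _ _ cs that])
      (use sub2 in \<open>blast intro: dA dr has_vector_derivative_within_subset[OF dA2 sub2] has_vector_derivative_within_subset[OF dt sub2]\<close>)+
  have ci: "Im (integral {c..d} f) = integral {c..d} (\<lambda>t. Im (f t))" if "continuous_on {c..d} f" for f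
    using integral_linear[OF integrable_continuous_real[OF that] bounded_linear_Im] by (simp add: o_def)
  have sl: "continuous_on {c..d} (f r)" if "continuous_on ?K (\<lambda>(r,t). f r t)" "r \<in> {a..b}" for f :: "real \<Rightarrow> real \<Rightarrow> complex" and r
    using continuous_on_subset[OF continuous_on_polar_angle_slice[OF that] sub2] .
  have dh: "((\<lambda>r. Im (H r)) has_vector_derivative (B r + integral {c..d} (J r))) (at r within {a..b})" if r: "r \<in> {a..b}" for r
  proof -
    have "continuous_on {c..d} (\<lambda>t. Ar r t * Zt r t - At r t * Zr r t)"
      by (intro continuous_intros sl cAr cZt cAt cZr r)
    from ci[OF this] have "Im (A r d * Zr r d - A r c * Zr r c + integral {c..d} (\<lambda>t. Ar r t * Zt r t - At r t * Zr r t))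
       = B r + integral {c..d} (J r)"
      unfolding J B_def by simp
    with bounded_linear.has_vector_derivative[OF bounded_linear_Im dH[OF r]] show ?thesis by simp
  qed
  have "((\<lambda>r. \<psi> r * (B r + integral {c..d} (J r)) + \<psi>' r * Im (H r)) has_integral \<psi> b * Im (H b) - \<psi> a * Im (H a)) {a..b}"
    using ab by (intro fundamental_theorem_of_calculus has_vector_derivative_mult \<psi> dh) auto
  then have eq: "integral {a..b} (\<lambda>r. \<psi> r * B r + \<psi> r * integral {c..d} (J r) + \<psi>' r * Im (H r)) = \<psi> b * Im (H b) - \<psi> a * Im (H a)"
    by (simp add: integral_unique algebra_simps)
  have c\<psi>: "continuous_on {a..b} \<psi>"
    using \<psi>(1) by (intro continuous_on_vector_derivative)
  have cB: "continuous_on {a..b} B"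
    unfolding B_def using cd
    by (intro continuous_intros continuous_on_polar_slice[OF cA] continuous_on_polar_slice[OF cZr]) auto
  have cIJ: "continuous_on {a..b} (\<lambda>r. integral {c..d} (J r))"
    using integral_continuous_on_param[of "{a..b}" c d J] continuous_on_subset[OF cJ sub] by simp
  have cH: "continuous_on {a..b} (\<lambda>r. Im (H r))"
    using dh by (intro continuous_on_vector_derivative)
  have ii: "f integrable_on {a..b}" if "continuous_on {a..b} f" for f :: "real \<Rightarrow> real"
    using that by (rule integrable_continuous_real)
  have split: "integral {a..b} (\<lambda>r. \<psi> r * B r + \<psi> r * integral {c..d} (J r) + \<psi>' r * Im (H r))
     = integral {a..b} (\<lambda>r. \<psi> r * B r) + integral {a..b} (\<lambda>r. \<psi> r * integral {c..d} (J r)) + integral {a..b} (\<lambda>r. \<psi>' r * Im (H r))"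
    by (subst Henstock_Kurzweil_Integration.integral_add;
        (subst Henstock_Kurzweil_Integration.integral_add)?; (intro ii continuous_intros c\<psi> \<psi>(2) cB cIJ cH refl)?)
  \<comment> \<open>This is where exact boundary values are needed: on such a circle the values of
    \<open>Z\<close> determine \<open>Zt\<close>, whereas convergence of the boundary values in L2
    would say nothing about this tangential derivative. The factor \<open>r^2 / (r^2 + e)\<close>
    tends to 1 with \<open>e\<close>.\<close>
  have Hval: "Im (H r) = (d - c) * (r\<^sup>2 / (r\<^sup>2 + e))" if r: "r > 0" "r \<in> {a..b}" and Zr: "\<And>t. t \<in> {0..2*pi} \<Longrightarrow> Z r t = of_real r * cis t" for r
  proof -
    have "Zt r t = of_real r * (\<i> * cis t)" if t: "t \<in> {0..2*pi}" for t
    proof (rule vector_derivative_unique_within_closed_interval[of 0 "2*pi" t "Z r"])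
      have "((\<lambda>t. of_real r * cis t) has_vector_derivative of_real r * (\<i> * cis t)) (at t within {0..2*pi})"
        by (intro has_vector_derivative_mult_right has_vector_derivative_cis)
      then have "(Z r has_vector_derivative of_real r * (\<i> * cis t)) (at t within {0..2*pi})"
        by (rule has_vector_derivative_transform[rotated 2]) (use t Zr in auto)
      then show "(Z r has_vector_derivative of_real r * (\<i> * cis t)) (at t within cbox 0 (2*pi))" by simp
      show "(Z r has_vector_derivative Zt r t) (at t within cbox 0 (2*pi))"
        using dt[OF r(2) t] by simp
    qed (use t in auto)
    then have "A r t * Zt r t = \<i> * of_real (r\<^sup>2 / (r\<^sup>2 + e))" if "t \<in> {c..d}" for t
      using that sub2 Zr[of t] reg_inv_mult_cis[OF r(1)] by (auto simp: A_def)
    then have "H r = integral {c..d} (\<lambda>t. \<i> * of_real (r\<^sup>2 / (r\<^sup>2 + e)))"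
      unfolding H_def by (intro Henstock_Kurzweil_Integration.integral_cong)
    also have "\<dots> = (d - c) *\<^sub>R (\<i> * of_real (r\<^sup>2 / (r\<^sup>2 + e)))"
      using cd by (simp add: scaleR_conv_of_real)
    finally show ?thesis by simp
  qed
  have L1: "(LINT p|polar_rect a b. indicator {c..d} (fst p) *\<^sub>R (\<psi>' (snd p) * Im (reg_inv e (Z (snd p) (fst p)) * Zt (snd p) (fst p))))
     = integral {a..b} (\<lambda>r. \<psi>' r * Im (H r))"
  proof -
    have c1: "continuous_on ?K (\<lambda>p. \<psi>' (fst p))"
      by (rule continuous_on_compose2[OF \<psi>(2)]) (auto intro: continuous_intros)
    have "continuous_on ?K (\<lambda>(r,t). \<psi>' r * Im (A r t * Zt r t))"
      unfolding case_prod_beta by (intro continuous_intros cZt' cA[unfolded case_prod_beta] c1)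
    from polar_rect_iterated(1)[OF this cd(1,3)]
    have "(LINT p|polar_rect a b. indicator {c..d} (fst p) *\<^sub>R (\<psi>' (snd p) * Im (A (snd p) (fst p) * Zt (snd p) (fst p))))
      = integral {a..b} (\<lambda>r. integral {c..d} (\<lambda>t. \<psi>' r * Im (A r t * Zt r t)))" .
    also have "\<dots> = integral {a..b} (\<lambda>r. \<psi>' r * Im (H r))"
      unfolding H_def by (intro Henstock_Kurzweil_Integration.integral_cong) (simp add: ci[OF sl[OF cAZ]])
    finally show ?thesis by (simp add: A_def)
  qed
  have L2: "(LINT p|polar_rect a b. indicator {c..d} (fst p) *\<^sub>R (\<psi> (snd p) * reg_jac e (Z (snd p) (fst p)) (Zr (snd p) (fst p)) (Zt (snd p) (fst p))))
     = integral {a..b} (\<lambda>r. \<psi> r * integral {c..d} (J r))"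
  proof -
    have c1: "continuous_on ?K (\<lambda>p. \<psi> (fst p))"
      by (rule continuous_on_compose2[OF c\<psi>]) (auto intro: continuous_intros)
    have "continuous_on ?K (\<lambda>(r,t). \<psi> r * J r t)"
      using cJ unfolding case_prod_beta by (intro continuous_intros c1)
    from polar_rect_iterated(1)[OF this cd(1,3)] show ?thesis
      by (simp add: J_def[abs_def])
  qed
  have L3: "(LINT r|ivl a b. \<psi> r * (Im (reg_inv e (Z r d) * Zr r d) - Im (reg_inv e (Z r c) * Zr r c))) = integral {a..b} (\<lambda>r. \<psi> r * B r)"
    using integral_ivl_continuous(1)[of a b "\<lambda>r. \<psi> r * B r"] continuous_on_mult[OF c\<psi> cB]
    by (simp add: B_def A_def)
  have "Im (H b) = (d - c) * (b\<^sup>2 / (b\<^sup>2 + e))" by (rule Hval) (use ab bd in auto)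
  moreover have "Im (H a) = (d - c) * (a\<^sup>2 / (a\<^sup>2 + e))" by (rule Hval) (use ab bd in auto)
  ultimately show ?thesis using eq split unfolding L1 L2 L3 by (simp add: algebra_simps)
qed

section \<open>Convergence of products in L1\<close>

lemma ennreal_tendsto_0_of_square_le:
  fixes u v :: "nat \<Rightarrow> ennreal"
  assumes "\<And>n. (u n)\<^sup>2 \<le> v n" "v \<longlonglongrightarrow> 0"
  shows "u \<longlonglongrightarrow> 0"
proof (rule order_tendstoI)
  fix y :: ennreal assume y: "0 < y"
  have "0 < y * y" using y by (simp add: ennreal_zero_less_mult_iff)
  then have "eventually (\<lambda>n. v n < y * y) sequentially"
    using assms(2) by (rule order_tendstoD(2)[rotated])
  then show "eventually (\<lambda>n. u n < y) sequentially"
  proof eventually_elim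
    fix n assume "v n < y * y"
    then have "(u n)\<^sup>2 < y * y" using assms(1)[of n] by (rule le_less_trans[rotated])
    then have "\<not> y \<le> u n" using mult_mono[of y "u n" y "u n"] by (auto simp: power2_eq_square)
    then show "u n < y" by simp
  qed
qed auto

lemma nn_integral_norm_mult_tendsto_0:
  fixes f g :: "nat \<Rightarrow> 'a \<Rightarrow> complex"
  assumes [measurable]: "\<And>n. f n \<in> borel_measurable M" "\<And>n. g n \<in> borel_measurable M"
    and f: "(\<lambda>n. \<integral>\<^sup>+x. ennreal ((norm (f n x))\<^sup>2) \<partial>M) \<longlonglongrightarrow> 0"
    and g: "\<And>n. (\<integral>\<^sup>+x. ennreal ((norm (g n x))\<^sup>2) \<partial>M) \<le> C" "C < \<infinity>"
  shows "(\<lambda>n. \<integral>\<^sup>+x. ennreal (norm (f n x) * norm (g n x)) \<partial>M) \<longlonglongrightarrow> 0"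
proof (rule ennreal_tendsto_0_of_square_le)
  fix n
  have "(\<integral>\<^sup>+x. ennreal (norm (f n x) * norm (g n x)) \<partial>M)\<^sup>2 \<le>
     (\<integral>\<^sup>+x. (ennreal (norm (f n x)))\<^sup>2 \<partial>M) * (\<integral>\<^sup>+x. (ennreal (norm (g n x)))\<^sup>2 \<partial>M)"
    unfolding ennreal_mult[OF norm_ge_zero norm_ge_zero] by (rule Cauchy_Schwarz_nn_integral) measurable
  also have "\<dots> \<le> (\<integral>\<^sup>+x. ennreal ((norm (f n x))\<^sup>2) \<partial>M) * C"
    using g(1)[of n] by (simp add: ennreal_power mult_left_mono)
  finally show "(\<integral>\<^sup>+x. ennreal (norm (f n x) * norm (g n x)) \<partial>M)\<^sup>2 \<le> (\<integral>\<^sup>+x. ennreal ((norm (f n x))\<^sup>2) \<partial>M) * C" .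
next
  show "(\<lambda>n. (\<integral>\<^sup>+x. ennreal ((norm (f n x))\<^sup>2) \<partial>M) * C) \<longlonglongrightarrow> 0"
  proof -
    have "(\<lambda>n. (\<integral>\<^sup>+x. ennreal ((norm (f n x))\<^sup>2) \<partial>M) * C) \<longlonglongrightarrow> 0 * C"
      using g(2) by (intro tendsto_mult_ennreal f tendsto_const) auto
    then show ?thesis by simp
  qed
qed

lemma nn_integral_norm_tendsto_0_of_L2:
  fixes f :: "nat \<Rightarrow> 'a \<Rightarrow> complex"
  assumes "finite_measure M" and "\<And>n. f n \<in> borel_measurable M"
    and "(\<lambda>n. \<integral>\<^sup>+x. ennreal ((norm (f n x))\<^sup>2) \<partial>M) \<longlonglongrightarrow> 0"
  shows "(\<lambda>n. \<integral>\<^sup>+x. ennreal (norm (f n x)) \<partial>M) \<longlonglongrightarrow> 0"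
  using nn_integral_norm_mult_tendsto_0[OF assms(2) _ assms(3), of "\<lambda>n x. 1" "emeasure M (space M)"]
    finite_measure.emeasure_finite[OF assms(1)] by (simp add: less_top)

lemma nn_integral_add_tendsto_0:
  fixes f g h :: "nat \<Rightarrow> 'a \<Rightarrow> real"
  assumes m: "\<And>n. f n \<in> borel_measurable M" "\<And>n. g n \<in> borel_measurable M"
    and f: "(\<lambda>n. \<integral>\<^sup>+x. ennreal (f n x) \<partial>M) \<longlonglongrightarrow> 0" and g: "(\<lambda>n. \<integral>\<^sup>+x. ennreal (g n x) \<partial>M) \<longlonglongrightarrow> 0"
    and h: "\<And>n x. x \<in> space M \<Longrightarrow> h n x \<le> f n x + g n x" and nn: "\<And>n x. 0 \<le> f n x" "\<And>n x. 0 \<le> g n x"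
  shows "(\<lambda>n. \<integral>\<^sup>+x. ennreal (h n x) \<partial>M) \<longlonglongrightarrow> 0"
proof (rule tendsto_sandwich[OF _ _ tendsto_const])
  have "(\<integral>\<^sup>+x. ennreal (h n x) \<partial>M) \<le> (\<integral>\<^sup>+x. ennreal (f n x) \<partial>M) + (\<integral>\<^sup>+x. ennreal (g n x) \<partial>M)" for n
  proof -
    have "(\<integral>\<^sup>+x. ennreal (h n x) \<partial>M) \<le> (\<integral>\<^sup>+x. ennreal (f n x) + ennreal (g n x) \<partial>M)"
      using h nn by (intro nn_integral_mono) (simp flip: ennreal_plus add: ennreal_leI)
    also have "\<dots> = (\<integral>\<^sup>+x. ennreal (f n x) \<partial>M) + (\<integral>\<^sup>+x. ennreal (g n x) \<partial>M)"
      using m by (intro nn_integral_add) auto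
    finally show ?thesis .
  qed
  then show "\<forall>\<^sub>F n in sequentially. (\<integral>\<^sup>+x. ennreal (h n x) \<partial>M) \<le> (\<integral>\<^sup>+x. ennreal (f n x) \<partial>M) + (\<integral>\<^sup>+x. ennreal (g n x) \<partial>M)"
    by (intro always_eventually allI)
  show "(\<lambda>n. (\<integral>\<^sup>+x. ennreal (f n x) \<partial>M) + (\<integral>\<^sup>+x. ennreal (g n x) \<partial>M)) \<longlonglongrightarrow> 0"
    using tendsto_add[OF f g] by simp
qed simp

text \<open>Splitting \<open>c g - c' g'\<close> into \<open>c (g - g')\<close> and
  \<open>(c - c') g'\<close>: the first part is at most \<open>C\<close> times an L1 distance, the
  second tends to 0 by dominated convergence with majorant \<open>2 C |g'|\<close>.\<close>

lemma L1_tendsto_mult_bounded: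
  fixes c :: "nat \<Rightarrow> 'a \<Rightarrow> complex" and g :: "nat \<Rightarrow> 'a \<Rightarrow> complex"
  assumes [measurable]: "\<And>n. c n \<in> borel_measurable M" "c' \<in> borel_measurable M" "\<And>n. g n \<in> borel_measurable M"
    and g': "integrable M g'" and C: "\<And>n x. x \<in> space M \<Longrightarrow> norm (c n x) \<le> C" "\<And>x. x \<in> space M \<Longrightarrow> norm (c' x) \<le> C" and C0: "0 \<le> C"
    and clim: "AE x in M. (\<lambda>n. c n x) \<longlonglongrightarrow> c' x"
    and glim: "(\<lambda>n. \<integral>\<^sup>+x. ennreal (norm (g n x - g' x)) \<partial>M) \<longlonglongrightarrow> 0"
  shows "(\<lambda>n. \<integral>\<^sup>+x. ennreal (norm (c n x * g n x - c' x * g' x)) \<partial>M) \<longlonglongrightarrow> 0"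
proof -
  have [measurable]: "g' \<in> borel_measurable M" using g' by auto
  have "(\<lambda>n. ennreal C * (\<integral>\<^sup>+x. ennreal (norm (g n x - g' x)) \<partial>M)) \<longlonglongrightarrow> ennreal C * 0"
    by (intro tendsto_mult_ennreal glim tendsto_const) auto
  then have 1: "(\<lambda>n. \<integral>\<^sup>+x. ennreal (C * norm (g n x - g' x)) \<partial>M) \<longlonglongrightarrow> 0"
    using C0 by (simp add: ennreal_mult nn_integral_cmult)
  have "(\<lambda>n. \<integral>\<^sup>+x. ennreal (norm (c n x - c' x) * norm (g' x)) \<partial>M) \<longlonglongrightarrow> (\<integral>\<^sup>+x. ennreal 0 \<partial>M)"
  proof (rule nn_integral_dominated_convergence[where w="\<lambda>x. ennreal (2 * C * norm (g' x))"])
    show "(\<integral>\<^sup>+x. ennreal (2 * C * norm (g' x)) \<partial>M) < \<infinity>"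
      using integrable_mult_right[OF integrable_norm[OF g'], of "2*C"] C0
      by (simp add: nn_integral_eq_integral)
    show "AE x in M. ennreal (norm (c n x - c' x) * norm (g' x)) \<le> ennreal (2 * C * norm (g' x))" for n
    proof (intro AE_I2 ennreal_leI mult_right_mono)
      fix x assume x: "x \<in> space M"
      show "norm (c n x - c' x) \<le> 2 * C"
        using norm_triangle_ineq4[of "c n x" "c' x"] C(1)[OF x, of n] C(2)[OF x] by linarith
    qed simp
    show "AE x in M. (\<lambda>n. ennreal (norm (c n x - c' x) * norm (g' x))) \<longlonglongrightarrow> ennreal 0"
      using clim
    proof eventually_elim
      fix x assume "(\<lambda>n. c n x) \<longlonglongrightarrow> c' x"
      then have "(\<lambda>n. norm (c n x - c' x) * norm (g' x)) \<longlonglongrightarrow> 0 * norm (g' x)"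
        by (intro tendsto_mult tendsto_const tendsto_norm_zero LIM_zero)
      then show "(\<lambda>n. ennreal (norm (c n x - c' x) * norm (g' x))) \<longlonglongrightarrow> ennreal 0"
        by (intro tendsto_ennrealI) simp
    qed
  qed auto
  then have 2: "(\<lambda>n. \<integral>\<^sup>+x. ennreal (norm (c n x - c' x) * norm (g' x)) \<partial>M) \<longlonglongrightarrow> 0" by simp
  show ?thesis
  proof (rule nn_integral_add_tendsto_0[OF _ _ 1 2])
    fix n :: nat and x assume x: "x \<in> space M"
    have "c n x * g n x - c' x * g' x = c n x * (g n x - g' x) + (c n x - c' x) * g' x" by (simp add: algebra_simps)
    then have "norm (c n x * g n x - c' x * g' x) \<le> norm (c n x) * norm (g n x - g' x) + norm (c n x - c' x) * norm (g' x)"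
      by (metis norm_mult norm_triangle_ineq)
    also have "\<dots> \<le> C * norm (g n x - g' x) + norm (c n x - c' x) * norm (g' x)"
      using C(1)[OF x] by (intro add_right_mono mult_right_mono) auto
    finally show "norm (c n x * g n x - c' x * g' x) \<le> C * norm (g n x - g' x) + norm (c n x - c' x) * norm (g' x)" .
  qed (use C0 in auto)
qed

text \<open>Made for the Jacobian \<open>Im (cnj Zr * Zt)\<close>, quadratic in the derivatives.
  Both derivatives converge strongly in L2, so the expansion around the limit and Cauchy-Schwarz
  suffice; the product of the two errors is bounded by the sum of their squares.\<close>

lemma L1_tendsto_cnj_mult:
  fixes f g :: "nat \<Rightarrow> 'a \<Rightarrow> complex"
  assumes [measurable]: "\<And>n. f n \<in> borel_measurable M" "\<And>n. g n \<in> borel_measurable M" "f' \<in> borel_measurable M" "g' \<in> borel_measurable M"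
    and f: "(\<lambda>n. \<integral>\<^sup>+x. ennreal ((norm (f n x - f' x))\<^sup>2) \<partial>M) \<longlonglongrightarrow> 0"
    and g: "(\<lambda>n. \<integral>\<^sup>+x. ennreal ((norm (g n x - g' x))\<^sup>2) \<partial>M) \<longlonglongrightarrow> 0"
    and f': "(\<integral>\<^sup>+x. ennreal ((norm (f' x))\<^sup>2) \<partial>M) < \<infinity>" and g': "(\<integral>\<^sup>+x. ennreal ((norm (g' x))\<^sup>2) \<partial>M) < \<infinity>"
  shows "(\<lambda>n. \<integral>\<^sup>+x. ennreal (norm (cnj (f n x) * g n x - cnj (f' x) * g' x)) \<partial>M) \<longlonglongrightarrow> 0"
proof -
  have 1: "(\<lambda>n. \<integral>\<^sup>+x. ennreal (norm (f n x - f' x) * norm (g' x)) \<partial>M) \<longlonglongrightarrow> 0"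
    using g' by (intro nn_integral_norm_mult_tendsto_0[where g="\<lambda>n. g'", OF _ _ f order_refl]) auto
  have 2: "(\<lambda>n. \<integral>\<^sup>+x. ennreal (norm (g n x - g' x) * norm (f' x)) \<partial>M) \<longlonglongrightarrow> 0"
    using f' by (intro nn_integral_norm_mult_tendsto_0[where g="\<lambda>n. f'", OF _ _ g order_refl]) auto
  have 3: "(\<lambda>n. \<integral>\<^sup>+x. ennreal ((norm (f n x - f' x))\<^sup>2 + (norm (g n x - g' x))\<^sup>2) \<partial>M) \<longlonglongrightarrow> 0"
    by (rule nn_integral_add_tendsto_0[OF _ _ f g]) auto
  have 4: "(\<lambda>n. \<integral>\<^sup>+x. ennreal (norm (f n x - f' x) * norm (g' x) + norm (g n x - g' x) * norm (f' x)) \<partial>M) \<longlonglongrightarrow> 0"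
    by (rule nn_integral_add_tendsto_0[OF _ _ 1 2]) auto
  show ?thesis
  proof (rule nn_integral_add_tendsto_0[OF _ _ 3 4])
    fix n x
    let ?x = "f n x - f' x" and ?y = "g n x - g' x"
    have "cnj (f n x) * g n x - cnj (f' x) * g' x = cnj ?x * ?y + (cnj ?x * g' x + cnj (f' x) * ?y)"
      by (simp add: algebra_simps)
    then have "norm (cnj (f n x) * g n x - cnj (f' x) * g' x) \<le> norm (cnj ?x * ?y) + norm (cnj ?x * g' x + cnj (f' x) * ?y)"
      using norm_triangle_ineq[of "cnj ?x * ?y" "cnj ?x * g' x + cnj (f' x) * ?y"] by (simp only:)
    also have "norm (cnj ?x * g' x + cnj (f' x) * ?y) \<le> norm (cnj ?x * g' x) + norm (cnj (f' x) * ?y)"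
      by (rule norm_triangle_ineq)
    finally have "norm (cnj (f n x) * g n x - cnj (f' x) * g' x) \<le> norm ?x * norm ?y + (norm ?x * norm (g' x) + norm ?y * norm (f' x))"
      by (simp add: norm_mult mult.commute[of "norm (f' x)"] del: complex_cnj_diff complex_cnj_mult)
    moreover have "norm ?x * norm ?y \<le> (norm ?x)\<^sup>2 + (norm ?y)\<^sup>2"
      using sum_squares_bound[of "norm ?x" "norm ?y", unfolded mult.assoc]
        mult_nonneg_nonneg[OF norm_ge_zero norm_ge_zero, of ?x ?y] by linarith
    ultimately show "norm (cnj (f n x) * g n x - cnj (f' x) * g' x) \<le> (norm ?x)\<^sup>2 + (norm ?y)\<^sup>2 + (norm ?x * norm (g' x) + norm ?y * norm (f' x))"
      by linarith
  qed auto
qed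

section \<open>Bounds and limits as the regularisation is removed\<close>

lemma norm_reg_inv_le_inverse:
  assumes "e > 0" "w \<noteq> 0" shows "norm (reg_inv e w) \<le> 1 / norm w"
proof -
  have "0 < (norm w)\<^sup>2 + e" using assms(1) zero_le_power2[of "norm w"] by linarith
  then show ?thesis
    using assms unfolding reg_inv_def reg_inv_denom norm_divide norm_of_real complex_mod_cnj
    by (simp add: divide_simps) (simp add: power2_eq_square)
qed

lemma reg_inv_tendsto:
  assumes "w \<noteq> 0" shows "(\<lambda>n. reg_inv (1 / real (Suc n)) w) \<longlonglongrightarrow> 1 / w"
proof -
  have "(\<lambda>n. cnj w / (w * cnj w + of_real (inverse (real (Suc n))))) \<longlonglongrightarrow> cnj w / (w * cnj w + of_real 0)"
    by (intro tendsto_divide tendsto_add tendsto_const tendsto_of_real LIMSEQ_inverse_real_of_nat) (use assms in simp)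
  moreover have "cnj w / (w * cnj w + of_real 0) = 1 / w" using assms by simp
  ultimately show ?thesis by (simp only: reg_inv_def inverse_eq_divide)
qed

text \<open>From \<open>2 e |w|^2 \<le> (|w|^2 + e)^2\<close>. The bound does not depend on
  \<open>e\<close> and is integrable when the logarithmic derivatives are in L2, so it is the
  majorant that removes the defect in the limit.\<close>

lemma abs_reg_jac_le:
  assumes "e > 0" "w \<noteq> 0"
  shows "\<bar>reg_jac e w x y\<bar> \<le> norm (x / w) * norm (y / w)"
proof -
  have w: "(norm w)\<^sup>2 > 0" using assms by simp
  have "2 * e * (norm w)\<^sup>2 \<le> ((norm w)\<^sup>2 + e)\<^sup>2"
    using sum_squares_ge_zero[of "(norm w)\<^sup>2" e] by (simp add: power2_eq_square algebra_simps)
  moreover have "((norm w)\<^sup>2 + e)\<^sup>2 > 0" by (rule zero_less_power[OF add_pos_pos[OF w assms(1)]])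
  ultimately have k: "2 * e / ((norm w)\<^sup>2 + e)\<^sup>2 \<le> 1 / (norm w)\<^sup>2" using w by (simp add: divide_simps)
  have "\<bar>Im (cnj x * y)\<bar> \<le> norm x * norm y"
    using abs_Im_le_cmod[of "cnj x * y"] by (simp add: norm_mult del: complex_cnj_mult)
  then have "2 * e / ((norm w)\<^sup>2 + e)\<^sup>2 * \<bar>Im (cnj x * y)\<bar> \<le> 1 / (norm w)\<^sup>2 * (norm x * norm y)"
    using k assms by (intro mult_mono) auto
  moreover have "\<bar>reg_jac e w x y\<bar> = 2 * e / ((norm w)\<^sup>2 + e)\<^sup>2 * \<bar>Im (cnj x * y)\<bar>"
    using assms(1) by (simp add: reg_jac_def abs_mult del: times_complex.simps)
  ultimately show ?thesis by (simp add: norm_divide power2_eq_square)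
qed

lemma reg_jac_tendsto:
  assumes "w \<noteq> 0" shows "(\<lambda>n. reg_jac (1 / real (Suc n)) w x y) \<longlonglongrightarrow> 0"
proof -
  have l: "(\<lambda>n. inverse (real (Suc n))) \<longlonglongrightarrow> 0" by (rule LIMSEQ_inverse_real_of_nat)
  have "(\<lambda>n. 2 * inverse (real (Suc n)) * Im (cnj x * y) / ((norm w)\<^sup>2 + inverse (real (Suc n)))\<^sup>2)
     \<longlonglongrightarrow> 2 * 0 * Im (cnj x * y) / ((norm w)\<^sup>2 + 0)\<^sup>2"
    using assms by (intro tendsto_intros l) auto
  then show ?thesis by (simp add: reg_jac_def divide_inverse)
qed

section \<open>The logarithmic equation along one ray\<close>

lemma borel_measurable_ivl_continuous:
  fixes f :: "real \<Rightarrow> 'b::euclidean_space"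
  assumes "continuous_on {a..b} f" shows "f \<in> borel_measurable (ivl a b)"
  using integral_ivl_continuous(2)[OF assms] by (rule borel_measurable_integrable)

lemma ivl_restrict: "r \<le> b \<Longrightarrow> ivl a r = restrict_space (ivl a b) {a..r}"
  by (simp add: restrict_restrict_space Int_absorb1 Int_absorb2 subset_iff)

lemma integrable_ivl_mono:
  fixes f :: "real \<Rightarrow> 'b::{banach, second_countable_topology}"
  assumes "r \<le> b" "integrable (ivl a b) f" shows "integrable (ivl a r) f"
proof -
  have s: "{a..r} \<in> sets (ivl a b)" using assms(1) by (auto simp: sets_restrict_space_iff)
  have "integrable (ivl a b) (\<lambda>x. indicator {a..r} x *\<^sub>R f x)"
    using s assms(2) by (rule integrable_mult_indicator)
  then show ?thesis
    unfolding ivl_restrict[OF assms(1), of a] using s by (subst integrable_restrict_space) (auto simp: min_absorb1 assms(1))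
qed

lemma nn_integral_ivl_mono:
  assumes "r \<le> b" shows "(\<integral>\<^sup>+x. f x \<partial>ivl a r) \<le> (\<integral>\<^sup>+x. f x \<partial>ivl a b)"
proof -
  have s: "{a..r} \<in> sets (ivl a b)" using assms(1) by (auto simp: sets_restrict_space_iff)
  have "(\<integral>\<^sup>+x. f x \<partial>ivl a r) = (\<integral>\<^sup>+x. f x * indicator {a..r} x \<partial>ivl a b)"
    unfolding ivl_restrict[OF assms(1), of a] using s by (subst nn_integral_restrict_space) (auto simp: min_absorb1 assms(1))
  also have "\<dots> \<le> (\<integral>\<^sup>+x. f x \<partial>ivl a b)"
    by (intro nn_integral_mono) (auto simp: indicator_def)
  finally show ?thesis .
qed

lemma L1_tendsto_integral_norm:
  fixes u :: "nat \<Rightarrow> 'a \<Rightarrow> complex"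
  assumes u: "\<And>n. integrable M (u n)" "integrable M v"
    and l: "(\<lambda>n. \<integral>\<^sup>+x. ennreal (norm (u n x - v x)) \<partial>M) \<longlonglongrightarrow> 0"
  shows "(\<lambda>n. LINT x|M. norm (u n x)) \<longlonglongrightarrow> (LINT x|M. norm (v x))"
proof (rule tendsto_L1_int)
  show "(\<lambda>n. \<integral>\<^sup>+x. ennreal (norm (norm (u n x) - norm (v x))) \<partial>M) \<longlonglongrightarrow> 0"
  proof (rule tendsto_sandwich[OF _ _ tendsto_const l])
    show "\<forall>\<^sub>F n in sequentially. (\<integral>\<^sup>+x. ennreal (norm (norm (u n x) - norm (v x))) \<partial>M) \<le> (\<integral>\<^sup>+x. ennreal (norm (u n x - v x)) \<partial>M)"
      by (intro always_eventually allI nn_integral_mono ennreal_leI) (simp add: norm_triangle_ineq3)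
  qed simp
qed (use u in auto)

lemma one_minus_reg_inv_mult: "e > 0 \<Longrightarrow> 1 - reg_inv e w * w = of_real (e / ((norm w)\<^sup>2 + e))"
proof -
  assume e: "e > 0"
  have "reg_inv e w * w = (w * cnj w) / (w * cnj w + of_real e)" by (simp add: reg_inv_def)
  moreover have "1 - (w * cnj w) / (w * cnj w + of_real e) = of_real e / (w * cnj w + of_real e)"
    using reg_inv_denom_neq_0[OF e, of w] by (simp add: field_simps)
  ultimately have "1 - reg_inv e w * w = of_real e / (w * cnj w + of_real e)" by (simp only:)
  then show ?thesis unfolding reg_inv_denom by simp
qed

lemma norm_one_minus_reg_inv_mult: "e > 0 \<Longrightarrow> norm (1 - reg_inv e w * w) \<le> 1"
  using add_nonneg_pos[of "(norm w)\<^sup>2" e]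
  unfolding one_minus_reg_inv_mult norm_of_real by simp

text \<open>If \<open>f\<close> were \<open>1 / z\<close>, the product \<open>z exp (- P)\<close>,
  with \<open>P\<close> the primitive of \<open>f d\<close>, would be constant. In general its
  derivative is \<open>(1 - f z) d exp (- P)\<close>, so \<open>1 - f z\<close> measures the
  deviation. The resulting bound involves only integrals that are stable under convergence in
  L1.\<close>

lemma exp_integrating_factor_estimate:
  fixes z d f :: "real \<Rightarrow> complex"
  assumes z: "\<And>r. r \<in> {a..b} \<Longrightarrow> (z has_vector_derivative d r) (at r within {a..b})"
    and d: "continuous_on {a..b} d" and f: "continuous_on {a..b} f" and r: "r \<in> {a..b}"
  shows "norm (z r * exp (- (LINT x|ivl a r. f x * d x)) - z a)
     \<le> exp (LINT x|ivl a b. norm (f x * d x)) * (LINT x|ivl a b. norm ((1 - f x * z x) * d x))"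
proof -
  have cz: "continuous_on {a..b} z" using z by (intro continuous_on_vector_derivative)
  define P where "P r = integral {a..r} (\<lambda>x. f x * d x)" for r
  have cfd: "continuous_on {a..b} (\<lambda>x. f x * d x)" by (intro continuous_intros d f)
  have dP: "(P has_vector_derivative f x * d x) (at x within {a..b})" if "x \<in> {a..b}" for x
    unfolding P_def using integral_has_vector_derivative[OF cfd that] .
  define E where "E = integral {a..b} (\<lambda>x. norm (f x * d x))"
  have Pn: "norm (exp (- P x)) \<le> exp E" if x: "x \<in> {a..b}" for x
  proof -
    have sub: "{a..x} \<subseteq> {a..b}" using x by auto
    have "norm (P x) \<le> integral {a..x} (\<lambda>x. norm (f x * d x))"
      unfolding P_def
      by (intro integral_norm_bound_integral integrable_continuous_real continuous_intros
          continuous_on_subset[OF d sub] continuous_on_subset[OF f sub]) auto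
    also have "\<dots> \<le> E"
      unfolding E_def
      by (intro integral_subset_le integrable_continuous_real continuous_intros sub d f
          continuous_on_subset[OF d sub] continuous_on_subset[OF f sub]) auto
    finally have "norm (P x) \<le> E" .
    then have "Re (- P x) \<le> E" using abs_Re_le_cmod[of "P x"] by simp
    then show ?thesis by simp
  qed
  define h where "h x = z x * exp (- P x)" for x
  have dh: "(h has_vector_derivative (1 - f x * z x) * d x * exp (- P x)) (at x within {a..b})" if x: "x \<in> {a..b}" for x
  proof -
    have "((\<lambda>x. exp (- P x)) has_vector_derivative (- (f x * d x)) * exp (- P x)) (at x within {a..b})"
      using field_vector_diff_chain_within[OF has_vector_derivative_minus[OF dP[OF x]] has_field_derivative_at_within[OF DERIV_exp]]
      by (simp add: o_def)
    from has_vector_derivative_mult[OF z[OF x] this] show ?thesis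
      unfolding h_def by (simp add: algebra_simps)
  qed
  have sub: "{a..r} \<subseteq> {a..b}" using r by auto
  have cP: "continuous_on {a..b} P" using dP by (intro continuous_on_vector_derivative)
  have cg: "continuous_on {a..b} (\<lambda>x. (1 - f x * z x) * d x * exp (- P x))"
    by (intro continuous_intros f cz d cP)
  have cg': "continuous_on {a..b} (\<lambda>x. (1 - f x * z x) * d x)"
    by (intro continuous_intros f cz d)
  have "((\<lambda>x. (1 - f x * z x) * d x * exp (- P x)) has_integral (h r - h a)) {a..r}"
    using r by (intro fundamental_theorem_of_calculus has_vector_derivative_within_subset[OF dh sub]) auto
  then have "norm (h r - h a) = norm (integral {a..r} (\<lambda>x. (1 - f x * z x) * d x * exp (- P x)))"
    by (simp add: integral_unique)
  also have "\<dots> \<le> integral {a..r} (\<lambda>x. exp E * norm ((1 - f x * z x) * d x))"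
  proof (rule integral_norm_bound_integral)
    show "(\<lambda>x. (1 - f x * z x) * d x * exp (- P x)) integrable_on {a..r}"
      by (rule integrable_continuous_real[OF continuous_on_subset[OF cg sub]])
    show "(\<lambda>x. exp E * norm ((1 - f x * z x) * d x)) integrable_on {a..r}"
      by (intro integrable_continuous_real continuous_intros continuous_on_subset[OF f sub] continuous_on_subset[OF cz sub] continuous_on_subset[OF d sub])
    fix x assume "x \<in> {a..r}"
    then show "norm ((1 - f x * z x) * d x * exp (- P x)) \<le> exp E * norm ((1 - f x * z x) * d x)"
      using Pn[of x] sub mult_left_mono[of "norm (exp (- P x))" "exp E" "norm ((1 - f x * z x) * d x)"]
      by (auto simp: norm_mult mult.commute simp del: norm_exp_eq_Re)
  qed
  also have "\<dots> \<le> integral {a..b} (\<lambda>x. exp E * norm ((1 - f x * z x) * d x))"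
    by (intro integral_subset_le sub integrable_continuous_real continuous_intros f cz d continuous_on_subset[OF f sub] continuous_on_subset[OF cz sub] continuous_on_subset[OF d sub]) auto
  also have "\<dots> = exp E * integral {a..b} (\<lambda>x. norm ((1 - f x * z x) * d x))" by simp
  finally have "norm (h r - h a) \<le> exp E * integral {a..b} (\<lambda>x. norm ((1 - f x * z x) * d x))" .
  moreover have "P r = (LINT x|ivl a r. f x * d x)"
    unfolding P_def by (rule integral_ivl_continuous(1)[OF continuous_on_subset[OF cfd sub], symmetric])
  moreover have "P a = 0" by (simp add: P_def)
  moreover have "E = (LINT x|ivl a b. norm (f x * d x))"
    unfolding E_def by (rule integral_ivl_continuous(1)[symmetric]) (intro continuous_intros f d)
  moreover have "integral {a..b} (\<lambda>x. norm ((1 - f x * z x) * d x)) = (LINT x|ivl a b. norm ((1 - f x * z x) * d x))"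
    by (rule integral_ivl_continuous(1)[symmetric]) (intro continuous_on_norm cg')
  ultimately show ?thesis by (simp add: h_def)
qed

text \<open>The limit curve \<open>y\<close> solves \<open>y' = (v' / v) y\<close> in integrated form. Since \<open>1 / v\<close> may be unbounded,
  the integrating factor is built from \<^const>\<open>reg_inv\<close>.\<close>

lemma ray_limit:
  fixes z d :: "nat \<Rightarrow> real \<Rightarrow> complex"
  assumes z: "\<And>n r. r \<in> {a..b} \<Longrightarrow> (z n has_vector_derivative d n r) (at r within {a..b})"
    and d: "\<And>n. continuous_on {a..b} (d n)" and z0: "\<And>n. z n a = z0"
    and v[measurable]: "v \<in> borel_measurable (ivl a b)" and v': "integrable (ivl a b) v'"
    and zl: "AE x in ivl a b. (\<lambda>n. z n x) \<longlonglongrightarrow> v x"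
    and dl: "(\<lambda>n. \<integral>\<^sup>+x. ennreal (norm (d n x - v' x)) \<partial>ivl a b) \<longlonglongrightarrow> 0"
    and nz: "AE x in ivl a b. v x \<noteq> 0" and ip: "integrable (ivl a b) (\<lambda>x. v' x / v x)" and r: "r \<in> {a..b}"
  shows "(\<lambda>n. z n r) \<longlonglongrightarrow> z0 * exp (LINT x|ivl a r. v' x / v x)"
proof -
  have rb: "r \<le> b" using r by auto
  have [measurable]: "v' \<in> borel_measurable (ivl a b)" using v' by auto
  have cz: "continuous_on {a..b} (z n)" for n using z by (intro continuous_on_vector_derivative)
  have [measurable]: "z n \<in> borel_measurable (ivl a b)" "d n \<in> borel_measurable (ivl a b)" for n
    by (intro borel_measurable_ivl_continuous cz d)+
  have sub: "{a..r} \<subseteq> {a..b}" using r by auto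
  have int_r: "(\<lambda>n. LINT x|ivl a r. u n x) \<longlonglongrightarrow> (LINT x|ivl a r. w x)"
    if "\<And>n. integrable (ivl a b) (u n)" "integrable (ivl a b) w"
      "(\<lambda>n. \<integral>\<^sup>+x. ennreal (norm (u n x - w x)) \<partial>ivl a b) \<longlonglongrightarrow> 0" for u :: "nat \<Rightarrow> real \<Rightarrow> complex" and w
  proof (rule tendsto_L1_int)
    show "(\<lambda>n. \<integral>\<^sup>+x. ennreal (norm (u n x - w x)) \<partial>ivl a r) \<longlonglongrightarrow> 0"
      by (rule tendsto_sandwich[OF _ _ tendsto_const that(3)])
        (auto intro!: always_eventually nn_integral_ivl_mono[OF rb])
  qed (use that integrable_ivl_mono[OF rb] in auto)
  \<comment> \<open>The limit of \<open>z n r\<close> exists already by integrating the derivatives.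
    What remains is to identify it, that is, to show that \<open>y\<close> times the exponential of
    minus the integral of \<open>v' / v\<close> equals \<open>z0\<close>.\<close>
  define y where "y = z0 + (LINT x|ivl a r. v' x)"
  have zy: "(\<lambda>n. z n r) \<longlonglongrightarrow> y"
  proof -
    have "z n r = z0 + (LINT x|ivl a r. d n x)" for n
    proof -
      have "(d n has_integral (z n r - z n a)) {a..r}"
        using r by (intro fundamental_theorem_of_calculus has_vector_derivative_within_subset[OF z sub]) auto
      then show ?thesis
        using integral_ivl_continuous(1)[OF continuous_on_subset[OF d sub], of n] z0[of n] by (simp add: integral_unique)
    qed
    moreover have "(\<lambda>n. z0 + (LINT x|ivl a r. d n x)) \<longlonglongrightarrow> y"
      unfolding y_def by (intro tendsto_intros int_r integral_ivl_continuous(2) d v' dl)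
    ultimately show ?thesis by simp
  qed
  define p where "p x = v' x / v x" for x
  define C where "C = (LINT x|ivl a b. norm (p x))"
  have ip': "integrable (ivl a b) p" using ip by (simp add: p_def[abs_def])
  \<comment> \<open>Two limits in succession. At fixed \<open>e\<close> the coefficients are bounded
    and continuous, so \<open>n\<close> can go to infinity in the estimate; the exponent is then
    replaced by \<open>C\<close>, which is free of \<open>e\<close>, so that \<open>e\<close> can
    tend to 0 afterwards.\<close>
  have est: "norm (y * exp (- (LINT x|ivl a r. reg_inv e (v x) * v' x)) - z0) \<le> exp C * (LINT x|ivl a b. norm ((1 - reg_inv e (v x) * v x) * v' x))"
    if e: "e > 0" for e
  proof -
    have [measurable]: "reg_inv e \<in> borel_measurable borel"
      by (intro borel_measurable_continuous_onI continuous_on_reg_inv[OF e])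
    have ci: "isCont (reg_inv e) w" for w
      using continuous_on_reg_inv[OF e, of UNIV] by (simp add: continuous_on_eq_continuous_at)
    have cf: "continuous_on {a..b} (\<lambda>x. reg_inv e (z n x))" for n
      by (rule continuous_on_compose2[OF continuous_on_reg_inv[OF e, of UNIV] cz]) simp
    have L1: "(\<lambda>n. \<integral>\<^sup>+x. ennreal (norm (reg_inv e (z n x) * d n x - reg_inv e (v x) * v' x)) \<partial>ivl a b) \<longlonglongrightarrow> 0"
    proof (rule L1_tendsto_mult_bounded[OF _ _ _ v' norm_reg_inv_le[OF e] norm_reg_inv_le[OF e] _ _ dl])
      show "AE x in ivl a b. (\<lambda>n. reg_inv e (z n x)) \<longlonglongrightarrow> reg_inv e (v x)"
        using zl by eventually_elim (rule isCont_tendsto_compose[OF ci])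
      show "0 \<le> 1 / sqrt e" using e by simp
    qed measurable
    have L2: "(\<lambda>n. \<integral>\<^sup>+x. ennreal (norm ((1 - reg_inv e (z n x) * z n x) * d n x - (1 - reg_inv e (v x) * v x) * v' x)) \<partial>ivl a b) \<longlonglongrightarrow> 0"
    proof (rule L1_tendsto_mult_bounded[OF _ _ _ v' norm_one_minus_reg_inv_mult[OF e] norm_one_minus_reg_inv_mult[OF e] _ _ dl])
      show "AE x in ivl a b. (\<lambda>n. 1 - reg_inv e (z n x) * z n x) \<longlonglongrightarrow> 1 - reg_inv e (v x) * v x"
        using zl by eventually_elim (intro tendsto_intros isCont_tendsto_compose[OF ci])
      show "(0::real) \<le> 1" by simp
    qed measurable
    have i1: "integrable (ivl a b) (\<lambda>x. reg_inv e (z n x) * d n x)" for n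
      by (intro integral_ivl_continuous(2) continuous_intros cf d)
    have i2: "integrable (ivl a b) (\<lambda>x. (1 - reg_inv e (z n x) * z n x) * d n x)" for n
      by (intro integral_ivl_continuous(2) continuous_intros cf d cz)
    have i3: "integrable (ivl a b) (\<lambda>x. reg_inv e (v x) * v' x)"
    proof (rule Bochner_Integration.integrable_bound[OF integrable_mult_right[OF v', of "of_real (1 / sqrt e)"]])
      show "AE x in ivl a b. norm (reg_inv e (v x) * v' x) \<le> norm (complex_of_real (1 / sqrt e) * v' x)"
        using norm_reg_inv_le[OF e] e unfolding norm_mult norm_of_real by (intro AE_I2 mult_right_mono) auto
    qed measurable
    have i4: "integrable (ivl a b) (\<lambda>x. (1 - reg_inv e (v x) * v x) * v' x)"
    proof (rule Bochner_Integration.integrable_bound[OF v'])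
      show "AE x in ivl a b. norm ((1 - reg_inv e (v x) * v x) * v' x) \<le> norm (v' x)"
        using norm_one_minus_reg_inv_mult[OF e] unfolding norm_mult by (intro AE_I2 mult_left_le_one_le) auto
    qed measurable
    have "norm (y * exp (- (LINT x|ivl a r. reg_inv e (v x) * v' x)) - z0)
        \<le> exp (LINT x|ivl a b. norm (reg_inv e (v x) * v' x)) * (LINT x|ivl a b. norm ((1 - reg_inv e (v x) * v x) * v' x))"
    proof (rule LIMSEQ_le)
      show "(\<lambda>n. norm (z n r * exp (- (LINT x|ivl a r. reg_inv e (z n x) * d n x)) - z0)) \<longlonglongrightarrow> norm (y * exp (- (LINT x|ivl a r. reg_inv e (v x) * v' x)) - z0)"
        by (intro tendsto_intros zy int_r i1 i3 L1)
      show "(\<lambda>n. exp (LINT x|ivl a b. norm (reg_inv e (z n x) * d n x)) * (LINT x|ivl a b. norm ((1 - reg_inv e (z n x) * z n x) * d n x)))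
         \<longlonglongrightarrow> exp (LINT x|ivl a b. norm (reg_inv e (v x) * v' x)) * (LINT x|ivl a b. norm ((1 - reg_inv e (v x) * v x) * v' x))"
        by (intro tendsto_intros L1_tendsto_integral_norm i1 i2 i3 i4 L1 L2)
      show "\<exists>N. \<forall>n\<ge>N. norm (z n r * exp (- (LINT x|ivl a r. reg_inv e (z n x) * d n x)) - z0)
          \<le> exp (LINT x|ivl a b. norm (reg_inv e (z n x) * d n x)) * (LINT x|ivl a b. norm ((1 - reg_inv e (z n x) * z n x) * d n x))"
        using exp_integrating_factor_estimate[OF z d cf r] z0 by auto
    qed
    also have "\<dots> \<le> exp C * (LINT x|ivl a b. norm ((1 - reg_inv e (v x) * v x) * v' x))"
    proof (intro mult_right_mono)
      have "(LINT x|ivl a b. norm (reg_inv e (v x) * v' x)) \<le> C"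
        unfolding C_def
      proof (rule integral_mono_AE)
        show "AE x in ivl a b. norm (reg_inv e (v x) * v' x) \<le> norm (p x)"
          using nz
        proof eventually_elim
          fix x assume "v x \<noteq> 0"
          then show "norm (reg_inv e (v x) * v' x) \<le> norm (p x)"
            using mult_right_mono[OF norm_reg_inv_le_inverse[OF e, of "v x"], of "norm (v' x)"]
            by (simp add: p_def norm_mult norm_divide)
        qed
      qed (use i3 ip' in auto)
      then show "exp (LINT x|ivl a b. norm (reg_inv e (v x) * v' x)) \<le> exp C" by simp
    qed simp
    finally show ?thesis .
  qed
  let ?e = "\<lambda>k. 1 / real (Suc k)"
  have e0: "?e k > 0" for k by simp
  have rm: "reg_inv (?e k) \<in> borel_measurable borel" for k
    by (intro borel_measurable_continuous_onI continuous_on_reg_inv e0)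
  note rm[measurable]
  have "norm (y * exp (- (LINT x|ivl a r. p x)) - z0) \<le> exp C * 0"
  proof (rule LIMSEQ_le)
    have "(\<lambda>k. LINT x|ivl a r. reg_inv (?e k) (v x) * v' x) \<longlonglongrightarrow> (LINT x|ivl a r. p x)"
    proof (rule integral_dominated_convergence[where w="\<lambda>x. norm (p x)"])
      have mr: "f \<in> borel_measurable (ivl a r)" if "f \<in> borel_measurable (ivl a b)" for f :: "real \<Rightarrow> complex"
        using that unfolding ivl_restrict[OF rb, of a] by (rule measurable_restrict_space1)
      show "p \<in> borel_measurable (ivl a r)" using ip' by (intro mr) auto
      show "(\<lambda>x. reg_inv (?e k) (v x) * v' x) \<in> borel_measurable (ivl a r)" for k
        by (intro mr borel_measurable_times measurable_compose[OF v rm]) measurable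
      show "integrable (ivl a r) (\<lambda>x. norm (p x))"
        using integrable_ivl_mono[OF rb ip'] by auto
      have AEr: "AE x in ivl a r. v x \<noteq> 0"
        using nz unfolding AE_restrict_space_iff[of "{a..r}" lborel, simplified] AE_restrict_space_iff[of "{a..b}" lborel, simplified]
        by eventually_elim (use rb in auto)
      show "AE x in ivl a r. (\<lambda>k. reg_inv (?e k) (v x) * v' x) \<longlonglongrightarrow> p x"
        using AEr
      proof eventually_elim
        fix x assume "v x \<noteq> 0"
        then have "(\<lambda>k. reg_inv (?e k) (v x) * v' x) \<longlonglongrightarrow> 1 / v x * v' x"
          by (intro tendsto_mult reg_inv_tendsto tendsto_const)
        then show "(\<lambda>k. reg_inv (?e k) (v x) * v' x) \<longlonglongrightarrow> p x" by (simp add: p_def)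
      qed
      show "AE x in ivl a r. norm (reg_inv (?e k) (v x) * v' x) \<le> norm (p x)" for k
        using AEr
      proof eventually_elim
        fix x assume "v x \<noteq> 0"
        then show "norm (reg_inv (?e k) (v x) * v' x) \<le> norm (p x)"
          using mult_right_mono[OF norm_reg_inv_le_inverse[OF e0, of "v x"], of "norm (v' x)"]
          by (simp add: p_def norm_mult norm_divide del: of_nat_Suc)
      qed
    qed
    then show "(\<lambda>k. norm (y * exp (- (LINT x|ivl a r. reg_inv (?e k) (v x) * v' x)) - z0)) \<longlonglongrightarrow> norm (y * exp (- (LINT x|ivl a r. p x)) - z0)"
      by (intro tendsto_intros)
    have "(\<lambda>k. LINT x|ivl a b. norm ((1 - reg_inv (?e k) (v x) * v x) * v' x)) \<longlonglongrightarrow> (LINT x|ivl a b. 0)"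
    proof (rule integral_dominated_convergence[where w="\<lambda>x. norm (v' x)"])
      show "(\<lambda>x. norm ((1 - reg_inv (?e k) (v x) * v x) * v' x)) \<in> borel_measurable (ivl a b)" for k
        by measurable
      show "AE x in ivl a b. (\<lambda>k. norm ((1 - reg_inv (?e k) (v x) * v x) * v' x)) \<longlonglongrightarrow> 0"
        using nz
      proof eventually_elim
        fix x assume "v x \<noteq> 0"
        then have "(\<lambda>k. norm ((1 - reg_inv (?e k) (v x) * v x) * v' x)) \<longlonglongrightarrow> norm ((1 - 1 / v x * v x) * v' x)"
          by (intro tendsto_intros reg_inv_tendsto)
        then show "(\<lambda>k. norm ((1 - reg_inv (?e k) (v x) * v x) * v' x)) \<longlonglongrightarrow> 0" using \<open>v x \<noteq> 0\<close> by simp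
      qed
      show "AE x in ivl a b. norm (norm ((1 - reg_inv (?e k) (v x) * v x) * v' x)) \<le> norm (v' x)" for k
        using norm_one_minus_reg_inv_mult[OF e0, of k] by (intro AE_I2) (simp add: norm_mult mult_left_le_one_le)
    qed (use v' in auto)
    then show "(\<lambda>k. exp C * (LINT x|ivl a b. norm ((1 - reg_inv (?e k) (v x) * v x) * v' x))) \<longlonglongrightarrow> exp C * 0"
      by (intro tendsto_intros) simp
    show "\<exists>N. \<forall>n\<ge>N. norm (y * exp (- (LINT x|ivl a r. reg_inv (?e n) (v x) * v' x)) - z0) \<le> exp C * (LINT x|ivl a b. norm ((1 - reg_inv (?e n) (v x) * v x) * v' x))"
      using est[OF e0] by blast
  qed
  then have "y * exp (- (LINT x|ivl a r. p x)) = z0" by simp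
  then have "y = z0 * exp (LINT x|ivl a r. p x)" by (auto simp: exp_minus field_simps)
  with zy show ?thesis by (simp add: p_def)
qed

section \<open>The logarithmic derivative of an approximable map\<close>

lemma strict_mono_nn_tendsto: "(u::nat\<Rightarrow>ennreal) \<longlonglongrightarrow> 0 \<Longrightarrow> strict_mono s \<Longrightarrow> (\<lambda>n. u (s n)) \<longlonglongrightarrow> 0"
  using LIMSEQ_subseq_LIMSEQ[of u 0 s] by (simp add: o_def)

text \<open>Points of the rectangle are pairs of an angle and a radius.\<close>

locale polar_approximation =
  fixes a b :: real and V Vr Vt :: "real \<times> real \<Rightarrow> complex"
    and Z Zr Zt :: "nat \<Rightarrow> real \<Rightarrow> real \<Rightarrow> complex"
  assumes a: "0 < a" and ab: "a < b"
    and C1: "C1_polar a b (Z n) (Zr n) (Zt n)"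
    and periodic: "r \<in> {a..b} \<Longrightarrow> Z n r 0 = Z n r (2*pi)" "r \<in> {a..b} \<Longrightarrow> Zr n r 0 = Zr n r (2*pi)"
    and bdry: "t \<in> {0..2*pi} \<Longrightarrow> Z n a t = of_real a * cis t" "t \<in> {0..2*pi} \<Longrightarrow> Z n b t = of_real b * cis t"
    and meas [measurable]: "V \<in> borel_measurable (polar_rect a b)" "Vr \<in> borel_measurable (polar_rect a b)" "Vt \<in> borel_measurable (polar_rect a b)"
    and L2: "(\<integral>\<^sup>+p. ennreal ((norm (Vr p))\<^sup>2) \<partial>polar_rect a b) < \<infinity>" "(\<integral>\<^sup>+p. ennreal ((norm (Vt p))\<^sup>2) \<partial>polar_rect a b) < \<infinity>"
    and lim: "(\<lambda>n. \<integral>\<^sup>+p. ennreal ((norm (Z n (snd p) (fst p) - V p))\<^sup>2) \<partial>polar_rect a b) \<longlonglongrightarrow> 0"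
    and limr: "(\<lambda>n. \<integral>\<^sup>+p. ennreal ((norm (Zr n (snd p) (fst p) - Vr p))\<^sup>2) \<partial>polar_rect a b) \<longlonglongrightarrow> 0"
    and limt: "(\<lambda>n. \<integral>\<^sup>+p. ennreal ((norm (Zt n (snd p) (fst p) - Vt p))\<^sup>2) \<partial>polar_rect a b) \<longlonglongrightarrow> 0"
    and nz: "AE p in polar_rect a b. V p \<noteq> 0"
    and logL2: "integrable (polar_rect a b) (\<lambda>p. (norm (Vr p / V p))\<^sup>2)" "integrable (polar_rect a b) (\<lambda>p. (norm (Vt p / V p))\<^sup>2)"
begin

abbreviation "R \<equiv> polar_rect a b"

lemma space_R: "space R = {0..2*pi} \<times> {a..b}" by (simp add: space_pair_measure)

lemma finR: "finite_measure R" by (rule finite_measure_pair_ivl)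

lemma Z_cont: "continuous_on ({a..b} \<times> {0..2*pi}) (\<lambda>(r,t). Z n r t)"
    "continuous_on ({a..b} \<times> {0..2*pi}) (\<lambda>(r,t). Zr n r t)"
    "continuous_on ({a..b} \<times> {0..2*pi}) (\<lambda>(r,t). Zt n r t)"
  using C1[of n] unfolding C1_polar_def by auto

lemma Z_meas [measurable]: "(\<lambda>p. Z n (snd p) (fst p)) \<in> borel_measurable R"
    "(\<lambda>p. Zr n (snd p) (fst p)) \<in> borel_measurable R" "(\<lambda>p. Zt n (snd p) (fst p)) \<in> borel_measurable R"
  using Z_cont[THEN borel_measurable_polar_rect_continuous, of n] by (simp_all add: case_prod_beta)

lemma sq_imp_integrable:
  assumes [measurable]: "f \<in> borel_measurable R" and i: "integrable R (\<lambda>p. (norm (f p :: complex))\<^sup>2)"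
  shows "integrable R f"
  using square_integrable_imp_integrable[OF finR, of f] assms by (simp add: square_integrable_def)

lemma log_integrable: "integrable R (\<lambda>p. Vr p / V p)" "integrable R (\<lambda>p. Vt p / V p)"
  by (rule sq_imp_integrable; use logL2 in measurable)+

lemma V_integrable: "integrable R Vr" "integrable R Vt"
  by (rule sq_imp_integrable, measurable, rule integrableI_bounded, measurable, use L2 in simp)+

lemma L1_lim: "(\<lambda>n. \<integral>\<^sup>+p. ennreal (norm (Zr n (snd p) (fst p) - Vr p)) \<partial>R) \<longlonglongrightarrow> 0"
    "(\<lambda>n. \<integral>\<^sup>+p. ennreal (norm (Zt n (snd p) (fst p) - Vt p)) \<partial>R) \<longlonglongrightarrow> 0"
    "(\<lambda>n. \<integral>\<^sup>+p. ennreal (norm (Z n (snd p) (fst p) - V p)) \<partial>R) \<longlonglongrightarrow> 0"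
  by (rule nn_integral_norm_tendsto_0_of_L2[OF finR _ limr], measurable)
     (rule nn_integral_norm_tendsto_0_of_L2[OF finR _ limt], measurable,
      rule nn_integral_norm_tendsto_0_of_L2[OF finR _ lim], measurable)

lemma nn_to_LINT:
  fixes f :: "nat \<Rightarrow> 'c \<Rightarrow> real"
  assumes "\<And>n. integrable M (f n)" "\<And>n x. 0 \<le> f n x" "(\<lambda>n. \<integral>\<^sup>+x. ennreal (f n x) \<partial>M) \<longlonglongrightarrow> 0"
  shows "(\<lambda>n. LINT x|M. f n x) \<longlonglongrightarrow> 0"
proof -
  have "(\<lambda>n. ennreal (LINT x|M. f n x)) \<longlonglongrightarrow> ennreal 0"
    using assms by (simp add: nn_integral_eq_integral)
  then show ?thesis
    by (subst (asm) tendsto_ennreal_iff) (auto intro!: always_eventually Bochner_Integration.integral_nonneg assms(2))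
qed

lemma Z_integrable: "integrable R (\<lambda>p. Z n (snd p) (fst p))" "integrable R (\<lambda>p. Zr n (snd p) (fst p))" "integrable R (\<lambda>p. Zt n (snd p) (fst p))"
proof -
  have i: "integrable R (\<lambda>p. f (snd p) (fst p))" if f: "continuous_on ({a..b} \<times> {0..2*pi}) (\<lambda>(r,t). f r t)" for f :: "real \<Rightarrow> real \<Rightarrow> complex"
  proof -
    obtain B where "\<And>r t. r \<in> {a..b} \<Longrightarrow> t \<in> {0..2*pi} \<Longrightarrow> norm (f r t) \<le> B"
      using bounded_polar_rect_continuous[OF f] by blast
    then show ?thesis
      using borel_measurable_polar_rect_continuous[OF f]
      by (intro integrable_polar_rect_bounded[where B=B]) (auto simp: case_prod_beta)
  qed
  show "integrable R (\<lambda>p. Z n (snd p) (fst p))" "integrable R (\<lambda>p. Zr n (snd p) (fst p))" "integrable R (\<lambda>p. Zt n (snd p) (fst p))"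
    by (intro i Z_cont)+
qed

text \<open>One subsequence serves both the pointwise convergence and the convergence along almost every ray.\<close>

lemma subsequence:
  obtains s :: "nat \<Rightarrow> nat" where "strict_mono s"
    and "AE p in R. (\<lambda>n. Z (s n) (snd p) (fst p)) \<longlonglongrightarrow> V p"
    and "AE t in ivl 0 (2*pi). (\<lambda>n. \<integral>\<^sup>+r. ennreal (norm (Zr (s n) r t - Vr (t,r))) \<partial>ivl a b) \<longlonglongrightarrow> 0"
proof -
  \<comment> \<open>Integrability of \<open>V\<close> itself is obtained here: a single approximant,
    bounded on the rectangle, lies at finite L1 distance from \<open>V\<close>.\<close>
  obtain N where N: "(\<integral>\<^sup>+p. ennreal (norm (Z N (snd p) (fst p) - V p)) \<partial>R) < 1"
    using order_tendstoD(2)[OF L1_lim(3), of 1] by (auto simp: eventually_sequentially)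
  have "integrable R (\<lambda>p. Z N (snd p) (fst p) - V p)"
    by (rule integrableI_bounded) (use N in \<open>auto intro: less_trans simp: less_top[symmetric]\<close>)
  then have VI: "integrable R V"
    using Bochner_Integration.integrable_diff[OF Z_integrable(1)[of N]] by fastforce
  have i1: "integrable R (\<lambda>p. Z n (snd p) (fst p) - V p)" for n by (intro Bochner_Integration.integrable_diff Z_integrable VI)
  have i2: "integrable R (\<lambda>p. Zr n (snd p) (fst p) - Vr p)" for n by (intro Bochner_Integration.integrable_diff Z_integrable V_integrable)
  have "(\<lambda>n. LINT p|R. norm (Z n (snd p) (fst p) - V p)) \<longlonglongrightarrow> 0"
    using i1 by (intro nn_to_LINT L1_lim) auto
  from tendsto_L1_AE_subseq[OF i1 this] obtain s1 where s1: "strict_mono s1"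
    "AE p in R. (\<lambda>n. Z (s1 n) (snd p) (fst p) - V p) \<longlonglongrightarrow> 0" by blast
  \<comment> \<open>By Fubini the integral of \<open>?f n\<close> over the angle is the L1 distance
    of the radial derivatives on the rectangle. A second extraction therefore makes
    \<open>?f\<close> tend to 0 for almost every angle.\<close>
  let ?f = "\<lambda>n t. LINT r|ivl a b. norm (Zr (s1 n) r t - Vr (t,r))"
  have i3: "integrable (ivl 0 (2*pi)) (?f n)" for n
    using ivl_pair.integrable_fst'[OF integrable_norm[OF i2[of "s1 n"]]] by simp
  have "(LINT t|ivl 0 (2*pi). norm (?f n t)) = (LINT p|R. norm (Zr (s1 n) (snd p) (fst p) - Vr p))" for n
  proof -
    have "norm (?f n t) = ?f n t" for t by (simp add: Bochner_Integration.integral_nonneg)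
    then show ?thesis using ivl_pair.integral_fst'[OF integrable_norm[OF i2[of "s1 n"]]] by simp
  qed
  moreover have "(\<lambda>n. LINT p|R. norm (Zr (s1 n) (snd p) (fst p) - Vr p)) \<longlonglongrightarrow> 0"
    using i2 by (intro nn_to_LINT strict_mono_nn_tendsto[OF L1_lim(1) s1(1)]) auto
  ultimately have "(\<lambda>n. LINT t|ivl 0 (2*pi). norm (?f n t)) \<longlonglongrightarrow> 0" by simp
  from tendsto_L1_AE_subseq[OF i3 this] obtain s2 where s2: "strict_mono s2"
    "AE t in ivl 0 (2*pi). (\<lambda>n. ?f (s2 n) t) \<longlonglongrightarrow> 0" by blast
  show thesis
  proof (rule that[of "s1 \<circ> s2"])
    show "strict_mono (s1 \<circ> s2)" using s1(1) s2(1) by (rule strict_mono_o)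
    show "AE p in R. (\<lambda>n. Z ((s1 \<circ> s2) n) (snd p) (fst p)) \<longlonglongrightarrow> V p"
      using s1(2)
    proof eventually_elim
      fix p assume "(\<lambda>n. Z (s1 n) (snd p) (fst p) - V p) \<longlonglongrightarrow> 0"
      then have "(\<lambda>n. Z (s1 n) (snd p) (fst p)) \<longlonglongrightarrow> V p" by (simp add: LIM_zero_iff)
      from LIMSEQ_subseq_LIMSEQ[OF this s2(1)] show "(\<lambda>n. Z ((s1 \<circ> s2) n) (snd p) (fst p)) \<longlonglongrightarrow> V p" by (simp add: o_def)
    qed
    have "AE t in ivl 0 (2*pi). \<forall>n. integrable (ivl a b) (\<lambda>r. norm (Zr (s1 n) r t - Vr (t,r)))"
      unfolding AE_all_countable
    proof
      fix n show "AE t in ivl 0 (2*pi). integrable (ivl a b) (\<lambda>r. norm (Zr (s1 n) r t - Vr (t,r)))"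
        using ivl_pair.AE_integrable_fst'[OF integrable_norm[OF i2[of "s1 n"]]] by simp
    qed
    with s2(2) show "AE t in ivl 0 (2*pi). (\<lambda>n. \<integral>\<^sup>+r. ennreal (norm (Zr ((s1 \<circ> s2) n) r t - Vr (t,r))) \<partial>ivl a b) \<longlonglongrightarrow> 0"
    proof eventually_elim
      fix t assume l: "(\<lambda>n. ?f (s2 n) t) \<longlonglongrightarrow> 0" and i: "\<forall>n. integrable (ivl a b) (\<lambda>r. norm (Zr (s1 n) r t - Vr (t,r)))"
      have "(\<integral>\<^sup>+r. ennreal (norm (Zr (s1 n) r t - Vr (t,r))) \<partial>ivl a b) = ennreal (?f n t)" for n
        using i by (intro nn_integral_eq_integral) auto
      then show "(\<lambda>n. \<integral>\<^sup>+r. ennreal (norm (Zr ((s1 \<circ> s2) n) r t - Vr (t,r))) \<partial>ivl a b) \<longlonglongrightarrow> 0"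
        using tendsto_ennrealI[OF l] by (simp add: o_def)
    qed
  qed
qed

text \<open>Collects what \<open>ray_limit\<close> asks of a single ray, and the square
  integrability on which the later separation estimate rests. Fubini makes almost every angle
  good.\<close>

definition good :: "(nat \<Rightarrow> nat) \<Rightarrow> real \<Rightarrow> bool" where
  "good s t \<longleftrightarrow> t \<in> {0..2*pi} \<and> (\<lambda>r. V (t,r)) \<in> borel_measurable (ivl a b) \<and> integrable (ivl a b) (\<lambda>r. Vr (t,r)) \<and>
     (AE r in ivl a b. (\<lambda>n. Z (s n) r t) \<longlonglongrightarrow> V (t,r)) \<and>
     (\<lambda>n. \<integral>\<^sup>+r. ennreal (norm (Zr (s n) r t - Vr (t,r))) \<partial>ivl a b) \<longlonglongrightarrow> 0 \<and>
     (AE r in ivl a b. V (t,r) \<noteq> 0) \<and> integrable (ivl a b) (\<lambda>r. Vr (t,r) / V (t,r)) \<and>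
     integrable (ivl a b) (\<lambda>r. (norm (Vr (t,r) / V (t,r)))\<^sup>2)"

lemma AE_good:
  assumes "AE p in R. (\<lambda>n. Z (s n) (snd p) (fst p)) \<longlonglongrightarrow> V p"
    and "AE t in ivl 0 (2*pi). (\<lambda>n. \<integral>\<^sup>+r. ennreal (norm (Zr (s n) r t - Vr (t,r))) \<partial>ivl a b) \<longlonglongrightarrow> 0"
  shows "AE t in ivl 0 (2*pi). good s t"
proof -
  have 1: "AE t in ivl 0 (2*pi). AE r in ivl a b. (\<lambda>n. Z (s n) r t) \<longlonglongrightarrow> V (t,r)"
    using ivl_pair.AE_pair[OF assms(1)] by simp
  have 2: "AE t in ivl 0 (2*pi). AE r in ivl a b. V (t,r) \<noteq> 0"
    using ivl_pair.AE_pair[OF nz] by simp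
  note 3 = ivl_pair.AE_integrable_fst'[OF V_integrable(1)] ivl_pair.AE_integrable_fst'[OF log_integrable(1)]
    ivl_pair.AE_integrable_fst'[OF logL2(1)]
  have 4: "AE t in ivl 0 (2*pi). (\<lambda>r. V (t,r)) \<in> borel_measurable (ivl a b)"
    by (intro AE_I2) (rule measurable_compose[OF measurable_Pair1' meas(1)])
  show ?thesis
    using 1 2 3 4 assms(2) AE_space
    by eventually_elim (simp add: good_def)
qed

definition ray_integral :: "real \<Rightarrow> complex" where
  "ray_integral t = (LINT r|ivl a b. Vr (t,r) / V (t,r))"

lemma good_ray:
  assumes "good s t" "r \<in> {a..b}"
  shows "(\<lambda>n. Z (s n) r t) \<longlonglongrightarrow> of_real a * cis t * exp (LINT x|ivl a r. Vr (t,x) / V (t,x))"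
proof (rule ray_limit[where b=b and d="\<lambda>n r. Zr (s n) r t" and v="\<lambda>r. V (t,r)" and v'="\<lambda>r. Vr (t,r)" and z="\<lambda>n r. Z (s n) r t"])
  have t: "t \<in> {0..2*pi}" using assms by (simp add: good_def)
  show "((\<lambda>r. Z (s n) r t) has_vector_derivative Zr (s n) r t) (at r within {a..b})" if "r \<in> {a..b}" for n r
    using C1[of "s n"] that t unfolding C1_polar_def by blast
  show "continuous_on {a..b} (\<lambda>r. Zr (s n) r t)" for n
    by (rule continuous_on_polar_slice[OF Z_cont(2) t])
  show "Z (s n) a t = of_real a * cis t" for n by (rule bdry(1)[OF t])
qed (use assms in \<open>auto simp: good_def\<close>)

lemma good_ray_AE:
  assumes "good s t"
  shows "AE r in ivl a b. V (t,r) = of_real a * cis t * exp (LINT x|ivl a r. Vr (t,x) / V (t,x))"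
proof -
  have "AE r in ivl a b. (\<lambda>n. Z (s n) r t) \<longlonglongrightarrow> V (t,r)" using assms by (simp add: good_def)
  moreover have "AE r in ivl a b. r \<in> {a..b}" using AE_space[of "ivl a b"] by simp
  ultimately show ?thesis
    by eventually_elim (use LIMSEQ_unique good_ray[OF assms] in blast)
qed

text \<open>At \<open>r = b\<close> all approximants have the same value \<open>b cis t\<close>, so
  the limit formula of \<open>good_ray\<close> becomes an equation. It fixes the real part of the
  ray integral and leaves a multiple of 2 pi open in the imaginary part.\<close>

lemma exp_ray_integral:
  assumes "good s t" shows "exp (ray_integral t) = of_real (b / a)"
proof -
  have t: "t \<in> {0..2*pi}" using assms by (simp add: good_def)
  have "(\<lambda>n. Z (s n) b t) \<longlonglongrightarrow> of_real a * cis t * exp (ray_integral t)"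
    using good_ray[OF assms, of b] ab by (simp add: ray_integral_def)
  then have "(\<lambda>n::nat. of_real b * cis t) \<longlonglongrightarrow> of_real a * cis t * exp (ray_integral t)"
    by (simp add: bdry(2)[OF t])
  then have "of_real b * cis t = of_real a * cis t * exp (ray_integral t)"
    by (simp add: LIMSEQ_const_iff)
  then show ?thesis using a by (simp add: field_simps)
qed

end

text \<open>The common shape of all limits at fixed \<open>e\<close>: a bounded coefficient that
  converges pointwise times a factor that converges in L1.\<close>

lemma Im_integral_tendsto:
  fixes c g :: "nat \<Rightarrow> 'a \<Rightarrow> complex"
  assumes m: "\<And>n. c n \<in> borel_measurable M" "c' \<in> borel_measurable M"
    and g: "\<And>n. integrable M (g n)" "integrable M g'"
    and C: "\<And>n x. x \<in> space M \<Longrightarrow> norm (c n x) \<le> C" "\<And>x. x \<in> space M \<Longrightarrow> norm (c' x) \<le> C" "0 \<le> C"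
    and cl: "AE x in M. (\<lambda>n. c n x) \<longlonglongrightarrow> c' x"
    and gl: "(\<lambda>n. \<integral>\<^sup>+x. ennreal (norm (g n x - g' x)) \<partial>M) \<longlonglongrightarrow> 0"
  shows "(\<lambda>n. LINT x|M. Im (c n x * g n x)) \<longlonglongrightarrow> (LINT x|M. Im (c' x * g' x))"
    and "integrable M (\<lambda>x. Im (c' x * g' x))"
proof -
  have i: "integrable M (\<lambda>x. Im (f x * h x))"
    if "f \<in> borel_measurable M" "integrable M h" "\<And>x. x \<in> space M \<Longrightarrow> norm (f x) \<le> C" for f h :: "'a \<Rightarrow> complex"
  proof (rule Bochner_Integration.integrable_bound[OF integrable_mult_right[OF integrable_norm[OF that(2)], of C]])
    show "(\<lambda>x. Im (f x * h x)) \<in> borel_measurable M"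
      using that(1) borel_measurable_integrable[OF that(2)] by measurable
    show "AE x in M. norm (Im (f x * h x)) \<le> norm (C * norm (h x))"
    proof (rule AE_I2)
      fix x assume x: "x \<in> space M"
      have "norm (Im (f x * h x)) \<le> norm (f x) * norm (h x)"
        unfolding norm_mult[symmetric] real_norm_def by (rule abs_Im_le_cmod)
      also have "\<dots> \<le> C * norm (h x)" by (intro mult_right_mono that(3) x) simp
      finally show "norm (Im (f x * h x)) \<le> norm (C * norm (h x))" using C(3) by simp
    qed
  qed
  show i': "integrable M (\<lambda>x. Im (c' x * g' x))" by (rule i[OF m(2) g(2) C(2)])
  show "(\<lambda>n. LINT x|M. Im (c n x * g n x)) \<longlonglongrightarrow> (LINT x|M. Im (c' x * g' x))"
  proof (rule tendsto_L1_int[OF i[OF m(1) g(1) C(1)] i'])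
    show "(\<lambda>n. \<integral>\<^sup>+x. ennreal (norm (Im (c n x * g n x) - Im (c' x * g' x))) \<partial>M) \<longlonglongrightarrow> 0"
    proof (rule tendsto_sandwich[OF _ _ tendsto_const])
      show "(\<lambda>n. \<integral>\<^sup>+x. ennreal (norm (c n x * g n x - c' x * g' x)) \<partial>M) \<longlonglongrightarrow> 0"
        by (rule L1_tendsto_mult_bounded[OF m borel_measurable_integrable[OF g(1)] g(2) C cl gl])
      show "\<forall>\<^sub>F n in sequentially. (\<integral>\<^sup>+x. ennreal (norm (Im (c n x * g n x) - Im (c' x * g' x))) \<partial>M) \<le> (\<integral>\<^sup>+x. ennreal (norm (c n x * g n x - c' x * g' x)) \<partial>M)"
        unfolding minus_complex.sel(2)[symmetric] real_norm_def
        by (intro always_eventually allI nn_integral_mono ennreal_leI abs_Im_le_cmod)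
    qed simp
  qed
qed

lemma borel_measurable_cnj [measurable (raw)]: "f \<in> borel_measurable M \<Longrightarrow> (\<lambda>x. cnj (f x)) \<in> borel_measurable M"
  by (rule measurable_compose[OF _ borel_measurable_continuous_onI]) (auto intro: continuous_intros)

context polar_approximation
begin

lemma coefficient_bound:
  assumes "continuous_on {a..b} f"
  obtains B :: real where "0 \<le> B" "\<And>p c d. p \<in> space R \<Longrightarrow> \<bar>indicator {c..d} (fst p) * f (snd p)\<bar> \<le> B"
    "\<And>r. r \<in> {a..b} \<Longrightarrow> \<bar>f r\<bar> \<le> B"
proof -
  obtain B where B: "\<And>r. r \<in> {a..b} \<Longrightarrow> norm (f r) \<le> B"
    using continuous_on_compact_bounded[OF compact_Icc assms] by blast
  have "0 \<le> B" using B[of a] ab norm_ge_zero[of "f a"] by auto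
  then show thesis using B by (intro that[of B]) (auto simp: space_R indicator_def)
qed

lemma coefficient_measurable [measurable]:
  fixes f :: "real \<Rightarrow> real"
  assumes "continuous_on {a..b} f"
  shows "(\<lambda>p. indicator {c..d} (fst p) * f (snd p)) \<in> borel_measurable R"
  using measurable_compose[OF measurable_snd borel_measurable_ivl_continuous[OF assms], of "ivl 0 (2*pi)"]
  by measurable

text \<open>The limit of \<open>regularised_green\<close>, first along the approximants at fixed
  \<open>e\<close>, then for \<open>e = 1/(k+1)\<close>. The ray terms at the angles
  \<open>c\<close> and \<open>d\<close> involve only single rays and are not controlled by
  convergence on the rectangle, so their limits \<open>E e\<close> and \<open>E'\<close> are
  hypotheses: they cancel on the full circle and become ray integrals between good angles.\<close>

lemma log_green:
  assumes s: "strict_mono s" "AE p in R. (\<lambda>n. Z (s n) (snd p) (fst p)) \<longlonglongrightarrow> V p"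
    and cd: "0 \<le> c" "c \<le> d" "d \<le> 2*pi"
    and \<psi>: "\<And>r. r \<in> {a..b} \<Longrightarrow> (\<psi> has_vector_derivative \<psi>' r) (at r within {a..b})" "continuous_on {a..b} \<psi>'"
    and E: "\<And>e. e > 0 \<Longrightarrow> (\<lambda>n. LINT r|ivl a b. \<psi> r * (Im (reg_inv e (Z (s n) r d) * Zr (s n) r d) - Im (reg_inv e (Z (s n) r c) * Zr (s n) r c))) \<longlonglongrightarrow> E e"
    and E': "(\<lambda>k. E (1 / real (Suc k))) \<longlonglongrightarrow> E'"
  shows "(LINT p|R. indicator {c..d} (fst p) * \<psi>' (snd p) * Im (Vt p / V p)) = (d - c) * (\<psi> b - \<psi> a) - E'"
proof -
  have c\<psi>: "continuous_on {a..b} \<psi>" using \<psi>(1) by (intro continuous_on_vector_derivative)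
  define X where "X p = indicator {c..d} (fst p) * \<psi> (snd p)" for p :: "real \<times> real"
  define X' where "X' p = indicator {c..d} (fst p) * \<psi>' (snd p)" for p :: "real \<times> real"
  have [measurable]: "X \<in> borel_measurable R" "X' \<in> borel_measurable R"
    unfolding X_def[abs_def] X'_def[abs_def] by (intro coefficient_measurable c\<psi> \<psi>(2))+
  obtain B where B: "0 \<le> B" "\<And>p. p \<in> space R \<Longrightarrow> \<bar>X p\<bar> \<le> B"
    unfolding X_def using coefficient_bound[OF c\<psi>] by metis
  obtain B' where B': "0 \<le> B'" "\<And>p. p \<in> space R \<Longrightarrow> \<bar>X' p\<bar> \<le> B'"
    unfolding X'_def using coefficient_bound[OF \<psi>(2)] by metis
  have eq_e: "(LINT p|R. X' p * Im (reg_inv e (V p) * Vt p))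
     = (d - c) * (\<psi> b * (b\<^sup>2 / (b\<^sup>2 + e)) - \<psi> a * (a\<^sup>2 / (a\<^sup>2 + e))) - E e - (LINT p|R. X p * reg_jac e (V p) (Vr p) (Vt p))"
    if e: "e > 0" for e
  proof -
    have [measurable]: "reg_inv e \<in> borel_measurable borel"
      by (intro borel_measurable_continuous_onI continuous_on_reg_inv[OF e])
    have ci: "isCont (reg_inv e) w" for w
      using continuous_on_reg_inv[OF e, of UNIV] by (simp add: continuous_on_eq_continuous_at)
    \<comment> \<open>Splits \<open>reg_jac\<close> into a bounded continuous coefficient of the
      value, at most \<open>2 e / e^2\<close>, and the product of derivatives that converges in
      L1.\<close>
    define k where "k w = complex_of_real (2 * e / ((norm w)\<^sup>2 + e)\<^sup>2)" for w :: complex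
    have den: "(norm w)\<^sup>2 + e > 0" for w :: complex using e zero_le_power2[of "norm w"] by linarith
    have ck: "continuous_on UNIV k"
      unfolding k_def by (intro continuous_intros) (use den in \<open>auto simp: less_imp_neq[symmetric]\<close>)
    then have ick: "isCont k w" for w by (simp add: continuous_on_eq_continuous_at)
    have [measurable]: "k \<in> borel_measurable borel" by (intro borel_measurable_continuous_onI ck)
    have nk: "norm (k w) \<le> 2 * e / e\<^sup>2" for w
      unfolding k_def norm_of_real using e den[of w]
      by (simp add: divide_left_mono power_mono)
    have jac: "reg_jac e w x y = Im (k w * (cnj x * y))" for w x y
      unfolding reg_jac_def k_def by simp
    have g1: "(\<lambda>n. \<integral>\<^sup>+p. ennreal (norm (Zt (s n) (snd p) (fst p) - Vt p)) \<partial>R) \<longlonglongrightarrow> 0"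
      by (rule strict_mono_nn_tendsto[OF L1_lim(2) s(1)])
    have g2: "(\<lambda>n. \<integral>\<^sup>+p. ennreal (norm (cnj (Zr (s n) (snd p) (fst p)) * Zt (s n) (snd p) (fst p) - cnj (Vr p) * Vt p)) \<partial>R) \<longlonglongrightarrow> 0"
      by (rule L1_tendsto_cnj_mult[OF _ _ _ _ strict_mono_nn_tendsto[OF limr s(1)] strict_mono_nn_tendsto[OF limt s(1)] L2]; intro Z_meas meas)
    have iZ: "integrable R (\<lambda>p. cnj (Zr n (snd p) (fst p)) * Zt n (snd p) (fst p))" for n
    proof -
      have c: "continuous_on ({a..b} \<times> {0..2*pi}) (\<lambda>(r,t). cnj (Zr n r t) * Zt n r t)"
        using Z_cont(2,3)[of n] unfolding case_prod_beta by (intro continuous_intros)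
      obtain D where "\<And>r t. r \<in> {a..b} \<Longrightarrow> t \<in> {0..2*pi} \<Longrightarrow> norm (cnj (Zr n r t) * Zt n r t) \<le> D"
        using bounded_polar_rect_continuous[OF c] by blast
      moreover have "(\<lambda>p. cnj (Zr n (snd p) (fst p)) * Zt n (snd p) (fst p)) \<in> borel_measurable R"
        by (intro borel_measurable_times borel_measurable_cnj Z_meas)
      ultimately show ?thesis
        by (intro integrable_polar_rect_bounded[where B=D]) auto
    qed
    have iV: "integrable R (\<lambda>p. cnj (Vr p) * Vt p)"
    proof (rule Bochner_Integration.integrable_bound[of _ "\<lambda>p. (norm (Vr p))\<^sup>2 + (norm (Vt p))\<^sup>2"])
      show "integrable R (\<lambda>p. (norm (Vr p))\<^sup>2 + (norm (Vt p))\<^sup>2)"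
        using L2 by (intro Bochner_Integration.integrable_add integrableI_bounded) auto
      show "AE p in R. norm (cnj (Vr p) * Vt p) \<le> norm ((norm (Vr p))\<^sup>2 + (norm (Vt p))\<^sup>2)"
      proof (rule AE_I2)
        fix p
        show "norm (cnj (Vr p) * Vt p) \<le> norm ((norm (Vr p))\<^sup>2 + (norm (Vt p))\<^sup>2)"
          using sum_squares_bound[of "norm (Vr p)" "norm (Vt p)", unfolded mult.assoc]
            mult_nonneg_nonneg[OF norm_ge_zero norm_ge_zero, of "Vr p" "Vt p"]
          unfolding norm_mult complex_mod_cnj real_norm_def by linarith
      qed
      show "(\<lambda>p. cnj (Vr p) * Vt p) \<in> borel_measurable R"
        by (intro borel_measurable_times borel_measurable_cnj meas)
    qed
    have l1: "(\<lambda>n. LINT p|R. Im ((of_real (X' p) * reg_inv e (Z (s n) (snd p) (fst p))) * Zt (s n) (snd p) (fst p)))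
       \<longlonglongrightarrow> (LINT p|R. Im ((of_real (X' p) * reg_inv e (V p)) * Vt p))"
    proof (rule Im_integral_tendsto(1)[where C="B' * (1 / sqrt e)", OF _ _ Z_integrable(3) V_integrable(2) _ _ _ _ g1])
      show "norm (of_real (X' p) * reg_inv e (Z (s n) (snd p) (fst p))) \<le> B' * (1 / sqrt e)" if "p \<in> space R" for n p
        unfolding norm_mult norm_of_real using B' that e by (intro mult_mono norm_reg_inv_le) auto
      show "norm (of_real (X' p) * reg_inv e (V p)) \<le> B' * (1 / sqrt e)" if "p \<in> space R" for p
        unfolding norm_mult norm_of_real using B' that e by (intro mult_mono norm_reg_inv_le) auto
      show "AE p in R. (\<lambda>n. of_real (X' p) * reg_inv e (Z (s n) (snd p) (fst p))) \<longlonglongrightarrow> of_real (X' p) * reg_inv e (V p)"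
        using s(2) by eventually_elim (intro tendsto_intros isCont_tendsto_compose[OF ci])
      show "0 \<le> B' * (1 / sqrt e)" using B' e by simp
    qed measurable
    have l2: "(\<lambda>n. LINT p|R. Im ((of_real (X p) * k (Z (s n) (snd p) (fst p))) * (cnj (Zr (s n) (snd p) (fst p)) * Zt (s n) (snd p) (fst p))))
       \<longlonglongrightarrow> (LINT p|R. Im ((of_real (X p) * k (V p)) * (cnj (Vr p) * Vt p)))"
    proof (rule Im_integral_tendsto(1)[where C="B * (2 * e / e\<^sup>2)", OF _ _ iZ iV _ _ _ _ g2])
      show "norm (of_real (X p) * k (Z (s n) (snd p) (fst p))) \<le> B * (2 * e / e\<^sup>2)" if "p \<in> space R" for n p
        unfolding norm_mult norm_of_real using B that e by (intro mult_mono nk) auto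
      show "norm (of_real (X p) * k (V p)) \<le> B * (2 * e / e\<^sup>2)" if "p \<in> space R" for p
        unfolding norm_mult norm_of_real using B that e by (intro mult_mono nk) auto
      show "AE p in R. (\<lambda>n. of_real (X p) * k (Z (s n) (snd p) (fst p))) \<longlonglongrightarrow> of_real (X p) * k (V p)"
        using s(2) by eventually_elim (intro tendsto_intros isCont_tendsto_compose[OF ick])
      show "0 \<le> B * (2 * e / e\<^sup>2)" using B e by simp
    qed measurable
    have ImX: "Im ((of_real x * u) * v) = x * Im (u * v)" for x u v
      by (simp add: algebra_simps)
    have "(\<lambda>n. (d - c) * (\<psi> b * (b\<^sup>2 / (b\<^sup>2 + e)) - \<psi> a * (a\<^sup>2 / (a\<^sup>2 + e)))
        - (LINT r|ivl a b. \<psi> r * (Im (reg_inv e (Z (s n) r d) * Zr (s n) r d) - Im (reg_inv e (Z (s n) r c) * Zr (s n) r c)))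
        - (LINT p|R. X p * reg_jac e (Z (s n) (snd p) (fst p)) (Zr (s n) (snd p) (fst p)) (Zt (s n) (snd p) (fst p))))
       \<longlonglongrightarrow> (d - c) * (\<psi> b * (b\<^sup>2 / (b\<^sup>2 + e)) - \<psi> a * (a\<^sup>2 / (a\<^sup>2 + e))) - E e - (LINT p|R. X p * reg_jac e (V p) (Vr p) (Vt p))"
      using l2 unfolding ImX jac[symmetric] by (intro tendsto_intros E[OF e])
    moreover have "(\<lambda>n. LINT p|R. X' p * Im (reg_inv e (Z (s n) (snd p) (fst p)) * Zt (s n) (snd p) (fst p)))
       \<longlonglongrightarrow> (LINT p|R. X' p * Im (reg_inv e (V p) * Vt p))"
      using l1 unfolding ImX .
    moreover have "(LINT p|R. X' p * Im (reg_inv e (Z n (snd p) (fst p)) * Zt n (snd p) (fst p)))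
      = (d - c) * (\<psi> b * (b\<^sup>2 / (b\<^sup>2 + e)) - \<psi> a * (a\<^sup>2 / (a\<^sup>2 + e)))
        - (LINT r|ivl a b. \<psi> r * (Im (reg_inv e (Z n r d) * Zr n r d) - Im (reg_inv e (Z n r c) * Zr n r c)))
        - (LINT p|R. X p * reg_jac e (Z n (snd p) (fst p)) (Zr n (snd p) (fst p)) (Zt n (snd p) (fst p)))" for n
      using regularised_green[OF a ab C1 cd e bdry \<psi>, of n] by (simp add: X_def X'_def mult.assoc)
    ultimately show ?thesis using LIMSEQ_unique by simp
  qed
  let ?e = "\<lambda>k. 1 / real (Suc k)"
  have e0: "?e k > 0" for k by simp
  have mk [measurable]: "reg_inv (?e k) \<in> borel_measurable borel" for k
    by (intro borel_measurable_continuous_onI continuous_on_reg_inv e0)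
  have q: "(\<lambda>k. LINT p|R. X' p * Im (reg_inv (?e k) (V p) * Vt p)) \<longlonglongrightarrow> (LINT p|R. X' p * Im (Vt p / V p))"
  proof (rule integral_dominated_convergence[where w="\<lambda>p. B' * norm (Vt p / V p)"])
    show "integrable R (\<lambda>p. B' * norm (Vt p / V p))" using log_integrable(2) by auto
    show "(\<lambda>p. X' p * Im (reg_inv (?e k) (V p) * Vt p)) \<in> borel_measurable R" for k by measurable
    show "(\<lambda>p. X' p * Im (Vt p / V p)) \<in> borel_measurable R" by measurable
    show "AE p in R. (\<lambda>k. X' p * Im (reg_inv (?e k) (V p) * Vt p)) \<longlonglongrightarrow> X' p * Im (Vt p / V p)"
      using nz
    proof eventually_elim
      fix p assume "V p \<noteq> 0"
      then have "(\<lambda>k. X' p * Im (reg_inv (?e k) (V p) * Vt p)) \<longlonglongrightarrow> X' p * Im (1 / V p * Vt p)"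
        by (intro tendsto_intros reg_inv_tendsto)
      then show "(\<lambda>k. X' p * Im (reg_inv (?e k) (V p) * Vt p)) \<longlonglongrightarrow> X' p * Im (Vt p / V p)"
        by (simp only: times_divide_eq_left mult_1_left)
    qed
    show "AE p in R. norm (X' p * Im (reg_inv (?e k) (V p) * Vt p)) \<le> B' * norm (Vt p / V p)" for k
      using nz AE_space
    proof eventually_elim
      fix p assume p: "V p \<noteq> 0" "p \<in> space R"
      have "\<bar>Im (reg_inv (?e k) (V p) * Vt p)\<bar> \<le> norm (reg_inv (?e k) (V p)) * norm (Vt p)"
        unfolding norm_mult[symmetric] by (rule abs_Im_le_cmod)
      also have "\<dots> \<le> 1 / norm (V p) * norm (Vt p)"
        by (intro mult_right_mono norm_reg_inv_le_inverse e0 p) simp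
      finally have "\<bar>Im (reg_inv (?e k) (V p) * Vt p)\<bar> \<le> norm (Vt p / V p)" by (simp only: norm_divide times_divide_eq_left mult_1_left)
      then show "norm (X' p * Im (reg_inv (?e k) (V p) * Vt p)) \<le> B' * norm (Vt p / V p)"
        unfolding real_norm_def abs_mult using B' p by (intro mult_mono) auto
    qed
  qed
  have mj: "(\<lambda>p. X p * reg_jac e (V p) (Vr p) (Vt p)) \<in> borel_measurable R" for e
    unfolding reg_jac_def by measurable
  \<comment> \<open>The Jacobian defect disappears here. Away from zeros of \<open>V\<close> it
    tends to 0 pointwise, and by \<open>abs_reg_jac_le\<close> the squared logarithmic derivatives
    dominate it.\<close>
  have j: "(\<lambda>k. LINT p|R. X p * reg_jac (?e k) (V p) (Vr p) (Vt p)) \<longlonglongrightarrow> (LINT p|R. 0)"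
  proof (rule integral_dominated_convergence[where w="\<lambda>p. B * ((norm (Vr p / V p))\<^sup>2 + (norm (Vt p / V p))\<^sup>2)"])
    show "integrable R (\<lambda>p. B * ((norm (Vr p / V p))\<^sup>2 + (norm (Vt p / V p))\<^sup>2))"
      by (intro integrable_mult_right Bochner_Integration.integrable_add logL2)
    show "(\<lambda>p. X p * reg_jac (?e k) (V p) (Vr p) (Vt p)) \<in> borel_measurable R" for k by (rule mj)
    show "AE p in R. (\<lambda>k. X p * reg_jac (?e k) (V p) (Vr p) (Vt p)) \<longlonglongrightarrow> 0"
      using nz
    proof eventually_elim
      fix p assume "V p \<noteq> 0"
      then have "(\<lambda>k. X p * reg_jac (?e k) (V p) (Vr p) (Vt p)) \<longlonglongrightarrow> X p * 0"
        by (intro tendsto_mult tendsto_const reg_jac_tendsto)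
      then show "(\<lambda>k. X p * reg_jac (?e k) (V p) (Vr p) (Vt p)) \<longlonglongrightarrow> 0" by (simp only: mult_zero_right)
    qed
    show "AE p in R. norm (X p * reg_jac (?e k) (V p) (Vr p) (Vt p)) \<le> B * ((norm (Vr p / V p))\<^sup>2 + (norm (Vt p / V p))\<^sup>2)" for k
      using nz AE_space
    proof eventually_elim
      fix p assume p: "V p \<noteq> 0" "p \<in> space R"
      have "\<bar>reg_jac (?e k) (V p) (Vr p) (Vt p)\<bar> \<le> norm (Vr p / V p) * norm (Vt p / V p)"
        by (rule abs_reg_jac_le[OF e0 p(1)])
      also have "\<dots> \<le> (norm (Vr p / V p))\<^sup>2 + (norm (Vt p / V p))\<^sup>2"
        using sum_squares_bound[of "norm (Vr p / V p)" "norm (Vt p / V p)", unfolded mult.assoc]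
          mult_nonneg_nonneg[OF norm_ge_zero norm_ge_zero, of "Vr p / V p" "Vt p / V p"] by linarith
      finally show "norm (X p * reg_jac (?e k) (V p) (Vr p) (Vt p)) \<le> B * ((norm (Vr p / V p))\<^sup>2 + (norm (Vt p / V p))\<^sup>2)"
        unfolding real_norm_def abs_mult using B p by (intro mult_mono) auto
    qed
  qed simp
  have l: "(\<lambda>k. x\<^sup>2 / (x\<^sup>2 + ?e k)) \<longlonglongrightarrow> 1" if "x > 0" for x :: real
  proof -
    have "(\<lambda>k. x\<^sup>2 / (x\<^sup>2 + inverse (real (Suc k)))) \<longlonglongrightarrow> x\<^sup>2 / (x\<^sup>2 + 0)"
      using that by (intro tendsto_divide tendsto_add tendsto_const LIMSEQ_inverse_real_of_nat) auto
    then show ?thesis using that by (simp add: inverse_eq_divide)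
  qed
  have "(\<lambda>k. (d - c) * (\<psi> b * (b\<^sup>2 / (b\<^sup>2 + ?e k)) - \<psi> a * (a\<^sup>2 / (a\<^sup>2 + ?e k))) - E (?e k) - (LINT p|R. X p * reg_jac (?e k) (V p) (Vr p) (Vt p)))
     \<longlonglongrightarrow> (d - c) * (\<psi> b * 1 - \<psi> a * 1) - E' - (LINT p|R. 0)"
    using a ab by (intro tendsto_diff tendsto_mult tendsto_const l E' j) auto
  then have "(LINT p|R. X' p * Im (Vt p / V p)) = (d - c) * (\<psi> b * 1 - \<psi> a * 1) - E' - (LINT p|R. 0)"
    using q unfolding eq_e[OF e0] by (rule LIMSEQ_unique[rotated])
  then show ?thesis by (simp add: X'_def)
qed

text \<open>The weight \<open>ln\<close> is chosen for its derivative \<open>1 / r\<close>. On the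
  full circle the two ray terms belong to the same ray and cancel by periodicity, so only the two
  boundary circles contribute.\<close>

lemma angular_log_integral: "(LINT p|R. Im (Vt p / V p) / snd p) = 2 * pi * ln (b / a)"
proof -
  obtain s where s: "strict_mono s" "AE p in R. (\<lambda>n. Z (s n) (snd p) (fst p)) \<longlonglongrightarrow> V p"
    by (rule subsequence)
  have "(LINT p|R. indicator {0..2*pi} (fst p) * inverse (snd p) * Im (Vt p / V p)) = (2*pi - 0) * (ln b - ln a) - 0"
  proof (rule log_green[OF s, where \<psi>=ln and \<psi>'=inverse and E="\<lambda>e. 0"])
    show "(ln has_vector_derivative inverse r) (at r within {a..b})" if "r \<in> {a..b}" for r
    proof -
      have "(ln has_real_derivative inverse r) (at r)" using that a by (intro DERIV_ln) auto
      then show ?thesis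
        unfolding has_real_derivative_iff_has_vector_derivative by (rule has_vector_derivative_at_within)
    qed
    show "continuous_on {a..b} inverse" by (rule continuous_on_inverse[OF continuous_on_id]) (use a in simp)
    show "(\<lambda>n. LINT r|ivl a b. ln r * (Im (reg_inv e (Z (s n) r (2*pi)) * Zr (s n) r (2*pi)) - Im (reg_inv e (Z (s n) r 0) * Zr (s n) r 0))) \<longlonglongrightarrow> 0" for e
    proof -
      have "(LINT r|ivl a b. ln r * (Im (reg_inv e (Z (s n) r (2*pi)) * Zr (s n) r (2*pi)) - Im (reg_inv e (Z (s n) r 0) * Zr (s n) r 0))) = (LINT r|ivl a b. 0)" for n
        by (rule Bochner_Integration.integral_cong) (simp_all add: periodic)
      then show ?thesis by simp
    qed
    show "(\<lambda>k::nat. 0::real) \<longlonglongrightarrow> 0" by (rule tendsto_const)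
  qed simp_all
  moreover have "(LINT p|R. indicator {0..2*pi} (fst p) * inverse (snd p) * Im (Vt p / V p)) = (LINT p|R. Im (Vt p / V p) / snd p)"
  proof (rule Bochner_Integration.integral_cong[OF refl])
    fix p assume "p \<in> space R"
    then have "fst p \<in> {0..2*pi}" unfolding space_R by auto
    then show "indicator {0..2*pi} (fst p) * inverse (snd p) * Im (Vt p / V p) = Im (Vt p / V p) / snd p"
      by (simp only: indicator_simps mult_1_left divide_inverse[of _ "snd p"] mult.commute)
  qed
  ultimately show ?thesis using a ab by (simp add: ln_div)
qed

lemma good_end_term:
  assumes g: "good s t" and e: "e > 0"
  shows "(\<lambda>n. LINT r|ivl a b. Im (reg_inv e (Z (s n) r t) * Zr (s n) r t)) \<longlonglongrightarrow> (LINT r|ivl a b. Im (reg_inv e (V (t,r)) * Vr (t,r)))"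
proof (rule Im_integral_tendsto(1)[where C="1 / sqrt e"])
  have t: "t \<in> {0..2*pi}" using g by (simp add: good_def)
  have ci: "isCont (reg_inv e) w" for w
    using continuous_on_reg_inv[OF e, of UNIV] by (simp add: continuous_on_eq_continuous_at)
  have mi: "reg_inv e \<in> borel_measurable borel"
    by (intro borel_measurable_continuous_onI continuous_on_reg_inv[OF e])
  show "(\<lambda>r. reg_inv e (Z (s n) r t)) \<in> borel_measurable (ivl a b)" for n
    by (intro measurable_compose[OF borel_measurable_ivl_continuous[OF continuous_on_polar_slice[OF Z_cont(1) t]] mi])
  show "(\<lambda>r. reg_inv e (V (t,r))) \<in> borel_measurable (ivl a b)"
    using g by (intro measurable_compose[OF _ mi]) (simp add: good_def)
  show "integrable (ivl a b) (\<lambda>r. Zr (s n) r t)" for n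
    by (intro integral_ivl_continuous(2) continuous_on_polar_slice[OF Z_cont(2) t])
  have "AE r in ivl a b. (\<lambda>n. Z (s n) r t) \<longlonglongrightarrow> V (t,r)" using g by (simp add: good_def)
  then show "AE r in ivl a b. (\<lambda>n. reg_inv e (Z (s n) r t)) \<longlonglongrightarrow> reg_inv e (V (t,r))"
    by eventually_elim (rule isCont_tendsto_compose[OF ci])
qed (use g e norm_reg_inv_le in \<open>auto simp: good_def\<close>)

lemma good_end_term_limit:
  assumes g: "good s t"
  shows "(\<lambda>k. LINT r|ivl a b. Im (reg_inv (1 / real (Suc k)) (V (t,r)) * Vr (t,r))) \<longlonglongrightarrow> Im (ray_integral t)"
proof -
  let ?e = "\<lambda>k. 1 / real (Suc k)"
  have e0: "?e k > 0" for k by simp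
  have mk: "reg_inv (?e k) \<in> borel_measurable borel" for k
    by (intro borel_measurable_continuous_onI continuous_on_reg_inv e0)
  have mV [measurable]: "(\<lambda>r. V (t,r)) \<in> borel_measurable (ivl a b)" and iVr: "integrable (ivl a b) (\<lambda>r. Vr (t,r))"
    and nzt: "AE r in ivl a b. V (t,r) \<noteq> 0" and ip: "integrable (ivl a b) (\<lambda>r. Vr (t,r) / V (t,r))"
    using g by (simp_all add: good_def)
  have [measurable]: "(\<lambda>r. Vr (t,r)) \<in> borel_measurable (ivl a b)" using iVr by auto
  have [measurable]: "(\<lambda>r. reg_inv (?e k) (V (t,r))) \<in> borel_measurable (ivl a b)" for k
    by (rule measurable_compose[OF mV mk])
  have "(\<lambda>k. LINT r|ivl a b. Im (reg_inv (?e k) (V (t,r)) * Vr (t,r))) \<longlonglongrightarrow> (LINT r|ivl a b. Im (Vr (t,r) / V (t,r)))"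
  proof (rule integral_dominated_convergence[where w="\<lambda>r. norm (Vr (t,r) / V (t,r))"])
    show "integrable (ivl a b) (\<lambda>r. norm (Vr (t,r) / V (t,r)))" using ip by auto
    show "(\<lambda>r. Im (reg_inv (?e k) (V (t,r)) * Vr (t,r))) \<in> borel_measurable (ivl a b)" for k by measurable
    show "(\<lambda>r. Im (Vr (t,r) / V (t,r))) \<in> borel_measurable (ivl a b)" by measurable
    show "AE r in ivl a b. (\<lambda>k. Im (reg_inv (?e k) (V (t,r)) * Vr (t,r))) \<longlonglongrightarrow> Im (Vr (t,r) / V (t,r))"
      using nzt
    proof eventually_elim
      fix r assume "V (t,r) \<noteq> 0"
      then have "(\<lambda>k. Im (reg_inv (?e k) (V (t,r)) * Vr (t,r))) \<longlonglongrightarrow> Im (1 / V (t,r) * Vr (t,r))"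
        by (intro tendsto_intros reg_inv_tendsto)
      then show "(\<lambda>k. Im (reg_inv (?e k) (V (t,r)) * Vr (t,r))) \<longlonglongrightarrow> Im (Vr (t,r) / V (t,r))"
        by (simp only: times_divide_eq_left mult_1_left)
    qed
    show "AE r in ivl a b. norm (Im (reg_inv (?e k) (V (t,r)) * Vr (t,r))) \<le> norm (Vr (t,r) / V (t,r))" for k
      using nzt
    proof eventually_elim
      fix r assume p: "V (t,r) \<noteq> 0"
      have "norm (Im (reg_inv (?e k) (V (t,r)) * Vr (t,r))) \<le> norm (reg_inv (?e k) (V (t,r))) * norm (Vr (t,r))"
        unfolding norm_mult[symmetric] real_norm_def by (rule abs_Im_le_cmod)
      also have "\<dots> \<le> 1 / norm (V (t,r)) * norm (Vr (t,r))"
        by (intro mult_right_mono norm_reg_inv_le_inverse e0 p) simp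
      finally show "norm (Im (reg_inv (?e k) (V (t,r)) * Vr (t,r))) \<le> norm (Vr (t,r) / V (t,r))"
        by (simp only: norm_divide times_divide_eq_left mult_1_left)
    qed
  qed
  moreover have "(LINT r|ivl a b. Im (Vr (t,r) / V (t,r))) = Im (ray_integral t)"
    unfolding ray_integral_def by (rule integral_bounded_linear[OF bounded_linear_Im ip])
  ultimately show ?thesis by simp
qed

text \<open>With constant weight the area integral vanishes and the contributions of the two
  boundary circles cancel in the limit; Green's formula on the sector between two good rays then
  leaves only the difference of their ray integrals.\<close>

lemma Im_ray_integral_le_case:
  assumes s: "strict_mono s" "AE p in R. (\<lambda>n. Z (s n) (snd p) (fst p)) \<longlonglongrightarrow> V p"
    and g: "good s c" "good s d" "c \<le> d"
  shows "Im (ray_integral c) = Im (ray_integral d)"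
proof -
  have cd: "0 \<le> c" "d \<le> 2*pi" and t: "c \<in> {0..2*pi}" "d \<in> {0..2*pi}" using g by (simp_all add: good_def)
  let ?F = "\<lambda>e t. LINT r|ivl a b. Im (reg_inv e (V (t,r)) * Vr (t,r))"
  have "(LINT p|R. indicator {c..d} (fst p) * 0 * Im (Vt p / V p)) = (d - c) * (1 - 1) - (Im (ray_integral d) - Im (ray_integral c))"
  proof (rule log_green[OF s cd(1) g(3) cd(2), where \<psi>="\<lambda>r. 1" and \<psi>'="\<lambda>r. 0" and E="\<lambda>e. ?F e d - ?F e c"])
    show "(\<lambda>n. LINT r|ivl a b. 1 * (Im (reg_inv e (Z (s n) r d) * Zr (s n) r d) - Im (reg_inv e (Z (s n) r c) * Zr (s n) r c))) \<longlonglongrightarrow> ?F e d - ?F e c"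
      if e: "e > 0" for e
    proof -
      have cf: "continuous_on {a..b} (\<lambda>r. Im (reg_inv e (Z n r t) * Zr n r t))" if "t \<in> {0..2*pi}" for n t
        by (intro continuous_intros continuous_on_polar_slice[OF Z_cont(2) that]
            continuous_on_compose2[OF continuous_on_reg_inv[OF e, of UNIV] continuous_on_polar_slice[OF Z_cont(1) that]]) auto
      have "(LINT r|ivl a b. 1 * (Im (reg_inv e (Z n r d) * Zr n r d) - Im (reg_inv e (Z n r c) * Zr n r c)))
        = (LINT r|ivl a b. Im (reg_inv e (Z n r d) * Zr n r d)) - (LINT r|ivl a b. Im (reg_inv e (Z n r c) * Zr n r c))" for n
        unfolding mult_1_left by (intro Bochner_Integration.integral_diff integral_ivl_continuous(2) cf t)
      moreover have "(\<lambda>n. (LINT r|ivl a b. Im (reg_inv e (Z (s n) r d) * Zr (s n) r d)) - (LINT r|ivl a b. Im (reg_inv e (Z (s n) r c) * Zr (s n) r c))) \<longlonglongrightarrow> ?F e d - ?F e c"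
        by (intro tendsto_diff good_end_term g e)
      ultimately show ?thesis by (simp only:)
    qed
    show "(\<lambda>k. ?F (1 / real (Suc k)) d - ?F (1 / real (Suc k)) c) \<longlonglongrightarrow> Im (ray_integral d) - Im (ray_integral c)"
      by (intro tendsto_diff good_end_term_limit[OF g(1)] good_end_term_limit[OF g(2)])
  qed auto
  then show ?thesis by simp
qed

text \<open>The integer is the degree of the map; along almost every ray it is seen as the winding number.\<close>

theorem ray_structure:
  obtains m :: int where
    "AE t in ivl 0 (2*pi). integrable (ivl a b) (\<lambda>r. Vr (t,r) / V (t,r)) \<and>
       integrable (ivl a b) (\<lambda>r. (norm (Vr (t,r) / V (t,r)))\<^sup>2) \<and>
       (LINT r|ivl a b. Vr (t,r) / V (t,r)) = Complex (ln (b / a)) (2 * pi * of_int m) \<and>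
       (AE r in ivl a b. V (t,r) = of_real a * cis t * exp (LINT x|ivl a r. Vr (t,x) / V (t,x)))"
proof -
  obtain s where s: "strict_mono s" "AE p in R. (\<lambda>n. Z (s n) (snd p) (fst p)) \<longlonglongrightarrow> V p"
    "AE t in ivl 0 (2*pi). (\<lambda>n. \<integral>\<^sup>+r. ennreal (norm (Zr (s n) r t - Vr (t,r))) \<partial>ivl a b) \<longlonglongrightarrow> 0"
    by (rule subsequence)
  note good = AE_good[OF s(2,3)]
  have "\<exists>t. good s t"
  proof (rule ccontr)
    assume "\<not> ?thesis"
    then have "AE t in ivl 0 (2*pi). False" using good by simp
    then have "emeasure (ivl 0 (2*pi)) {0..2*pi} = 0"
      by (simp add: eventually_False ae_filter_eq_bot_iff)
    then show False by (simp add: emeasure_restrict_space)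
  qed
  then obtain t0 where t0: "good s t0" by blast
  \<comment> \<open>The exponential fixes the ray integral up to a multiple of
    \<open>2 pi i\<close>, possibly a different one on each ray; comparison with the reference ray
    \<open>t0\<close> makes the multiple common.\<close>
  have ex: "exp (Re (ray_integral t)) = b / a \<and> (\<exists>m::int. Im (ray_integral t) = 2 * pi * of_int m)" if "good s t" for t
  proof -
    have e: "exp (ray_integral t) = exp (of_real (ln (b/a)))"
      using exp_ray_integral[OF that] a ab by (simp add: exp_of_real)
    then obtain m :: int where "ray_integral t = of_real (ln (b/a)) + (of_int (2 * m) * pi) * \<i>"
      using exp_eq by auto
    then show ?thesis using a ab by auto
  qed
  obtain m :: int where m: "Im (ray_integral t0) = 2 * pi * of_int m" using ex[OF t0] by blast
  have val: "ray_integral t = Complex (ln (b / a)) (2 * pi * of_int m)" if t: "good s t" for t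
  proof (rule complex_eqI)
    have "exp (Re (ray_integral t)) = b / a" using ex[OF t] by blast
    then have "Re (ray_integral t) = ln (b / a)" by (metis ln_exp)
    then show "Re (ray_integral t) = Re (Complex (ln (b / a)) (2 * pi * of_int m))" by simp
    have "Im (ray_integral t) = Im (ray_integral t0)"
      using Im_ray_integral_le_case[OF s(1,2) t t0] Im_ray_integral_le_case[OF s(1,2) t0 t] by linarith
    then show "Im (ray_integral t) = Im (Complex (ln (b / a)) (2 * pi * of_int m))" using m by simp
  qed
  from good have "AE t in ivl 0 (2*pi). integrable (ivl a b) (\<lambda>r. Vr (t,r) / V (t,r)) \<and>
       integrable (ivl a b) (\<lambda>r. (norm (Vr (t,r) / V (t,r)))\<^sup>2) \<and>
       (LINT r|ivl a b. Vr (t,r) / V (t,r)) = Complex (ln (b / a)) (2 * pi * of_int m) \<and>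
       (AE r in ivl a b. V (t,r) = of_real a * cis t * exp (LINT x|ivl a r. Vr (t,x) / V (t,x)))"
  proof eventually_elim
    fix t assume g: "good s t"
    show "integrable (ivl a b) (\<lambda>r. Vr (t,r) / V (t,r)) \<and>
       integrable (ivl a b) (\<lambda>r. (norm (Vr (t,r) / V (t,r)))\<^sup>2) \<and>
       (LINT r|ivl a b. Vr (t,r) / V (t,r)) = Complex (ln (b / a)) (2 * pi * of_int m) \<and>
       (AE r in ivl a b. V (t,r) = of_real a * cis t * exp (LINT x|ivl a r. Vr (t,x) / V (t,x)))"
      using g good_ray_AE[OF g] val[OF g] unfolding good_def ray_integral_def by (intro conjI) simp_all
  qed
  then show thesis by (rule that)
qed

end

section \<open>Approximation with exact boundary values\<close>

lemma has_real_derivative_max_0_square: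
  "((\<lambda>x::real. (max 0 x)\<^sup>2) has_real_derivative 2 * max 0 x) (at x)"
proof (cases x "0::real" rule: linorder_cases)
  case less
  have "((\<lambda>x::real. 0) has_real_derivative 0) (at x)" by simp
  moreover have "\<forall>\<^sub>F y in nhds x. (max 0 y)\<^sup>2 = (0::real)"
    using eventually_nhds_in_open[of "{..<0}" x] less by (auto elim!: eventually_mono)
  ultimately show ?thesis
    using less DERIV_cong_ev[of x x "\<lambda>y. (max 0 y)\<^sup>2" "\<lambda>_. 0" 0 0] by (simp add: max_def)
next
  case greater
  have "((\<lambda>x::real. x\<^sup>2) has_real_derivative 2 * x) (at x)" by (auto intro!: derivative_eq_intros)
  moreover have "\<forall>\<^sub>F y in nhds x. (max 0 y)\<^sup>2 = y\<^sup>2"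
    using eventually_nhds_in_open[of "{0<..}" x] greater by (auto elim!: eventually_mono)
  ultimately show ?thesis
    using greater DERIV_cong_ev[of x x "\<lambda>y. (max 0 y)\<^sup>2" "\<lambda>y. y\<^sup>2" "2*x" "2*x"] by (simp add: max_def)
next
  case equal
  have "((\<lambda>h::real. max 0 h) \<longlongrightarrow> max 0 0) (at 0)" by (intro tendsto_intros)
  moreover have "(max 0 (0 + h))\<^sup>2 / h = max 0 h" for h :: real
    by (auto simp: max_def power2_eq_square)
  ultimately show ?thesis using equal unfolding DERIV_def by simp
qed

text \<open>Quadratic contact at 1 makes the bump C1 with an explicit derivative, which is all that
  \<open>C1_polar\<close> asks for. The value 1 at 0 lets \<open>radial_cutoff\<close> vanish on
  both boundary circles, while it equals 1 on the annulus at distance at least \<open>h\<close> from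
  both.\<close>

definition edge_bump :: "real \<Rightarrow> real" where "edge_bump t = (max 0 (1 - t))\<^sup>2"

lemma has_real_derivative_edge_bump:
  "(edge_bump has_real_derivative - 2 * max 0 (1 - t)) (at t)"
proof -
  have "((\<lambda>t. 1 - t) has_real_derivative -1) (at t)" by (auto intro!: derivative_eq_intros)
  from DERIV_chain2[OF has_real_derivative_max_0_square this] show ?thesis
    unfolding edge_bump_def[abs_def] by simp
qed

lemma edge_bump_bounds: "0 \<le> t \<Longrightarrow> 0 \<le> edge_bump t" "0 \<le> t \<Longrightarrow> edge_bump t \<le> 1" "1 \<le> t \<Longrightarrow> edge_bump t = 0" "edge_bump 0 = 1"
  by (auto simp: edge_bump_def max_def power_le_one)

definition radial_cutoff :: "real \<Rightarrow> real \<Rightarrow> real \<Rightarrow> real \<Rightarrow> real" where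
  "radial_cutoff a b h r = (1 - edge_bump ((r - a) / h)) * (1 - edge_bump ((b - r) / h))"

definition radial_cutoff_deriv :: "real \<Rightarrow> real \<Rightarrow> real \<Rightarrow> real \<Rightarrow> real" where
  "radial_cutoff_deriv a b h r = 2 / h * (max 0 (1 - (r - a) / h) * (1 - edge_bump ((b - r) / h))
      - max 0 (1 - (b - r) / h) * (1 - edge_bump ((r - a) / h)))"

text \<open>A sum of indicators rather than the indicator of a union: where the two strips overlap
  the value is 2, and integrals against it split without any disjointness.\<close>

definition strip :: "real \<Rightarrow> real \<Rightarrow> real \<Rightarrow> real \<Rightarrow> real" where
  "strip a b h r = indicator {a..a+h} r + indicator {b-h..b} r"

lemma strip_bounds: "0 \<le> strip a b h r" "strip a b h r \<le> 2"
  by (auto simp: strip_def indicator_def)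

lemma has_real_derivative_radial_cutoff:
  assumes "h > 0"
  shows "(radial_cutoff a b h has_real_derivative radial_cutoff_deriv a b h r) (at r)"
proof -
  have 1: "((\<lambda>r. (r - a) / h) has_real_derivative 1 / h) (at r)"
    using assms by (auto intro!: derivative_eq_intros)
  have 2: "((\<lambda>r. (b - r) / h) has_real_derivative - 1 / h) (at r)"
    using assms by (auto intro!: derivative_eq_intros)
  have "((\<lambda>r. (1 - edge_bump ((r - a) / h)) * (1 - edge_bump ((b - r) / h))) has_real_derivative
     (0 - - 2 * max 0 (1 - (r - a) / h) * (1 / h)) * (1 - edge_bump ((b - r) / h))
     + (0 - - 2 * max 0 (1 - (b - r) / h) * (- 1 / h)) * (1 - edge_bump ((r - a) / h))) (at r)"
    by (intro DERIV_mult DERIV_diff DERIV_const DERIV_chain2[OF has_real_derivative_edge_bump] 1 2)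
  then show ?thesis
    unfolding radial_cutoff_def[abs_def]
    by (rule back_subst[of "\<lambda>D. (_ has_real_derivative D) (at r)"]) (simp add: radial_cutoff_deriv_def algebra_simps diff_divide_distrib add_divide_distrib)
qed

lemma continuous_on_radial_cutoff: "h > 0 \<Longrightarrow> continuous_on S (radial_cutoff a b h)"
  by (meson DERIV_isCont continuous_at_imp_continuous_on has_real_derivative_radial_cutoff)

lemma continuous_on_radial_cutoff_deriv: "h > 0 \<Longrightarrow> continuous_on S (radial_cutoff_deriv a b h)"
  unfolding radial_cutoff_deriv_def[abs_def] edge_bump_def by (intro continuous_intros) auto

text \<open>Outside the strips the cutoff is locally 1, so both errors vanish there. Inside, the
  derivative is \<open>2 / h\<close> times a difference of two products with values in
  \<open>[0,1]\<close>; bounding that difference by 2 and squaring gives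
  \<open>16 / h^2\<close>.\<close>

lemma radial_cutoff_estimates:
  assumes h: "h > 0" and r: "r \<in> {a..b}"
  shows "0 \<le> radial_cutoff a b h r" "radial_cutoff a b h r \<le> 1"
    and "(1 - radial_cutoff a b h r)\<^sup>2 \<le> strip a b h r"
    and "(radial_cutoff_deriv a b h r)\<^sup>2 \<le> 16 / h\<^sup>2 * strip a b h r"
proof -
  let ?x = "(r - a) / h" and ?y = "(b - r) / h"
  have xy: "0 \<le> ?x" "0 \<le> ?y" using assms by auto
  note ex = edge_bump_bounds(1,2)[OF xy(1)] and ey = edge_bump_bounds(1,2)[OF xy(2)]
  show c: "0 \<le> radial_cutoff a b h r" "radial_cutoff a b h r \<le> 1"
    unfolding radial_cutoff_def using ex ey by (auto intro!: mult_nonneg_nonneg mult_le_one)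
  have out: "radial_cutoff a b h r = 1" "radial_cutoff_deriv a b h r = 0" if "strip a b h r < 1"
  proof -
    have "\<not> r \<le> a + h" "\<not> b - h \<le> r"
      using that h r by (auto simp: strip_def indicator_def of_bool_def split: if_splits)
    then have "1 \<le> ?x" "1 \<le> ?y" using h by (auto simp: divide_simps)
    then show "radial_cutoff a b h r = 1" "radial_cutoff_deriv a b h r = 0"
      unfolding radial_cutoff_def radial_cutoff_deriv_def using edge_bump_bounds(3) by (auto simp: max_def)
  qed
  show "(1 - radial_cutoff a b h r)\<^sup>2 \<le> strip a b h r"
  proof (cases "strip a b h r < 1")
    case True then show ?thesis using out(1) strip_bounds(1) by simp
  next
    case False
    have "(1 - radial_cutoff a b h r)\<^sup>2 \<le> 1" using c by (intro power_le_one) auto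
    then show ?thesis using False by linarith
  qed
  show "(radial_cutoff_deriv a b h r)\<^sup>2 \<le> 16 / h\<^sup>2 * strip a b h r"
  proof (cases "strip a b h r < 1")
    case True then show ?thesis using out(2) strip_bounds(1) h by simp
  next
    case False
    have m: "0 \<le> max 0 (1 - ?x)" "max 0 (1 - ?x) \<le> 1" "0 \<le> max 0 (1 - ?y)" "max 0 (1 - ?y) \<le> 1" using xy by auto
    have "\<bar>max 0 (1 - ?x) * (1 - edge_bump ?y) - max 0 (1 - ?y) * (1 - edge_bump ?x)\<bar> \<le> 2"
    proof -
      have "0 \<le> max 0 (1 - ?x) * (1 - edge_bump ?y)" "max 0 (1 - ?x) * (1 - edge_bump ?y) \<le> 1"
        "0 \<le> max 0 (1 - ?y) * (1 - edge_bump ?x)" "max 0 (1 - ?y) * (1 - edge_bump ?x) \<le> 1"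
        using m ex ey by (intro mult_nonneg_nonneg mult_le_one; simp)+
      then show ?thesis by linarith
    qed
    then have "\<bar>radial_cutoff_deriv a b h r\<bar> \<le> 2 / h * 2"
      unfolding radial_cutoff_deriv_def abs_mult using h by (intro mult_mono) auto
    then have "(radial_cutoff_deriv a b h r)\<^sup>2 \<le> (2 / h * 2)\<^sup>2"
      by (rule abs_le_square_iff[THEN iffD1, OF order_trans[OF _ abs_ge_self]])
    also have "\<dots> = 16 / h\<^sup>2 * 1" by (simp add: power2_eq_square)
    also have "\<dots> \<le> 16 / h\<^sup>2 * strip a b h r" using False by (intro mult_left_mono) auto
    finally show ?thesis .
  qed
qed

lemma radial_cutoff_ends: "a < b \<Longrightarrow> h > 0 \<Longrightarrow> radial_cutoff a b h a = 0" "a < b \<Longrightarrow> h > 0 \<Longrightarrow> radial_cutoff a b h b = 0"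
  by (simp_all add: radial_cutoff_def edge_bump_bounds)

lemma norm_add_square_le: "(norm (x + y :: 'a::real_normed_vector))\<^sup>2 \<le> 2 * (norm x)\<^sup>2 + 2 * (norm y)\<^sup>2"
proof -
  have "(norm (x + y))\<^sup>2 \<le> (norm x + norm y)\<^sup>2" by (intro power_mono norm_triangle_ineq) auto
  also have "\<dots> \<le> 2 * (norm x)\<^sup>2 + 2 * (norm y)\<^sup>2"
    using sum_squares_bound[of "norm x" "norm y"] by (simp add: power2_sum)
  finally show ?thesis .
qed

lemma measurable_ennreal_norm:
  fixes f g :: "'a \<Rightarrow> complex"
  assumes [measurable]: "f \<in> borel_measurable M"
  shows "(\<lambda>x. ennreal (norm (f x))) \<in> borel_measurable M"
    and "(\<lambda>x. ennreal ((norm (f x))\<^sup>2)) \<in> borel_measurable M"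
    and "g \<in> borel_measurable M \<Longrightarrow> (\<lambda>x. ennreal ((norm (f x))\<^sup>2 + (norm (g x))\<^sup>2)) \<in> borel_measurable M"
  by measurable

text \<open>The oscillation of \<open>f\<close> is at most the integral of \<open>|f'|\<close>, and
  Cauchy-Schwarz on an interval of length at most \<open>h\<close> yields one factor
  \<open>h\<close>, integration over the strip the second. The resulting \<open>h^2\<close>
  compensates the \<open>1 / h^2\<close> of the squared cutoff derivative.\<close>

lemma strip_poincare:
  fixes f f' :: "real \<Rightarrow> complex"
  assumes cd: "c \<le> d" "d - c \<le> h" and x0: "x0 \<in> {c..d}"
    and f: "\<And>r. r \<in> {c..d} \<Longrightarrow> (f has_vector_derivative f' r) (at r within {c..d})" and f': "continuous_on {c..d} f'"
  shows "(\<integral>\<^sup>+r. ennreal ((norm (f r))\<^sup>2) \<partial>ivl c d) \<le> ennreal (2 * h) * ennreal ((norm (f x0))\<^sup>2) + ennreal (2 * h\<^sup>2) * (\<integral>\<^sup>+r. ennreal ((norm (f' r))\<^sup>2) \<partial>ivl c d)"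
proof -
  have h0: "0 \<le> h" using cd by linarith
  define I where "I = integral {c..d} (\<lambda>x. norm (f' x))"
  have I0: "0 \<le> I" unfolding I_def by (intro integral_nonneg integrable_continuous_real continuous_intros f') auto
  have cn: "continuous_on {c..d} (\<lambda>x. norm (f' x))" by (intro continuous_intros f')
  have diff: "norm (f y - f x) \<le> I" if "x \<in> {c..d}" "y \<in> {c..d}" "x \<le> y" for x y
  proof -
    have sub: "{x..y} \<subseteq> {c..d}" using that by auto
    have "(f' has_integral (f y - f x)) {x..y}"
      using that by (intro fundamental_theorem_of_calculus has_vector_derivative_within_subset[OF f sub]) auto
    then have "norm (f y - f x) = norm (integral {x..y} f')" by (simp add: integral_unique)
    also have "\<dots> \<le> integral {x..y} (\<lambda>x. norm (f' x))"
      by (intro integral_norm_bound_integral integrable_continuous_real continuous_on_subset[OF f' sub] continuous_on_subset[OF cn sub]) auto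
    also have "\<dots> \<le> I" unfolding I_def
      by (intro integral_subset_le sub integrable_continuous_real cn continuous_on_subset[OF cn sub]) auto
    finally show ?thesis .
  qed
  have bound: "(norm (f r))\<^sup>2 \<le> 2 * (norm (f x0))\<^sup>2 + 2 * I\<^sup>2" if "r \<in> {c..d}" for r
  proof -
    have "norm (f r - f x0) \<le> I"
      using diff[OF x0 that] diff[OF that x0] by (cases "x0 \<le> r") (auto simp: norm_minus_commute)
    then have "(norm (f r - f x0))\<^sup>2 \<le> I\<^sup>2" by (intro power_mono) auto
    then show ?thesis using norm_add_square_le[of "f x0" "f r - f x0"] by simp
  qed
  have em: "emeasure (ivl c d) (space (ivl c d)) = ennreal (d - c)"
    using cd by (simp add: emeasure_restrict_space)
  have fin: "(\<integral>\<^sup>+r. ennreal ((norm (f' r))\<^sup>2) \<partial>ivl c d) = ennreal (LINT r|ivl c d. (norm (f' r))\<^sup>2)"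
    by (intro nn_integral_eq_integral integral_ivl_continuous(2) continuous_intros f') auto
  have mf: "f' \<in> borel_measurable (ivl c d)" by (rule borel_measurable_ivl_continuous[OF f'])
  have "ennreal (I\<^sup>2) = (\<integral>\<^sup>+r. ennreal (norm (f' r)) * 1 \<partial>ivl c d)\<^sup>2"
  proof -
    have "(\<integral>\<^sup>+r. ennreal (norm (f' r)) \<partial>ivl c d) = ennreal (LINT r|ivl c d. norm (f' r))"
      by (intro nn_integral_eq_integral integral_ivl_continuous(2) cn) auto
    also have "(LINT r|ivl c d. norm (f' r)) = I" unfolding I_def by (rule integral_ivl_continuous(1)[OF cn])
    finally show ?thesis using I0 by (simp add: ennreal_power)
  qed
  also have "\<dots> \<le> (\<integral>\<^sup>+r. (ennreal (norm (f' r)))\<^sup>2 \<partial>ivl c d) * (\<integral>\<^sup>+r. 1\<^sup>2 \<partial>ivl c d)"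
    by (intro Cauchy_Schwarz_nn_integral borel_measurable_const measurable_ennreal_norm mf)
  also have "\<dots> = (\<integral>\<^sup>+r. ennreal ((norm (f' r))\<^sup>2) \<partial>ivl c d) * ennreal (d - c)"
    using em by (simp add: ennreal_power)
  also have "\<dots> \<le> (\<integral>\<^sup>+r. ennreal ((norm (f' r))\<^sup>2) \<partial>ivl c d) * ennreal h"
    using cd by (intro mult_left_mono ennreal_leI) auto
  finally have I2: "ennreal (I\<^sup>2) \<le> (\<integral>\<^sup>+r. ennreal ((norm (f' r))\<^sup>2) \<partial>ivl c d) * ennreal h" .
  have "(\<integral>\<^sup>+r. ennreal ((norm (f r))\<^sup>2) \<partial>ivl c d) \<le> (\<integral>\<^sup>+r. ennreal (2 * (norm (f x0))\<^sup>2 + 2 * I\<^sup>2) \<partial>ivl c d)"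
    using bound by (intro nn_integral_mono ennreal_leI) auto
  also have "\<dots> = ennreal (2 * (norm (f x0))\<^sup>2 + 2 * I\<^sup>2) * ennreal (d - c)"
    using em by simp
  also have "\<dots> \<le> ennreal (2 * (norm (f x0))\<^sup>2 + 2 * I\<^sup>2) * ennreal h"
    using cd by (intro mult_left_mono ennreal_leI) auto
  also have "\<dots> = ennreal (2 * h) * ennreal ((norm (f x0))\<^sup>2) + ennreal (2 * h) * ennreal (I\<^sup>2)"
    using h0 by (simp add: ennreal_mult[symmetric] algebra_simps flip: ennreal_plus)
  also have "\<dots> \<le> ennreal (2 * h) * ennreal ((norm (f x0))\<^sup>2) + ennreal (2 * h) * ((\<integral>\<^sup>+r. ennreal ((norm (f' r))\<^sup>2) \<partial>ivl c d) * ennreal h)"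
    by (intro add_left_mono mult_left_mono I2) auto
  also have "ennreal (2 * h) * ((\<integral>\<^sup>+r. ennreal ((norm (f' r))\<^sup>2) \<partial>ivl c d) * ennreal h) = ennreal (2 * h\<^sup>2) * (\<integral>\<^sup>+r. ennreal ((norm (f' r))\<^sup>2) \<partial>ivl c d)"
  proof -
    have "ennreal (2 * h\<^sup>2) = ennreal (2 * h) * ennreal h"
      using h0 by (simp add: ennreal_mult[symmetric] power2_eq_square)
    then show ?thesis by (simp add: mult_ac)
  qed
  finally show ?thesis .
qed

lemma nn_integral_strip:
  assumes h: "0 < h" "h \<le> b - a" and g: "g \<in> borel_measurable (ivl a b)"
  shows "(\<integral>\<^sup>+r. ennreal (strip a b h r) * g r \<partial>ivl a b) = (\<integral>\<^sup>+r. g r \<partial>ivl a (a+h)) + (\<integral>\<^sup>+r. g r \<partial>ivl (b-h) b)"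
proof -
  have 1: "ivl a (a+h) = restrict_space (ivl a b) {a..a+h}" and 2: "ivl (b-h) b = restrict_space (ivl a b) {b-h..b}"
    using h by (auto simp: restrict_restrict_space intro!: arg_cong[of _ _ "restrict_space lborel"])
  have s: "{a..a+h} \<in> sets (ivl a b)" "{b-h..b} \<in> sets (ivl a b)"
    using h by (auto simp: sets_restrict_space_iff)
  have "(\<integral>\<^sup>+r. ennreal (strip a b h r) * g r \<partial>ivl a b) = (\<integral>\<^sup>+r. g r * indicator {a..a+h} r + g r * indicator {b-h..b} r \<partial>ivl a b)"
    by (intro nn_integral_cong) (auto simp: strip_def indicator_def ennreal_plus[symmetric] distrib_left mult_2 simp del: ennreal_plus)
  also have "\<dots> = (\<integral>\<^sup>+r. g r * indicator {a..a+h} r \<partial>ivl a b) + (\<integral>\<^sup>+r. g r * indicator {b-h..b} r \<partial>ivl a b)"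
    using g s by (intro nn_integral_add borel_measurable_times_ennreal borel_measurable_indicator) auto
  also have "\<dots> = (\<integral>\<^sup>+r. g r \<partial>ivl a (a+h)) + (\<integral>\<^sup>+r. g r \<partial>ivl (b-h) b)"
    unfolding 1 2 nn_integral_restrict_space[OF sets.Int[OF s(1) sets.top]] nn_integral_restrict_space[OF sets.Int[OF s(2) sets.top]] ..
  finally show ?thesis .
qed

lemma strip_measurable: "(\<lambda>p. strip a b h (snd p)) \<in> borel_measurable (polar_rect c d)"
proof -
  have "strip a b h \<in> borel_measurable (ivl c d)"
    unfolding strip_def[abs_def] by (intro measurable_restrict_space1) measurable
  then show ?thesis by (rule measurable_compose[OF measurable_snd])
qed

text \<open>Each ray is treated on its two end intervals separately, the inner one anchored at
  radius \<open>a\<close> and the outer one at \<open>b\<close>, so that exactly the boundary errors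
  appear.\<close>

lemma strip_poincare_polar:
  fixes E Er :: "real \<Rightarrow> real \<Rightarrow> complex"
  assumes ab: "a < b" and h: "0 < h" "h \<le> b - a"
    and cE: "continuous_on ({a..b} \<times> {0..2*pi}) (\<lambda>(r,t). E r t)" and cEr: "continuous_on ({a..b} \<times> {0..2*pi}) (\<lambda>(r,t). Er r t)"
    and d: "\<And>r t. r \<in> {a..b} \<Longrightarrow> t \<in> {0..2*pi} \<Longrightarrow> ((\<lambda>r. E r t) has_vector_derivative Er r t) (at r within {a..b})"
  shows "(\<integral>\<^sup>+p. ennreal (strip a b h (snd p)) * ennreal ((norm (E (snd p) (fst p)))\<^sup>2) \<partial>polar_rect a b)
    \<le> ennreal (2 * h) * (\<integral>\<^sup>+t. ennreal ((norm (E a t))\<^sup>2 + (norm (E b t))\<^sup>2) \<partial>ivl 0 (2*pi))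
      + ennreal (2 * h\<^sup>2) * (\<integral>\<^sup>+p. ennreal (strip a b h (snd p)) * ennreal ((norm (Er (snd p) (fst p)))\<^sup>2) \<partial>polar_rect a b)"
proof -
  let ?S = "\<lambda>F p. ennreal (strip a b h (snd p)) * ennreal ((norm (F (snd p) (fst p)))\<^sup>2)"
  have m2: "(\<lambda>p. F (snd p) (fst p)) \<in> borel_measurable (polar_rect a b)" if "continuous_on ({a..b} \<times> {0..2*pi}) (\<lambda>(r,t). F r t)" for F :: "real \<Rightarrow> real \<Rightarrow> complex"
    using borel_measurable_polar_rect_continuous[OF that] by (simp add: case_prod_beta)
  have m3: "(\<lambda>p. ?S F p) \<in> borel_measurable (polar_rect a b)" if "continuous_on ({a..b} \<times> {0..2*pi}) (\<lambda>(r,t). F r t)" for F :: "real \<Rightarrow> real \<Rightarrow> complex"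
    by (intro borel_measurable_times_ennreal measurable_compose[OF strip_measurable measurable_ennreal]
        measurable_ennreal_norm(2) m2[OF that])
  have fub: "(\<integral>\<^sup>+p. ?S F p \<partial>polar_rect a b) = (\<integral>\<^sup>+t. \<integral>\<^sup>+r. ennreal (strip a b h r) * ennreal ((norm (F r t))\<^sup>2) \<partial>ivl a b \<partial>ivl 0 (2*pi))"
    if "continuous_on ({a..b} \<times> {0..2*pi}) (\<lambda>(r,t). F r t)" for F :: "real \<Rightarrow> real \<Rightarrow> complex"
    using sigma_finite_measure.nn_integral_fst[OF finite_measure_ivl[THEN finite_measure.axioms(1)] m3[OF that]] by simp
  have mt: "(\<lambda>t. F r t) \<in> borel_measurable (ivl 0 (2*pi))" if "continuous_on ({a..b} \<times> {0..2*pi}) (\<lambda>(r,t). F r t)" "r \<in> {a..b}" for F :: "real \<Rightarrow> real \<Rightarrow> complex" and r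
    by (rule borel_measurable_ivl_continuous[OF continuous_on_polar_angle_slice[OF that]])
  have mIr: "(\<lambda>t. \<integral>\<^sup>+r. ennreal (strip a b h r) * ennreal ((norm (Er r t))\<^sup>2) \<partial>ivl a b) \<in> borel_measurable (ivl 0 (2*pi))"
    using sigma_finite_measure.borel_measurable_nn_integral_fst[OF finite_measure_ivl[THEN finite_measure.axioms(1)] m3[OF cEr]] by simp
  have ray: "(\<integral>\<^sup>+r. ennreal (strip a b h r) * ennreal ((norm (E r t))\<^sup>2) \<partial>ivl a b)
      \<le> ennreal (2 * h) * ennreal ((norm (E a t))\<^sup>2 + (norm (E b t))\<^sup>2) + ennreal (2 * h\<^sup>2) * (\<integral>\<^sup>+r. ennreal (strip a b h r) * ennreal ((norm (Er r t))\<^sup>2) \<partial>ivl a b)"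
    if t: "t \<in> {0..2*pi}" for t
  proof -
    have c1: "continuous_on {a..b} (\<lambda>r. E r t)" and c2: "continuous_on {a..b} (\<lambda>r. Er r t)"
      by (rule continuous_on_polar_slice[OF cE t], rule continuous_on_polar_slice[OF cEr t])
    have mm: "(\<lambda>r. ennreal ((norm (F r))\<^sup>2)) \<in> borel_measurable (ivl a b)" if "continuous_on {a..b} F" for F :: "real \<Rightarrow> complex"
      by (intro measurable_ennreal_norm(2) borel_measurable_ivl_continuous that)
    have s1: "{a..a+h} \<subseteq> {a..b}" and s2: "{b-h..b} \<subseteq> {a..b}" using h by auto
    have A: "(\<integral>\<^sup>+r. ennreal ((norm (E r t))\<^sup>2) \<partial>ivl a (a+h)) \<le> ennreal (2 * h) * ennreal ((norm (E a t))\<^sup>2) + ennreal (2 * h\<^sup>2) * (\<integral>\<^sup>+r. ennreal ((norm (Er r t))\<^sup>2) \<partial>ivl a (a+h))"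
      using h s1 t by (intro strip_poincare has_vector_derivative_within_subset[OF d s1] continuous_on_subset[OF c2 s1]) auto
    have B: "(\<integral>\<^sup>+r. ennreal ((norm (E r t))\<^sup>2) \<partial>ivl (b-h) b) \<le> ennreal (2 * h) * ennreal ((norm (E b t))\<^sup>2) + ennreal (2 * h\<^sup>2) * (\<integral>\<^sup>+r. ennreal ((norm (Er r t))\<^sup>2) \<partial>ivl (b-h) b)"
      using h s2 t by (intro strip_poincare has_vector_derivative_within_subset[OF d s2] continuous_on_subset[OF c2 s2]) auto
    show ?thesis
      unfolding nn_integral_strip[OF h mm[OF c1]] nn_integral_strip[OF h mm[OF c2]]
      using add_mono[OF A B] by (simp add: distrib_left add_ac ennreal_plus)
  qed
  have "(\<integral>\<^sup>+p. ?S E p \<partial>polar_rect a b) \<le> (\<integral>\<^sup>+t. ennreal (2 * h) * ennreal ((norm (E a t))\<^sup>2 + (norm (E b t))\<^sup>2) + ennreal (2 * h\<^sup>2) * (\<integral>\<^sup>+r. ennreal (strip a b h r) * ennreal ((norm (Er r t))\<^sup>2) \<partial>ivl a b) \<partial>ivl 0 (2*pi))"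
    unfolding fub[OF cE] by (intro nn_integral_mono ray) simp
  also have "\<dots> = ennreal (2 * h) * (\<integral>\<^sup>+t. ennreal ((norm (E a t))\<^sup>2 + (norm (E b t))\<^sup>2) \<partial>ivl 0 (2*pi)) + ennreal (2 * h\<^sup>2) * (\<integral>\<^sup>+t. \<integral>\<^sup>+r. ennreal (strip a b h r) * ennreal ((norm (Er r t))\<^sup>2) \<partial>ivl a b \<partial>ivl 0 (2*pi))"
  proof -
    have me: "(\<lambda>t. ennreal ((norm (E a t))\<^sup>2 + (norm (E b t))\<^sup>2)) \<in> borel_measurable (ivl 0 (2*pi))"
      using ab by (intro measurable_ennreal_norm(3) mt cE) auto
    show ?thesis
      unfolding nn_integral_add[OF borel_measurable_times_ennreal[OF borel_measurable_const me] borel_measurable_times_ennreal[OF borel_measurable_const mIr]]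
        nn_integral_cmult[OF me] nn_integral_cmult[OF mIr] ..
  qed
  finally show ?thesis unfolding fub[OF cEr] .
qed

lemma nn_strip_tendsto_0:
  assumes ab: "a < b" and g: "g \<in> borel_measurable (polar_rect a b)" "(\<integral>\<^sup>+p. ennreal (g p) \<partial>polar_rect a b) < \<infinity>"
  shows "(\<lambda>n. \<integral>\<^sup>+p. ennreal (strip a b ((b - a) / real (Suc n)) (snd p)) * ennreal (g p) \<partial>polar_rect a b) \<longlonglongrightarrow> 0"
proof -
  let ?h = "\<lambda>n. (b - a) / real (Suc n)"
  have mg: "(\<lambda>p. ennreal (g p)) \<in> borel_measurable (polar_rect a b)"
    by (rule measurable_compose[OF g(1) measurable_ennreal])
  have m: "(\<lambda>p. ennreal (strip a b (?h n) (snd p)) * ennreal (g p)) \<in> borel_measurable (polar_rect a b)" for n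
    by (intro borel_measurable_times_ennreal measurable_compose[OF strip_measurable measurable_ennreal] mg)
  have ae: "AE p in polar_rect a b. snd p \<noteq> a \<and> snd p \<noteq> b"
  proof (rule ivl_pair.AE_pair_measure)
    have "snd \<in> borel_measurable (polar_rect a b)"
      by (rule measurable_compose[OF measurable_snd]) (auto intro: measurable_restrict_space1)
    then show "{x \<in> space (polar_rect a b). snd x \<noteq> a \<and> snd x \<noteq> b} \<in> sets (polar_rect a b)"
      by measurable
    have "AE y in ivl a b. y \<noteq> a \<and> y \<noteq> b"
      using AE_lborel_singleton[of a] AE_lborel_singleton[of b] by (subst AE_restrict_space_iff) auto
    then show "AE x in ivl 0 (2*pi). AE y in ivl a b. snd (x, y) \<noteq> a \<and> snd (x, y) \<noteq> b" by simp
  qed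
  have "(\<lambda>n. \<integral>\<^sup>+p. ennreal (strip a b (?h n) (snd p)) * ennreal (g p) \<partial>polar_rect a b) \<longlonglongrightarrow> (\<integral>\<^sup>+p. 0 \<partial>polar_rect a b)"
  proof (rule nn_integral_dominated_convergence[where w="\<lambda>p. ennreal 2 * ennreal (g p)"])
    show "(\<integral>\<^sup>+p. ennreal 2 * ennreal (g p) \<partial>polar_rect a b) < \<infinity>"
      using g(2) mg by (simp add: nn_integral_cmult ennreal_mult_less_top)
    show "AE p in polar_rect a b. ennreal (strip a b (?h n) (snd p)) * ennreal (g p) \<le> ennreal 2 * ennreal (g p)" for n
      by (intro AE_I2 mult_right_mono ennreal_leI strip_bounds) simp
    show "AE p in polar_rect a b. (\<lambda>n. ennreal (strip a b (?h n) (snd p)) * ennreal (g p)) \<longlonglongrightarrow> 0"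
      using ae AE_space
    proof eventually_elim
      fix p assume p: "snd p \<noteq> a \<and> snd p \<noteq> b" "p \<in> space (polar_rect a b)"
      then have r: "a < snd p" "snd p < b" by (auto simp: space_pair_measure)
      have "(\<lambda>n. (b - a) * inverse (real (Suc n))) \<longlonglongrightarrow> (b - a) * 0"
        by (intro tendsto_intros LIMSEQ_inverse_real_of_nat)
      then have "eventually (\<lambda>n. (b - a) * inverse (real (Suc n)) < min (snd p - a) (b - snd p)) sequentially"
        by (rule order_tendstoD(2)) (use r in simp)
      then have "eventually (\<lambda>n. ennreal (strip a b (?h n) (snd p)) * ennreal (g p) = 0) sequentially"
      proof eventually_elim
        fix n assume "(b - a) * inverse (real (Suc n)) < min (snd p - a) (b - snd p)"
        then have "?h n < snd p - a" "?h n < b - snd p" by (simp_all add: divide_inverse)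
        then have "strip a b (?h n) (snd p) = 0" unfolding strip_def by (simp add: indicator_def del: of_nat_Suc)
        then show "ennreal (strip a b (?h n) (snd p)) * ennreal (g p) = 0" by simp
      qed
      then show "(\<lambda>n. ennreal (strip a b (?h n) (snd p)) * ennreal (g p)) \<longlonglongrightarrow> 0"
        by (rule tendsto_eventually)
    qed
  qed (use m mg in auto)
  then show ?thesis by simp
qed

definition L2_distance :: "'a measure \<Rightarrow> ('a \<Rightarrow> complex) \<Rightarrow> ('a \<Rightarrow> complex) \<Rightarrow> ennreal" where
  "L2_distance M f g = (\<integral>\<^sup>+x. ennreal ((norm (f x - g x))\<^sup>2) \<partial>M)"

lemma measurable_norm_square:
  fixes f :: "'a \<Rightarrow> complex"
  assumes [measurable]: "f \<in> borel_measurable M" shows "(\<lambda>x. (norm (f x))\<^sup>2) \<in> borel_measurable M"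
  by measurable

lemma nn_integral_lincomb:
  fixes f g :: "'a \<Rightarrow> real"
  assumes [measurable]: "f \<in> borel_measurable M" "g \<in> borel_measurable M"
    and "\<And>x. 0 \<le> f x" "\<And>x. 0 \<le> g x" "0 \<le> c" "0 \<le> d"
  shows "(\<integral>\<^sup>+x. ennreal (c * f x + d * g x) \<partial>M) = ennreal c * (\<integral>\<^sup>+x. ennreal (f x) \<partial>M) + ennreal d * (\<integral>\<^sup>+x. ennreal (g x) \<partial>M)"
proof -
  have "ennreal (c * f x + d * g x) = ennreal c * ennreal (f x) + ennreal d * ennreal (g x)" for x
    using assms by (simp add: ennreal_mult)
  then show ?thesis by (simp add: nn_integral_add nn_integral_cmult)
qed

text \<open>The corrected map is \<open>X + eta (W - X)\<close>, where \<open>X\<close> is the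
  identity in polar form and \<open>eta\<close> the cutoff, so it equals \<open>X\<close> on both
  circles. \<open>F\<close> is the distance of \<open>W\<close> from the limit, \<open>G\<close>
  that of the identity restricted to the strips, \<open>B\<close> the boundary error. The constants
  400 and 100 are generous: the worst case, the radial derivative, needs 260, 132 and 64.\<close>

lemma cutoff_error:
  fixes W Wr Wt :: "real \<Rightarrow> real \<Rightarrow> complex" and V Vr Vt :: "real \<times> real \<Rightarrow> complex"
  assumes a: "0 < a" "a < b" and h: "0 < h" "h \<le> b - a"
    and W: "C1_polar a b W Wr Wt"
    and per: "\<And>r. r \<in> {a..b} \<Longrightarrow> W r 0 = W r (2*pi)" "\<And>r. r \<in> {a..b} \<Longrightarrow> Wr r 0 = Wr r (2*pi)"
    and m [measurable]: "V \<in> borel_measurable (polar_rect a b)" "Vr \<in> borel_measurable (polar_rect a b)" "Vt \<in> borel_measurable (polar_rect a b)"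
  defines "F \<equiv> L2_distance (polar_rect a b) (\<lambda>p. W (snd p) (fst p)) V + L2_distance (polar_rect a b) (\<lambda>p. Wr (snd p) (fst p)) Vr + L2_distance (polar_rect a b) (\<lambda>p. Wt (snd p) (fst p)) Vt"
    and "B \<equiv> (\<integral>\<^sup>+t. ennreal ((norm (W a t - of_real a * cis t))\<^sup>2 + (norm (W b t - of_real b * cis t))\<^sup>2) \<partial>ivl 0 (2*pi))"
    and "G \<equiv> (\<integral>\<^sup>+p. ennreal (strip a b h (snd p)) * ennreal ((norm (of_real (snd p) * cis (fst p) - V p))\<^sup>2 + (norm (cis (fst p) - Vr p))\<^sup>2 + (norm (of_real (snd p) * (\<i> * cis (fst p)) - Vt p))\<^sup>2) \<partial>polar_rect a b)"
  shows "\<exists>Z Zr Zt. C1_polar a b Z Zr Zt \<and> (\<forall>r\<in>{a..b}. Z r 0 = Z r (2*pi) \<and> Zr r 0 = Zr r (2*pi)) \<and>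
    (\<forall>t. Z a t = of_real a * cis t \<and> Z b t = of_real b * cis t) \<and>
    L2_distance (polar_rect a b) (\<lambda>p. Z (snd p) (fst p)) V \<le> 400 * F + 400 * G + ennreal (100 / h) * B \<and>
    L2_distance (polar_rect a b) (\<lambda>p. Zr (snd p) (fst p)) Vr \<le> 400 * F + 400 * G + ennreal (100 / h) * B \<and>
    L2_distance (polar_rect a b) (\<lambda>p. Zt (snd p) (fst p)) Vt \<le> 400 * F + 400 * G + ennreal (100 / h) * B"
proof -
  let ?K = "{a..b} \<times> {0..2*pi}" and ?R = "polar_rect a b"
  let ?eta = "radial_cutoff a b h" and ?deta = "radial_cutoff_deriv a b h"
  define X where "X r t = complex_of_real r * cis t" for r t
  define Xt where "Xt r t = complex_of_real r * (\<i> * cis t)" for r t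
  define E where "E r t = W r t - X r t" for r t
  define Er where "Er r t = Wr r t - cis t" for r t
  define Z where "Z r t = X r t + of_real (?eta r) * E r t" for r t
  define Zr where "Zr r t = cis t + (of_real (?eta r) * Er r t + of_real (?deta r) * E r t)" for r t
  define Zt where "Zt r t = Xt r t + of_real (?eta r) * (Wt r t - Xt r t)" for r t
  have cW: "continuous_on ?K (\<lambda>p. W (fst p) (snd p))" and cWr: "continuous_on ?K (\<lambda>p. Wr (fst p) (snd p))" and cWt: "continuous_on ?K (\<lambda>p. Wt (fst p) (snd p))"
    and dr: "\<And>r t. r \<in> {a..b} \<Longrightarrow> t \<in> {0..2*pi} \<Longrightarrow> ((\<lambda>r. W r t) has_vector_derivative Wr r t) (at r within {a..b})"
    and dt: "\<And>r t. r \<in> {a..b} \<Longrightarrow> t \<in> {0..2*pi} \<Longrightarrow> ((\<lambda>t. W r t) has_vector_derivative Wt r t) (at t within {0..2*pi})"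
    using W unfolding C1_polar_def by (simp_all add: case_prod_beta)
  have ccis: "continuous_on ?K (\<lambda>p. cis (snd p))" by (intro continuous_intros)
  have ceta: "continuous_on ?K (\<lambda>p. ?eta (fst p))" "continuous_on ?K (\<lambda>p. ?deta (fst p))"
    by (rule continuous_on_compose2[OF continuous_on_radial_cutoff[OF h(1), of UNIV]], auto intro: continuous_intros)
       (rule continuous_on_compose2[OF continuous_on_radial_cutoff_deriv[OF h(1), of UNIV]], auto intro: continuous_intros)
  have cX: "continuous_on ?K (\<lambda>p. X (fst p) (snd p))" "continuous_on ?K (\<lambda>p. Xt (fst p) (snd p))"
    unfolding X_def Xt_def by (intro continuous_intros ccis)+
  have cE: "continuous_on ?K (\<lambda>p. E (fst p) (snd p))" "continuous_on ?K (\<lambda>p. Er (fst p) (snd p))"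
    unfolding E_def Er_def by (intro continuous_intros cW cWr cX ccis)+
  have dX: "((\<lambda>r. X r t) has_vector_derivative cis t) (at r within S)" for r t S
  proof -
    have "((\<lambda>r. r *\<^sub>R cis t) has_vector_derivative 1 *\<^sub>R cis t) (at r within S)"
      unfolding has_vector_derivative_def by (auto intro!: derivative_eq_intros)
    then show ?thesis by (simp add: X_def scaleR_conv_of_real)
  qed
  have dXt: "((\<lambda>t. X r t) has_vector_derivative Xt r t) (at t within S)" for r t S
    unfolding X_def Xt_def by (intro has_vector_derivative_mult_right has_vector_derivative_cis)
  have dE: "((\<lambda>r. E r t) has_vector_derivative Er r t) (at r within {a..b})" if "r \<in> {a..b}" "t \<in> {0..2*pi}" for r t
    unfolding E_def Er_def by (intro has_vector_derivative_diff dr dX that)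
  have deta: "((\<lambda>r. complex_of_real (?eta r)) has_vector_derivative of_real (?deta r)) (at r within {a..b})" for r
    by (rule has_vector_derivative_of_real[OF has_field_derivative_at_within[OF has_real_derivative_radial_cutoff[OF h(1)]]])
  have C1: "C1_polar a b Z Zr Zt"
    unfolding C1_polar_def case_prod_beta
  proof (intro conjI ballI)
    show "continuous_on ?K (\<lambda>p. Z (fst p) (snd p))" "continuous_on ?K (\<lambda>p. Zr (fst p) (snd p))" "continuous_on ?K (\<lambda>p. Zt (fst p) (snd p))"
      unfolding Z_def Zr_def Zt_def by (intro continuous_intros cX cE ceta ccis cWt)+
    fix r t assume rt: "r \<in> {a..b}" "t \<in> {0..2*pi}"
    show "((\<lambda>r. Z r t) has_vector_derivative Zr r t) (at r within {a..b})"
      unfolding Z_def Zr_def by (intro has_vector_derivative_add dX has_vector_derivative_mult deta dE rt)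
    show "((\<lambda>t. Z r t) has_vector_derivative Zt r t) (at t within {0..2*pi})"
      unfolding Z_def Zt_def E_def by (intro has_vector_derivative_add dXt has_vector_derivative_mult_right has_vector_derivative_diff dt rt)
  qed
  have mR: "(\<lambda>p. f (snd p) (fst p)) \<in> borel_measurable ?R" if "continuous_on ?K (\<lambda>p. f (fst p) (snd p))" for f :: "real \<Rightarrow> real \<Rightarrow> complex"
    using borel_measurable_polar_rect_continuous[of a b 0 "2*pi" f] that by (simp add: case_prod_beta)
  have mcis: "(\<lambda>p. cis (fst p)) \<in> borel_measurable ?R" using mR[of "\<lambda>r t. cis t"] ccis by simp
  note mW = mR[OF cW] and mWr = mR[OF cWr] and mWt = mR[OF cWt] and mX = mR[OF cX(1)] and mXt = mR[OF cX(2)] and mE = mR[OF cE(1)] and mEr = mR[OF cE(2)]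
  define w where "w p = (norm (W (snd p) (fst p) - V p))\<^sup>2" for p
  define wr where "wr p = (norm (Wr (snd p) (fst p) - Vr p))\<^sup>2" for p
  define wt where "wt p = (norm (Wt (snd p) (fst p) - Vt p))\<^sup>2" for p
  define x where "x p = (norm (X (snd p) (fst p) - V p))\<^sup>2" for p
  define xr where "xr p = (norm (cis (fst p) - Vr p))\<^sup>2" for p
  define xt where "xt p = (norm (Xt (snd p) (fst p) - Vt p))\<^sup>2" for p
  define ee where "ee p = (norm (E (snd p) (fst p)))\<^sup>2" for p :: "real \<times> real"
  define er where "er p = (norm (Er (snd p) (fst p)))\<^sup>2" for p :: "real \<times> real"
  define s where "s p = strip a b h (snd p)" for p :: "real \<times> real"
  have ms [measurable]: "s \<in> borel_measurable ?R" unfolding s_def[abs_def] by (rule strip_measurable)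
  have meas: "w \<in> borel_measurable ?R" "wr \<in> borel_measurable ?R" "wt \<in> borel_measurable ?R" "x \<in> borel_measurable ?R"
    "xr \<in> borel_measurable ?R" "xt \<in> borel_measurable ?R" "ee \<in> borel_measurable ?R" "er \<in> borel_measurable ?R"
    unfolding w_def[abs_def] wr_def[abs_def] wt_def[abs_def] x_def[abs_def] xr_def[abs_def] xt_def[abs_def] ee_def[abs_def] er_def[abs_def]
    by (intro measurable_norm_square borel_measurable_diff mW mWr mWt mX mXt mE mEr mcis m)+
  note meas[measurable]
  have nn: "0 \<le> w p" "0 \<le> wr p" "0 \<le> wt p" "0 \<le> x p" "0 \<le> xr p" "0 \<le> xt p" "0 \<le> ee p" "0 \<le> er p" "0 \<le> s p" "s p \<le> 2" for p
    by (auto simp: w_def wr_def wt_def x_def xr_def xt_def ee_def er_def s_def strip_bounds)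
  have space: "snd p \<in> {a..b}" "fst p \<in> {0..2*pi}" if "p \<in> space ?R" for p
    using that by (auto simp: space_pair_measure)
  have F: "F = (\<integral>\<^sup>+p. ennreal (w p + wr p + wt p) \<partial>?R)"
    unfolding F_def L2_distance_def using nn
    by (simp add: w_def[symmetric] wr_def[symmetric] wt_def[symmetric] nn_integral_add)
  have G: "G = (\<integral>\<^sup>+p. ennreal (s p * (x p + xr p + xt p)) \<partial>?R)"
    unfolding G_def using nn by (simp add: ennreal_mult x_def xr_def xt_def s_def X_def Xt_def)
  have B: "B = (\<integral>\<^sup>+t. ennreal ((norm (E a t))\<^sup>2 + (norm (E b t))\<^sup>2) \<partial>ivl 0 (2*pi))"
    unfolding B_def E_def X_def ..
  have simple: "L2_distance ?R (\<lambda>p. U (snd p) (fst p)) U' \<le> 400 * F + 400 * G + ennreal (100 / h) * B"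
    if le: "\<And>p. p \<in> space ?R \<Longrightarrow> (norm (U (snd p) (fst p) - U' p))\<^sup>2 \<le> 2 * (w p + wr p + wt p) + 2 * (s p * (x p + xr p + xt p))" for U :: "real \<Rightarrow> real \<Rightarrow> complex" and U'
  proof -
    have "L2_distance ?R (\<lambda>p. U (snd p) (fst p)) U' \<le> (\<integral>\<^sup>+p. ennreal (2 * (w p + wr p + wt p) + 2 * (s p * (x p + xr p + xt p))) \<partial>?R)"
      unfolding L2_distance_def by (intro nn_integral_mono ennreal_leI le)
    also have "\<dots> = 2 * F + 2 * G"
      unfolding F G
      by (subst nn_integral_lincomb[of "\<lambda>p. w p + wr p + wt p" _ "\<lambda>p. s p * (x p + xr p + xt p)"])
        (use nn in \<open>auto intro!: mult_nonneg_nonneg add_nonneg_nonneg\<close>)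
    also have "\<dots> \<le> 400 * F + 400 * G + ennreal (100 / h) * B"
      by (intro add_increasing2 add_mono mult_right_mono) auto
    finally show ?thesis .
  qed
  \<comment> \<open>The error of a convex combination is the same combination of errors,
    \<open>e (D - C) + (1 - e) (A - C)\<close>, and the weight \<open>1 - e\<close> of the second is
    confined to the strips.\<close>
  have convex: "(norm (A + of_real e * (D - A) - C))\<^sup>2 \<le> 2 * (norm (D - C))\<^sup>2 + 2 * (k * (norm (A - C))\<^sup>2)"
    if e: "0 \<le> e" "e \<le> 1" "(1 - e)\<^sup>2 \<le> k" for A D C :: complex and e k :: real
  proof -
    have "A + of_real e * (D - A) - C = of_real e * (D - C) + of_real (1 - e) * (A - C)" by (simp add: algebra_simps)
    then have "(norm (A + of_real e * (D - A) - C))\<^sup>2 \<le> 2 * (norm (of_real e * (D - C)))\<^sup>2 + 2 * (norm (of_real (1 - e) * (A - C)))\<^sup>2"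
      using norm_add_square_le[of "of_real e * (D - C)" "of_real (1 - e) * (A - C)"] by (simp only:)
    also have "(norm (of_real e * (D - C)))\<^sup>2 \<le> 1 * (norm (D - C))\<^sup>2"
      unfolding norm_mult norm_of_real power_mult_distrib using e by (intro mult_right_mono power_le_one) auto
    also have "(norm (of_real (1 - e) * (A - C)))\<^sup>2 \<le> k * (norm (A - C))\<^sup>2"
      unfolding norm_mult norm_of_real power_mult_distrib using e by (intro mult_right_mono) auto
    finally show ?thesis by simp
  qed
  have cut: "0 \<le> ?eta (snd p)" "?eta (snd p) \<le> 1" "(1 - ?eta (snd p))\<^sup>2 \<le> s p" "(?deta (snd p))\<^sup>2 \<le> 16 / h\<^sup>2 * s p" if "p \<in> space ?R" for p
    using radial_cutoff_estimates[OF h(1) space(1)[OF that]] by (simp_all add: s_def)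
  have c: "L2_distance ?R (\<lambda>p. Z (snd p) (fst p)) V \<le> 400 * F + 400 * G + ennreal (100 / h) * B"
  proof (rule simple)
    fix p assume p: "p \<in> space ?R"
    have "(norm (Z (snd p) (fst p) - V p))\<^sup>2 \<le> 2 * w p + 2 * (s p * x p)"
      unfolding Z_def E_def w_def x_def by (rule convex[OF cut(1-3)[OF p]])
    also have "\<dots> \<le> 2 * (w p + wr p + wt p) + 2 * (s p * (x p + xr p + xt p))"
      using nn[of p] by (intro add_mono mult_left_mono) auto
    finally show "(norm (Z (snd p) (fst p) - V p))\<^sup>2 \<le> 2 * (w p + wr p + wt p) + 2 * (s p * (x p + xr p + xt p))" .
  qed
  have ct: "L2_distance ?R (\<lambda>p. Zt (snd p) (fst p)) Vt \<le> 400 * F + 400 * G + ennreal (100 / h) * B"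
  proof (rule simple)
    fix p assume p: "p \<in> space ?R"
    have "(norm (Zt (snd p) (fst p) - Vt p))\<^sup>2 \<le> 2 * wt p + 2 * (s p * xt p)"
      unfolding Zt_def wt_def xt_def by (rule convex[OF cut(1-3)[OF p]])
    also have "\<dots> \<le> 2 * (w p + wr p + wt p) + 2 * (s p * (x p + xr p + xt p))"
      using nn[of p] by (intro add_mono mult_left_mono) auto
    finally show "(norm (Zt (snd p) (fst p) - Vt p))\<^sup>2 \<le> 2 * (w p + wr p + wt p) + 2 * (s p * (x p + xr p + xt p))" .
  qed
  have poin: "(\<integral>\<^sup>+p. ennreal (s p * ee p) \<partial>?R) \<le> ennreal (2 * h) * B + ennreal (2 * h\<^sup>2) * (\<integral>\<^sup>+p. ennreal (s p * er p) \<partial>?R)"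
    using strip_poincare_polar[OF a(2) h _ _ dE] cE nn
    unfolding B s_def ee_def er_def by (simp add: case_prod_beta ennreal_mult strip_bounds)
  have er_le: "(\<integral>\<^sup>+p. ennreal (s p * er p) \<partial>?R) \<le> 4 * F + 2 * G"
  proof -
    have "(\<integral>\<^sup>+p. ennreal (s p * er p) \<partial>?R) \<le> (\<integral>\<^sup>+p. ennreal (4 * (w p + wr p + wt p) + 2 * (s p * (x p + xr p + xt p))) \<partial>?R)"
    proof (intro nn_integral_mono ennreal_leI)
      fix p
      have "Er (snd p) (fst p) = (Wr (snd p) (fst p) - Vr p) + - (cis (fst p) - Vr p)" by (simp add: Er_def)
      then have "er p \<le> 2 * wr p + 2 * xr p"
        unfolding er_def wr_def xr_def using norm_add_square_le[of "Wr (snd p) (fst p) - Vr p" "- (cis (fst p) - Vr p)"]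
        by (simp only: norm_minus_cancel)
      then have "s p * er p \<le> s p * (2 * wr p + 2 * xr p)" using nn by (intro mult_left_mono)
      also have "\<dots> = s p * (2 * wr p) + 2 * (s p * xr p)" by (simp add: algebra_simps)
      also have "\<dots> \<le> 2 * (2 * wr p) + 2 * (s p * (x p + xr p + xt p))"
        using nn[of p] by (intro add_mono mult_right_mono mult_left_mono) auto
      also have "\<dots> \<le> 4 * (w p + wr p + wt p) + 2 * (s p * (x p + xr p + xt p))" using nn[of p] by simp
      finally show "s p * er p \<le> 4 * (w p + wr p + wt p) + 2 * (s p * (x p + xr p + xt p))" .
    qed
    also have "\<dots> = 4 * F + 2 * G"
      unfolding F G
      by (subst nn_integral_lincomb[of "\<lambda>p. w p + wr p + wt p" _ "\<lambda>p. s p * (x p + xr p + xt p)"])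
        (use nn in \<open>auto intro!: mult_nonneg_nonneg add_nonneg_nonneg\<close>)
    finally show ?thesis .
  qed
  \<comment> \<open>The critical case: differentiation of the cutoff produces the cutoff derivative
    times \<open>E\<close>, of order \<open>1 / h\<close> on the strips. The Poincare estimate
    bounds it by the radial derivative of \<open>E\<close> and the boundary error, the latter with a
    remaining factor \<open>1 / h\<close>.\<close>
  have cr: "L2_distance ?R (\<lambda>p. Zr (snd p) (fst p)) Vr \<le> 400 * F + 400 * G + ennreal (100 / h) * B"
  proof -
    have "L2_distance ?R (\<lambda>p. Zr (snd p) (fst p)) Vr \<le> (\<integral>\<^sup>+p. ennreal (4 * (w p + wr p + wt p) + 4 * (s p * (x p + xr p + xt p)) + 32 / h\<^sup>2 * (s p * ee p)) \<partial>?R)"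
      unfolding L2_distance_def
    proof (intro nn_integral_mono ennreal_leI)
      fix p assume p: "p \<in> space ?R"
      have "Zr (snd p) (fst p) - Vr p = (cis (fst p) + of_real (?eta (snd p)) * (Wr (snd p) (fst p) - cis (fst p)) - Vr p) + of_real (?deta (snd p)) * E (snd p) (fst p)"
        by (simp add: Zr_def Er_def)
      then have "(norm (Zr (snd p) (fst p) - Vr p))\<^sup>2 \<le> 2 * (norm (cis (fst p) + of_real (?eta (snd p)) * (Wr (snd p) (fst p) - cis (fst p)) - Vr p))\<^sup>2
          + 2 * (norm (of_real (?deta (snd p)) * E (snd p) (fst p)))\<^sup>2"
        by (simp only: norm_add_square_le)
      also have "(norm (cis (fst p) + of_real (?eta (snd p)) * (Wr (snd p) (fst p) - cis (fst p)) - Vr p))\<^sup>2 \<le> 2 * wr p + 2 * (s p * xr p)"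
        unfolding wr_def xr_def by (rule convex[OF cut(1-3)[OF p]])
      also have "(norm (of_real (?deta (snd p)) * E (snd p) (fst p)))\<^sup>2 \<le> 16 / h\<^sup>2 * s p * ee p"
        unfolding norm_mult norm_of_real power_mult_distrib ee_def using cut(4)[OF p] by (intro mult_right_mono) auto
      finally have "(norm (Zr (snd p) (fst p) - Vr p))\<^sup>2 \<le> 2 * (2 * wr p + 2 * (s p * xr p)) + 2 * (16 / h\<^sup>2 * s p * ee p)" by simp
      also have "\<dots> = 4 * wr p + 4 * (s p * xr p) + 32 / h\<^sup>2 * (s p * ee p)" by simp
      also have "\<dots> \<le> 4 * (w p + wr p + wt p) + 4 * (s p * (x p + xr p + xt p)) + 32 / h\<^sup>2 * (s p * ee p)"
        using nn[of p] by (intro add_mono mult_left_mono) auto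
      finally show "(norm (Zr (snd p) (fst p) - Vr p))\<^sup>2 \<le> 4 * (w p + wr p + wt p) + 4 * (s p * (x p + xr p + xt p)) + 32 / h\<^sup>2 * (s p * ee p)" .
    qed
    also have "\<dots> = (4 * F + 4 * G) + ennreal (32 / h\<^sup>2) * (\<integral>\<^sup>+p. ennreal (s p * ee p) \<partial>?R)"
    proof -
      have "ennreal (4 * (w p + wr p + wt p) + 4 * (s p * (x p + xr p + xt p)) + 32 / h\<^sup>2 * (s p * ee p))
         = 4 * ennreal (w p + wr p + wt p) + 4 * ennreal (s p * (x p + xr p + xt p)) + ennreal (32 / h\<^sup>2) * ennreal (s p * ee p)" for p
      proof -
        have n: "0 \<le> w p + wr p + wt p" "0 \<le> s p * (x p + xr p + xt p)" "0 \<le> s p * ee p" "0 \<le> 32 / h\<^sup>2" using nn[of p] by auto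
        have "ennreal (4 * u + 4 * v + k * z) = 4 * ennreal u + 4 * ennreal v + ennreal k * ennreal z"
          if "0 \<le> u" "0 \<le> v" "0 \<le> z" "0 \<le> k" for u v z k :: real
          using that by (simp add: ennreal_mult)
        from this[OF n] show ?thesis .
      qed
      then show ?thesis unfolding F G by (simp add: nn_integral_add nn_integral_cmult)
    qed
    also have "\<dots> \<le> (4 * F + 4 * G) + ennreal (32 / h\<^sup>2) * (ennreal (2 * h) * B + ennreal (2 * h\<^sup>2) * (4 * F + 2 * G))"
      by (intro add_left_mono mult_left_mono order_trans[OF poin] er_le) auto
    also have "\<dots> = (4 * F + 4 * G) + (ennreal (64 / h) * B + 64 * (4 * F + 2 * G))"
    proof -
      have "ennreal (32 / h\<^sup>2) * ennreal (2 * h) = ennreal (64 / h)" "ennreal (32 / h\<^sup>2) * ennreal (2 * h\<^sup>2) = ennreal 64"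
        using h by (simp_all add: ennreal_mult[symmetric] power2_eq_square)
      then show ?thesis by (simp add: distrib_left mult.assoc[symmetric])
    qed
    also have "\<dots> = 260 * F + 132 * G + ennreal (64 / h) * B"
    proof -
      have "(4 * F + 4 * G) + (u + 64 * (4 * F + 2 * G)) = (4 + 256) * F + (4 + 128) * G + u" for u
        by (simp only: distrib_left distrib_right mult.assoc[symmetric]) (simp add: add_ac)
      then show ?thesis by simp
    qed
    also have "\<dots> \<le> 400 * F + 400 * G + ennreal (100 / h) * B"
      using h by (intro add_mono mult_right_mono ennreal_leI divide_right_mono) auto
    finally show ?thesis .
  qed
  have pr: "Z r 0 = Z r (2*pi) \<and> Zr r 0 = Zr r (2*pi)" if "r \<in> {a..b}" for r
    using per[OF that] by (simp add: Z_def Zr_def E_def Er_def X_def)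
  have bd: "Z a t = of_real a * cis t \<and> Z b t = of_real b * cis t" for t
    using radial_cutoff_ends[OF a(2) h(1)] by (simp add: Z_def X_def)
  show ?thesis using C1 pr bd c cr ct by blast
qed

text \<open>A diagonal choice. The width of the strips is fixed first and tends to 0 with
  \<open>k\<close>, which makes \<open>G k\<close> small; the index of the approximant is chosen
  afterwards, so large that its boundary error is small even after division by that width.\<close>

lemma exact_boundary_approximation:
  fixes W Wr Wt :: "nat \<Rightarrow> real \<Rightarrow> real \<Rightarrow> complex" and V Vr Vt :: "real \<times> real \<Rightarrow> complex"
  assumes a: "0 < a" "a < b"
    and W: "\<And>n. C1_polar a b (W n) (Wr n) (Wt n)"
    and per: "\<And>n r. r \<in> {a..b} \<Longrightarrow> W n r 0 = W n r (2*pi)" "\<And>n r. r \<in> {a..b} \<Longrightarrow> Wr n r 0 = Wr n r (2*pi)"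
    and m [measurable]: "V \<in> borel_measurable (polar_rect a b)" "Vr \<in> borel_measurable (polar_rect a b)" "Vt \<in> borel_measurable (polar_rect a b)"
    and L2: "(\<integral>\<^sup>+p. ennreal ((norm (V p))\<^sup>2) \<partial>polar_rect a b) < \<infinity>" "(\<integral>\<^sup>+p. ennreal ((norm (Vr p))\<^sup>2) \<partial>polar_rect a b) < \<infinity>" "(\<integral>\<^sup>+p. ennreal ((norm (Vt p))\<^sup>2) \<partial>polar_rect a b) < \<infinity>"
    and lim: "(\<lambda>n. L2_distance (polar_rect a b) (\<lambda>p. W n (snd p) (fst p)) V) \<longlonglongrightarrow> 0"
      "(\<lambda>n. L2_distance (polar_rect a b) (\<lambda>p. Wr n (snd p) (fst p)) Vr) \<longlonglongrightarrow> 0"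
      "(\<lambda>n. L2_distance (polar_rect a b) (\<lambda>p. Wt n (snd p) (fst p)) Vt) \<longlonglongrightarrow> 0"
    and bd: "(\<lambda>n. \<integral>\<^sup>+t. ennreal ((norm (W n a t - of_real a * cis t))\<^sup>2 + (norm (W n b t - of_real b * cis t))\<^sup>2) \<partial>ivl 0 (2*pi)) \<longlonglongrightarrow> 0"
  obtains Z Zr Zt :: "nat \<Rightarrow> real \<Rightarrow> real \<Rightarrow> complex" where
    "\<And>n. C1_polar a b (Z n) (Zr n) (Zt n)"
    "\<And>n r. r \<in> {a..b} \<Longrightarrow> Z n r 0 = Z n r (2*pi)" "\<And>n r. r \<in> {a..b} \<Longrightarrow> Zr n r 0 = Zr n r (2*pi)"
    "\<And>n t. Z n a t = of_real a * cis t" "\<And>n t. Z n b t = of_real b * cis t"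
    "(\<lambda>n. L2_distance (polar_rect a b) (\<lambda>p. Z n (snd p) (fst p)) V) \<longlonglongrightarrow> 0"
    "(\<lambda>n. L2_distance (polar_rect a b) (\<lambda>p. Zr n (snd p) (fst p)) Vr) \<longlonglongrightarrow> 0"
    "(\<lambda>n. L2_distance (polar_rect a b) (\<lambda>p. Zt n (snd p) (fst p)) Vt) \<longlonglongrightarrow> 0"
proof -
  let ?R = "polar_rect a b"
  let ?h = "\<lambda>n. (b - a) / real (Suc n)"
  define F where "F n = L2_distance ?R (\<lambda>p. W n (snd p) (fst p)) V + L2_distance ?R (\<lambda>p. Wr n (snd p) (fst p)) Vr + L2_distance ?R (\<lambda>p. Wt n (snd p) (fst p)) Vt" for n
  define B where "B n = (\<integral>\<^sup>+t. ennreal ((norm (W n a t - of_real a * cis t))\<^sup>2 + (norm (W n b t - of_real b * cis t))\<^sup>2) \<partial>ivl 0 (2*pi))" for n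
  define g where "g p = (norm (of_real (snd p) * cis (fst p) - V p))\<^sup>2 + (norm (cis (fst p) - Vr p))\<^sup>2 + (norm (of_real (snd p) * (\<i> * cis (fst p)) - Vt p))\<^sup>2" for p
  define G where "G n = (\<integral>\<^sup>+p. ennreal (strip a b (?h n) (snd p)) * ennreal (g p) \<partial>?R)" for n
  define T where "T n k = 400 * F n + 400 * G k + ennreal (100 / ?h k) * B n" for n k
  have h: "0 < ?h k" "?h k \<le> b - a" for k using a by (simp_all add: divide_le_eq)
  define P where "P n k Z Zr Zt \<longleftrightarrow> C1_polar a b Z Zr Zt \<and> (\<forall>r\<in>{a..b}. Z r 0 = Z r (2*pi) \<and> Zr r 0 = Zr r (2*pi)) \<and>
    (\<forall>t. Z a t = of_real a * cis t \<and> Z b t = of_real b * cis t) \<and>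
    L2_distance ?R (\<lambda>p. Z (snd p) (fst p)) V \<le> T n k \<and>
    L2_distance ?R (\<lambda>p. Zr (snd p) (fst p)) Vr \<le> T n k \<and>
    L2_distance ?R (\<lambda>p. Zt (snd p) (fst p)) Vt \<le> T n k" for n k Z Zr Zt
  have "\<exists>Z Zr Zt. P n k Z Zr Zt" for n k
    unfolding P_def T_def F_def B_def G_def g_def by (rule cutoff_error[OF a h W per m])
  then obtain Z Zr Zt where Z0: "\<And>n k. P n k (Z n k) (Zr n k) (Zt n k)" by metis
  note Z = Z0[unfolded P_def]
  \<comment> \<open>The boundary error is asked to be below the square of \<open>1 / (k+1)\<close>:
    one power is consumed by the factor \<open>100 / h\<close>, which grows linearly in
    \<open>k\<close>.\<close>
  have ex: "\<exists>n. F n < ennreal (1 / real (Suc k)) \<and> B n < ennreal ((1 / real (Suc k))\<^sup>2)" for k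
  proof -
    have "F \<longlonglongrightarrow> 0 + 0 + 0" unfolding F_def by (intro tendsto_add lim)
    then have "eventually (\<lambda>n. F n < ennreal (1 / real (Suc k))) sequentially"
      by (intro order_tendstoD(2)[where y=0]) (auto simp del: of_nat_Suc)
    moreover have "B \<longlonglongrightarrow> 0" unfolding B_def by (rule bd)
    then have "eventually (\<lambda>n. B n < ennreal ((1 / real (Suc k))\<^sup>2)) sequentially"
      by (rule order_tendstoD(2)) (auto simp del: of_nat_Suc)
    ultimately have "eventually (\<lambda>n. F n < ennreal (1 / real (Suc k)) \<and> B n < ennreal ((1 / real (Suc k))\<^sup>2)) sequentially"
      by (rule eventually_conj)
    then show ?thesis by (rule eventually_happens'[OF sequentially_bot])
  qed
  define N where "N k = (SOME n. F n < ennreal (1 / real (Suc k)) \<and> B n < ennreal ((1 / real (Suc k))\<^sup>2))" for k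
  have N: "F (N k) < ennreal (1 / real (Suc k)) \<and> B (N k) < ennreal ((1 / real (Suc k))\<^sup>2)" for k
    unfolding N_def by (rule someI_ex[OF ex])
  have mR: "(\<lambda>p. f (snd p) (fst p)) \<in> borel_measurable ?R" if "continuous_on ({a..b} \<times> {0..2*pi}) (\<lambda>p. f (fst p) (snd p))" for f :: "real \<Rightarrow> real \<Rightarrow> complex"
    using borel_measurable_polar_rect_continuous[of a b 0 "2*pi" f] that by (simp add: case_prod_beta)
  have mcis: "(\<lambda>p. cis (fst p)) \<in> borel_measurable ?R" "(\<lambda>p. of_real (snd p) * cis (fst p)) \<in> borel_measurable ?R" "(\<lambda>p. of_real (snd p) * (\<i> * cis (fst p))) \<in> borel_measurable ?R"
    by (rule mR[of "\<lambda>r t. cis t"], intro continuous_intros)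
       (rule mR[of "\<lambda>r t. of_real r * cis t"], intro continuous_intros,
        rule mR[of "\<lambda>r t. of_real r * (\<i> * cis t)"], intro continuous_intros)
  have mg: "g \<in> borel_measurable ?R"
    unfolding g_def[abs_def] by (intro borel_measurable_add measurable_norm_square borel_measurable_diff mcis m)
  have G0: "G \<longlonglongrightarrow> 0"
    unfolding G_def
  proof (rule nn_strip_tendsto_0[OF a(2) mg])
    define q where "q p = (2 * (norm (V p))\<^sup>2 + 2 * (norm (Vr p))\<^sup>2 + 2 * (norm (Vt p))\<^sup>2) + (4 * b\<^sup>2 + 2)" for p
    have "(\<integral>\<^sup>+p. ennreal (g p) \<partial>?R) \<le> (\<integral>\<^sup>+p. ennreal (q p) \<partial>?R)"
    proof (intro nn_integral_mono ennreal_leI)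
      fix p assume "p \<in> space ?R"
      then have r: "0 \<le> snd p" "snd p \<le> b" using a by (auto simp: space_pair_measure)
      have "(snd p)\<^sup>2 \<le> b\<^sup>2" using r by (intro power_mono)
      have "(norm (x - y))\<^sup>2 \<le> 2 * (norm x)\<^sup>2 + 2 * (norm y)\<^sup>2" for x y :: complex
        using norm_add_square_le[of x "- y"] by simp
      from this[of "of_real (snd p) * cis (fst p)" "V p"] this[of "cis (fst p)" "Vr p"] this[of "of_real (snd p) * (\<i> * cis (fst p))" "Vt p"]
        \<open>(snd p)\<^sup>2 \<le> b\<^sup>2\<close> show "g p \<le> q p"
        unfolding g_def q_def by (simp add: norm_mult)
    qed
    also have "\<dots> < \<infinity>"
    proof -
      have i: "integrable ?R (\<lambda>p. (norm (f p))\<^sup>2)" if "f \<in> borel_measurable ?R" "(\<integral>\<^sup>+p. ennreal ((norm (f p))\<^sup>2) \<partial>?R) < \<infinity>" for f :: "real \<times> real \<Rightarrow> complex"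
        using that measurable_norm_square[OF that(1)] by (intro integrableI_bounded) auto
      have "integrable ?R q"
        unfolding q_def[abs_def]
        by (intro Bochner_Integration.integrable_add integrable_mult_right i m L2 finite_measure.integrable_const finite_measure_pair_ivl)
      moreover have "0 \<le> q p" for p by (simp add: q_def)
      ultimately show ?thesis by (simp add: nn_integral_eq_integral)
    qed
    finally show "(\<integral>\<^sup>+p. ennreal (g p) \<partial>?R) < \<infinity>" .
  qed
  have T0: "(\<lambda>k. T (N k) k) \<longlonglongrightarrow> 0"
  proof (rule tendsto_sandwich[OF _ _ tendsto_const])
    have "T (N k) k \<le> 400 * ennreal (1 / real (Suc k)) + 400 * G k + ennreal (100 / (b - a)) * ennreal (1 / real (Suc k))" for k
    proof -
      have "ennreal (100 / ?h k) * B (N k) \<le> ennreal (100 / ?h k) * ennreal ((1 / real (Suc k))\<^sup>2)"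
        using N[of k] by (intro mult_left_mono) auto
      also have "\<dots> = ennreal (100 / (b - a)) * ennreal (1 / real (Suc k))"
        using a by (simp add: ennreal_mult[symmetric] power2_eq_square field_simps del: of_nat_Suc)
      finally show ?thesis unfolding T_def using N[of k] by (intro add_mono mult_left_mono) auto
    qed
    then show "\<forall>\<^sub>F k in sequentially. T (N k) k \<le> 400 * ennreal (1 / real (Suc k)) + 400 * G k + ennreal (100 / (b - a)) * ennreal (1 / real (Suc k))"
      by (intro always_eventually allI)
    have l: "(\<lambda>k. ennreal (1 / real (Suc k))) \<longlonglongrightarrow> 0"
      using tendsto_ennrealI[OF LIMSEQ_inverse_real_of_nat] by (simp add: inverse_eq_divide)
    have "(\<lambda>k. 400 * ennreal (1 / real (Suc k)) + 400 * G k + ennreal (100 / (b - a)) * ennreal (1 / real (Suc k))) \<longlonglongrightarrow> 400 * 0 + 400 * 0 + ennreal (100 / (b - a)) * 0"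
      by (intro tendsto_add tendsto_mult_ennreal tendsto_const l G0) auto
    then show "(\<lambda>k. 400 * ennreal (1 / real (Suc k)) + 400 * G k + ennreal (100 / (b - a)) * ennreal (1 / real (Suc k))) \<longlonglongrightarrow> 0" by simp
  qed simp
  have sq: "u \<longlonglongrightarrow> 0" if "\<And>k. u k \<le> T (N k) k" for u :: "nat \<Rightarrow> ennreal"
    by (rule tendsto_sandwich[OF _ _ tendsto_const T0]) (use that in auto)
  show thesis
  proof (rule that[of "\<lambda>k. Z (N k) k" "\<lambda>k. Zr (N k) k" "\<lambda>k. Zt (N k) k"])
    show "(\<lambda>n. L2_distance ?R (\<lambda>p. Z (N n) n (snd p) (fst p)) V) \<longlonglongrightarrow> 0" using Z by (intro sq) blast
    show "(\<lambda>n. L2_distance ?R (\<lambda>p. Zr (N n) n (snd p) (fst p)) Vr) \<longlonglongrightarrow> 0" using Z by (intro sq) blast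
    show "(\<lambda>n. L2_distance ?R (\<lambda>p. Zt (N n) n (snd p) (fst p)) Vt) \<longlonglongrightarrow> 0" using Z by (intro sq) blast
  qed (use Z in blast)+
qed

section \<open>Polar coordinates\<close>

no_notation fps_nth (infixl \<open>$\<close> 75)

lemma polar_nth [simp]: "polar r t $ 1 = r * cos t" "polar r t $ 2 = r * sin t"
  by (simp_all add: polar_def)

lemma polar_axis: "polar r t = (r * cos t) *\<^sub>R axis 1 1 + (r * sin t) *\<^sub>R axis 2 1"
  by (simp add: vec_eq_iff forall_2 axis_def)

lemma norm_vec2: "norm (x::real^2) = sqrt ((x $ 1)\<^sup>2 + (x $ 2)\<^sup>2)"
  by (simp add: norm_vec_def L2_set_def sum_2)

lemma norm_polar: "norm (polar r t) = \<bar>r\<bar>"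
proof -
  have "(r * cos t)\<^sup>2 + (r * sin t)\<^sup>2 = r\<^sup>2 * ((cos t)\<^sup>2 + (sin t)\<^sup>2)" by (simp only: power_mult_distrib distrib_left)
  then show ?thesis unfolding norm_vec2 by simp
qed

lemma continuous_on_polar:
  fixes f g :: "'a::t2_space \<Rightarrow> real"
  assumes "continuous_on S f" "continuous_on S g"
  shows "continuous_on S (\<lambda>p. polar (f p) (g p))"
  unfolding polar_axis by (intro continuous_intros assms)

lemma open_annulus: "open (annulus a b)"
proof -
  have "annulus a b = norm -` {a<..<b}" by (auto simp: annulus_def)
  then show ?thesis by (simp add: open_vimage continuous_on_norm_id)
qed

lemma bounded_annulus: "bounded (annulus a b)"
  by (rule bounded_subset[OF bounded_cball[of 0 b]]) (auto simp: annulus_def)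

lemma prod_Basis_vec2: "(\<Prod>i\<in>Basis. (x::real^2) \<bullet> i) = x $ 1 * x $ 2"
proof -
  have B: "(Basis :: (real^2) set) = {axis 1 1, axis 2 1}"
    by (auto simp: Basis_vec_def exhaust_2) (metis exhaust_2)
  have "axis 1 1 \<noteq> (axis 2 1 :: real^2)" by (simp add: axis_eq_axis)
  then show ?thesis unfolding B by (simp add: inner_axis)
qed

text \<open>Connects two models of the plane: change of variables takes place in
  \<open>real^2\<close>, iterated integration on pairs. By uniqueness of Lebesgue measure it is
  enough to compare boxes.\<close>

lemma lborel_vec2: "(lborel :: (real^2) measure) = distr (lborel \<Otimes>\<^sub>M lborel) borel (\<lambda>p. vector [fst p, snd p])"
proof (rule lborel_eqI)
  have v: "(vector [x, y] :: real^2) = x *\<^sub>R axis 1 1 + y *\<^sub>R axis 2 1" for x y :: real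
    by (simp add: vec_eq_iff forall_2 axis_def)
  have m: "(\<lambda>p. vector [fst p, snd p] :: real^2) \<in> borel_measurable (lborel \<Otimes>\<^sub>M lborel)"
    unfolding v lborel_prod measurable_lborel2 by (intro borel_measurable_continuous_onI continuous_intros) 
  fix l u :: "real^2" assume le: "\<And>b. b \<in> Basis \<Longrightarrow> l \<bullet> b \<le> u \<bullet> b"
  have "axis i (1::real) \<in> (Basis :: (real^2) set)" for i :: 2 by (simp add: axis_in_Basis_iff)
  then have le': "l $ i \<le> u $ i" for i using le[of "axis i 1"] by (simp add: inner_axis)
  have "(\<lambda>p. vector [fst p, snd p] :: real^2) -` box l u = {l $ 1<..<u $ 1} \<times> {l $ 2<..<u $ 2}"
    by (auto simp: mem_box_cart forall_2)
  then have "emeasure (distr (lborel \<Otimes>\<^sub>M lborel) borel (\<lambda>p. vector [fst p, snd p])) (box l u) = emeasure (lborel \<Otimes>\<^sub>M lborel) ({l $ 1<..<u $ 1} \<times> {l $ 2<..<u $ 2})"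
    using m by (subst emeasure_distr) (auto simp: space_pair_measure)
  also have "\<dots> = emeasure lborel {l $ 1<..<u $ 1} * emeasure lborel {l $ 2<..<u $ 2}"
    by (rule sigma_finite_measure.emeasure_pair_measure_Times[OF sigma_finite_lborel]) auto
  also have "\<dots> = ennreal ((u - l) $ 1 * (u - l) $ 2)"
    using le' by (simp add: ennreal_mult[symmetric])
  finally show "emeasure (distr (lborel \<Otimes>\<^sub>M lborel) borel (\<lambda>p. vector [fst p, snd p])) (box l u) = ennreal (\<Prod>b\<in>Basis. (u - l) \<bullet> b)"
    unfolding prod_Basis_vec2 .
qed simp

text \<open>Radius and angle are packed into a vector of \<open>real^2\<close>, so that the change
  of variables for injective differentiable maps applies. On the open set with angle strictly
  between 0 and 2 pi, \<open>polar\<close> is injective with Jacobian \<open>x $ 1\<close>.\<close>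

lemma emeasure_annulus_polar:
  assumes ab: "0 < a" "a < b" and A: "A \<in> sets borel"
  shows "emeasure lborel (A \<inter> annulus a b) = (\<integral>\<^sup>+x. ennreal (x $ 1) * indicator {x::real^2. a < x $ 1 \<and> x $ 1 < b \<and> 0 < x $ 2 \<and> x $ 2 < 2*pi \<and> polar (x $ 1) (x $ 2) \<in> A} x \<partial>lborel)"
proof -
  define \<Phi> where "\<Phi> x = polar (x $ 1) (x $ 2)" for x :: "real^2"
  define S where "S = {x :: real^2. a < x $ 1 \<and> x $ 1 < b \<and> 0 < x $ 2 \<and> x $ 2 < 2*pi \<and> \<Phi> x \<in> A}"
  have c\<Phi>: "continuous_on UNIV \<Phi>" unfolding \<Phi>_def by (intro continuous_on_polar continuous_intros)
  have m\<Phi>: "\<Phi> \<in> borel_measurable borel" by (rule borel_measurable_continuous_onI[OF c\<Phi>])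
  have S: "S \<in> sets borel"
  proof -
    have "open {x :: real^2. a < x $ 1 \<and> x $ 1 < b \<and> 0 < x $ 2 \<and> x $ 2 < 2*pi}"
      by (intro open_Collect_conj open_Collect_less continuous_intros)
    moreover have "\<Phi> -` A \<in> sets borel" using measurable_sets[OF m\<Phi> A] by simp
    ultimately have "{x :: real^2. a < x $ 1 \<and> x $ 1 < b \<and> 0 < x $ 2 \<and> x $ 2 < 2*pi} \<inter> \<Phi> -` A \<in> sets borel" by auto
    moreover have "{x :: real^2. a < x $ 1 \<and> x $ 1 < b \<and> 0 < x $ 2 \<and> x $ 2 < 2*pi} \<inter> \<Phi> -` A = S" by (auto simp: S_def)
    ultimately show ?thesis by simp
  qed
  define D where "D x h = (cos (x $ 2) * h $ 1 - x $ 1 * sin (x $ 2) * h $ 2) *\<^sub>R axis 1 1 + (sin (x $ 2) * h $ 1 + x $ 1 * cos (x $ 2) * h $ 2) *\<^sub>R (axis 2 1 :: real^2)" for x h :: "real^2"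
  have der: "(\<Phi> has_derivative D x) (at x within S)" for x
  proof -
    have n: "((\<lambda>x::real^2. x $ i) has_derivative (\<lambda>h. h $ i)) (at x within S)" for i
      by (rule bounded_linear_imp_has_derivative[OF bounded_linear_vec_nth])
    have c: "((\<lambda>x::real^2. x $ 1 * cos (x $ 2)) has_derivative (\<lambda>h. cos (x $ 2) * h $ 1 - x $ 1 * sin (x $ 2) * h $ 2)) (at x within S)"
      by (auto intro!: derivative_eq_intros n simp: algebra_simps)
    have s: "((\<lambda>x::real^2. x $ 1 * sin (x $ 2)) has_derivative (\<lambda>h. sin (x $ 2) * h $ 1 + x $ 1 * cos (x $ 2) * h $ 2)) (at x within S)"
      by (auto intro!: derivative_eq_intros n simp: algebra_simps)
    show ?thesis unfolding \<Phi>_def polar_axis D_def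
      by (intro has_derivative_add has_derivative_scaleR_left c s)
  qed
  have det: "det (matrix (D x)) = x $ 1" for x
  proof -
    have "det (matrix (D x)) = x $ 1 * (cos (x $ 2) * cos (x $ 2)) + x $ 1 * (sin (x $ 2) * sin (x $ 2))"
      by (simp add: det_2 matrix_def D_def axis_def algebra_simps)
    also have "\<dots> = x $ 1" by (simp only: distrib_left[symmetric] sin_cos_squared_add3 mult_1_right)
    finally show ?thesis .
  qed
  have inj: "inj_on \<Phi> S"
  proof (rule inj_onI)
    fix x y assume x: "x \<in> S" and y: "y \<in> S" and e: "\<Phi> x = \<Phi> y"
    have pos: "x $ 1 > 0" "y $ 1 > 0" using x y ab by (auto simp: S_def)
    have r: "x $ 1 = y $ 1" using arg_cong[OF e, of norm] pos by (simp add: \<Phi>_def norm_polar)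
    have "x $ 1 * cos (x $ 2) = y $ 1 * cos (y $ 2)" "x $ 1 * sin (x $ 2) = y $ 1 * sin (y $ 2)"
      using arg_cong[OF e, of "\<lambda>v::real^2. v $ 1"] arg_cong[OF e, of "\<lambda>v::real^2. v $ 2"] by (simp_all add: \<Phi>_def)
    then have "sin (x $ 2) = sin (y $ 2) \<and> cos (x $ 2) = cos (y $ 2)" using r pos by simp
    then obtain n :: int where n: "x $ 2 = y $ 2 + 2 * pi * of_int n" using sin_cos_eq_iff[of "x $ 2" "y $ 2"] by auto
    have b: "x $ 2 - y $ 2 < 2 * pi" "- (2 * pi) < x $ 2 - y $ 2" using x y by (auto simp: S_def)
    have "2 * pi * of_int n < 2 * pi * 1" "2 * pi * (-1) < 2 * pi * of_int n" using n b by linarith+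
    then have "real_of_int n < 1" "-1 < real_of_int n" using pi_gt_zero by (simp_all only: mult_less_cancel_left_pos[of "2*pi"] mult_pos_pos zero_less_numeral)
    then have "n = 0" by linarith
    then show "x = y" using n r by (simp add: vec_eq_iff forall_2)
  qed
  have iS: "set_integrable lborel S (\<lambda>x. x $ 1)"
    unfolding set_integrable_def
  proof (rule integrableI_bounded_set_indicator[where B=b])
    have "norm x \<le> b + 2 * pi" if "x \<in> S" for x
    proof -
      have "norm x \<le> \<bar>x $ 1\<bar> + \<bar>x $ 2\<bar>"
        using norm_le_l1_cart[of x] by (simp only: sum_2)
      moreover have "\<bar>x $ 1\<bar> \<le> b" "\<bar>x $ 2\<bar> \<le> 2 * pi" using that ab by (simp_all add: S_def)
      ultimately show ?thesis by linarith
    qed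
    then have "bounded S" unfolding bounded_iff by blast
    then show "emeasure lborel S < \<infinity>" by (rule emeasure_bounded_finite)
    show "(\<lambda>x::real^2. x $ 1) \<in> borel_measurable lborel"
      unfolding measurable_lborel2
      by (intro borel_measurable_continuous_onI bounded_linear.continuous_on[OF bounded_linear_vec_nth] continuous_on_id)
    show "AE x in lborel. x \<in> S \<longrightarrow> norm (x $ 1) \<le> b" by (rule AE_I2) (use ab in \<open>simp add: S_def\<close>)
  qed (use S in simp)
  have eqint: "integral S (\<lambda>x. \<bar>det (matrix (D x))\<bar>) = (LINT x:S|lborel. x $ 1)"
  proof -
    have "integral S (\<lambda>x. \<bar>det (matrix (D x))\<bar>) = integral S (\<lambda>x. x $ 1)"
      using ab by (intro Henstock_Kurzweil_Integration.integral_cong) (auto simp: det S_def)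
    then show ?thesis using set_borel_integral_eq_integral(2)[OF iS] by simp
  qed
  have int: "(\<lambda>x. \<bar>det (matrix (D x))\<bar>) integrable_on S"
    by (rule integrable_eq[OF set_borel_integral_eq_integral(1)[OF iS]]) (use ab in \<open>auto simp: det S_def\<close>)
  have "measure lebesgue (\<Phi> ` S) = (LINT x:S|lborel. x $ 1)"
    unfolding eqint[symmetric] by (rule measure_differentiable_image_eq[OF _ der inj int]) (use S in auto)
  \<comment> \<open>The open range of angles misses the positive first axis. Deleting the whole line
    \<open>x $ 2 = 0\<close>, a null set, is simpler and equally harmless.\<close>
  have img: "(A \<inter> annulus a b) - {x. x $ 2 = 0} \<subseteq> \<Phi> ` S" "\<Phi> ` S \<subseteq> A \<inter> annulus a b"
  proof -
    show "\<Phi> ` S \<subseteq> A \<inter> annulus a b"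
      using ab by (auto simp: S_def annulus_def \<Phi>_def norm_polar)
    show "(A \<inter> annulus a b) - {x. x $ 2 = 0} \<subseteq> \<Phi> ` S"
    proof
      fix x assume x: "x \<in> (A \<inter> annulus a b) - {x. x $ 2 = 0}"
      define r where "r = norm x"
      have r: "a < r" "r < b" "r > 0" using x ab by (auto simp: annulus_def r_def)
      have "(x $ 1)\<^sup>2 + (x $ 2)\<^sup>2 = r\<^sup>2" unfolding r_def norm_vec2 by simp
      then have "(x $ 1 / r)\<^sup>2 + (x $ 2 / r)\<^sup>2 = 1" using r by (simp add: power_divide add_divide_distrib[symmetric])
      then obtain t where t: "0 \<le> t" "t < 2 * pi" "x $ 1 / r = cos t" "x $ 2 / r = sin t"
        by (rule sincos_total_2pi)
      have xr: "x $ 1 = r * cos t" "x $ 2 = r * sin t" using t(3,4) r by (auto simp: field_simps)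
      have "t \<noteq> 0" using x xr by auto
      then have t0: "0 < t" using t(1) by simp
      have pr: "polar r t = x" using xr by (simp add: vec_eq_iff forall_2)
      have "vector [r, t] \<in> S" "\<Phi> (vector [r, t]) = x"
        using r t0 t(2) x by (simp_all add: S_def \<Phi>_def pr)
      then show "x \<in> \<Phi> ` S" by (metis imageI)
    qed
  qed
  have neg: "negligible {x::real^2. x $ 2 = 0}" by (rule negligible_standard_hyperplane_cart)
  have AA: "A \<inter> annulus a b \<in> lmeasurable"
    using A open_annulus bounded_annulus by (intro bounded_set_imp_lmeasurable bounded_Int) auto
  have "measure lebesgue (\<Phi> ` S) = measure lebesgue (A \<inter> annulus a b)"
    by (rule measure_negligible_symdiff[OF AA, symmetric, THEN sym]) (rule negligible_subset[OF neg], use img in auto)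
  then have ml: "measure lebesgue (A \<inter> annulus a b) = (LINT x:S|lborel. x $ 1)"
    using \<open>measure lebesgue (\<Phi> ` S) = (LINT x:S|lborel. x $ 1)\<close> by simp
  have "emeasure lborel (A \<inter> annulus a b) = emeasure lebesgue (A \<inter> annulus a b)"
    using A open_annulus by simp
  also have "\<dots> = ennreal (LINT x:S|lborel. x $ 1)"
    using AA ml by (simp add: emeasure_eq_measure2)
  also have "\<dots> = (\<integral>\<^sup>+x. ennreal (indicator S x *\<^sub>R x $ 1) \<partial>lborel)"
    unfolding set_lebesgue_integral_def
    by (rule nn_integral_eq_integral[symmetric]) (use iS ab in \<open>auto simp: set_integrable_def S_def indicator_def\<close>)
  also have "\<dots> = (\<integral>\<^sup>+x. ennreal (x $ 1) * indicator S x \<partial>lborel)"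
    by (intro nn_integral_cong) (auto simp: indicator_def)
  finally show ?thesis unfolding S_def \<Phi>_def .
qed

text \<open>Both sides integrate \<open>f\<close> against a measure on the plane: Lebesgue measure
  on the annulus, and the image under \<open>polar\<close> of the weight \<open>r\<close> on the
  rectangle. These measures agree on Borel sets by the preceding computation, since the edges of the
  closed rectangle are null, and equality for all \<open>f\<close> follows.\<close>

theorem nn_integral_annulus_polar:
  assumes ab: "0 < a" "a < b" and f[measurable]: "f \<in> borel_measurable borel"
  shows "(\<integral>\<^sup>+x. f x * indicator (annulus a b) x \<partial>lborel) = (\<integral>\<^sup>+p. f (polar (snd p) (fst p)) * ennreal (snd p) \<partial>polar_rect a b)"
proof -
  have mp: "(\<lambda>p. polar (snd p) (fst p)) \<in> measurable (polar_rect a b) borel"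
    using borel_measurable_polar_rect_continuous[of a b 0 "2*pi" polar] continuous_on_polar[OF continuous_on_fst[OF continuous_on_id] continuous_on_snd[OF continuous_on_id]]
    by (simp add: case_prod_beta)
  have msnd [measurable]: "snd \<in> borel_measurable (polar_rect a b)"
    by (rule measurable_compose[OF measurable_snd]) (auto intro: measurable_restrict_space1)
  have an: "annulus a b \<in> sets borel" using open_annulus by auto
  let ?D = "density (polar_rect a b) (\<lambda>p. ennreal (snd p))"
  have eq: "density lborel (indicator (annulus a b)) = distr ?D borel (\<lambda>p. polar (snd p) (fst p))"
  proof (rule measure_eqI)
    fix A :: "(real^2) set" assume "A \<in> sets (density lborel (indicator (annulus a b)))"
    then have A: "A \<in> sets borel" by simp
    let ?f = "\<lambda>x. ennreal (x $ 1) * indicator {x::real^2. a < x $ 1 \<and> x $ 1 < b \<and> 0 < x $ 2 \<and> x $ 2 < 2*pi \<and> polar (x $ 1) (x $ 2) \<in> A} x"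
    let ?g = "\<lambda>p. ennreal (fst p) * indicator {p. a < fst p \<and> fst p < b \<and> 0 < snd p \<and> snd p < 2*pi \<and> polar (fst p) (snd p) \<in> A} p"
    have mpolar: "(\<lambda>p::real\<times>real. polar (fst p) (snd p)) \<in> borel_measurable borel"
      by (intro borel_measurable_continuous_onI continuous_on_polar continuous_intros)
    have mpolar2: "(\<lambda>x::real^2. polar (x $ 1) (x $ 2)) \<in> borel_measurable borel"
      by (intro borel_measurable_continuous_onI continuous_on_polar continuous_intros)
    have sf: "{x::real^2. a < x $ 1 \<and> x $ 1 < b \<and> 0 < x $ 2 \<and> x $ 2 < 2*pi \<and> polar (x $ 1) (x $ 2) \<in> A} \<in> sets borel"
    proof -
      have "open {x :: real^2. a < x $ 1 \<and> x $ 1 < b \<and> 0 < x $ 2 \<and> x $ 2 < 2*pi}"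
        by (intro open_Collect_conj open_Collect_less continuous_intros)
      then have "{x :: real^2. a < x $ 1 \<and> x $ 1 < b \<and> 0 < x $ 2 \<and> x $ 2 < 2*pi} \<inter> (\<lambda>x. polar (x $ 1) (x $ 2)) -` A \<in> sets borel"
        using measurable_sets[OF mpolar2 A] by auto
      moreover have "{x :: real^2. a < x $ 1 \<and> x $ 1 < b \<and> 0 < x $ 2 \<and> x $ 2 < 2*pi} \<inter> (\<lambda>x. polar (x $ 1) (x $ 2)) -` A
          = {x::real^2. a < x $ 1 \<and> x $ 1 < b \<and> 0 < x $ 2 \<and> x $ 2 < 2*pi \<and> polar (x $ 1) (x $ 2) \<in> A}" by auto
      ultimately show ?thesis by (simp only:)
    qed
    have m1: "(\<lambda>x::real^2. ennreal (x $ 1)) \<in> borel_measurable borel"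
      by (intro measurable_compose[OF _ measurable_ennreal] borel_measurable_continuous_onI
          bounded_linear.continuous_on[OF bounded_linear_vec_nth] continuous_on_id)
    have mf: "?f \<in> borel_measurable borel"
      by (intro borel_measurable_times_ennreal m1 borel_measurable_indicator sf)
    have mv: "(\<lambda>p. vector [fst p, snd p] :: real^2) \<in> borel_measurable (lborel \<Otimes>\<^sub>M lborel)"
    proof -
      have v: "(vector [x, y] :: real^2) = x *\<^sub>R axis 1 1 + y *\<^sub>R axis 2 1" for x y :: real
        by (simp add: vec_eq_iff forall_2 axis_def)
      show ?thesis
        unfolding v lborel_prod measurable_lborel2 by (intro borel_measurable_continuous_onI continuous_intros)
    qed
    have "emeasure (density lborel (indicator (annulus a b))) A = (\<integral>\<^sup>+x. indicator (annulus a b) x * indicator A x \<partial>lborel)"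
      using A an by (intro emeasure_density) auto
    also have "\<dots> = (\<integral>\<^sup>+x. indicator (A \<inter> annulus a b) x \<partial>lborel)"
      by (intro nn_integral_cong) (auto simp: indicator_def)
    also have "\<dots> = emeasure lborel (A \<inter> annulus a b)"
      using A an by (intro nn_integral_indicator) auto
    also have "\<dots> = (\<integral>\<^sup>+x. ?f x \<partial>lborel)" by (rule emeasure_annulus_polar[OF ab A])
    also have "\<dots> = (\<integral>\<^sup>+p. ?f (vector [fst p, snd p]) \<partial>(lborel \<Otimes>\<^sub>M lborel))"
      unfolding lborel_vec2 by (rule nn_integral_distr[OF mv]) (simp only: measurable_distr_eq1 mf)
    also have "\<dots> = (\<integral>\<^sup>+p. ?g p \<partial>(lborel \<Otimes>\<^sub>M lborel))"
      by (intro nn_integral_cong) (simp add: indicator_def)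
    also have "\<dots> = (\<integral>\<^sup>+t. \<integral>\<^sup>+r. ?g (r, t) \<partial>lborel \<partial>lborel)"
    proof -
      have "?f \<circ> (\<lambda>p. vector [fst p, snd p]) \<in> borel_measurable (lborel \<Otimes>\<^sub>M lborel)"
        by (rule measurable_comp[OF mv mf])
      moreover have "?f \<circ> (\<lambda>p. vector [fst p, snd p]) = ?g" by (rule ext) (simp add: indicator_def)
      ultimately have gm: "?g \<in> borel_measurable (lborel \<Otimes>\<^sub>M lborel)" by (simp only:)
      show ?thesis by (rule lborel_pair.nn_integral_snd[OF gm, symmetric])
    qed
    also have "\<dots> = (\<integral>\<^sup>+t. \<integral>\<^sup>+r. indicator A (polar r t) * ennreal r \<partial>ivl a b \<partial>ivl 0 (2*pi))"
    proof -
      have 1: "(\<integral>\<^sup>+r. ?g (r, t) \<partial>lborel) = (\<integral>\<^sup>+r. indicator A (polar r t) * ennreal r \<partial>ivl a b) * indicator {0..2*pi} t"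
        if "t \<noteq> 0" "t \<noteq> 2 * pi" for t
      proof (cases "t \<in> {0..2*pi}")
        case True
        have "(\<integral>\<^sup>+r. ?g (r, t) \<partial>lborel) = (\<integral>\<^sup>+r. (indicator A (polar r t) * ennreal r) * indicator {a..b} r \<partial>lborel)"
          by (intro nn_integral_cong_AE) (use AE_lborel_singleton[of a] AE_lborel_singleton[of b] in \<open>eventually_elim, use True that in \<open>auto simp: indicator_def\<close>\<close>)
        then show ?thesis using True by (simp add: nn_integral_restrict_space)
      next
        case False
        then have z: "?g (r, t) = 0" for r by (auto simp: indicator_def)
        have "(\<integral>\<^sup>+r. ?g (r, t) \<partial>lborel) = (\<integral>\<^sup>+r. 0 \<partial>(lborel :: real measure))" by (rule nn_integral_cong) (rule z)
        then show ?thesis using False by simp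
      qed
      have "(\<integral>\<^sup>+t. \<integral>\<^sup>+r. ?g (r, t) \<partial>lborel \<partial>lborel) = (\<integral>\<^sup>+t. (\<integral>\<^sup>+r. indicator A (polar r t) * ennreal r \<partial>ivl a b) * indicator {0..2*pi} t \<partial>lborel)"
      proof (rule nn_integral_cong_AE)
        show "AE t in lborel. (\<integral>\<^sup>+r. ?g (r, t) \<partial>lborel) = (\<integral>\<^sup>+r. indicator A (polar r t) * ennreal r \<partial>ivl a b) * indicator {0..2*pi} t"
          using AE_lborel_singleton[of 0] AE_lborel_singleton[of "2*pi"] by eventually_elim (rule 1)
      qed
      then show ?thesis by (simp add: nn_integral_restrict_space)
    qed
    also have "\<dots> = (\<integral>\<^sup>+p. indicator A (polar (snd p) (fst p)) * ennreal (snd p) \<partial>polar_rect a b)"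
    proof -
      have "(\<lambda>p. indicator A (polar (snd p) (fst p)) * ennreal (snd p)) \<in> borel_measurable (polar_rect a b)"
        by (intro borel_measurable_times_ennreal measurable_compose[OF msnd measurable_ennreal] measurable_compose[OF mp borel_measurable_indicator[OF A]])
      from sigma_finite_measure.nn_integral_fst[OF finite_measure_ivl[THEN finite_measure.axioms(1)] this] show ?thesis by simp
    qed
    also have "\<dots> = emeasure (distr ?D borel (\<lambda>p. polar (snd p) (fst p))) A"
    proof -
      have "emeasure (distr ?D borel (\<lambda>p. polar (snd p) (fst p))) A = (\<integral>\<^sup>+x. indicator A x \<partial>distr ?D borel (\<lambda>p. polar (snd p) (fst p)))"
        using A by simp
      also have "\<dots> = (\<integral>\<^sup>+p. indicator A (polar (snd p) (fst p)) \<partial>?D)"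
        using mp A by (intro nn_integral_distr) auto
      also have "\<dots> = (\<integral>\<^sup>+p. ennreal (snd p) * indicator A (polar (snd p) (fst p)) \<partial>polar_rect a b)"
        by (intro nn_integral_density measurable_compose[OF msnd measurable_ennreal] measurable_compose[OF mp borel_measurable_indicator[OF A]])
      finally show ?thesis by (simp add: mult.commute)
    qed
    finally show "emeasure (density lborel (indicator (annulus a b))) A = emeasure (distr ?D borel (\<lambda>p. polar (snd p) (fst p))) A" .
  qed simp
  have "(\<integral>\<^sup>+x. f x * indicator (annulus a b) x \<partial>lborel) = (\<integral>\<^sup>+x. f x \<partial>density lborel (indicator (annulus a b)))"
    using an by (subst nn_integral_density) (auto simp: mult.commute)
  also have "\<dots> = (\<integral>\<^sup>+p. f (polar (snd p) (fst p)) \<partial>?D)"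
    unfolding eq using mp f by (intro nn_integral_distr) auto
  also have "\<dots> = (\<integral>\<^sup>+p. ennreal (snd p) * f (polar (snd p) (fst p)) \<partial>polar_rect a b)"
    by (intro nn_integral_density measurable_compose[OF msnd measurable_ennreal] measurable_compose[OF mp f])
  finally show ?thesis by (simp add: mult.commute)
qed

text \<open>The pullback of a null set has integral 0 against the positive weight \<open>r\<close>,
  hence is null. Nothing is known on the two circles themselves, so the radii \<open>a\<close> and
  \<open>b\<close> are discarded.\<close>

lemma AE_annulus_polar:
  assumes ab: "0 < a" "a < b" and P: "AE x in lborel. x \<in> annulus a b \<longrightarrow> P x"
  shows "AE p in polar_rect a b. P (polar (snd p) (fst p))"
proof -
  obtain N where N: "{x \<in> space lborel. \<not> (x \<in> annulus a b \<longrightarrow> P x)} \<subseteq> N" "emeasure lborel N = 0" "N \<in> sets lborel"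
    using P by (rule AE_E)
  have NB: "N \<in> sets borel" using N(3) by simp
  have mp: "(\<lambda>p. polar (snd p) (fst p)) \<in> measurable (polar_rect a b) borel"
    using borel_measurable_polar_rect_continuous[of a b 0 "2*pi" polar] continuous_on_polar[OF continuous_on_fst[OF continuous_on_id] continuous_on_snd[OF continuous_on_id]]
    by (simp add: case_prod_beta)
  have msnd: "snd \<in> borel_measurable (polar_rect a b)"
    by (rule measurable_compose[OF measurable_snd]) (auto intro: measurable_restrict_space1)
  have m: "(\<lambda>p. indicator N (polar (snd p) (fst p)) * ennreal (snd p)) \<in> borel_measurable (polar_rect a b)"
    by (intro borel_measurable_times_ennreal measurable_compose[OF msnd measurable_ennreal] measurable_compose[OF mp borel_measurable_indicator[OF NB]])
  have "(\<integral>\<^sup>+p. indicator N (polar (snd p) (fst p)) * ennreal (snd p) \<partial>polar_rect a b) = (\<integral>\<^sup>+x. indicator N x * indicator (annulus a b) x \<partial>lborel)"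
    by (rule nn_integral_annulus_polar[OF ab borel_measurable_indicator[OF NB], symmetric])
  also have "\<dots> \<le> (\<integral>\<^sup>+x. indicator N x \<partial>lborel)" by (intro nn_integral_mono) (auto simp: indicator_def)
  also have "\<dots> = 0" using N by simp
  finally have "(\<integral>\<^sup>+p. indicator N (polar (snd p) (fst p)) * ennreal (snd p) \<partial>polar_rect a b) = 0" by simp
  then have "AE p in polar_rect a b. indicator N (polar (snd p) (fst p)) * ennreal (snd p) = 0"
    using nn_integral_0_iff_AE[OF m] by simp
  moreover have "AE p in polar_rect a b. snd p \<noteq> a \<and> snd p \<noteq> b"
  proof (rule ivl_pair.AE_pair_measure)
    show "{x \<in> space (polar_rect a b). snd x \<noteq> a \<and> snd x \<noteq> b} \<in> sets (polar_rect a b)"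
      using msnd by measurable
    have "AE y in ivl a b. y \<noteq> a \<and> y \<noteq> b"
      using AE_lborel_singleton[of a] AE_lborel_singleton[of b] by (subst AE_restrict_space_iff) auto
    then show "AE x in ivl 0 (2*pi). AE y in ivl a b. snd (x, y) \<noteq> a \<and> snd (x, y) \<noteq> b" by simp
  qed
  ultimately show ?thesis using AE_space
  proof eventually_elim
    fix p assume p: "indicator N (polar (snd p) (fst p)) * ennreal (snd p) = 0" "snd p \<noteq> a \<and> snd p \<noteq> b" "p \<in> space (polar_rect a b)"
    have r: "a < snd p" "snd p < b" using p(2,3) by (auto simp: space_pair_measure)
    then have "polar (snd p) (fst p) \<notin> N" using p(1) ab by (auto simp: indicator_def split: if_splits)
    moreover have "polar (snd p) (fst p) \<in> annulus a b" using r ab by (simp add: annulus_def norm_polar)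
    ultimately show "P (polar (snd p) (fst p))" using N(1) by auto
  qed
qed

text \<open>Admissible maps and their gradients are only Lebesgue measurable, and composition with
  \<open>polar\<close> is unproblematic only for Borel functions. A representative is chosen
  coordinate by coordinate.\<close>

lemma borel_representative:
  fixes f :: "'a::euclidean_space \<Rightarrow> 'b::euclidean_space"
  assumes \<Omega>: "\<Omega> \<in> sets borel" and f: "f \<in> borel_measurable (lebesgue_on \<Omega>)"
  obtains g where "g \<in> borel_measurable borel" "AE x in lborel. x \<in> \<Omega> \<longrightarrow> f x = g x"
proof -
  have \<Omega>': "\<Omega> \<in> sets lebesgue" using \<Omega> by simp
  have "\<exists>g\<in>borel_measurable lborel. AE x in lborel. (if x \<in> \<Omega> then f x \<bullet> i else 0) = g x" for i
  proof (rule completion_ex_borel_measurable_real)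
    have "(\<lambda>x. f x \<bullet> i) \<in> borel_measurable (lebesgue_on \<Omega>)" using f by (rule borel_measurable_inner) simp
    then show "(\<lambda>x. if x \<in> \<Omega> then f x \<bullet> i else 0) \<in> borel_measurable lebesgue"
      using borel_measurable_if[OF \<Omega>', of "\<lambda>x. f x \<bullet> i"] by blast
  qed
  then have "\<forall>i. \<exists>g. g \<in> borel_measurable lborel \<and> (AE x in lborel. (if x \<in> \<Omega> then f x \<bullet> i else 0) = g x)" by blast
  from choice[OF this] obtain g where g: "\<And>i. g i \<in> borel_measurable lborel" "\<And>i. AE x in lborel. (if x \<in> \<Omega> then f x \<bullet> i else 0) = g i x" by blast
  show thesis
  proof (rule that[of "\<lambda>x. \<Sum>i\<in>Basis. g i x *\<^sub>R i"])
    show "(\<lambda>x. \<Sum>i\<in>Basis. g i x *\<^sub>R i) \<in> borel_measurable borel"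
      using g(1) by (intro borel_measurable_sum borel_measurable_scaleR) auto
    have "AE x in lborel. \<forall>i\<in>Basis. (if x \<in> \<Omega> then f x \<bullet> i else 0) = g i x"
      by (rule AE_finite_allI) (use g(2) in auto)
    then show "AE x in lborel. x \<in> \<Omega> \<longrightarrow> f x = (\<Sum>i\<in>Basis. g i x *\<^sub>R i)"
    proof eventually_elim
      fix x assume *: "\<forall>i\<in>Basis. (if x \<in> \<Omega> then f x \<bullet> i else 0) = g i x"
      show "x \<in> \<Omega> \<longrightarrow> f x = (\<Sum>i\<in>Basis. g i x *\<^sub>R i)"
      proof
        assume x: "x \<in> \<Omega>"
        have "(\<Sum>i\<in>Basis. g i x *\<^sub>R i) = (\<Sum>i\<in>Basis. (f x \<bullet> i) *\<^sub>R i)"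
          by (rule sum.cong) (use * x in auto)
        then show "f x = (\<Sum>i\<in>Basis. g i x *\<^sub>R i)" by (simp add: euclidean_representation)
      qed
    qed
  qed
qed

lemma linear_to_complex: "linear to_complex"
  by (rule linearI) (simp_all add: to_complex_def complex_eq_iff)

lemma norm_to_complex [simp]: "norm (to_complex y) = norm y"
  by (simp add: to_complex_def cmod_def norm_vec2)

lemma bounded_linear_to_complex: "bounded_linear to_complex"
  using linear_to_complex by (rule linear_conv_bounded_linear[THEN iffD1])

lemmas to_complex_diff = linear_diff[OF linear_to_complex]
lemmas to_complex_scaleR = linear_scale[OF linear_to_complex]

lemma to_complex_polar: "to_complex (polar r t) = of_real r * cis t"
  by (simp add: to_complex_def complex_eq_iff)

lemma norm_matrix2: "(norm (G::real^2^2))\<^sup>2 = (G$1$1)\<^sup>2 + (G$1$2)\<^sup>2 + (G$2$1)\<^sup>2 + (G$2$2)\<^sup>2"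
  by (simp add: norm_vec_def L2_set_def sum_2 norm_vec2)

text \<open>The vectors \<open>polar 1 t\<close> and \<open>polar 1 (t + pi/2)\<close> are the
  radial and tangential unit vectors. They arise from the standard basis by a rotation, which
  preserves the Hilbert-Schmidt norm and the determinant.\<close>

lemma rotated_frame_identities:
  fixes G :: "real^2^2" and t :: real
  defines "x \<equiv> G *v polar 1 t" and "y \<equiv> G *v polar 1 (t + pi/2)"
  shows "(norm x)\<^sup>2 + (norm y)\<^sup>2 = (norm G)\<^sup>2"
    and "Im (cnj (to_complex x) * to_complex y) = det G"
    and "(norm x)\<^sup>2 \<le> (norm G)\<^sup>2" and "(norm y)\<^sup>2 \<le> (norm G)\<^sup>2"
proof -
  let ?c = "cos t" and ?s = "sin t"
  have x: "x $ i = G$i$1 * ?c + G$i$2 * ?s" for i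
    by (simp add: x_def matrix_vector_mult_def sum_2)
  have y: "y $ i = G$i$2 * ?c - G$i$1 * ?s" for i
    by (simp add: y_def matrix_vector_mult_def sum_2 cos_add sin_add)
  have cs: "?c * ?c = 1 - ?s * ?s" using sin_cos_squared_add3[of t] by linarith
  have row: "(p * ?c + q * ?s)\<^sup>2 + (q * ?c - p * ?s)\<^sup>2 = p\<^sup>2 + q\<^sup>2" for p q :: real
  proof -
    have "(p * ?c + q * ?s)\<^sup>2 + (q * ?c - p * ?s)\<^sup>2 = (p\<^sup>2 + q\<^sup>2) * (?c * ?c + ?s * ?s)" by (simp only: power2_eq_square) (simp only: algebra_simps)
    then show ?thesis by (simp only: sin_cos_squared_add3 mult_1_right)
  qed
  have n: "(norm v)\<^sup>2 = (v$1)\<^sup>2 + (v$2)\<^sup>2" for v :: "real^2" by (simp add: norm_vec2)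
  show s: "(norm x)\<^sup>2 + (norm y)\<^sup>2 = (norm G)\<^sup>2"
    unfolding n x y norm_matrix2 using row[of "G$1$1" "G$1$2"] row[of "G$2$1" "G$2$2"] by linarith
  show "(norm x)\<^sup>2 \<le> (norm G)\<^sup>2" "(norm y)\<^sup>2 \<le> (norm G)\<^sup>2"
    using s zero_le_power2[of "norm x"] zero_le_power2[of "norm y"] by linarith+
  have "Im (cnj (to_complex x) * to_complex y) = x$1 * y$2 - x$2 * y$1"
    by (simp add: to_complex_def)
  also have "\<dots> = (G$1$1 * G$2$2 - G$1$2 * G$2$1) * (?c * ?c + ?s * ?s)"
    unfolding x y by (simp only: algebra_simps)
  finally show "Im (cnj (to_complex x) * to_complex y) = det G"
    by (simp only: sin_cos_squared_add3 mult_1_right det_2)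
qed

lemma has_vector_derivative_polar:
  "((\<lambda>r. polar r t) has_vector_derivative polar 1 t) (at r within S)"
  "((\<lambda>t. polar r t) has_vector_derivative r *\<^sub>R polar 1 (t + pi/2)) (at t within S)"
proof -
  show "((\<lambda>r. polar r t) has_vector_derivative polar 1 t) (at r within S)"
    unfolding polar_axis has_vector_derivative_def
    by (auto intro!: derivative_eq_intros simp: scaleR_add_right)
  have "((\<lambda>t. r * cos t) has_vector_derivative - (r * sin t)) (at t within S)" "((\<lambda>t. r * sin t) has_vector_derivative r * cos t) (at t within S)"
    unfolding has_real_derivative_iff_has_vector_derivative[symmetric] by (auto intro!: derivative_eq_intros)
  from has_vector_derivative_add[OF bounded_linear.has_vector_derivative[OF bounded_linear_scaleR_left this(1)] bounded_linear.has_vector_derivative[OF bounded_linear_scaleR_left this(2)]]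
  have "((\<lambda>t. polar r t) has_vector_derivative - (r * sin t) *\<^sub>R axis 1 1 + (r * cos t) *\<^sub>R axis 2 1) (at t within S)"
    unfolding polar_axis .
  moreover have "- (r * sin t) *\<^sub>R axis 1 1 + (r * cos t) *\<^sub>R axis 2 1 = r *\<^sub>R polar 1 (t + pi/2)"
    by (simp add: vec_eq_iff forall_2 axis_def cos_add sin_add)
  ultimately show "((\<lambda>t. polar r t) has_vector_derivative r *\<^sub>R polar 1 (t + pi/2)) (at t within S)" by simp
qed

lemma C1_polar_of_C1:
  assumes U: "open U" "\<And>x. a \<le> norm x \<Longrightarrow> norm x \<le> b \<Longrightarrow> x \<in> U" and w: "Ck_on 1 U (w :: real^2 \<Rightarrow> real^2)" and a: "0 < a"
  defines "D \<equiv> \<lambda>x. matrix (frechet_derivative w (at x))"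
  shows "C1_polar a b (\<lambda>r t. to_complex (w (polar r t))) (\<lambda>r t. to_complex (D (polar r t) *v polar 1 t)) (\<lambda>r t. to_complex (D (polar r t) *v (r *\<^sub>R polar 1 (t + pi/2))))"
  unfolding C1_polar_def case_prod_beta
proof (intro conjI ballI)
  let ?K = "{a..b} \<times> {0..2*pi::real}"
  have inU: "polar r t \<in> U" if "r \<in> {a..b}" for r t using that a by (intro U) (auto simp: norm_polar)
  have cp: "continuous_on ?K (\<lambda>p. polar (fst p) (snd p))" by (intro continuous_on_polar continuous_intros)
  have img: "(\<lambda>p. polar (fst p) (snd p)) ` ?K \<subseteq> U" using inU by auto
  have cw: "continuous_on ?K (\<lambda>p. w (polar (fst p) (snd p)))"
    by (rule continuous_on_compose2[OF Ck_on_1D(3)[OF w] cp img])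
  have cD: "continuous_on ?K (\<lambda>p. D (polar (fst p) (snd p)))"
    unfolding D_def by (rule continuous_on_compose2[OF continuous_on_matrix_frechet_derivative[OF w] cp img])
  have cmv: "continuous_on ?K (\<lambda>p. to_complex (A p *v x p))" if "continuous_on ?K A" "continuous_on ?K x" for A :: "real \<times> real \<Rightarrow> real^2^2" and x
    unfolding matrix_vector_mult_def
    by (intro bounded_linear.continuous_on[OF bounded_linear_to_complex] continuous_on_vec_lambda continuous_on_sum
        continuous_on_mult bounded_linear.continuous_on[OF bounded_linear_vec_nth] that)
  show "continuous_on ?K (\<lambda>p. to_complex (w (polar (fst p) (snd p))))"
    by (intro bounded_linear.continuous_on[OF bounded_linear_to_complex] cw)
  show "continuous_on ?K (\<lambda>p. to_complex (D (polar (fst p) (snd p)) *v polar 1 (snd p)))"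
    by (intro cmv cD continuous_on_polar continuous_intros)
  show "continuous_on ?K (\<lambda>p. to_complex (D (polar (fst p) (snd p)) *v (fst p *\<^sub>R polar 1 (snd p + pi/2))))"
    by (intro cmv cD continuous_on_scaleR continuous_on_polar continuous_intros)
  fix r t assume rt: "r \<in> {a..b}" "t \<in> {0..2*pi}"
  have lin: "frechet_derivative w (at x) h = D x *v h" if "x \<in> U" for x h
    unfolding D_def by (rule fun_cong[OF matrix_vector_mul(2)[OF has_derivative_linear[OF Ck_on_1D(1)[OF w that]]], symmetric])
  have chain: "((\<lambda>s. to_complex (w (g s))) has_vector_derivative to_complex (D (g s) *v g')) (at s within S)"
    if g: "(g has_vector_derivative g') (at s within S)" and gU: "g s \<in> U" for g :: "real \<Rightarrow> real^2" and g' s S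
  proof -
    have "((\<lambda>s. w (g s)) has_derivative (\<lambda>h. frechet_derivative w (at (g s)) (h *\<^sub>R g'))) (at s within S)"
      using has_derivative_compose[OF g[unfolded has_vector_derivative_def] Ck_on_1D(1)[OF w gU]] .
    then have "((\<lambda>s. w (g s)) has_vector_derivative D (g s) *v g') (at s within S)"
      unfolding has_vector_derivative_def lin[OF gU] by (simp add: matrix_vector_mult_scaleR)
    then show ?thesis by (rule bounded_linear.has_vector_derivative[OF bounded_linear_to_complex])
  qed
  show "((\<lambda>r. to_complex (w (polar r t))) has_vector_derivative to_complex (D (polar r t) *v polar 1 t)) (at r within {a..b})"
    by (rule chain[OF has_vector_derivative_polar(1) inU[OF rt(1)]])
  show "((\<lambda>t. to_complex (w (polar r t))) has_vector_derivative to_complex (D (polar r t) *v (r *\<^sub>R polar 1 (t + pi/2)))) (at t within {0..2*pi})"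
    by (rule chain[OF has_vector_derivative_polar(2) inU[OF rt(1)]])
qed

lemma annulus_closure:
  assumes "0 < a" "a < b"
  shows "closure (annulus a b) = {x. a \<le> norm x \<and> norm x \<le> b}"
proof
  have "closed {x::real^2. a \<le> norm x \<and> norm x \<le> b}"
    by (intro closed_Collect_conj closed_Collect_le continuous_intros)
  then show "closure (annulus a b) \<subseteq> {x. a \<le> norm x \<and> norm x \<le> b}"
    by (rule closure_minimal[rotated]) (auto simp: annulus_def)
  show "{x. a \<le> norm x \<and> norm x \<le> b} \<subseteq> closure (annulus a b)"
  proof
    fix x :: "real^2" assume x: "x \<in> {x. a \<le> norm x \<and> norm x \<le> b}"
    define c where "c = (a + b) / 2"
    \<comment> \<open>Pushing \<open>x\<close> towards the middle circle of radius \<open>c\<close>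
      makes its norm lie strictly between \<open>a\<close> and \<open>b\<close>, with an amount of
      push that tends to 0.\<close>
    define y where "y n = (1 - inverse (real (Suc n))) *\<^sub>R x + inverse (real (Suc n)) *\<^sub>R ((c / norm x) *\<^sub>R x)" for n
    have n0: "norm x > 0" using x assms by auto
    have c: "a < c" "c < b" using assms by (auto simp: c_def)
    have "y \<longlonglongrightarrow> (1 - 0) *\<^sub>R x + 0 *\<^sub>R ((c / norm x) *\<^sub>R x)"
      unfolding y_def by (intro tendsto_intros LIMSEQ_inverse_real_of_nat)
    then have yl: "y \<longlonglongrightarrow> x" by simp
    have "y n \<in> annulus a b" for n
    proof -
      let ?i = "inverse (real (Suc n))"
      have i: "0 < ?i" "?i \<le> 1" by (auto simp: inverse_le_1_iff)
      have "y n = ((1 - ?i) + ?i * (c / norm x)) *\<^sub>R x" by (simp add: y_def scaleR_add_left)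
      then have "norm (y n) = \<bar>(1 - ?i) + ?i * (c / norm x)\<bar> * norm x" by simp
      also have "\<bar>(1 - ?i) + ?i * (c / norm x)\<bar> = (1 - ?i) + ?i * (c / norm x)"
        using i c assms n0 by (intro abs_of_nonneg add_nonneg_nonneg mult_nonneg_nonneg) auto
      also have "((1 - ?i) + ?i * (c / norm x)) * norm x = (1 - ?i) * norm x + ?i * c"
        using n0 by (simp add: distrib_right del: of_nat_Suc)
      finally have ny: "norm (y n) = (1 - ?i) * norm x + ?i * c" .
      have "(1 - ?i) * a \<le> (1 - ?i) * norm x" "(1 - ?i) * norm x \<le> (1 - ?i) * b"
        using i x by (auto intro!: mult_left_mono)
      moreover have "?i * a < ?i * c" "?i * c < ?i * b" using i c by simp_all
      moreover have "(1 - ?i) * a + ?i * a = a" "(1 - ?i) * b + ?i * b = b" by (simp_all add: left_diff_distrib)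
      ultimately show ?thesis unfolding annulus_def ny mem_Collect_eq by linarith
    qed
    then show "x \<in> closure (annulus a b)" using yl closure_sequential by blast
  qed
qed

lemma annulus_frontier: "0 < a \<Longrightarrow> a < b \<Longrightarrow> frontier (annulus a b) = {x. norm x = a \<or> norm x = b}"
  unfolding frontier_def annulus_closure interior_open[OF open_annulus] by (auto simp: annulus_def)

lemma LINT_lebesgue_on_eq_nn:
  fixes f :: "'a::euclidean_space \<Rightarrow> real"
  assumes "\<Omega> \<in> sets borel" "integrable (lebesgue_on \<Omega>) f" "\<And>x. 0 \<le> f x"
    and g: "g \<in> borel_measurable borel" "AE x in lborel. x \<in> \<Omega> \<longrightarrow> f x = g x"
  shows "ennreal (LINT x|lebesgue_on \<Omega>. f x) = (\<integral>\<^sup>+x. ennreal (g x) * indicator \<Omega> x \<partial>lborel)"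
proof -
  have \<Omega>: "\<Omega> \<in> sets lebesgue" using assms(1) by simp
  have "ennreal (LINT x|lebesgue_on \<Omega>. f x) = (\<integral>\<^sup>+x. ennreal (f x) \<partial>lebesgue_on \<Omega>)"
    using assms by (intro nn_integral_eq_integral[symmetric]) auto
  also have "\<dots> = (\<integral>\<^sup>+x. ennreal (f x) * indicator \<Omega> x \<partial>lebesgue)"
    using \<Omega> by (intro nn_integral_restrict_space) simp
  also have "\<dots> = (\<integral>\<^sup>+x. ennreal (g x) * indicator \<Omega> x \<partial>lebesgue)"
    using AE_completion[OF g(2)] by (intro nn_integral_cong_AE) (auto elim!: eventually_mono simp: indicator_def)
  also have "\<dots> = (\<integral>\<^sup>+x. ennreal (g x) * indicator \<Omega> x \<partial>lborel)"
    using g(1) assms(1) by (intro nn_integral_completion)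
  finally show ?thesis .
qed

lemma borel_polar_measurable:
  fixes f :: "real^2 \<Rightarrow> 'b::euclidean_space"
  assumes f: "f \<in> borel_measurable borel"
  shows "(\<lambda>p. f (polar (snd p) (fst p))) \<in> borel_measurable (polar_rect a b)"
proof (rule measurable_compose[OF _ f])
  show "(\<lambda>p. polar (snd p) (fst p)) \<in> measurable (polar_rect a b) borel"
    using borel_measurable_polar_rect_continuous[of a b 0 "2*pi" polar] continuous_on_polar[OF continuous_on_fst[OF continuous_on_id] continuous_on_snd[OF continuous_on_id]]
    by (simp add: case_prod_beta)
qed

text \<open>The area element contributes a factor \<open>r\<close>; an estimate without weight on
  the rectangle costs a constant such as \<open>1 / a\<close>.\<close>

lemma polar_nn_le:
  fixes F :: "real \<times> real \<Rightarrow> real" and f :: "real^2 \<Rightarrow> real"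
  assumes ab: "0 < a" "a < b" and f: "f \<in> borel_measurable borel" and C: "0 \<le> C"
    and le: "\<And>p. p \<in> space (polar_rect a b) \<Longrightarrow> F p \<le> C * (f (polar (snd p) (fst p)) * snd p)"
    and f0: "\<And>x. 0 \<le> f x"
  shows "(\<integral>\<^sup>+p. ennreal (F p) \<partial>polar_rect a b) \<le> ennreal C * (\<integral>\<^sup>+x. ennreal (f x) * indicator (annulus a b) x \<partial>lborel)"
proof -
  have m: "(\<lambda>x. ennreal (f x)) \<in> borel_measurable borel" using f by measurable
  have msnd: "snd \<in> borel_measurable (polar_rect a b)"
    by (rule measurable_compose[OF measurable_snd]) (auto intro: measurable_restrict_space1)
  have mm: "(\<lambda>p. ennreal (f (polar (snd p) (fst p))) * ennreal (snd p)) \<in> borel_measurable (polar_rect a b)"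
    by (intro borel_measurable_times_ennreal measurable_compose[OF msnd measurable_ennreal] measurable_compose[OF borel_polar_measurable[OF f] measurable_ennreal])
  have "(\<integral>\<^sup>+p. ennreal (F p) \<partial>polar_rect a b) \<le> (\<integral>\<^sup>+p. ennreal C * (ennreal (f (polar (snd p) (fst p))) * ennreal (snd p)) \<partial>polar_rect a b)"
  proof (rule nn_integral_mono)
    fix p assume p: "p \<in> space (polar_rect a b)"
    then have "0 \<le> snd p" using ab by (auto simp: space_pair_measure)
    then show "ennreal (F p) \<le> ennreal C * (ennreal (f (polar (snd p) (fst p))) * ennreal (snd p))"
      using le[OF p] C f0 by (simp add: ennreal_mult[symmetric] ennreal_leI)
  qed
  also have "\<dots> = ennreal C * (\<integral>\<^sup>+x. ennreal (f x) * indicator (annulus a b) x \<partial>lborel)"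
    unfolding nn_integral_annulus_polar[OF ab m] by (rule nn_integral_cmult[OF mm])
  finally show ?thesis .
qed

lemma matrix_vector_mult_measurable:
  fixes G :: "'a \<Rightarrow> real^2^2" and x :: "'a \<Rightarrow> real^2"
  assumes G: "G \<in> borel_measurable M" and x: "x \<in> borel_measurable M"
  shows "(\<lambda>p. to_complex (G p *v x p)) \<in> borel_measurable M"
proof -
  have c: "continuous_on UNIV (\<lambda>(A, v). to_complex ((A::real^2^2) *v v))"
    unfolding matrix_vector_mult_def case_prod_beta
    by (intro bounded_linear.continuous_on[OF bounded_linear_to_complex] continuous_on_vec_lambda continuous_on_sum
        continuous_on_mult bounded_linear.continuous_on[OF bounded_linear_vec_nth] continuous_on_fst continuous_on_snd continuous_on_id)
  from measurable_compose[OF borel_measurable_Pair[OF G x] borel_measurable_continuous_onI[OF c]] show ?thesis by simp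
qed

lemma W12_norm_tendsto:
  assumes "(\<lambda>n. W12_norm \<Omega> (f n)) \<longlonglongrightarrow> 0"
  shows "(\<lambda>n. LINT x|lebesgue_on \<Omega>. (norm (f n x))\<^sup>2) \<longlonglongrightarrow> 0" "(\<lambda>n. LINT x|lebesgue_on \<Omega>. (norm (wgrad \<Omega> (f n) x))\<^sup>2) \<longlonglongrightarrow> 0"
proof -
  let ?A = "\<lambda>n. LINT x|lebesgue_on \<Omega>. (norm (f n x))\<^sup>2" and ?B = "\<lambda>n. LINT x|lebesgue_on \<Omega>. (norm (wgrad \<Omega> (f n) x))\<^sup>2"
  have nn: "0 \<le> ?A n" "0 \<le> ?B n" for n by (auto intro!: Bochner_Integration.integral_nonneg)
  have "(\<lambda>n. (W12_norm \<Omega> (f n))\<^sup>2) \<longlonglongrightarrow> 0\<^sup>2" by (intro tendsto_intros assms)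
  moreover have "(W12_norm \<Omega> (f n))\<^sup>2 = ?A n + ?B n" for n
    unfolding W12_norm_def using nn[of n] by (intro real_sqrt_pow2 add_nonneg_nonneg)
  ultimately have s: "(\<lambda>n. ?A n + ?B n) \<longlonglongrightarrow> 0" by simp
  show "?A \<longlonglongrightarrow> 0" by (rule tendsto_sandwich[OF _ _ tendsto_const s]) (use nn in auto)
  show "?B \<longlonglongrightarrow> 0" by (rule tendsto_sandwich[OF _ _ tendsto_const s]) (use nn in auto)
qed

text \<open>Complex quotients encode both components of the logarithmic
  derivative: the real part belongs to the modulus, the imaginary part to the argument.\<close>

lemma admissible_polar:
  assumes ab: "0 < a" "a < b" and v: "v \<in> admissible a b" and fin: "energy (annulus a b) v < \<infinity>"
  obtains V Vr Vt Z Zr Zt where "polar_approximation a b V Vr Vt Z Zr Zt"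
    and "AE p in polar_rect a b. V p = to_complex (v (polar (snd p) (fst p)))"
    and "energy (annulus a b) v = (1/2) * (\<integral>\<^sup>+p. ennreal ((norm (Vr p / V p))\<^sup>2 * snd p + (norm (Vt p / V p))\<^sup>2 / snd p) \<partial>polar_rect a b)"
proof -
  let ?X = "annulus a b" and ?R = "polar_rect a b"
  have XB: "?X \<in> sets borel" using open_annulus by auto
  have XL: "?X \<in> sets lebesgue" using XB by simp
  define G where "G = wgrad ?X v"
  have "v \<in> W12 ?X" and det: "AE x in lebesgue_on ?X. det (G x) = 1" and tr: "has_trace a b v (\<lambda>x. x)"
    using v unfolding admissible_def mem_Collect_eq G_def by - ((elim conjE, assumption)+)
  then have vW: "square_integrable (lebesgue_on ?X) v" and exG: "\<exists>G. has_L2_gradient ?X v G"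
    unfolding W12_def mem_Collect_eq by - ((elim conjE, assumption)+)
  have hG: "has_L2_gradient ?X v G" unfolding G_def wgrad_def by (rule someI_ex[OF exG])
  then have sG: "square_integrable (lebesgue_on ?X) G" by (simp add: has_L2_gradient_def)
  obtain v' where v': "v' \<in> borel_measurable borel" "AE x in lborel. x \<in> ?X \<longrightarrow> v x = v' x"
    by (rule borel_representative[OF XB conjunct1[OF vW[unfolded square_integrable_def]]])
  obtain G' where G': "G' \<in> borel_measurable borel" "AE x in lborel. x \<in> ?X \<longrightarrow> G x = G' x"
    by (rule borel_representative[OF XB conjunct1[OF sG[unfolded square_integrable_def]]])
  define V where "V p = to_complex (v' (polar (snd p) (fst p)))" for p
  define Vr where "Vr p = to_complex (G' (polar (snd p) (fst p)) *v polar 1 (fst p))" for p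
  \<comment> \<open>The factor \<open>snd p\<close> is the length of the angular velocity of
    \<open>polar\<close>, so this is the derivative in the angle, not the tangential derivative of
    unit speed.\<close>
  define Vt where "Vt p = to_complex (G' (polar (snd p) (fst p)) *v (snd p *\<^sub>R polar 1 (fst p + pi/2)))" for p
  have mtc: "to_complex \<in> borel_measurable borel"
    by (intro borel_measurable_continuous_onI linear_continuous_on bounded_linear_to_complex)
  have mfst: "fst \<in> borel_measurable ?R" and msnd: "snd \<in> borel_measurable ?R"
    by (rule measurable_compose[OF measurable_fst]; auto intro: measurable_restrict_space1)
       (rule measurable_compose[OF measurable_snd]; auto intro: measurable_restrict_space1)
  have mp1: "(\<lambda>p. polar 1 (fst p + s)) \<in> borel_measurable ?R" for s
  proof -
    have "(\<lambda>t. polar 1 (t + s)) \<in> borel_measurable borel"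
      by (intro borel_measurable_continuous_onI continuous_on_polar continuous_intros)
    from measurable_compose[OF mfst this] show ?thesis .
  qed
  have mV: "V \<in> borel_measurable ?R" unfolding V_def
    by (intro measurable_compose[OF borel_polar_measurable[OF v'(1)] mtc])
  have mVr: "Vr \<in> borel_measurable ?R" unfolding Vr_def
    using mp1[of 0] by (intro matrix_vector_mult_measurable borel_polar_measurable G'(1)) simp
  have mVt: "Vt \<in> borel_measurable ?R" unfolding Vt_def
    by (intro matrix_vector_mult_measurable borel_polar_measurable G'(1) borel_measurable_scaleR msnd mp1)
  have Vt_eq: "Vt p = of_real (snd p) * to_complex (G' (polar (snd p) (fst p)) *v polar 1 (fst p + pi/2))" for p
    unfolding Vt_def matrix_vector_mult_scaleR to_complex_scaleR by (rule scaleR_conv_of_real)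
  have sp: "a \<le> snd p" "snd p \<le> b" "0 < snd p" if "p \<in> space ?R" for p
    using that ab by (auto simp: space_pair_measure)
  have weight: "c \<le> (1 / a) * (c * snd p)" if "p \<in> space ?R" "0 \<le> c" for c p
    using mult_left_mono[OF sp(1)[OF that(1)] that(2)] ab by (simp add: divide_simps mult.commute)
  have msq: "(\<lambda>x. (norm (f x))\<^sup>2) \<in> borel_measurable borel" if "f \<in> borel_measurable borel" for f :: "real^2 \<Rightarrow> 'z::euclidean_space"
    using that by measurable
  have finsq: "(\<integral>\<^sup>+x. ennreal ((norm (g x))\<^sup>2) * indicator ?X x \<partial>lborel) < \<infinity>"
    if "square_integrable (lebesgue_on ?X) f" "g \<in> borel_measurable borel" "AE x in lborel. x \<in> ?X \<longrightarrow> f x = g x" for f g :: "real^2 \<Rightarrow> 'z::euclidean_space"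
  proof -
    have "ennreal (LINT x|lebesgue_on ?X. (norm (f x))\<^sup>2) = (\<integral>\<^sup>+x. ennreal ((norm (g x))\<^sup>2) * indicator ?X x \<partial>lborel)"
      using that by (intro LINT_lebesgue_on_eq_nn XB msq) (auto simp: square_integrable_def elim!: eventually_mono)
    then show ?thesis by (metis ennreal_less_top infinity_ennreal_def)
  qed
  have L2V: "(\<integral>\<^sup>+p. ennreal ((norm (V p))\<^sup>2) \<partial>?R) < \<infinity>"
  proof (rule le_less_trans[OF polar_nn_le[OF ab msq[OF v'(1)], of "1/a"]])
    show "(norm (V p))\<^sup>2 \<le> 1 / a * ((norm (v' (polar (snd p) (fst p))))\<^sup>2 * snd p)" if "p \<in> space ?R" for p
      unfolding V_def norm_to_complex by (rule weight[OF that]) simp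
    show "ennreal (1 / a) * (\<integral>\<^sup>+x. ennreal ((norm (v' x))\<^sup>2) * indicator ?X x \<partial>lborel) < \<infinity>"
      using finsq[OF vW v'] by (simp add: ennreal_mult_less_top)
  qed (use ab in auto)
  have L2Vr: "(\<integral>\<^sup>+p. ennreal ((norm (Vr p))\<^sup>2) \<partial>?R) < \<infinity>"
  proof (rule le_less_trans[OF polar_nn_le[OF ab msq[OF G'(1)], of "1/a"]])
    show "(norm (Vr p))\<^sup>2 \<le> 1 / a * ((norm (G' (polar (snd p) (fst p))))\<^sup>2 * snd p)" if "p \<in> space ?R" for p
      unfolding Vr_def norm_to_complex
      by (rule order_trans[OF rotated_frame_identities(3) weight[OF that]]) simp
    show "ennreal (1 / a) * (\<integral>\<^sup>+x. ennreal ((norm (G' x))\<^sup>2) * indicator ?X x \<partial>lborel) < \<infinity>"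
      using finsq[OF sG G'] by (simp add: ennreal_mult_less_top)
  qed (use ab in auto)
  have bt: "(norm (to_complex (A *v (snd p *\<^sub>R polar 1 (fst p + pi/2)))))\<^sup>2 \<le> (b\<^sup>2 / a) * ((norm A)\<^sup>2 * snd p)" if p: "p \<in> space ?R" for p and A :: "real^2^2"
  proof -
    have "(norm (to_complex (A *v (snd p *\<^sub>R polar 1 (fst p + pi/2)))))\<^sup>2 = (snd p)\<^sup>2 * (norm (A *v polar 1 (fst p + pi/2)))\<^sup>2"
      unfolding matrix_vector_mult_scaleR norm_to_complex norm_scaleR power_mult_distrib by simp
    also have "\<dots> \<le> b\<^sup>2 * (norm A)\<^sup>2"
      using sp[OF p] by (intro mult_mono power_mono rotated_frame_identities(4)) auto
    also have "\<dots> \<le> b\<^sup>2 * (1 / a * ((norm A)\<^sup>2 * snd p))"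
      by (intro mult_left_mono weight[OF p]) auto
    finally show ?thesis by simp
  qed
  have L2Vt: "(\<integral>\<^sup>+p. ennreal ((norm (Vt p))\<^sup>2) \<partial>?R) < \<infinity>"
  proof (rule le_less_trans[OF polar_nn_le[OF ab msq[OF G'(1)], of "b\<^sup>2/a"]])
    show "(norm (Vt p))\<^sup>2 \<le> b\<^sup>2 / a * ((norm (G' (polar (snd p) (fst p))))\<^sup>2 * snd p)" if "p \<in> space ?R" for p
      unfolding Vt_def by (rule bt[OF that])
    show "ennreal (b\<^sup>2 / a) * (\<integral>\<^sup>+x. ennreal ((norm (G' x))\<^sup>2) * indicator ?X x \<partial>lborel) < \<infinity>"
      using finsq[OF sG G'] by (simp add: ennreal_mult_less_top)
  qed (use ab in auto)
  have mE: "(\<lambda>x. ennreal ((norm (G' x))\<^sup>2) / ennreal ((norm (v' x))\<^sup>2)) \<in> borel_measurable borel"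
    using msq[OF G'(1)] msq[OF v'(1)] by (intro borel_measurable_divide_ennreal measurable_compose[OF _ measurable_ennreal])
  have E1: "energy ?X v = (1/2) * (\<integral>\<^sup>+x. ennreal ((norm (G' x))\<^sup>2) / ennreal ((norm (v' x))\<^sup>2) * indicator ?X x \<partial>lborel)"
  proof -
    have "(\<integral>\<^sup>+x. ennreal ((norm (G x))\<^sup>2) / ennreal ((norm (v x))\<^sup>2) \<partial>lebesgue_on ?X)
      = (\<integral>\<^sup>+x. ennreal ((norm (G x))\<^sup>2) / ennreal ((norm (v x))\<^sup>2) * indicator ?X x \<partial>lebesgue)"
      using XL by (intro nn_integral_restrict_space) simp
    also have "\<dots> = (\<integral>\<^sup>+x. ennreal ((norm (G' x))\<^sup>2) / ennreal ((norm (v' x))\<^sup>2) * indicator ?X x \<partial>lebesgue)"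
    proof (rule nn_integral_cong_AE)
      show "AE x in lebesgue. ennreal ((norm (G x))\<^sup>2) / ennreal ((norm (v x))\<^sup>2) * indicator ?X x = ennreal ((norm (G' x))\<^sup>2) / ennreal ((norm (v' x))\<^sup>2) * indicator ?X x"
        using AE_completion[OF v'(2)] AE_completion[OF G'(2)] by eventually_elim (simp add: indicator_def)
    qed
    also have "\<dots> = (\<integral>\<^sup>+x. ennreal ((norm (G' x))\<^sup>2) / ennreal ((norm (v' x))\<^sup>2) * indicator ?X x \<partial>lborel)"
      using mE XB by (intro nn_integral_completion borel_measurable_times_ennreal borel_measurable_indicator)
    finally show ?thesis unfolding energy_def G_def by simp
  qed
  have finE: "(\<integral>\<^sup>+x. ennreal ((norm (G' x))\<^sup>2) / ennreal ((norm (v' x))\<^sup>2) * indicator ?X x \<partial>lborel) < \<infinity>"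
    using fin unfolding E1 by (auto simp: ennreal_mult_less_top ennreal_divide_eq_top_iff less_top split: if_splits)
  have det': "AE x in lborel. x \<in> ?X \<longrightarrow> det (G' x) = 1"
  proof -
    have "AE x in lebesgue. x \<in> ?X \<longrightarrow> det (G x) = 1" using det XL by (simp add: AE_restrict_space_iff)
    then have "AE x in lborel. x \<in> ?X \<longrightarrow> det (G x) = 1" by (simp add: AE_completion_iff)
    then show ?thesis using G'(2) by eventually_elim auto
  qed
  have G'pos: "0 < norm A" if "det A = 1" for A :: "real^2^2"
  proof -
    have "A \<noteq> 0" using that by (auto simp: det_2)
    then show ?thesis by simp
  qed
  \<comment> \<open>A matrix of determinant 1 is not 0, and in \<open>ennreal\<close> a nonzero
    number divided by 0 is infinite. Zeros of the map on a set of positive measure would make the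
    energy infinite.\<close>
  have nzx: "AE x in lborel. x \<in> ?X \<longrightarrow> v' x \<noteq> 0"
  proof -
    have "AE x in lborel. ennreal ((norm (G' x))\<^sup>2) / ennreal ((norm (v' x))\<^sup>2) * indicator ?X x \<noteq> \<infinity>"
      using finE mE XB by (intro nn_integral_PInf_AE borel_measurable_times_ennreal borel_measurable_indicator) auto
    then show ?thesis using det'
    proof eventually_elim
      fix x assume f: "ennreal ((norm (G' x))\<^sup>2) / ennreal ((norm (v' x))\<^sup>2) * indicator ?X x \<noteq> \<infinity>" and d: "x \<in> ?X \<longrightarrow> det (G' x) = 1"
      show "x \<in> ?X \<longrightarrow> v' x \<noteq> 0"
      proof (intro impI notI)
        assume x: "x \<in> ?X" and z: "v' x = 0"
        have "ennreal ((norm (G' x))\<^sup>2) \<noteq> 0" using G'pos d x by simp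
        then show False using f x z by (simp add: ennreal_divide_zero)
      qed
    qed
  qed
  have nz: "AE p in ?R. V p \<noteq> 0"
    using AE_annulus_polar[OF ab nzx]
  proof eventually_elim
    fix p assume "v' (polar (snd p) (fst p)) \<noteq> 0"
    then have "norm (V p) \<noteq> 0" unfolding V_def norm_to_complex by simp
    then show "V p \<noteq> 0" by simp
  qed
  \<comment> \<open>In the polar frame the squared gradient is \<open>|Vr|^2 + |Vt|^2 / r^2\<close>;
    multiplication by the area weight \<open>r\<close> and division by \<open>|V|^2\<close> give
    this density.\<close>
  define dens where "dens p = (norm (Vr p / V p))\<^sup>2 * snd p + (norm (Vt p / V p))\<^sup>2 / snd p" for p
  have dens: "ennreal ((norm (G' (polar (snd p) (fst p))))\<^sup>2) / ennreal ((norm (v' (polar (snd p) (fst p))))\<^sup>2) * ennreal (snd p) = ennreal (dens p)"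
    if p: "p \<in> space ?R" and V0: "V p \<noteq> 0" for p
  proof -
    let ?A = "G' (polar (snd p) (fst p))" and ?w = "v' (polar (snd p) (fst p))"
    have nv: "norm ?w = norm (V p)" unfolding V_def norm_to_complex ..
    have n: "(norm ?A)\<^sup>2 = (norm (Vr p))\<^sup>2 + (norm (Vt p))\<^sup>2 / (snd p)\<^sup>2"
    proof -
      have "(norm (Vt p))\<^sup>2 = (snd p)\<^sup>2 * (norm (?A *v polar 1 (fst p + pi/2)))\<^sup>2"
        unfolding Vt_eq norm_mult norm_to_complex norm_of_real power_mult_distrib by simp
      then show ?thesis
        using rotated_frame_identities(1)[of ?A "fst p"] sp(3)[OF p] by (simp add: Vr_def)
    qed
    have "ennreal ((norm ?A)\<^sup>2) / ennreal ((norm ?w)\<^sup>2) * ennreal (snd p) = ennreal ((norm ?A)\<^sup>2 / (norm (V p))\<^sup>2 * snd p)"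
      unfolding nv using V0 sp(3)[OF p] by (subst divide_ennreal) (simp_all add: ennreal_mult''[symmetric])
    also have "(norm ?A)\<^sup>2 / (norm (V p))\<^sup>2 * snd p = dens p"
      unfolding n dens_def norm_divide power_divide using V0 sp(3)[OF p]
      by (simp add: divide_simps power2_eq_square)
    finally show ?thesis .
  qed
  have E2: "(\<integral>\<^sup>+x. ennreal ((norm (G' x))\<^sup>2) / ennreal ((norm (v' x))\<^sup>2) * indicator ?X x \<partial>lborel) = (\<integral>\<^sup>+p. ennreal (dens p) \<partial>?R)"
    unfolding nn_integral_annulus_polar[OF ab mE]
  proof (rule nn_integral_cong_AE)
    show "AE p in ?R. ennreal ((norm (G' (polar (snd p) (fst p))))\<^sup>2) / ennreal ((norm (v' (polar (snd p) (fst p))))\<^sup>2) * ennreal (snd p) = ennreal (dens p)"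
      using nz AE_space by eventually_elim (rule dens)
  qed
  have dens_le: "(norm (Vr p / V p))\<^sup>2 \<le> (1 / a) * dens p" "(norm (Vt p / V p))\<^sup>2 \<le> b * dens p" if p: "p \<in> space ?R" for p
  proof -
    note s = sp[OF p]
    have x: "0 \<le> (norm (Vr p / V p))\<^sup>2 * snd p" "0 \<le> (norm (Vt p / V p))\<^sup>2 / snd p" using s by auto
    have "(norm (Vr p / V p))\<^sup>2 \<le> 1 / a * ((norm (Vr p / V p))\<^sup>2 * snd p)" by (rule weight[OF p]) simp
    also have "\<dots> \<le> 1 / a * dens p" unfolding dens_def using x ab by (intro mult_left_mono) auto
    finally show "(norm (Vr p / V p))\<^sup>2 \<le> (1 / a) * dens p" .
    have "(norm (Vt p / V p))\<^sup>2 = snd p * ((norm (Vt p / V p))\<^sup>2 / snd p)" using s by simp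
    also have "\<dots> \<le> b * ((norm (Vt p / V p))\<^sup>2 / snd p)" using s x by (intro mult_right_mono) auto
    also have "\<dots> \<le> b * dens p" unfolding dens_def using x ab by (intro mult_left_mono) auto
    finally show "(norm (Vt p / V p))\<^sup>2 \<le> b * dens p" .
  qed
  have mdens: "dens \<in> borel_measurable ?R"
    unfolding dens_def[abs_def]
    by (intro borel_measurable_add borel_measurable_times borel_measurable_divide measurable_norm_square mVr mVt mV msnd)
  have idens: "integrable ?R dens"
  proof (rule integrableI_bounded[OF mdens])
    have "(\<integral>\<^sup>+p. ennreal (norm (dens p)) \<partial>?R) = (\<integral>\<^sup>+p. ennreal (dens p) \<partial>?R)"
      unfolding real_norm_def
      by (intro nn_integral_cong arg_cong[where f=ennreal] abs_of_nonneg) (simp add: dens_def less_imp_le[OF sp(3)])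
    then show "(\<integral>\<^sup>+p. ennreal (norm (dens p)) \<partial>?R) < \<infinity>" using finE unfolding E2 by simp
  qed
  have iL: "integrable ?R (\<lambda>p. (norm (Vr p / V p))\<^sup>2)" "integrable ?R (\<lambda>p. (norm (Vt p / V p))\<^sup>2)"
  proof -
    show "integrable ?R (\<lambda>p. (norm (Vr p / V p))\<^sup>2)"
    proof (rule Bochner_Integration.integrable_bound[OF integrable_mult_right[OF idens, of "1/a"]])
      show "(\<lambda>p. (norm (Vr p / V p))\<^sup>2) \<in> borel_measurable ?R" by (intro measurable_norm_square borel_measurable_divide mVr mV)
      show "AE p in ?R. norm ((norm (Vr p / V p))\<^sup>2) \<le> norm (1 / a * dens p)"
        unfolding real_norm_def abs_power2 by (rule AE_I2) (rule order_trans[OF dens_le(1) abs_ge_self])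
    qed
    show "integrable ?R (\<lambda>p. (norm (Vt p / V p))\<^sup>2)"
    proof (rule Bochner_Integration.integrable_bound[OF integrable_mult_right[OF idens, of b]])
      show "(\<lambda>p. (norm (Vt p / V p))\<^sup>2) \<in> borel_measurable ?R" by (intro measurable_norm_square borel_measurable_divide mVt mV)
      show "AE p in ?R. norm ((norm (Vt p / V p))\<^sup>2) \<le> norm (b * dens p)"
        unfolding real_norm_def abs_power2 by (rule AE_I2) (rule order_trans[OF dens_le(2) abs_ge_self])
    qed
  qed
  obtain w :: "nat \<Rightarrow> real^2 \<Rightarrow> real^2" where w: "\<And>n. \<exists>U. open U \<and> closure ?X \<subseteq> U \<and> Ck_on 1 U (w n)"
    and w1: "(\<lambda>n. W12_norm ?X (\<lambda>x. w n x - v x)) \<longlonglongrightarrow> 0"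
    and w2: "(\<lambda>n. boundary_L2_norm a b (\<lambda>x. w n x - x)) \<longlonglongrightarrow> 0"
    using tr unfolding has_trace_def by blast
  define D where "D n x = matrix (frechet_derivative (w n) (at x))" for n x
  define W where "W n r t = to_complex (w n (polar r t))" for n r t
  define Wr where "Wr n r t = to_complex (D n (polar r t) *v polar 1 t)" for n r t
  define Wt where "Wt n r t = to_complex (D n (polar r t) *v (r *\<^sub>R polar 1 (t + pi/2)))" for n r t
  have C1: "C1_polar a b (W n) (Wr n) (Wt n)" for n
  proof -
    obtain U where U: "open U" "closure ?X \<subseteq> U" "Ck_on 1 U (w n)" using w by blast
    have "x \<in> U" if "a \<le> norm x" "norm x \<le> b" for x
      using that U(2) unfolding annulus_closure[OF ab] by blast
    from C1_polar_of_C1[OF U(1) this U(3) ab(1)] show ?thesis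
      unfolding W_def Wr_def Wt_def D_def .
  qed
  have p0: "polar r 0 = polar r (2*pi)" for r by (simp add: vec_eq_iff forall_2)
  have per: "W n r 0 = W n r (2*pi)" "Wr n r 0 = Wr n r (2*pi)" for n r
    unfolding W_def Wr_def using p0 by simp_all
  have hD: "has_L2_gradient ?X (w n) (D n)" and cw: "continuous_on (closure ?X) (w n)" and cD: "continuous_on (closure ?X) (D n)" for n
  proof -
    obtain U where U: "open U" "closure ?X \<subseteq> U" "Ck_on 1 U (w n)" using w by blast
    show "has_L2_gradient ?X (w n) (D n)"
      unfolding D_def by (rule has_L2_gradient_C1[OF open_annulus bounded_annulus U])
    show "continuous_on (closure ?X) (w n)" by (rule continuous_on_subset[OF Ck_on_1D(3)[OF U(3)] U(2)])
    show "continuous_on (closure ?X) (D n)"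
      unfolding D_def by (rule continuous_on_subset[OF continuous_on_matrix_frechet_derivative[OF U(3)] U(2)])
  qed
  have fmX: "finite_measure (lebesgue_on ?X)" by (rule finite_measure_lebesgue_on[OF bounded_annulus XL])
  have diff_sq: "square_integrable (lebesgue_on ?X) (\<lambda>x. f x - g x)"
    if "square_integrable (lebesgue_on ?X) f" "square_integrable (lebesgue_on ?X) g" for f g :: "real^2 \<Rightarrow> 'z::euclidean_space"
    unfolding square_integrable_def
  proof
    show m: "(\<lambda>x. f x - g x) \<in> borel_measurable (lebesgue_on ?X)"
      using that by (auto simp: square_integrable_def)
    show "integrable (lebesgue_on ?X) (\<lambda>x. (norm (f x - g x))\<^sup>2)"
    proof (rule Bochner_Integration.integrable_bound[of _ "\<lambda>x. 2 * (norm (f x))\<^sup>2 + 2 * (norm (g x))\<^sup>2"])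
      show "integrable (lebesgue_on ?X) (\<lambda>x. 2 * (norm (f x))\<^sup>2 + 2 * (norm (g x))\<^sup>2)"
        using that by (auto simp: square_integrable_def)
      show "(\<lambda>x. (norm (f x - g x))\<^sup>2) \<in> borel_measurable (lebesgue_on ?X)" using m by measurable
      show "AE x in lebesgue_on ?X. norm ((norm (f x - g x))\<^sup>2) \<le> norm (2 * (norm (f x))\<^sup>2 + 2 * (norm (g x))\<^sup>2)"
      proof (rule AE_I2)
        fix x show "norm ((norm (f x - g x))\<^sup>2) \<le> norm (2 * (norm (f x))\<^sup>2 + 2 * (norm (g x))\<^sup>2)"
          using norm_add_square_le[of "f x" "- g x"] by simp
      qed
    qed
  qed
  have sw: "square_integrable (lebesgue_on ?X) (w n)" for n
    by (rule square_integrable_continuous[OF open_annulus bounded_annulus cw])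
  have sD: "square_integrable (lebesgue_on ?X) (D n)" for n
    by (rule square_integrable_continuous[OF open_annulus bounded_annulus cD])
  \<comment> \<open>\<open>W12_norm\<close> contains \<open>wgrad\<close> of the difference of the
    two maps. Only after exhibiting the difference of the gradients as one weak gradient can
    uniqueness identify the two.\<close>
  have hDG: "has_L2_gradient ?X (\<lambda>x. w n x - v x) (\<lambda>x. D n x - G x)" for n
    unfolding has_L2_gradient_def
  proof (intro conjI allI impI)
    show "square_integrable (lebesgue_on ?X) (\<lambda>x. D n x - G x)" by (rule diff_sq[OF sD sG])
    fix \<phi> i and j :: 2 assume \<phi>: "test_function ?X \<phi>"
    have bl: "bounded_linear (\<lambda>A::real^2^2. A $ i $ j)"
      using bounded_linear_compose[OF bounded_linear_vec_nth bounded_linear_vec_nth] .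
    have iG: "integrable (lebesgue_on ?X) (\<lambda>x. K x $ i $ j * \<phi> x)" if "square_integrable (lebesgue_on ?X) K" for K :: "real^2 \<Rightarrow> real^2^2"
      by (rule integrable_mult_test_function[OF open_annulus integrable_bounded_linear[OF bl square_integrable_imp_integrable[OF fmX that]] \<phi>])
    have \<phi>1: "Ck_on 1 UNIV \<phi>" using \<phi> unfolding test_function_def by blast
    have K: "compact (closure {x. \<phi> x \<noteq> 0})" using \<phi> unfolding test_function_def by blast
    have iu: "integrable (lebesgue_on ?X) (\<lambda>x. u x $ i * frechet_derivative \<phi> (at x) (axis j 1))" if u: "square_integrable (lebesgue_on ?X) u" for u :: "real^2 \<Rightarrow> real^2"
    proof -
      obtain B where B: "\<And>x. x \<in> closure ?X \<Longrightarrow> norm (frechet_derivative \<phi> (at x) (axis j 1)) \<le> B"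
        using continuous_on_compact_bounded[of "closure ?X", OF _ continuous_on_subset[OF Ck_on_1D(2)[OF \<phi>1] subset_UNIV]] bounded_annulus
        by (auto simp: compact_closure)
      have iui: "integrable (lebesgue_on ?X) (\<lambda>x. u x $ i)"
        by (rule integrable_bounded_linear[OF bounded_linear_vec_nth square_integrable_imp_integrable[OF fmX u]])
      show ?thesis
      proof (rule Bochner_Integration.integrable_bound[OF integrable_mult_right[OF integrable_norm[OF iui], of B]])
        have "(\<lambda>x. frechet_derivative \<phi> (at x) (axis j 1)) \<in> borel_measurable (lebesgue_on ?X)"
          by (rule continuous_imp_measurable_on_sets_lebesgue[OF continuous_on_subset[OF Ck_on_1D(2)[OF \<phi>1] subset_UNIV] XL])
        then show "(\<lambda>x. u x $ i * frechet_derivative \<phi> (at x) (axis j 1)) \<in> borel_measurable (lebesgue_on ?X)"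
          using borel_measurable_integrable[OF iui] by (rule borel_measurable_times[rotated])
        show "AE x in lebesgue_on ?X. norm (u x $ i * frechet_derivative \<phi> (at x) (axis j 1)) \<le> norm (B * norm (u x $ i))"
        proof (rule AE_I2)
          fix x assume "x \<in> space (lebesgue_on ?X)"
          then have "x \<in> closure ?X" using closure_subset[of ?X] by (auto simp: space_restrict_space)
          from mult_right_mono[OF B[OF this] norm_ge_zero[of "u x $ i"]]
          show "norm (u x $ i * frechet_derivative \<phi> (at x) (axis j 1)) \<le> norm (B * norm (u x $ i))"
            unfolding norm_mult[of "u x $ i"] using abs_ge_self[of "B * norm (u x $ i)"] by (simp only: mult.commute real_norm_def)
        qed
      qed
    qed
    have h: "(LINT x|lebesgue_on ?X. u x $ i * frechet_derivative \<phi> (at x) (axis j 1)) = - (LINT x|lebesgue_on ?X. K x $ i $ j * \<phi> x)"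
      if "has_L2_gradient ?X u K" for u :: "real^2 \<Rightarrow> real^2" and K
      using that \<phi> unfolding has_L2_gradient_def by blast
    have "(LINT x|lebesgue_on ?X. (w n x - v x) $ i * frechet_derivative \<phi> (at x) (axis j 1))
       = (LINT x|lebesgue_on ?X. w n x $ i * frechet_derivative \<phi> (at x) (axis j 1)) - (LINT x|lebesgue_on ?X. v x $ i * frechet_derivative \<phi> (at x) (axis j 1))"
      unfolding vector_minus_component left_diff_distrib by (intro Bochner_Integration.integral_diff iu sw vW)
    also have "\<dots> = - (LINT x|lebesgue_on ?X. D n x $ i $ j * \<phi> x) - - (LINT x|lebesgue_on ?X. G x $ i $ j * \<phi> x)"
      unfolding h[OF hD] h[OF hG] ..
    also have "\<dots> = - (LINT x|lebesgue_on ?X. (D n x - G x) $ i $ j * \<phi> x)"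
      unfolding vector_minus_component left_diff_distrib
      by (subst Bochner_Integration.integral_diff) (simp_all add: iG sD sG)
    finally show "(LINT x|lebesgue_on ?X. (w n x - v x) $ i * frechet_derivative \<phi> (at x) (axis j 1)) = - (LINT x|lebesgue_on ?X. (D n x - G x) $ i $ j * \<phi> x)" .
  qed
  have hw: "has_L2_gradient ?X (\<lambda>x. w n x - v x) (wgrad ?X (\<lambda>x. w n x - v x))" for n
    unfolding wgrad_def by (rule someI[where P="has_L2_gradient ?X (\<lambda>x. w n x - v x)", OF hDG])
  have wg: "AE x in lebesgue_on ?X. wgrad ?X (\<lambda>x. w n x - v x) x = D n x - G x" for n
    by (rule has_L2_gradient_unique[OF open_annulus bounded_annulus hw hDG])
  \<comment> \<open>The approximants are controlled only near the closed annulus. Cutting them off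
    outside makes them Borel on the whole plane, as the change to polar coordinates
    requires.\<close>
  define w' where "w' n x = indicator (closure ?X) x *\<^sub>R w n x" for n x
  define D' where "D' n x = indicator (closure ?X) x *\<^sub>R D n x" for n x
  have cl: "closure ?X \<in> sets borel" by auto
  have mw': "w' n \<in> borel_measurable borel" and mD': "D' n \<in> borel_measurable borel" for n
    unfolding w'_def[abs_def] D'_def[abs_def] using borel_measurable_continuous_on_indicator[OF cl cw] borel_measurable_continuous_on_indicator[OF cl cD] .
  have pcl: "polar (snd p) (fst p) \<in> closure ?X" if "p \<in> space ?R" for p
    using sp[OF that] unfolding annulus_closure[OF ab] by (simp add: norm_polar)
  have eqX: "w' n x = w n x" "D' n x = D n x" if "x \<in> closure ?X" for n x using that by (simp_all add: w'_def D'_def)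
  have Xcl: "x \<in> closure ?X" if "x \<in> ?X" for x using that closure_subset by blast
  have lw: "(\<lambda>n. \<integral>\<^sup>+x. ennreal ((norm (w' n x - v' x))\<^sup>2) * indicator ?X x \<partial>lborel) \<longlonglongrightarrow> 0"
  proof -
    have "ennreal (LINT x|lebesgue_on ?X. (norm (w n x - v x))\<^sup>2) = (\<integral>\<^sup>+x. ennreal ((norm (w' n x - v' x))\<^sup>2) * indicator ?X x \<partial>lborel)" for n
    proof (rule LINT_lebesgue_on_eq_nn[OF XB])
      show "integrable (lebesgue_on ?X) (\<lambda>x. (norm (w n x - v x))\<^sup>2)" using diff_sq[OF sw vW] by (simp add: square_integrable_def)
      show "(\<lambda>x. (norm (w' n x - v' x))\<^sup>2) \<in> borel_measurable borel" by (intro msq borel_measurable_diff mw' v'(1))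
      show "AE x in lborel. x \<in> ?X \<longrightarrow> (norm (w n x - v x))\<^sup>2 = (norm (w' n x - v' x))\<^sup>2"
        using v'(2) by eventually_elim (simp add: eqX Xcl)
    qed simp
    with tendsto_ennrealI[OF W12_norm_tendsto(1)[OF w1]] show ?thesis by simp
  qed
  have lD: "(\<lambda>n. \<integral>\<^sup>+x. ennreal ((norm (D' n x - G' x))\<^sup>2) * indicator ?X x \<partial>lborel) \<longlonglongrightarrow> 0"
  proof -
    have "ennreal (LINT x|lebesgue_on ?X. (norm (wgrad ?X (\<lambda>x. w n x - v x) x))\<^sup>2) = (\<integral>\<^sup>+x. ennreal ((norm (D' n x - G' x))\<^sup>2) * indicator ?X x \<partial>lborel)" for n
    proof -
      have iD: "integrable (lebesgue_on ?X) (\<lambda>x. (norm (D n x - G x))\<^sup>2)" using diff_sq[OF sD sG] by (simp add: square_integrable_def)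
      have s: "square_integrable (lebesgue_on ?X) (wgrad ?X (\<lambda>x. w n x - v x))"
        using hw[of n] unfolding has_L2_gradient_def by blast
      have "(LINT x|lebesgue_on ?X. (norm (wgrad ?X (\<lambda>x. w n x - v x) x))\<^sup>2) = (LINT x|lebesgue_on ?X. (norm (D n x - G x))\<^sup>2)"
      proof (rule integral_cong_AE)
        show "(\<lambda>x. (norm (wgrad ?X (\<lambda>x. w n x - v x) x))\<^sup>2) \<in> borel_measurable (lebesgue_on ?X)"
          using s unfolding square_integrable_def by (intro borel_measurable_integrable) blast
        show "AE x in lebesgue_on ?X. (norm (wgrad ?X (\<lambda>x. w n x - v x) x))\<^sup>2 = (norm (D n x - G x))\<^sup>2"
          using wg[of n] by eventually_elim simp
      qed (use iD in auto)
      also have "ennreal \<dots> = (\<integral>\<^sup>+x. ennreal ((norm (D' n x - G' x))\<^sup>2) * indicator ?X x \<partial>lborel)"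
      proof (rule LINT_lebesgue_on_eq_nn[OF XB iD])
        show "(\<lambda>x. (norm (D' n x - G' x))\<^sup>2) \<in> borel_measurable borel" by (intro msq borel_measurable_diff mD' G'(1))
        show "AE x in lborel. x \<in> ?X \<longrightarrow> (norm (D n x - G x))\<^sup>2 = (norm (D' n x - G' x))\<^sup>2"
          using G'(2) by eventually_elim (simp add: eqX Xcl)
      qed simp
      finally show ?thesis .
    qed
    with tendsto_ennrealI[OF W12_norm_tendsto(2)[OF w1]] show ?thesis by simp
  qed
  have conv: "(\<lambda>n. \<integral>\<^sup>+p. ennreal (F n p) \<partial>?R) \<longlonglongrightarrow> 0"
    if m: "\<And>n. f n \<in> borel_measurable borel" and C: "0 \<le> C" and le: "\<And>n p. p \<in> space ?R \<Longrightarrow> F n p \<le> C * (f n (polar (snd p) (fst p)) * snd p)"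
      and f0: "\<And>n x. 0 \<le> f n x" and l: "(\<lambda>n. \<integral>\<^sup>+x. ennreal (f n x) * indicator ?X x \<partial>lborel) \<longlonglongrightarrow> 0" for F :: "nat \<Rightarrow> real \<times> real \<Rightarrow> real" and f C
  proof (rule tendsto_sandwich[OF _ _ tendsto_const])
    show "\<forall>\<^sub>F n in sequentially. (\<integral>\<^sup>+p. ennreal (F n p) \<partial>?R) \<le> ennreal C * (\<integral>\<^sup>+x. ennreal (f n x) * indicator ?X x \<partial>lborel)"
      by (intro always_eventually allI polar_nn_le[OF ab m C le f0])
    have "(\<lambda>n. ennreal C * (\<integral>\<^sup>+x. ennreal (f n x) * indicator ?X x \<partial>lborel)) \<longlonglongrightarrow> ennreal C * 0"
      by (intro tendsto_mult_ennreal tendsto_const l) auto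
    then show "(\<lambda>n. ennreal C * (\<integral>\<^sup>+x. ennreal (f n x) * indicator ?X x \<partial>lborel)) \<longlonglongrightarrow> 0" by simp
  qed simp
  have mvd: "A *v x - B *v x = (A - B) *v x" for A B :: "real^2^2" and x by (simp add: matrix_vector_mult_diff_rdistrib)
  have c1: "(\<lambda>n. L2_distance ?R (\<lambda>p. W n (snd p) (fst p)) V) \<longlonglongrightarrow> 0"
    unfolding L2_distance_def
  proof (rule conv[OF _ _ _ _ lw, of "1/a"])
    show "(norm (W n (snd p) (fst p) - V p))\<^sup>2 \<le> 1 / a * ((norm (w' n (polar (snd p) (fst p)) - v' (polar (snd p) (fst p))))\<^sup>2 * snd p)" if "p \<in> space ?R" for n p
      unfolding W_def V_def to_complex_diff[symmetric] norm_to_complex eqX[OF pcl[OF that]] by (rule weight[OF that]) simp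
  qed (use ab in \<open>auto intro!: msq borel_measurable_diff mw' v'(1)\<close>)
  have c2: "(\<lambda>n. L2_distance ?R (\<lambda>p. Wr n (snd p) (fst p)) Vr) \<longlonglongrightarrow> 0"
    unfolding L2_distance_def
  proof (rule conv[OF _ _ _ _ lD, of "1/a"])
    show "(norm (Wr n (snd p) (fst p) - Vr p))\<^sup>2 \<le> 1 / a * ((norm (D' n (polar (snd p) (fst p)) - G' (polar (snd p) (fst p))))\<^sup>2 * snd p)" if "p \<in> space ?R" for n p
      unfolding Wr_def Vr_def to_complex_diff[symmetric] norm_to_complex eqX[OF pcl[OF that]] mvd
      by (rule order_trans[OF rotated_frame_identities(3) weight[OF that]]) simp
  qed (use ab in \<open>auto intro!: msq borel_measurable_diff mD' G'(1)\<close>)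
  have c3: "(\<lambda>n. L2_distance ?R (\<lambda>p. Wt n (snd p) (fst p)) Vt) \<longlonglongrightarrow> 0"
    unfolding L2_distance_def
  proof (rule conv[OF _ _ _ _ lD, of "b\<^sup>2/a"])
    show "(norm (Wt n (snd p) (fst p) - Vt p))\<^sup>2 \<le> b\<^sup>2 / a * ((norm (D' n (polar (snd p) (fst p)) - G' (polar (snd p) (fst p))))\<^sup>2 * snd p)" if "p \<in> space ?R" for n p
      unfolding Wt_def Vt_def to_complex_diff[symmetric] eqX[OF pcl[OF that]] mvd by (rule bt[OF that])
  qed (use ab in \<open>auto intro!: msq borel_measurable_diff mD' G'(1)\<close>)
  \<comment> \<open>\<open>boundary_L2_norm\<close> weights each circle by its radius. Both radii
    are at least \<open>a\<close>, so the factor \<open>1 / a\<close> recovers the unweighted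
    integral over the angle.\<close>
  have c4: "(\<lambda>n. \<integral>\<^sup>+t. ennreal ((norm (W n a t - of_real a * cis t))\<^sup>2 + (norm (W n b t - of_real b * cis t))\<^sup>2) \<partial>ivl 0 (2*pi)) \<longlonglongrightarrow> 0"
  proof -
    define I where "I \<rho> n = (LINT t|lebesgue_on {0..2*pi}. (norm (w n (polar \<rho> t) - polar \<rho> t))\<^sup>2)" for \<rho> n
    have I0: "0 \<le> I \<rho> n" for \<rho> n unfolding I_def by (rule Bochner_Integration.integral_nonneg) simp
    have "(\<lambda>n. (boundary_L2_norm a b (\<lambda>x. w n x - x))\<^sup>2) \<longlonglongrightarrow> 0\<^sup>2" by (intro tendsto_intros w2)
    moreover have "(boundary_L2_norm a b (\<lambda>x. w n x - x))\<^sup>2 = a * I a n + b * I b n" for n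
      unfolding boundary_L2_norm_def using ab I0[of a n] I0[of b n]
      by (subst real_sqrt_pow2) (simp_all add: I_def[symmetric])
    ultimately have s: "(\<lambda>n. a * I a n + b * I b n) \<longlonglongrightarrow> 0" by simp
    have "(\<lambda>n. (1/a) * (a * I a n + b * I b n)) \<longlonglongrightarrow> (1/a) * 0" by (intro tendsto_intros s)
    then have s': "(\<lambda>n. (1/a) * (a * I a n + b * I b n)) \<longlonglongrightarrow> 0" by simp
    have le: "(\<integral>\<^sup>+t. ennreal ((norm (W n a t - of_real a * cis t))\<^sup>2 + (norm (W n b t - of_real b * cis t))\<^sup>2) \<partial>ivl 0 (2*pi)) \<le> ennreal ((1/a) * (a * I a n + b * I b n))" for n
    proof -
      have c: "continuous_on {0..2*pi} (\<lambda>t. (norm (W n \<rho> t - of_real \<rho> * cis t))\<^sup>2)" if "\<rho> \<in> {a..b}" for \<rho>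
      proof -
        have "continuous_on ({a..b} \<times> {0..2*pi}) (\<lambda>(r,t). W n r t)" using C1[of n] unfolding C1_polar_def by blast
        from continuous_on_polar_angle_slice[OF this that] show ?thesis by (intro continuous_intros)
      qed
      have Ieq: "(LINT t|ivl 0 (2*pi). (norm (W n \<rho> t - of_real \<rho> * cis t))\<^sup>2) = I \<rho> n" if "\<rho> \<in> {a..b}" for \<rho>
      proof -
        have e: "(norm (W n \<rho> t - of_real \<rho> * cis t))\<^sup>2 = (norm (w n (polar \<rho> t) - polar \<rho> t))\<^sup>2" for t
          unfolding W_def to_complex_polar[symmetric] to_complex_diff[symmetric] norm_to_complex ..
        have "I \<rho> n = integral {0..2*pi} (\<lambda>t. (norm (w n (polar \<rho> t) - polar \<rho> t))\<^sup>2)"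
          unfolding I_def
          by (rule lebesgue_integral_eq_integral[OF continuous_imp_integrable_real]) (use c[OF that] in \<open>simp add: e\<close>)+
        then show ?thesis using integral_ivl_continuous(1)[OF c[OF that]] by (simp add: e)
      qed
      have "(\<integral>\<^sup>+t. ennreal ((norm (W n a t - of_real a * cis t))\<^sup>2 + (norm (W n b t - of_real b * cis t))\<^sup>2) \<partial>ivl 0 (2*pi))
        = ennreal (LINT t|ivl 0 (2*pi). (norm (W n a t - of_real a * cis t))\<^sup>2 + (norm (W n b t - of_real b * cis t))\<^sup>2)"
        using ab by (intro nn_integral_eq_integral Bochner_Integration.integrable_add integral_ivl_continuous(2) c) auto
      also have "(LINT t|ivl 0 (2*pi). (norm (W n a t - of_real a * cis t))\<^sup>2 + (norm (W n b t - of_real b * cis t))\<^sup>2) = I a n + I b n"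
        using ab Ieq[of a] Ieq[of b] by (subst Bochner_Integration.integral_add) (auto intro!: integral_ivl_continuous(2) c)
      also have "ennreal (I a n + I b n) \<le> ennreal ((1/a) * (a * I a n + b * I b n))"
        using ab mult_right_mono[of a b "I b n"] I0[of b n] by (intro ennreal_leI) (simp add: divide_simps algebra_simps)
      finally show ?thesis .
    qed
    show ?thesis
      by (rule tendsto_sandwich[OF _ _ tendsto_const, where h="\<lambda>n. ennreal ((1/a) * (a * I a n + b * I b n))"])
        (use le tendsto_ennrealI[OF s'] in auto)
  qed
  obtain Z Zr Zt where Z: "\<And>n. C1_polar a b (Z n) (Zr n) (Zt n)"
    "\<And>n r. r \<in> {a..b} \<Longrightarrow> Z n r 0 = Z n r (2*pi)" "\<And>n r. r \<in> {a..b} \<Longrightarrow> Zr n r 0 = Zr n r (2*pi)"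
    "\<And>n t. Z n a t = of_real a * cis t" "\<And>n t. Z n b t = of_real b * cis t"
    "(\<lambda>n. L2_distance ?R (\<lambda>p. Z n (snd p) (fst p)) V) \<longlonglongrightarrow> 0"
    "(\<lambda>n. L2_distance ?R (\<lambda>p. Zr n (snd p) (fst p)) Vr) \<longlonglongrightarrow> 0"
    "(\<lambda>n. L2_distance ?R (\<lambda>p. Zt n (snd p) (fst p)) Vt) \<longlonglongrightarrow> 0"
    by (rule exact_boundary_approximation[OF ab C1 per mV mVr mVt L2V L2Vr L2Vt c1 c2 c3 c4]) (rule that; (assumption | simp))
  show thesis
  proof (rule that)
    show "polar_approximation a b V Vr Vt Z Zr Zt"
      by (unfold_locales) (use ab Z mV mVr mVt L2Vr L2Vt nz iL in \<open>simp_all add: L2_distance_def\<close>)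
    show "AE p in ?R. V p = to_complex (v (polar (snd p) (fst p)))"
      using AE_annulus_polar[OF ab v'(2)[THEN eventually_mono, of "\<lambda>x. x \<in> ?X \<longrightarrow> v' x = v x"]] by (auto simp: V_def elim!: eventually_mono)
    show "energy ?X v = (1/2) * (\<integral>\<^sup>+p. ennreal ((norm (Vr p / V p))\<^sup>2 * snd p + (norm (Vt p / V p))\<^sup>2 / snd p) \<partial>?R)"
      unfolding E1 E2 dens_def ..
  qed
qed

section \<open>Energy along rays and the lower bound\<close>

lemma integral_ivl:
  fixes f :: "real \<Rightarrow> 'b::euclidean_space"
  assumes "integrable (ivl a b) f"
  shows "(LINT r|ivl a b. f r) = integral {a..b} f" and "f integrable_on {a..b}"
proof -
  have i: "set_integrable lborel {a..b} f"
    using assms by (simp add: integrable_restrict_space set_integrable_def)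
  have "(LINT r|ivl a b. f r) = (LINT r:{a..b}|lborel. f r)"
    by (simp add: integral_restrict_space set_lebesgue_integral_def)
  then show "(LINT r|ivl a b. f r) = integral {a..b} f"
    using set_borel_integral_eq_integral(2)[OF i] by simp
  show "f integrable_on {a..b}" by (rule set_borel_integral_eq_integral(1)[OF i])
qed

lemma primitive_ivl:
  fixes f :: "real \<Rightarrow> 'b::euclidean_space"
  assumes f: "integrable (ivl a b) f"
  shows "r \<in> {a..b} \<Longrightarrow> (LINT x|ivl a r. f x) = integral {a..r} f"
    and "continuous_on {a..b} (\<lambda>r. LINT x|ivl a r. f x)"
proof -
  show e: "(LINT x|ivl a r. f x) = integral {a..r} f" if "r \<in> {a..b}" for r
    using that by (intro integral_ivl(1) integrable_ivl_mono[OF _ f]) simp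
  show "continuous_on {a..b} (\<lambda>r. LINT x|ivl a r. f x)"
    by (rule continuous_on_eq[OF indefinite_integral_continuous_1[OF integral_ivl(2)[OF f]] e[symmetric]])
qed

lemma continuous_AE_eq_ivl:
  fixes f g :: "real \<Rightarrow> 'b::euclidean_space"
  assumes ab: "a < b" and f: "continuous_on {a..b} f" and g: "continuous_on {a..b} g"
    and eq: "AE r in ivl a b. f r = g r" and r: "r \<in> {a..b}"
  shows "f r = g r"
proof -
  define h where "h r = norm (f r - g r)" for r
  have h: "continuous_on {a..b} h" unfolding h_def by (intro continuous_intros f g)
  have "(LINT r|ivl a b. h r) = (LINT r|ivl a b. 0)"
    by (rule integral_cong_AE[OF borel_measurable_ivl_continuous[OF h]]) (use eq in \<open>auto simp: h_def elim!: eventually_mono\<close>)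
  then have "integral {a..b} h = 0" using integral_ivl_continuous(1)[OF h] by simp
  then have "(h has_integral 0) (cbox a b)" using integrable_integral[OF integrable_continuous_real[OF h]] by simp
  then have "h r = 0"
    using has_integral_0_cbox_imp_0[of a b h r] h r ab by (auto simp: h_def)
  then show ?thesis by (simp add: h_def)
qed

lemma integral_polar_rect_radial:
  fixes f :: "real \<Rightarrow> real"
  assumes f: "continuous_on {a..b} f"
  shows "(LINT p|polar_rect a b. f (snd p)) = 2*pi * integral {a..b} f" and "integrable (polar_rect a b) (\<lambda>p. f (snd p))"
proof -
  have c: "continuous_on ({a..b} \<times> {0..2*pi}) (\<lambda>(r,t). f r)"
    unfolding case_prod_beta using continuous_on_compose[OF continuous_on_fst[OF continuous_on_id], of "{a..b} \<times> {0..2*pi}" f] f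
    by (auto simp: comp_def intro: continuous_on_subset)
  have e: "indicator {0..2*pi} (fst p) *\<^sub>R f (snd p) = f (snd p)" if "p \<in> space (polar_rect a b)" for p
    using that by (auto simp: space_pair_measure)
  note it = polar_rect_iterated[OF c, of 0 "2*pi"]
  have "(LINT p|polar_rect a b. f (snd p)) = (LINT p|polar_rect a b. indicator {0..2*pi} (fst p) *\<^sub>R f (snd p))"
    by (rule Bochner_Integration.integral_cong) (simp_all only: e)
  also have "\<dots> = 2*pi * integral {a..b} f" using it(1) by simp
  finally show "(LINT p|polar_rect a b. f (snd p)) = 2*pi * integral {a..b} f" .
  have "integrable (polar_rect a b) (\<lambda>p. indicator {0..2*pi} (fst p) *\<^sub>R f (snd p))" using it(2) by simp
  then show "integrable (polar_rect a b) (\<lambda>p. f (snd p))"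
    by (subst Bochner_Integration.integrable_cong[OF refl e[symmetric]])
qed

lemma integral_inverse_ivl:
  fixes a b :: real
  assumes "0 < a" "a < b" shows "integral {a..b} (\<lambda>r. 1 / r) = ln (b / a)"
proof -
  have "((\<lambda>r. 1 / r) has_integral ln b - ln a) {a..b}"
  proof (rule fundamental_theorem_of_calculus[where f="ln :: real \<Rightarrow> real" and f'="\<lambda>r. 1 / r" and a=a and b=b])
    fix r assume r: "r \<in> {a..b}"
    then have "(ln has_real_derivative 1 / r) (at r within {a..b})"
      using assms by (auto intro!: derivative_eq_intros)
    then show "(ln has_vector_derivative 1 / r) (at r within {a..b})"
      by (simp add: has_real_derivative_iff_has_vector_derivative)
  qed (use assms in simp)
  then show ?thesis using assms by (simp add: integral_unique ln_div)
qed

context polar_approximation begin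

definition log_energy_density :: "real \<times> real \<Rightarrow> real" where
  "log_energy_density p = (norm (Vr p / V p))\<^sup>2 * snd p + (norm (Vt p / V p))\<^sup>2 / snd p"

lemma snd_measurable: "snd \<in> borel_measurable R"
  by (rule measurable_compose[OF measurable_snd]) (auto intro: measurable_restrict_space1)

lemma snd_bounds: "p \<in> space R \<Longrightarrow> a \<le> snd p" "p \<in> space R \<Longrightarrow> snd p \<le> b" "p \<in> space R \<Longrightarrow> 0 < snd p"
  using a unfolding space_R by auto

lemma log_energy_density_integrable: "integrable R log_energy_density"
proof -
  have "integrable R (\<lambda>p. b * (norm (Vr p / V p))\<^sup>2 + (1 / a) * (norm (Vt p / V p))\<^sup>2)"
    using logL2 by (intro Bochner_Integration.integrable_add integrable_mult_right)
  then show ?thesis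
  proof (rule Bochner_Integration.integrable_bound)
    show "log_energy_density \<in> borel_measurable R"
      unfolding log_energy_density_def[abs_def]
      by (intro borel_measurable_add borel_measurable_times borel_measurable_divide measurable_norm_square meas snd_measurable)
    show "AE p in R. norm (log_energy_density p) \<le> norm (b * (norm (Vr p / V p))\<^sup>2 + (1 / a) * (norm (Vt p / V p))\<^sup>2)"
    proof (rule AE_I2)
      fix p assume p: "p \<in> space R"
      note s = snd_bounds[OF p]
      have 1: "(norm (Vr p / V p))\<^sup>2 * snd p \<le> b * (norm (Vr p / V p))\<^sup>2"
        using mult_left_mono[OF s(2), of "(norm (Vr p / V p))\<^sup>2"] by (simp only: mult.commute zero_le_power2)
      have "1 / snd p \<le> 1 / a" using s a by (intro divide_left_mono) auto
      from mult_right_mono[OF this, of "(norm (Vt p / V p))\<^sup>2"]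
      have 2: "(norm (Vt p / V p))\<^sup>2 / snd p \<le> (1 / a) * (norm (Vt p / V p))\<^sup>2" by simp
      have "0 \<le> (norm (Vr p / V p))\<^sup>2 * snd p" "0 \<le> (norm (Vt p / V p))\<^sup>2 / snd p" using s by auto
      then show "norm (log_energy_density p) \<le> norm (b * (norm (Vr p / V p))\<^sup>2 + (1 / a) * (norm (Vt p / V p))\<^sup>2)"
        unfolding log_energy_density_def real_norm_def using 1 2 by linarith
    qed
  qed
qed

lemma log_energy_density_nonneg: "p \<in> space R \<Longrightarrow> 0 \<le> log_energy_density p"
  unfolding log_energy_density_def using snd_bounds(3)[of p] by simp

text \<open>Completing squares around the logarithmic derivative \<open>\<kappa> / r\<close> of the twist map leaves only the
  two null Lagrangians given by \<open>angular_log_integral\<close> and the ray integrals.\<close>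

lemma log_energy_lower_bound:
  assumes ray: "AE t in ivl 0 (2*pi). (LINT r|ivl a b. Vr (t,r) / V (t,r)) = Complex (ln (b / a)) (2 * pi * of_int m)"
  shows "2 * pi * ln (b / a) * (2 + (2 * pi * of_int m / ln (b / a))\<^sup>2) \<le> (LINT p|R. log_energy_density p)"
proof -
  define L where "L = ln (b / a)"
  have L: "0 < L" using a ab by (simp add: L_def)
  define c where "c = 2 * pi * of_int m / L"
  \<comment> \<open>For the twist map of winding \<open>m\<close> the quotient \<open>Vr / V\<close>
    is \<open>\<kappa> / r\<close>: the real part 1 comes from the modulus \<open>r\<close>, and the
    slope \<open>c\<close> of the angle in \<open>ln r\<close> is the total angle
    \<open>2 pi m\<close> divided by \<open>L\<close>.\<close>
  define \<kappa> where "\<kappa> = Complex 1 c"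
  define F where "F p = cnj \<kappa> * (Vr p / V p)" for p
  have \<kappa>: "(norm \<kappa>)\<^sup>2 = 1 + c\<^sup>2" by (simp add: \<kappa>_def cmod_power2)
  have cs: "continuous_on {a..b} (\<lambda>r. 1 / r)" using a by (intro continuous_intros) auto
  have int_inv: "integrable R (\<lambda>p. 1 / snd p)" and vs: "(LINT p|R. 1 / snd p) = 2 * pi * L"
    using integral_polar_rect_radial[OF cs] integral_inverse_ivl[OF a ab] by (simp_all add: L_def)
  have iF: "integrable R F" unfolding F_def[abs_def] by (intro integrable_mult_right log_integrable)
  have vF: "(LINT p|R. F p) = of_real (2 * pi * (L * (1 + c\<^sup>2)))"
  proof -
    have "(LINT p|R. F p) = (LINT t|ivl 0 (2*pi). LINT r|ivl a b. F (t, r))"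
      by (rule ivl_pair.integral_fst'[OF iF, symmetric])
    also have "\<dots> = (LINT t|ivl 0 (2*pi). complex_of_real (L * (1 + c\<^sup>2)))"
    proof (rule integral_cong_AE)
      show "(\<lambda>t. LINT r|ivl a b. F (t, r)) \<in> borel_measurable (ivl 0 (2*pi))"
        using ivl_pair.integrable_fst'[OF iF] by (rule borel_measurable_integrable)
      show "AE t in ivl 0 (2*pi). (LINT r|ivl a b. F (t, r)) = complex_of_real (L * (1 + c\<^sup>2))"
        using ray
      proof eventually_elim
        fix t assume t: "(LINT r|ivl a b. Vr (t,r) / V (t,r)) = Complex (ln (b / a)) (2 * pi * of_int m)"
        have "(LINT r|ivl a b. F (t, r)) = cnj \<kappa> * Complex (ln (b / a)) (2 * pi * of_int m)"
          unfolding F_def integral_mult_right_zero t ..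
        also have "Complex (ln (b / a)) (2 * pi * of_int m) = of_real L * \<kappa>"
          using L by (simp add: complex_eq_iff \<kappa>_def c_def L_def)
        also have "cnj \<kappa> * (of_real L * \<kappa>) = of_real (L * (1 + c\<^sup>2))"
          by (simp add: complex_eq_iff \<kappa>_def power2_eq_square algebra_simps)
        finally show "(LINT r|ivl a b. F (t, r)) = complex_of_real (L * (1 + c\<^sup>2))" .
      qed
    qed simp
    also have "\<dots> = of_real (2 * pi * (L * (1 + c\<^sup>2)))"
      using integral_ivl_continuous(1)[of 0 "2*pi" "\<lambda>_. complex_of_real (L * (1 + c\<^sup>2))"] by (simp add: scaleR_conv_of_real)
    finally show ?thesis .
  qed
  have iFr: "integrable R (\<lambda>p. Re (F p))" and vFr: "(LINT p|R. Re (F p)) = 2 * pi * (L * (1 + c\<^sup>2))"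
    using iF vF by (auto simp: integrable_Re)
  \<comment> \<open>An integral that does not exist has the default value 0, whereas this one equals
    \<open>2 pi L > 0\<close>. The known value therefore yields integrability.\<close>
  have iA: "integrable R (\<lambda>p. Im (Vt p / V p) / snd p)"
  proof (rule ccontr)
    assume "\<not> ?thesis"
    then have "(LINT p|R. Im (Vt p / V p) / snd p) = 0" by (rule not_integrable_integral_eq)
    then show False using angular_log_integral L by (simp add: L_def)
  qed
  \<comment> \<open>The tangent plane of the density at the twist map, that is, at
    \<open>x = \<kappa> / s\<close> and \<open>y = i\<close>. Expanding
    \<open>|s x - \<kappa>|^2 \<ge> 0\<close> and \<open>|y - i|^2 \<ge> 0\<close> puts it below the
    density, and each of its terms has a known integral.\<close>
  define g where "g p = 2 * Re (F p) - (1 + c\<^sup>2) * (1 / snd p) + (2 * (Im (Vt p / V p) / snd p) - 1 / snd p)" for p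
  have ig: "integrable R g"
    unfolding g_def[abs_def] by (intro Bochner_Integration.integrable_add Bochner_Integration.integrable_diff integrable_mult_right iFr int_inv iA)
  have i1: "integrable R (\<lambda>p. 2 * Re (F p))" "integrable R (\<lambda>p. (1 + c\<^sup>2) * (1 / snd p))" "integrable R (\<lambda>p. 2 * (Im (Vt p / V p) / snd p))"
    by (intro integrable_mult_right iFr int_inv iA)+
  have "(LINT p|R. g p) = (2 * (2 * pi * (L * (1 + c\<^sup>2))) - (1 + c\<^sup>2) * (2 * pi * L)) + (2 * (2 * pi * L) - 2 * pi * L)"
    unfolding g_def Bochner_Integration.integral_add[OF Bochner_Integration.integrable_diff[OF i1(1,2)] Bochner_Integration.integrable_diff[OF i1(3) int_inv]]
      Bochner_Integration.integral_diff[OF i1(1,2)] Bochner_Integration.integral_diff[OF i1(3) int_inv]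
      integral_mult_right_zero vFr vs angular_log_integral L_def[symmetric] ..
  also have "\<dots> = 2 * pi * L * (2 + c\<^sup>2)" by (simp add: algebra_simps)
  finally have vg: "(LINT p|R. g p) = 2 * pi * L * (2 + c\<^sup>2)" .
  have "(LINT p|R. g p) \<le> (LINT p|R. log_energy_density p)"
  proof (rule integral_mono[OF ig log_energy_density_integrable])
    fix p assume p: "p \<in> space R"
    define s x y where "s = snd p" and "x = Vr p / V p" and "y = Vt p / V p"
    have s: "0 < s" using snd_bounds(3)[OF p] by (simp add: s_def)
    have "0 \<le> (norm (of_real s * x - \<kappa>))\<^sup>2" by simp
    also have "\<dots> = s\<^sup>2 * (norm x)\<^sup>2 - 2 * s * Re (cnj \<kappa> * x) + (1 + c\<^sup>2)"
      unfolding cmod_power2 by (simp add: \<kappa>_def power2_eq_square algebra_simps)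
    also have "\<dots> = s * ((norm x)\<^sup>2 * s - (2 * Re (cnj \<kappa> * x) - (1 + c\<^sup>2) * (1 / s)))"
      using s by (simp add: power2_eq_square field_simps)
    finally have 1: "2 * Re (cnj \<kappa> * x) - (1 + c\<^sup>2) * (1 / s) \<le> (norm x)\<^sup>2 * s"
      using s by (simp add: zero_le_mult_iff)
    have "0 \<le> (Re y)\<^sup>2 + (Im y - 1)\<^sup>2" by simp
    then have "2 * Im y - 1 \<le> (norm y)\<^sup>2" unfolding cmod_power2 by (simp add: power2_eq_square algebra_simps)
    from divide_right_mono[OF this less_imp_le[OF s]]
    have 2: "2 * (Im y / s) - 1 / s \<le> (norm y)\<^sup>2 / s" by (simp add: diff_divide_distrib)
    from 1 2 show "g p \<le> log_energy_density p"
      unfolding g_def log_energy_density_def F_def s_def[symmetric] x_def[symmetric] y_def[symmetric] by linarith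
  qed
  then show ?thesis unfolding vg c_def L_def .
qed

end

text \<open>Where \<open>W\<close> and the reference map differ in argument by a half turn up to a quarter turn, they are at
  distance at least \<open>r\<close>. A ray of small radial energy spends radius at least \<open>\<rho>\<close> in such positions if
  its relative winding does not vanish.\<close>

lemma ray_separation:
  fixes P W :: "real \<Rightarrow> complex" and g :: "real \<Rightarrow> real"
  assumes ab: "0 < a" "a < b"
    and P: "integrable (ivl a b) P" "integrable (ivl a b) (\<lambda>r. (norm (P r))\<^sup>2)"
    and g: "g a = 0" "\<And>r s. r \<in> {a..b} \<Longrightarrow> s \<in> {a..b} \<Longrightarrow> \<bar>g r - g s\<bar> \<le> c * \<bar>r - s\<bar>"
    and j: "Im (LINT r|ivl a b. P r) - g b = 2 * pi * of_int j" "j \<noteq> 0"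
    and W: "AE r in ivl a b. W r = of_real a * cis t * exp (LINT x|ivl a r. P x)"
    and K: "0 < K" and \<rho>: "0 < \<rho>" "\<rho> \<le> (b - a) / 2" "\<rho> * (2 * K / pi + c) \<le> pi / 4"
  shows "1 \<le> ennreal (1 / K) * (\<integral>\<^sup>+r. ennreal ((norm (P r))\<^sup>2) \<partial>ivl a b)
    + ennreal (1 / (a * \<rho>)) * (\<integral>\<^sup>+r. ennreal (norm (W r - of_real r * cis (t + g r))) \<partial>ivl a b)"
proof (cases "K \<le> (LINT r|ivl a b. (norm (P r))\<^sup>2)")
  case True
  \<comment> \<open>A ray of large radial energy needs no geometry: the first summand alone reaches
    1.\<close>
  have "1 = ennreal (1 / K) * ennreal K" using K by (simp add: ennreal_mult[symmetric])
  also have "\<dots> \<le> ennreal (1 / K) * ennreal (LINT r|ivl a b. (norm (P r))\<^sup>2)"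
    using True by (intro mult_left_mono ennreal_leI) auto
  also have "ennreal (LINT r|ivl a b. (norm (P r))\<^sup>2) = (\<integral>\<^sup>+r. ennreal ((norm (P r))\<^sup>2) \<partial>ivl a b)"
    by (rule nn_integral_eq_integral[OF P(2), symmetric]) simp
  finally show ?thesis by (rule order_trans) simp
next
  case False
  define S where "S r = (LINT x|ivl a r. P x)" for r
  have S: "S r = integral {a..r} P" if "r \<in> {a..b}" for r using primitive_ivl(1)[OF P(1) that] by (simp add: S_def)
  have cS: "continuous_on {a..b} S" unfolding S_def by (rule primitive_ivl(2)[OF P(1)])
  have c0: "0 \<le> c"
    using order_trans[OF abs_ge_zero g(2)[of a b]] ab by (simp add: zero_le_mult_iff)
  have cg: "continuous_on {a..b} g"
  proof (rule lipschitz_on_continuous_on)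
    show "c-lipschitz_on {a..b} g" by (rule lipschitz_onI) (use g(2) c0 in \<open>auto simp: dist_real_def\<close>)
  qed
  define q where "q r = Im (S r) - g r" for r
  have cq: "continuous_on {a..b} q" unfolding q_def by (intro continuous_intros cS cg)
  have "S a = 0" using S[of a] ab by simp
  then have qa: "q a = 0" by (simp add: q_def g)
  have qb: "q b = 2 * pi * of_int j" using j(1) by (simp add: q_def S_def)
  \<comment> \<open>The relative argument \<open>q\<close> runs from 0 to \<open>2 pi j\<close> with
    \<open>j \<noteq> 0\<close>, so it passes the half turn with the sign of \<open>j\<close>; the
    intermediate value theorem supplies the radius \<open>r0\<close>.\<close>
  define e :: real where "e = (if j > 0 then pi else - pi)"
  obtain r0 where r0: "r0 \<in> {a..b}" "q r0 = e"
  proof -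
    have "pi \<le> 2 * pi * real_of_int j" if "j > 0"
      using that mult_left_mono[of 1 "real_of_int j" "2 * pi"] pi_gt_zero by auto
    moreover have "2 * pi * real_of_int j \<le> - pi" if "\<not> j > 0"
    proof -
      have "2 * pi * real_of_int j \<le> 2 * pi * (- 1)" using that j(2) by (intro mult_left_mono) auto
      then show ?thesis using pi_gt_zero by linarith
    qed
    ultimately have h: "if j > 0 then q a \<le> e \<and> e \<le> q b else q b \<le> e \<and> e \<le> q a"
      unfolding qa qb e_def using pi_gt_zero by (auto split: if_splits)
    show thesis
    proof (cases "j > 0")
      case True
      with h IVT'[OF _ _ less_imp_le[OF ab(2)] cq, of e] that show ?thesis by auto
    next
      case False
      with h IVT2'[OF _ _ less_imp_le[OF ab(2)] cq, of e] that show ?thesis by auto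
    qed
  qed
  \<comment> \<open>For the inequality \<open>|P| \<le> \<eta> |P|^2 + 1 / (4 \<eta>)\<close>. With
    \<open>\<eta> K = pi / 8\<close> the argument moves by at most pi / 8 plus
    \<open>2 K / pi\<close> per unit of radius. Together with the pi / 4 granted by the choice of
    \<open>\<rho>\<close>, this makes 3 pi / 8, below a quarter turn.\<close>
  define \<eta> where "\<eta> = pi / (8 * K)"
  have \<eta>: "0 < \<eta>" "\<eta> * K = pi / 8" "1 / (4 * \<eta>) = 2 * K / pi" using K by (auto simp: \<eta>_def)
  have iN: "(\<lambda>r. (norm (P r))\<^sup>2) integrable_on {a..b}" and iP: "P integrable_on {a..b}"
    by (rule integral_ivl(2)[OF P(2)], rule integral_ivl(2)[OF P(1)])
  have vN: "integral {a..b} (\<lambda>r. (norm (P r))\<^sup>2) \<le> K" using False integral_ivl(1)[OF P(2)] by simp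
  have S_diff: "norm (S s - S r) \<le> pi / 8 + (s - r) * (2 * K / pi)" if rs: "r \<in> {a..b}" "s \<in> {a..b}" "r \<le> s" for r s
  proof -
    have sub: "{r..s} \<subseteq> {a..b}" using rs by auto
    have "S s - S r = integral {r..s} P"
    proof -
      have "P integrable_on {a..s}" by (rule integrable_on_subinterval[OF iP]) (use rs in auto)
      from Henstock_Kurzweil_Integration.integral_combine[OF _ rs(3) this] show ?thesis using rs(1) by (simp add: S[OF rs(1)] S[OF rs(2)] algebra_simps)
    qed
    also have "norm \<dots> \<le> integral {r..s} (\<lambda>x. \<eta> * (norm (P x))\<^sup>2 + 1 / (4 * \<eta>))"
    proof (rule Henstock_Kurzweil_Integration.integral_norm_bound_integral)
      show "P integrable_on {r..s}" by (rule integrable_on_subinterval[OF iP sub])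
      show "(\<lambda>x. \<eta> * (norm (P x))\<^sup>2 + 1 / (4 * \<eta>)) integrable_on {r..s}"
        by (intro integrable_add integrable_on_mult_right integrable_on_subinterval[OF iN sub] integrable_const_ivl)
      fix x
      have "0 \<le> (2 * \<eta> * norm (P x) - 1)\<^sup>2" by simp
      then have "4 * \<eta> * norm (P x) \<le> 4 * \<eta> * (\<eta> * (norm (P x))\<^sup>2 + 1 / (4 * \<eta>))"
        using \<eta>(1) by (simp add: power2_eq_square algebra_simps)
      then show "norm (P x) \<le> \<eta> * (norm (P x))\<^sup>2 + 1 / (4 * \<eta>)"
        using \<eta>(1) by (simp only: mult_le_cancel_left_pos mult_pos_pos zero_less_numeral)
    qed
    also have "\<dots> = \<eta> * integral {r..s} (\<lambda>x. (norm (P x))\<^sup>2) + (s - r) * (2 * K / pi)"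
    proof -
      have "integral {r..s} (\<lambda>x. \<eta> * (norm (P x))\<^sup>2 + 1 / (4 * \<eta>)) = integral {r..s} (\<lambda>x. \<eta> * (norm (P x))\<^sup>2) + integral {r..s} (\<lambda>x. 1 / (4 * \<eta>))"
        by (rule Henstock_Kurzweil_Integration.integral_add[OF integrable_on_mult_right[OF integrable_on_subinterval[OF iN sub]] integrable_const_ivl])
      then show ?thesis using rs(3) by (simp add: \<eta>(3)[symmetric])
    qed
    also have "integral {r..s} (\<lambda>x. (norm (P x))\<^sup>2) \<le> K"
      by (rule order_trans[OF integral_subset_le[OF sub integrable_on_subinterval[OF iN sub] iN] vN]) simp
    finally show ?thesis using \<eta> by (simp add: mult_left_mono order_trans)
  qed
  have q_near: "\<bar>q r - e\<bar> \<le> pi / 2" if r: "r \<in> {a..b}" "\<bar>r - r0\<bar> \<le> \<rho>" for r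
  proof -
    have "norm (S r - S r0) \<le> pi / 8 + \<bar>r - r0\<bar> * (2 * K / pi)"
      using S_diff[OF r(1) r0(1)] S_diff[OF r0(1) r(1)] by (cases "r \<le> r0") (auto simp: norm_minus_commute abs_if)
    moreover have "\<bar>Im (S r) - Im (S r0)\<bar> \<le> norm (S r - S r0)" using abs_Im_le_cmod[of "S r - S r0"] by simp
    moreover have "\<bar>g r - g r0\<bar> \<le> c * \<bar>r - r0\<bar>" by (rule g(2)[OF r(1) r0(1)])
    moreover have "\<bar>r - r0\<bar> * (2 * K / pi + c) \<le> \<rho> * (2 * K / pi + c)"
      using r(2) K c0 by (intro mult_right_mono) auto
    moreover have "\<bar>r - r0\<bar> * (2 * K / pi + c) = \<bar>r - r0\<bar> * (2 * K / pi) + c * \<bar>r - r0\<bar>" by (simp only: distrib_left mult.commute)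
    ultimately show ?thesis using \<rho>(3) pi_gt_zero unfolding r0(2)[symmetric] q_def by linarith
  qed
  \<comment> \<open>After rotation by the reference argument the reference point is the positive
    number \<open>r\<close>, while the other point has real part at most 0 because
    \<open>cos (q r) \<le> 0\<close>. The real parts alone differ by at least
    \<open>r\<close>.\<close>
  have dist: "a \<le> norm (of_real a * cis t * exp (S r) - of_real r * cis (t + g r))" if r: "r \<in> {a..b}" "\<bar>r - r0\<bar> \<le> \<rho>" for r
  proof -
    have "- (pi / 2) \<le> q r - e" "q r - e \<le> pi / 2" using q_near[OF r] by linarith+
    then have "cos (q r - e) \<ge> 0" by (rule cos_ge_zero)
    moreover have "cos (q r - e) = - cos (q r)" by (simp add: e_def cos_diff)
    ultimately have cosq: "cos (q r) \<le> 0" by simp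
    define M where "M = a * exp (Re (S r))"
    have "of_real a * cis t * exp (S r) = of_real M * cis (t + Im (S r))"
      by (simp add: M_def exp_eq_polar cis_mult[symmetric] exp_of_real)
    also have "cis (t + Im (S r)) = cis (t + g r) * cis (q r)" by (simp add: q_def cis_mult)
    finally have "of_real a * cis t * exp (S r) - of_real r * cis (t + g r) = cis (t + g r) * (of_real M * cis (q r) - of_real r)"
      by (simp add: algebra_simps)
    then have "norm (of_real a * cis t * exp (S r) - of_real r * cis (t + g r)) = norm (of_real M * cis (q r) - of_real r)"
      by (simp add: norm_mult)
    moreover have "\<bar>M * cos (q r) - r\<bar> \<le> norm (of_real M * cis (q r) - of_real r)"
      using abs_Re_le_cmod[of "of_real M * cis (q r) - of_real r"] by simp
    moreover have "M * cos (q r) \<le> 0" using cosq ab by (simp add: M_def mult_nonneg_nonpos)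
    ultimately show ?thesis using r(1) by auto
  qed
  \<comment> \<open>The interval extends from \<open>r0\<close> to one side only. Since
    \<open>\<rho>\<close> is at most half of \<open>b - a\<close>, at least one side has room for
    it.\<close>
  obtain l u where lu: "l \<le> u" "a \<le> l" "u \<le> b" "u - l = \<rho>" "\<And>r. r \<in> {l..u} \<Longrightarrow> \<bar>r - r0\<bar> \<le> \<rho>"
  proof (cases "r0 + \<rho> \<le> b")
    case True
    then show ?thesis using that[of r0 "r0 + \<rho>"] r0(1) \<rho>(1) by auto
  next
    case False
    then show ?thesis using that[of "r0 - \<rho>" r0] r0(1) \<rho>(1,2) by auto
  qed
  have "ennreal (a * \<rho>) = (\<integral>\<^sup>+r. ennreal a * indicator {l..u} r \<partial>ivl a b)"
  proof -
    have "{l..u} \<in> sets (ivl a b)" using lu by (auto simp: sets_restrict_space_iff)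
    moreover have "emeasure (ivl a b) {l..u} = ennreal \<rho>"
      using lu by (subst emeasure_restrict_space) auto
    ultimately show ?thesis using ab \<rho>(1) by (simp add: nn_integral_cmult_indicator ennreal_mult)
  qed
  also have "\<dots> \<le> (\<integral>\<^sup>+r. ennreal (norm (W r - of_real r * cis (t + g r))) \<partial>ivl a b)"
  proof (rule nn_integral_mono_AE)
    show "AE r in ivl a b. ennreal a * indicator {l..u} r \<le> ennreal (norm (W r - of_real r * cis (t + g r)))"
      using W AE_space
    proof eventually_elim
      fix r assume "W r = of_real a * cis t * exp (LINT x|ivl a r. P x)" "r \<in> space (ivl a b)"
      then show "ennreal a * indicator {l..u} r \<le> ennreal (norm (W r - of_real r * cis (t + g r)))"
        using dist[of r] lu(5)[of r] by (auto simp: S_def indicator_def intro!: ennreal_leI)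
    qed
  qed
  finally have "ennreal (1 / (a * \<rho>)) * ennreal (a * \<rho>) \<le> ennreal (1 / (a * \<rho>)) * (\<integral>\<^sup>+r. ennreal (norm (W r - of_real r * cis (t + g r))) \<partial>ivl a b)"
    by (intro mult_left_mono) auto
  moreover have "ennreal (1 / (a * \<rho>)) * ennreal (a * \<rho>) = 1" using ab \<rho>(1) by (simp add: ennreal_mult[symmetric])
  ultimately have "1 \<le> ennreal (1 / (a * \<rho>)) * (\<integral>\<^sup>+r. ennreal (norm (W r - of_real r * cis (t + g r))) \<partial>ivl a b)" by simp
  then show ?thesis by (rule order_trans) simp
qed

text \<open>A continuous argument \<open>q\<close> is a logarithm of the normalised curve, and the
  winding number of \<open>exp \<circ> p\<close> is read off at the ends of \<open>p\<close>. The
  formula also covers curves that are not closed.\<close>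

lemma winding_number_ray_curve:
  assumes ab: "a < b" and q: "continuous_on {a..b} q"
    and f: "\<And>r. r \<in> {a..b} \<Longrightarrow> to_complex (f (polar r \<theta>)) = of_real (\<rho> r) * cis (q r)" "\<And>r. r \<in> {a..b} \<Longrightarrow> 0 < \<rho> r"
  shows "winding_number (ray_curve a b f \<theta>) 0 = of_real ((q b - q a) / (2 * pi))"
proof -
  define p where "p s = \<i> * of_real (q (a + s * (b - a)))" for s
  have in': "a + s * (b - a) \<in> {a..b}" if "0 \<le> s" "s \<le> 1" for s
  proof -
    have "s * (b - a) \<le> 1 * (b - a)" "0 \<le> s * (b - a)" using that ab by (auto intro!: mult_right_mono)
    then show ?thesis by simp
  qed
  have "continuous_on {0..1} (\<lambda>s. q (a + s * (b - a)))"
    by (rule continuous_on_compose2[OF q]) (use in' in \<open>auto intro!: continuous_intros\<close>)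
  then have p: "path p" unfolding path_def p_def by (intro continuous_intros)
  have "winding_number (ray_curve a b f \<theta>) 0 = winding_number (exp \<circ> p) 0"
  proof (rule winding_number_cong)
    fix s :: real assume "0 \<le> s" "s \<le> 1"
    then have r: "a + s * (b - a) \<in> {a..b}" by (rule in')
    define y where "y = f (polar (a + s * (b - a)) \<theta>)"
    have y: "to_complex y = of_real (\<rho> (a + s * (b - a))) * cis (q (a + s * (b - a)))" unfolding y_def by (rule f(1)[OF r])
    have "norm y = \<rho> (a + s * (b - a))"
      using arg_cong[OF y, of norm] f(2)[OF r] by (simp add: norm_mult)
    then have "to_complex (y /\<^sub>R norm y) = cis (q (a + s * (b - a)))"
      unfolding to_complex_scaleR y using f(2)[OF r] by (simp add: scaleR_conv_of_real)
    then show "ray_curve a b f \<theta> s = (exp \<circ> p) s"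
      unfolding ray_curve_def Let_def y_def by (simp add: p_def cis_conv_exp)
  qed
  also have "\<dots> = (pathfinish p - pathstart p) / (2 * of_real pi * \<i>)" by (rule winding_number_compose_exp[OF p])
  also have "\<dots> = of_real ((q b - q a) / (2 * pi))"
    by (simp add: p_def pathfinish_def pathstart_def field_simps)
  finally show ?thesis .
qed

section \<open>The twist map\<close>

definition quarter_turn :: "real^2 \<Rightarrow> real^2" where
  "quarter_turn x = vector [- x $ 2, x $ 1]"

lemma quarter_turn_nth [simp]: "quarter_turn x $ 1 = - x $ 2" "quarter_turn x $ 2 = x $ 1"
  by (simp_all add: quarter_turn_def)

lemma bounded_linear_quarter_turn: "bounded_linear quarter_turn"
proof -
  have "linear quarter_turn" by (rule linearI) (simp_all add: vec_eq_iff forall_2)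
  then show ?thesis by (rule linear_conv_bounded_linear[THEN iffD1])
qed

lemma twist_eq: "twist g x = cos (g (norm x)) *\<^sub>R x + sin (g (norm x)) *\<^sub>R quarter_turn x"
  by (simp add: twist_def rotation_def vec_eq_iff forall_2 matrix_vector_mult_def sum_2)

lemma twist_polar: "0 < r \<Longrightarrow> twist g (polar r t) = polar r (t + g r)"
  by (simp add: twist_eq vec_eq_iff forall_2 norm_polar cos_add sin_add algebra_simps)

lemma norm_twist: "norm (twist g x) = norm x"
proof -
  have "(c * y - s * z)\<^sup>2 + (c * z + s * y)\<^sup>2 = (c\<^sup>2 + s\<^sup>2) * (y\<^sup>2 + z\<^sup>2)" for c s y z :: real
    by (simp add: power2_eq_square algebra_simps)
  from this[of "cos (g (norm x))" "x $ 1" "sin (g (norm x))" "x $ 2"]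
  show ?thesis unfolding norm_vec2[of "twist g x"] norm_vec2[of x] twist_eq by (simp add: norm_vec2)
qed

text \<open>The twist with a free real slope: the differential identities below depend neither on
  the integer \<open>k\<close> nor on \<open>b\<close>.\<close>

definition log_twist :: "real \<Rightarrow> real \<Rightarrow> real \<Rightarrow> real" where
  "log_twist \<alpha> a r = \<alpha> * ln (r / a)"

lemma twist_angle_eq: "twist_angle a b k = log_twist (2 * pi * of_int k / ln (b / a)) a"
  by (rule ext) (simp add: twist_angle_def log_twist_def)

text \<open>\<open>\<beta>\<close> is the derivative of the angle in direction \<open>h\<close>.
  With \<open>J\<close> the quarter turn, the value is the rotation by \<open>G\<close> applied to
  \<open>h + \<beta> J x\<close>.\<close>

definition log_twist_deriv :: "real \<Rightarrow> real \<Rightarrow> real^2 \<Rightarrow> real^2 \<Rightarrow> real^2" where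
  "log_twist_deriv \<alpha> a x h = (let G = log_twist \<alpha> a (norm x); \<beta> = \<alpha> * (x \<bullet> h) / (x \<bullet> x) in
     cos G *\<^sub>R (h + \<beta> *\<^sub>R quarter_turn x) + sin G *\<^sub>R (quarter_turn h - \<beta> *\<^sub>R x))"

lemma twist_has_derivative:
  assumes a: "0 < a" and x: "x \<noteq> 0"
  shows "(twist (log_twist \<alpha> a) has_derivative log_twist_deriv \<alpha> a x) (at x)"
proof -
  define G where "G x = log_twist \<alpha> a (norm x)" for x :: "real^2"
  have n: "0 < norm x" using x by simp
  have "((\<lambda>r. log_twist \<alpha> a r) has_real_derivative \<alpha> / norm x) (at (norm x))"
    unfolding log_twist_def using n a by (auto intro!: derivative_eq_intros)
  then have "((\<lambda>r. log_twist \<alpha> a r) has_derivative (\<lambda>h. \<alpha> / norm x * h)) (at (norm x))"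
    by (simp only: has_field_derivative_def)
  from has_derivative_compose[OF has_derivative_norm[OF x] this]
  have "(G has_derivative (\<lambda>h. \<alpha> / norm x * (h \<bullet> sgn x))) (at x)"
    unfolding G_def[abs_def] by (simp add: inner_commute)
  moreover have "\<alpha> / norm x * (h \<bullet> sgn x) = \<alpha> * (x \<bullet> h) / (x \<bullet> x)" for h
    unfolding sgn_div_norm inner_scaleR_right dot_square_norm by (simp add: inner_commute power2_eq_square divide_inverse)
  ultimately have dG: "(G has_derivative (\<lambda>h. \<alpha> * (x \<bullet> h) / (x \<bullet> x))) (at x)" by simp
  have dC: "((\<lambda>x. cos (G x)) has_derivative (\<lambda>h. - sin (G x) * (\<alpha> * (x \<bullet> h) / (x \<bullet> x)))) (at x)"
    and dS: "((\<lambda>x. sin (G x)) has_derivative (\<lambda>h. cos (G x) * (\<alpha> * (x \<bullet> h) / (x \<bullet> x)))) (at x)"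
    using has_derivative_compose[OF dG, of cos "\<lambda>h. - sin (G x) * h"] has_derivative_compose[OF dG, of sin "\<lambda>h. cos (G x) * h"]
      DERIV_cos[of "G x"] DERIV_sin[of "G x"] by (simp_all only: has_field_derivative_def)
  have "((\<lambda>x. cos (G x) *\<^sub>R x + sin (G x) *\<^sub>R quarter_turn x) has_derivative
      (\<lambda>h. (cos (G x) *\<^sub>R h + (- sin (G x) * (\<alpha> * (x \<bullet> h) / (x \<bullet> x))) *\<^sub>R x)
         + (sin (G x) *\<^sub>R quarter_turn h + (cos (G x) * (\<alpha> * (x \<bullet> h) / (x \<bullet> x))) *\<^sub>R quarter_turn x))) (at x)"
    by (intro has_derivative_add has_derivative_scaleR dC dS has_derivative_ident bounded_linear_imp_has_derivative bounded_linear_quarter_turn)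
  moreover have "(\<lambda>x. cos (G x) *\<^sub>R x + sin (G x) *\<^sub>R quarter_turn x) = twist (log_twist \<alpha> a)"
    by (rule ext) (simp add: twist_eq G_def)
  moreover have "(\<lambda>h. (cos (G x) *\<^sub>R h + (- sin (G x) * (\<alpha> * (x \<bullet> h) / (x \<bullet> x))) *\<^sub>R x)
         + (sin (G x) *\<^sub>R quarter_turn h + (cos (G x) * (\<alpha> * (x \<bullet> h) / (x \<bullet> x))) *\<^sub>R quarter_turn x)) = log_twist_deriv \<alpha> a x"
    by (rule ext) (simp add: log_twist_deriv_def Let_def G_def algebra_simps)
  ultimately show ?thesis by simp
qed

lemma twist_Ck_on:
  assumes a: "0 < a" shows "Ck_on 1 (- {0}) (twist (log_twist \<alpha> a))"
proof -
  have "continuous_on (- {0}) (\<lambda>x. frechet_derivative (twist (log_twist \<alpha> a)) (at x) h)" for h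
  proof -
    have "continuous_on (- {0}) (\<lambda>x. log_twist_deriv \<alpha> a x h)"
      unfolding log_twist_deriv_def Let_def log_twist_def using a
      by (intro continuous_intros bounded_linear.continuous_on[OF bounded_linear_quarter_turn]) auto
    then show ?thesis
      by (rule continuous_on_eq) (simp add: frechet_derivative_at[OF twist_has_derivative[OF a], symmetric])
  qed
  moreover have "twist (log_twist \<alpha> a) differentiable (at x)" if "x \<noteq> 0" for x
    using twist_has_derivative[OF a that] by (rule differentiableI)
  ultimately show ?thesis by simp
qed

text \<open>Up to a rotation the derivative is the identity plus \<alpha> times the rank-one matrix
  \<open>(J x) x^T / |x|^2\<close>, with \<open>J\<close> the quarter turn. Since \<open>J x\<close>
  is orthogonal to \<open>x\<close>, this is a shear: the determinant is 1, and the squared norm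
  exceeds that of the identity by \<open>\<alpha>^2\<close>. In coordinates the rank-one property
  reads \<open>y * y = z * w\<close>.\<close>

lemma log_twist_deriv_matrix:
  fixes \<alpha> a :: real and x :: "real^2"
  assumes a: "0 < a" and x: "x \<noteq> 0"
  defines "D \<equiv> matrix (frechet_derivative (twist (log_twist \<alpha> a)) (at x))"
  shows "det D = 1" and "(norm D)\<^sup>2 = 2 + \<alpha>\<^sup>2"
proof -
  define n where "n = x \<bullet> x"
  have n: "n = x $ 1 * x $ 1 + x $ 2 * x $ 2" by (simp add: n_def inner_vec_def sum_2)
  have n0: "n \<noteq> 0" using x by (simp add: n_def)
  define C S where "C = cos (log_twist \<alpha> a (norm x))" and "S = sin (log_twist \<alpha> a (norm x))"
  have CS: "C * C + S * S = 1" unfolding C_def S_def by (metis power2_eq_square sin_cos_squared_add2)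
  define y z w where "y = \<alpha> * (x $ 1 * x $ 2) / n" and "z = \<alpha> * (x $ 1 * x $ 1) / n" and "w = \<alpha> * (x $ 2 * x $ 2) / n"
  have zw: "z + w = \<alpha>" using n0 unfolding z_def w_def n by (simp add: add_divide_distrib[symmetric] distrib_left[symmetric])
  have yy: "y * y = z * w" by (simp add: y_def z_def w_def)
  have D: "D $ i $ j = log_twist_deriv \<alpha> a x (axis j 1) $ i" for i j
    unfolding D_def matrix_def frechet_derivative_at[OF twist_has_derivative[OF a x], symmetric] by simp
  have ax: "x \<bullet> axis j 1 = x $ j" for j by (simp add: inner_axis)
  have e: "D $ 1 $ 1 = C * (1 - y) - S * z" "D $ 2 $ 1 = C * z + S * (1 - y)"
      "D $ 1 $ 2 = - C * w - S * (1 + y)" "D $ 2 $ 2 = C * (1 + y) - S * w"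
    unfolding D log_twist_deriv_def Let_def ax n_def[symmetric] C_def[symmetric] S_def[symmetric]
    by (simp_all add: y_def z_def w_def axis_def algebra_simps)
  have "det D = (C * C + S * S) * (1 - y * y + z * w)"
    unfolding det_2 e by (simp add: algebra_simps)
  then show "det D = 1" unfolding CS yy by simp
  have "(norm D)\<^sup>2 = (C * C + S * S) * (2 + (z + w) * (z + w) + 2 * (y * y - z * w))"
    unfolding norm_matrix2 e by (simp add: power2_eq_square algebra_simps)
  then show "(norm D)\<^sup>2 = 2 + \<alpha>\<^sup>2" unfolding CS yy zw by (simp add: power2_eq_square)
qed

text \<open>Even for the zero map \<open>wgrad\<close> is an arbitrary choice; uniqueness of weak
  gradients makes it vanish almost everywhere.\<close>

lemma W12_norm_zero: "open \<Omega> \<Longrightarrow> bounded \<Omega> \<Longrightarrow> W12_norm \<Omega> (\<lambda>x. 0 :: real^'m) = 0"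
proof -
  assume \<Omega>: "open \<Omega>" "bounded \<Omega>"
  have 0: "has_L2_gradient \<Omega> (\<lambda>x. 0 :: real^'m) (\<lambda>x. 0)"
    by (simp add: has_L2_gradient_def square_integrable_def)
  have "has_L2_gradient \<Omega> (\<lambda>x. 0 :: real^'m) (wgrad \<Omega> (\<lambda>x. 0))"
    unfolding wgrad_def by (rule someI[where P="has_L2_gradient \<Omega> (\<lambda>x. 0 :: real^'m)", OF 0])
  from has_L2_gradient_unique[OF \<Omega> this 0]
  have ae: "AE x in lebesgue_on \<Omega>. (norm (wgrad \<Omega> (\<lambda>x. 0 :: real^'m) x))\<^sup>2 = 0" by eventually_elim simp
  have "(LINT x|lebesgue_on \<Omega>. (norm (wgrad \<Omega> (\<lambda>x. 0 :: real^'m) x))\<^sup>2) = 0"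
    by (rule integral_eq_zero_AE[OF ae])
  then show ?thesis unfolding W12_norm_def by simp
qed

lemma half_ennreal_double: "1 / 2 * ennreal (2 * x) = ennreal x"
proof -
  have "1 / 2 * ennreal (2 * x) = ennreal (1 / 2) * ennreal (2 * x)"
    by (metis divide_ennreal ennreal_1 ennreal_numeral zero_le_one zero_less_numeral)
  also have "\<dots> = ennreal (1 / 2 * (2 * x))" by (rule ennreal_mult'[symmetric]) simp
  finally show ?thesis by simp
qed

locale log_twist_map =
  fixes a b :: real and k :: int
  assumes a: "0 < a" and ab: "a < b"
begin

abbreviation "X \<equiv> annulus a b"
abbreviation "u \<equiv> twist (twist_angle a b k)"
definition "\<alpha> = 2 * pi * of_int k / ln (b / a)"

lemma u_eq: "u = twist (log_twist \<alpha> a)"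
  unfolding twist_angle_eq \<alpha>_def ..

lemma L: "0 < ln (b / a)"
  using a ab by simp

lemma angle_ends: "twist_angle a b k a = 0" "twist_angle a b k b = 2 * pi * of_int k"
  using a L by (simp_all add: twist_angle_def)

lemma angle_continuous: "continuous_on {a..b} (twist_angle a b k)"
  unfolding twist_angle_def using a L by (intro continuous_intros) auto

lemma u_boundary: "norm x = a \<or> norm x = b \<Longrightarrow> u x = x"
  by (elim disjE) (simp_all add: twist_eq angle_ends sin_int_2pin cos_int_2pin)

lemma closure_nonzero: "closure X \<subseteq> - {0}"
  using a unfolding annulus_closure[OF a ab] by auto

lemma u_continuous: "continuous_on (closure X) u"
  unfolding u_eq by (rule continuous_on_subset[OF Ck_on_1D(3)[OF twist_Ck_on[OF a]] closure_nonzero])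

lemma u_gradient: "has_L2_gradient X u (\<lambda>x. matrix (frechet_derivative u (at x)))"
  unfolding u_eq by (rule has_L2_gradient_C1[OF open_annulus bounded_annulus open_Compl[OF closed_singleton] closure_nonzero twist_Ck_on[OF a]])

lemma u_wgrad: "AE x in lebesgue_on X. det (wgrad X u x) = 1 \<and> (norm (wgrad X u x))\<^sup>2 = 2 + \<alpha>\<^sup>2"
proof -
  have "has_L2_gradient X u (wgrad X u)"
    unfolding wgrad_def by (rule someI[where P="has_L2_gradient X u", OF u_gradient])
  from has_L2_gradient_unique[OF open_annulus bounded_annulus this u_gradient] AE_space
  show ?thesis
  proof eventually_elim
    fix x assume e: "wgrad X u x = matrix (frechet_derivative u (at x))" and "x \<in> space (lebesgue_on X)"
    then have "x \<noteq> 0" using a by (auto simp: space_restrict_space annulus_def)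
    from log_twist_deriv_matrix[OF a this, of \<alpha>]
    show "det (wgrad X u x) = 1 \<and> (norm (wgrad X u x))\<^sup>2 = 2 + \<alpha>\<^sup>2"
      unfolding e unfolding u_eq by blast
  qed
qed

text \<open>The twist map is C1 away from the origin, hence near the closed annulus, and is the
  identity on both circles. The constant sequence \<open>u\<close> is an admissible
  approximation.\<close>

lemma u_trace: "has_trace a b u (\<lambda>x. x)"
  unfolding has_trace_def
proof (intro conjI ballI)
  fix \<rho> assume "\<rho> \<in> {a, b}"
  have c: "continuous_on {0..2*pi} (polar \<rho>)" by (intro continuous_on_polar continuous_intros)
  show "square_integrable (lebesgue_on {0..2*pi}) (polar \<rho>)"
    unfolding square_integrable_def norm_polar
    using finite_measure.integrable_const[OF finite_measure_lebesgue_on[of "{0..2*pi}"], of "\<bar>\<rho>\<bar>\<^sup>2"]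
    by (auto intro!: continuous_imp_measurable_on_sets_lebesgue c)
next
  have "Ck_on 1 (- {0}) u" unfolding u_eq by (rule twist_Ck_on[OF a])
  moreover have "open (- {0::real^2})" by (rule open_Compl[OF closed_singleton])
  ultimately have U: "\<exists>U. open U \<and> closure X \<subseteq> U \<and> Ck_on 1 U u" using closure_nonzero by blast
  have "boundary_L2_norm a b (\<lambda>x. u x - x) = 0"
    using a ab by (simp add: boundary_L2_norm_def u_boundary norm_polar)
  then show "\<exists>w. (\<forall>n. \<exists>U. open U \<and> closure X \<subseteq> U \<and> Ck_on 1 U (w n)) \<and>
      (\<lambda>n. W12_norm X (\<lambda>x. w n x - u x)) \<longlonglongrightarrow> 0 \<and> (\<lambda>n. boundary_L2_norm a b (\<lambda>x. w n x - x)) \<longlonglongrightarrow> 0"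
    using U W12_norm_zero[OF open_annulus bounded_annulus, where 'm=2] by (intro exI[of _ "\<lambda>n::nat. u"]) simp
qed

lemma u_admissible: "u \<in> admissible a b"
proof -
  have "u \<in> W12 X"
    unfolding W12_def using square_integrable_continuous[OF open_annulus bounded_annulus u_continuous] u_gradient by blast
  moreover have "AE x in lebesgue_on X. det (wgrad X u x) = 1" using u_wgrad by eventually_elim blast
  ultimately show ?thesis unfolding admissible_def using u_trace by blast
qed

lemma u_polar: "r \<in> {a..b} \<Longrightarrow> u (polar r t) = polar r (t + twist_angle a b k r)"
  using a by (intro twist_polar) auto

lemma u_homotopy_class: "u \<in> homotopy_class a b k"
proof -
  have "continuous_representative a b u u"
    unfolding continuous_representative_def annulus_frontier[OF a ab]
    using u_continuous u_boundary by (auto simp: annulus_closure[OF a ab] norm_twist)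
  moreover have "has_degree a b u k"
    unfolding has_degree_def
  proof
    fix \<theta>
    have "winding_number (ray_curve a b u \<theta>) 0 = of_real (((\<theta> + twist_angle a b k b) - (\<theta> + twist_angle a b k a)) / (2 * pi))"
    proof (rule winding_number_ray_curve[OF ab])
      show "continuous_on {a..b} (\<lambda>r. \<theta> + twist_angle a b k r)" by (intro continuous_intros angle_continuous)
      show "to_complex (u (polar r \<theta>)) = of_real r * cis (\<theta> + twist_angle a b k r)" "0 < r" if "r \<in> {a..b}" for r
        using that a by (auto simp: u_polar to_complex_polar)
    qed
    then show "winding_number (ray_curve a b u \<theta>) 0 = of_int k" by (simp add: angle_ends)
  qed
  ultimately show ?thesis unfolding homotopy_class_def using u_admissible by blast
qed

text \<open>Twisting preserves the modulus and the squared gradient is the constant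
  \<open>2 + \<alpha>^2\<close>, so the energy reduces to the integral of \<open>1 / r\<close> over
  the polar rectangle, which is \<open>2 pi ln (b / a)\<close>.\<close>

lemma u_energy: "energy X u = ennreal (pi * ln (b / a) * (2 + \<alpha>\<^sup>2))"
proof -
  have XB: "X \<in> sets borel" using open_annulus by auto
  have m: "(\<lambda>x::real^2. ennreal (2 + \<alpha>\<^sup>2) / ennreal ((norm x)\<^sup>2)) \<in> borel_measurable borel"
    by measurable
  have "(\<integral>\<^sup>+x. ennreal ((norm (wgrad X u x))\<^sup>2) / ennreal ((norm (u x))\<^sup>2) \<partial>lebesgue_on X)
      = (\<integral>\<^sup>+x. ennreal (2 + \<alpha>\<^sup>2) / ennreal ((norm x)\<^sup>2) \<partial>lebesgue_on X)"
  proof (rule nn_integral_cong_AE)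
    show "AE x in lebesgue_on X. ennreal ((norm (wgrad X u x))\<^sup>2) / ennreal ((norm (u x))\<^sup>2) = ennreal (2 + \<alpha>\<^sup>2) / ennreal ((norm x)\<^sup>2)"
      using u_wgrad by eventually_elim (simp only: norm_twist)
  qed
  also have "\<dots> = (\<integral>\<^sup>+x. ennreal (2 + \<alpha>\<^sup>2) / ennreal ((norm x)\<^sup>2) * indicator X x \<partial>lebesgue)"
    using XB by (intro nn_integral_restrict_space) simp
  also have "\<dots> = (\<integral>\<^sup>+x. ennreal (2 + \<alpha>\<^sup>2) / ennreal ((norm x)\<^sup>2) * indicator X x \<partial>lborel)"
    using m XB by (intro nn_integral_completion borel_measurable_times_ennreal borel_measurable_indicator)
  also have "\<dots> = (\<integral>\<^sup>+p. ennreal (2 + \<alpha>\<^sup>2) / ennreal ((norm (polar (snd p) (fst p)))\<^sup>2) * ennreal (snd p) \<partial>polar_rect a b)"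
    by (rule nn_integral_annulus_polar[OF a ab m])
  also have "\<dots> = (\<integral>\<^sup>+p. ennreal ((2 + \<alpha>\<^sup>2) * (1 / snd p)) \<partial>polar_rect a b)"
  proof (rule nn_integral_cong)
    fix p assume "p \<in> space (polar_rect a b)"
    then have "0 < snd p" using a by (auto simp: space_pair_measure)
    then show "ennreal (2 + \<alpha>\<^sup>2) / ennreal ((norm (polar (snd p) (fst p)))\<^sup>2) * ennreal (snd p) = ennreal ((2 + \<alpha>\<^sup>2) * (1 / snd p))"
      unfolding norm_polar by (subst divide_ennreal) (simp_all add: ennreal_mult''[symmetric] power2_eq_square)
  qed
  also have "\<dots> = ennreal (LINT p|polar_rect a b. (2 + \<alpha>\<^sup>2) * (1 / snd p))"
  proof (rule nn_integral_eq_integral)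
    have "continuous_on {a..b} (\<lambda>r. 1 / r)" using a by (intro continuous_intros) auto
    from integral_polar_rect_radial(2)[OF this]
    show "integrable (polar_rect a b) (\<lambda>p. (2 + \<alpha>\<^sup>2) * (1 / snd p))" by (rule integrable_mult_right)
    show "AE p in polar_rect a b. 0 \<le> (2 + \<alpha>\<^sup>2) * (1 / snd p)"
      using a by (intro AE_I2) (auto simp: space_pair_measure)
  qed
  also have "(LINT p|polar_rect a b. (2 + \<alpha>\<^sup>2) * (1 / snd p)) = 2 * (pi * ln (b / a) * (2 + \<alpha>\<^sup>2))"
  proof -
    have "continuous_on {a..b} (\<lambda>r. 1 / r)" using a by (intro continuous_intros) auto
    from integral_polar_rect_radial(1)[OF this] show ?thesis
      unfolding integral_mult_right_zero integral_inverse_ivl[OF a ab] by simp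
  qed
  finally show ?thesis
    by (simp add: energy_def half_ennreal_double)
qed

end

text \<open>A single good ray suffices, since the degree is required to be the same on all rays.
  Along it the primitive of \<open>Vr / V\<close> is a continuous logarithm of the continuous
  representative, so the winding number is the increment of its imaginary part divided by 2
  pi.\<close>

lemma (in polar_approximation) degree_eq_ray_winding:
  assumes V: "AE p in R. V p = to_complex (v (polar (snd p) (fst p)))"
    and f: "continuous_representative a b v f" and k: "has_degree a b f k"
    and ray: "AE t in ivl 0 (2*pi). integrable (ivl a b) (\<lambda>r. Vr (t,r) / V (t,r)) \<and>
       integrable (ivl a b) (\<lambda>r. (norm (Vr (t,r) / V (t,r)))\<^sup>2) \<and>
       (LINT r|ivl a b. Vr (t,r) / V (t,r)) = Complex (ln (b / a)) (2 * pi * of_int m) \<and>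
       (AE r in ivl a b. V (t,r) = of_real a * cis t * exp (LINT x|ivl a r. Vr (t,x) / V (t,x)))"
  shows "m = k"
proof -
  have "annulus a b \<in> sets lebesgue" using open_annulus by (simp add: lborelD_Collect borel_open)
  then have "AE x in lebesgue. x \<in> annulus a b \<longrightarrow> f x = v x"
    using f by (simp add: continuous_representative_def AE_restrict_space_iff)
  then have "AE x in lborel. x \<in> annulus a b \<longrightarrow> f x = v x" by (simp add: AE_completion_iff)
  from AE_annulus_polar[OF a ab this] V
  have "AE p in R. V p = to_complex (f (polar (snd p) (fst p)))" by eventually_elim simp
  from ivl_pair.AE_pair[OF this]
  have "AE t in ivl 0 (2*pi). AE r in ivl a b. V (t,r) = to_complex (f (polar r t))" by simp
  with ray have ae: "AE t in ivl 0 (2*pi). (AE r in ivl a b. V (t,r) = to_complex (f (polar r t))) \<and>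
       integrable (ivl a b) (\<lambda>r. Vr (t,r) / V (t,r)) \<and>
       (LINT r|ivl a b. Vr (t,r) / V (t,r)) = Complex (ln (b / a)) (2 * pi * of_int m) \<and>
       (AE r in ivl a b. V (t,r) = of_real a * cis t * exp (LINT x|ivl a r. Vr (t,x) / V (t,x)))"
    (is "AE t in _. ?Q t") by eventually_elim blast
  have "\<exists>t. ?Q t"
  proof (rule ccontr)
    assume "\<not> ?thesis"
    then have no: "\<not> ?Q t" for t by blast
    have "AE t in ivl 0 (2*pi). False" using ae by (rule eventually_mono) (rule notE[OF no])
    then have "emeasure (ivl 0 (2*pi)) (space (ivl 0 (2*pi))) = 0" by (simp only: eventually_False ae_filter_eq_bot_iff)
    then show False by (simp add: emeasure_restrict_space)
  qed
  then obtain t where t: "AE r in ivl a b. V (t,r) = to_complex (f (polar r t))"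
    "integrable (ivl a b) (\<lambda>r. Vr (t,r) / V (t,r))"
    "(LINT r|ivl a b. Vr (t,r) / V (t,r)) = Complex (ln (b / a)) (2 * pi * of_int m)"
    "AE r in ivl a b. V (t,r) = of_real a * cis t * exp (LINT x|ivl a r. Vr (t,x) / V (t,x))" by blast
  define S where "S r = (LINT x|ivl a r. Vr (t,x) / V (t,x))" for r
  have cS: "continuous_on {a..b} S" unfolding S_def by (rule primitive_ivl(2)[OF t(2)])
  have Sa: "S a = 0" using primitive_ivl(1)[OF t(2), of a] ab by (simp add: S_def)
  have cf: "continuous_on {a..b} (\<lambda>r. to_complex (f (polar r t)))"
  proof (rule bounded_linear.continuous_on[OF bounded_linear_to_complex continuous_on_compose2[of "closure (annulus a b)" f]])
    show "continuous_on (closure (annulus a b)) f" using f by (simp add: continuous_representative_def)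
    show "continuous_on {a..b} (\<lambda>r. polar r t)" by (intro continuous_on_polar continuous_intros)
    show "(\<lambda>r. polar r t) ` {a..b} \<subseteq> closure (annulus a b)"
      unfolding annulus_closure[OF a ab] using a by (auto simp: norm_polar)
  qed
  \<comment> \<open>Both sides are continuous and agree for almost every radius, hence for every
    radius. This is the only place where the continuity of the representative enters the
    comparison.\<close>
  have eq: "to_complex (f (polar r t)) = of_real a * cis t * exp (S r)" if "r \<in> {a..b}" for r
  proof (rule continuous_AE_eq_ivl[OF ab cf _ _ that])
    show "continuous_on {a..b} (\<lambda>r. of_real a * cis t * exp (S r))" by (intro continuous_intros cS)
    show "AE r in ivl a b. to_complex (f (polar r t)) = of_real a * cis t * exp (S r)"
      using t(1,4) unfolding S_def by eventually_elim simp
  qed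
  have "winding_number (ray_curve a b f t) 0 = of_real (((t + Im (S b)) - (t + Im (S a))) / (2 * pi))"
  proof (rule winding_number_ray_curve[OF ab])
    show "continuous_on {a..b} (\<lambda>r. t + Im (S r))" by (intro continuous_intros cS)
    show "to_complex (f (polar r t)) = of_real (a * exp (Re (S r))) * cis (t + Im (S r))" if "r \<in> {a..b}" for r
      unfolding eq[OF that] exp_eq_polar[of "S r"] by (simp add: cis_mult[symmetric])
  qed (use a in simp)
  moreover have "Im (S b) = 2 * pi * of_int m" using t(3) by (simp add: S_def)
  ultimately have "winding_number (ray_curve a b f t) 0 = of_int m" by (simp add: Sa)
  then show "m = k" using k by (simp add: has_degree_def)
qed

section \<open>Minimality in the homotopy class and local minimality\<close>

context log_twist_map begin

lemma angle_lipschitz: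
  assumes "r \<in> {a..b}" "s \<in> {a..b}"
  shows "\<bar>twist_angle a b k r - twist_angle a b k s\<bar> \<le> \<bar>\<alpha>\<bar> / a * \<bar>r - s\<bar>"
proof -
  have ln: "ln y - ln z \<le> \<bar>y - z\<bar> / a" if "y \<in> {a..b}" "z \<in> {a..b}" for y z
  proof -
    have p: "0 < y" "0 < z" "a \<le> z" using that a by auto
    have "ln y - ln z = ln (y / z)" using p by (simp add: ln_div)
    also have "\<dots> \<le> y / z - 1" using p by (intro ln_le_minus_one) simp
    also have "\<dots> = (y - z) / z" using p by (simp add: field_simps)
    also have "\<dots> \<le> \<bar>y - z\<bar> / z" using p by (intro divide_right_mono) auto
    also have "\<dots> \<le> \<bar>y - z\<bar> / a" using p a by (intro divide_left_mono) auto
    finally show ?thesis .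
  qed
  have "twist_angle a b k r - twist_angle a b k s = \<alpha> * (ln r - ln s)"
    using assms a unfolding twist_angle_def \<alpha>_def by (simp add: ln_div diff_divide_distrib algebra_simps)
  moreover have "\<bar>ln r - ln s\<bar> \<le> \<bar>r - s\<bar> / a"
    using ln[OF assms] ln[OF assms(2,1)] by (simp add: abs_minus_commute abs_le_iff)
  ultimately show ?thesis using mult_left_mono[of "\<bar>ln r - ln s\<bar>" "\<bar>r - s\<bar> / a" "\<bar>\<alpha>\<bar>"] by (simp add: abs_mult)
qed

text \<open>For winding \<open>k\<close> the bound of \<open>log_energy_lower_bound\<close>, halved,
  is exactly the value in \<open>u_energy\<close>. Stated for a given polar representation, without
  reference to a homotopy class, so that the local statement can use it too.\<close>

lemma energy_minimal_winding:
  assumes pa: "polar_approximation a b V Vr Vt Z Zr Zt"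
    and E: "energy X v = (1/2) * (\<integral>\<^sup>+p. ennreal ((norm (Vr p / V p))\<^sup>2 * snd p + (norm (Vt p / V p))\<^sup>2 / snd p) \<partial>polar_rect a b)"
  shows "energy X v = ennreal ((LINT p|polar_rect a b. polar_approximation.log_energy_density V Vr Vt p) / 2)" (is "_ = ennreal (?I / 2)")
    and "AE t in ivl 0 (2*pi). (LINT r|ivl a b. Vr (t,r) / V (t,r)) = Complex (ln (b / a)) (2 * pi * of_int k) \<Longrightarrow> energy X u \<le> energy X v"
proof -
  interpret polar_approximation a b V Vr Vt Z Zr Zt by (rule pa)
  have "(\<integral>\<^sup>+p. ennreal (log_energy_density p) \<partial>R) = ennreal (2 * (?I / 2))"
    using nn_integral_eq_integral[OF log_energy_density_integrable] log_energy_density_nonneg by (simp add: AE_I2)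
  then show e: "energy X v = ennreal (?I / 2)"
    unfolding E log_energy_density_def[symmetric] by (simp only: half_ennreal_double)
  assume "AE t in ivl 0 (2*pi). (LINT r|ivl a b. Vr (t,r) / V (t,r)) = Complex (ln (b / a)) (2 * pi * of_int k)"
  from log_energy_lower_bound[OF this] show "energy X u \<le> energy X v"
    unfolding e u_energy by (intro ennreal_leI) (simp add: \<alpha>_def)
qed

lemma u_minimises_homotopy_class:
  assumes "v \<in> homotopy_class a b k" shows "energy X u \<le> energy X v"
proof (cases "energy X v < \<infinity>")
  case True
  obtain f where v: "v \<in> admissible a b" and f: "continuous_representative a b v f" "has_degree a b f k"
    using assms unfolding homotopy_class_def by blast
  obtain V Vr Vt Z Zr Zt where pa: "polar_approximation a b V Vr Vt Z Zr Zt"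
    and V: "AE p in polar_rect a b. V p = to_complex (v (polar (snd p) (fst p)))"
    and E: "energy X v = (1/2) * (\<integral>\<^sup>+p. ennreal ((norm (Vr p / V p))\<^sup>2 * snd p + (norm (Vt p / V p))\<^sup>2 / snd p) \<partial>polar_rect a b)"
    by (rule admissible_polar[OF a ab v True])
  obtain m where m: "AE t in ivl 0 (2*pi). integrable (ivl a b) (\<lambda>r. Vr (t,r) / V (t,r)) \<and>
       integrable (ivl a b) (\<lambda>r. (norm (Vr (t,r) / V (t,r)))\<^sup>2) \<and>
       (LINT r|ivl a b. Vr (t,r) / V (t,r)) = Complex (ln (b / a)) (2 * pi * of_int m) \<and>
       (AE r in ivl a b. V (t,r) = of_real a * cis t * exp (LINT x|ivl a r. Vr (t,x) / V (t,x)))"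
    by (rule polar_approximation.ray_structure[OF pa])
  have mk: "m = k" by (rule polar_approximation.degree_eq_ray_winding[OF pa V f m])
  have "AE t in ivl 0 (2*pi). (LINT r|ivl a b. Vr (t,r) / V (t,r)) = Complex (ln (b / a)) (2 * pi * of_int k)"
    using m unfolding mk by eventually_elim blast
  then show ?thesis by (rule energy_minimal_winding(2)[OF pa E])
qed (simp add: top.not_eq_extremum[symmetric])

text \<open>\<open>ray_separation\<close>, integrated over all angles, bounds \<open>2 pi\<close> by
  a multiple of the radial energy plus a multiple of the L1 distance. The constants depend only on
  \<open>a\<close>, \<open>b\<close> and \<open>k\<close> and divide the 2 pi into halves: a
  competitor of energy below \<open>E0\<close> has at most pi in the first term, one closer than
  \<open>\<delta>\<close> has less than pi in the second.\<close>

lemma u_L1_local_minimiser: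
  "\<exists>\<delta>>0. \<forall>v\<in>admissible a b. (LINT x|lebesgue_on X. norm (v x - u x)) < \<delta> \<longrightarrow> energy X u \<le> energy X v"
proof -
  define E0 where "E0 = pi * ln (b / a) * (2 + \<alpha>\<^sup>2)"
  have E0: "0 < E0" unfolding E0_def using L by (intro mult_pos_pos add_pos_nonneg) auto
  \<comment> \<open>Energy below \<open>E0\<close> bounds the integral of \<open>|Vr / V|^2\<close>
    by \<open>2 E0 / a\<close>: the 2 undoes the factor one half of the energy, and
    \<open>1 / a\<close> removes the weight \<open>r\<close>. Division by \<open>K\<close> leaves
    pi.\<close>
  define K where "K = 2 * E0 / (a * pi)"
  have K: "0 < K" using E0 a by (simp add: K_def)
  define c where "c = \<bar>\<alpha>\<bar> / a"
  have c: "0 < 2 * K / pi + c" using K a by (intro add_pos_nonneg) (auto simp: c_def)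
  \<comment> \<open>The largest width permitted by the two requirements of
    \<open>ray_separation\<close>; \<open>2 K / pi + c\<close> adds the rate granted by the energy
    to the Lipschitz constant of the twist angle.\<close>
  define \<rho> where "\<rho> = min ((b - a) / 2) (pi / 4 / (2 * K / pi + c))"
  have lip: "\<bar>twist_angle a b k r - twist_angle a b k s\<bar> \<le> c * \<bar>r - s\<bar>" if "r \<in> {a..b}" "s \<in> {a..b}" for r s
    unfolding c_def by (rule angle_lipschitz[OF that])
  have \<rho>0: "0 < \<rho>" unfolding \<rho>_def using ab c pi_gt_zero by (simp add: min_less_iff_conj)
  have \<rho>1: "\<rho> \<le> (b - a) / 2" unfolding \<rho>_def by (rule min.cobounded1)
  have \<rho>2: "\<rho> * (2 * K / pi + c) \<le> pi / 4"
  proof -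
    have "\<rho> \<le> pi / 4 / (2 * K / pi + c)" unfolding \<rho>_def by (rule min.cobounded2)
    then show ?thesis by (simp only: pos_le_divide_eq[OF c])
  qed
  \<comment> \<open>One factor \<open>a\<close> passes from the area measure to the measure on the
    rectangle, \<open>a * \<rho>\<close> is the separation gained on each ray, and pi is the half of
    2 pi left over by the energy term.\<close>
  define \<delta> where "\<delta> = a * (a * \<rho>) * pi"
  have "energy X u \<le> energy X v" if v: "v \<in> admissible a b" and near: "(LINT x|lebesgue_on X. norm (v x - u x)) < \<delta>" for v
  proof (rule ccontr)
    assume "\<not> ?thesis"
    then have less: "energy X v < ennreal E0" unfolding u_energy E0_def by simp
    then have fin: "energy X v < \<infinity>" using less_trans ennreal_less_top by fastforce
    let ?R = "polar_rect a b"
    obtain V Vr Vt Z Zr Zt where pa: "polar_approximation a b V Vr Vt Z Zr Zt"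
      and V: "AE p in ?R. V p = to_complex (v (polar (snd p) (fst p)))"
      and E: "energy X v = (1/2) * (\<integral>\<^sup>+p. ennreal ((norm (Vr p / V p))\<^sup>2 * snd p + (norm (Vt p / V p))\<^sup>2 / snd p) \<partial>?R)"
      by (rule admissible_polar[OF a ab v fin])
    interpret pa: polar_approximation a b V Vr Vt Z Zr Zt by (rule pa)
    obtain m where m: "AE t in ivl 0 (2*pi). integrable (ivl a b) (\<lambda>r. Vr (t,r) / V (t,r)) \<and>
         integrable (ivl a b) (\<lambda>r. (norm (Vr (t,r) / V (t,r)))\<^sup>2) \<and>
         (LINT r|ivl a b. Vr (t,r) / V (t,r)) = Complex (ln (b / a)) (2 * pi * of_int m) \<and>
         (AE r in ivl a b. V (t,r) = of_real a * cis t * exp (LINT x|ivl a r. Vr (t,x) / V (t,x)))"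
      by (rule pa.ray_structure)
    have mk: "m \<noteq> k"
    proof
      assume mk: "m = k"
      have "AE t in ivl 0 (2*pi). (LINT r|ivl a b. Vr (t,r) / V (t,r)) = Complex (ln (b / a)) (2 * pi * of_int k)"
        using m unfolding mk by eventually_elim blast
      from energy_minimal_winding(2)[OF pa E this] \<open>\<not> energy X u \<le> energy X v\<close> show False by blast
    qed
    define A where "A p = (norm (Vr p / V p))\<^sup>2" for p
    define B where "B p = norm (V p - of_real (snd p) * cis (fst p + twist_angle a b k (snd p)))" for p
    have mA: "A \<in> borel_measurable ?R" unfolding A_def[abs_def]
      by (intro measurable_norm_square borel_measurable_divide pa.meas)
    have mB: "B \<in> borel_measurable ?R"
    proof -
      have "continuous_on ({a..b} \<times> {0..2*pi}) (\<lambda>(r,t). complex_of_real r * cis (t + twist_angle a b k r))"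
        unfolding case_prod_beta twist_angle_def using a L by (intro continuous_intros) auto
      from borel_measurable_polar_rect_continuous[OF this] show ?thesis
        unfolding B_def[abs_def] case_prod_beta by (intro measurable_compose[OF borel_measurable_diff[OF pa.meas(1)] borel_measurable_norm])
    qed
    have e: "(\<lambda>p. ennreal (f p)) \<in> borel_measurable ?R" if "f \<in> borel_measurable ?R" for f :: "real \<times> real \<Rightarrow> real"
      using measurable_compose[OF that measurable_ennreal] .
    note fub = sigma_finite_measure.nn_integral_fst[OF finite_measure_ivl[THEN finite_measure.axioms(1)]]
      and fubm = sigma_finite_measure.borel_measurable_nn_integral_fst[OF finite_measure_ivl[THEN finite_measure.axioms(1)]]
    let ?NA = "\<integral>\<^sup>+p. ennreal (A p) \<partial>?R" and ?NB = "\<integral>\<^sup>+p. ennreal (B p) \<partial>?R"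
    \<comment> \<open>The reference on each ray is the twist map itself, so the relative winding is
      \<open>m - k\<close>, which is not 0.\<close>
    have "AE t in ivl 0 (2*pi). 1 \<le> ennreal (1 / K) * (\<integral>\<^sup>+r. ennreal (A (t,r)) \<partial>ivl a b) + ennreal (1 / (a * \<rho>)) * (\<integral>\<^sup>+r. ennreal (B (t,r)) \<partial>ivl a b)"
      using m
    proof eventually_elim
      fix t assume t: "integrable (ivl a b) (\<lambda>r. Vr (t,r) / V (t,r)) \<and>
         integrable (ivl a b) (\<lambda>r. (norm (Vr (t,r) / V (t,r)))\<^sup>2) \<and>
         (LINT r|ivl a b. Vr (t,r) / V (t,r)) = Complex (ln (b / a)) (2 * pi * of_int m) \<and>
         (AE r in ivl a b. V (t,r) = of_real a * cis t * exp (LINT x|ivl a r. Vr (t,x) / V (t,x)))"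
      have "Im (LINT r|ivl a b. Vr (t,r) / V (t,r)) - twist_angle a b k b = 2 * pi * of_int (m - k)"
        using t by (simp add: angle_ends algebra_simps)
      moreover have "m - k \<noteq> 0" using mk by simp
      ultimately show "1 \<le> ennreal (1 / K) * (\<integral>\<^sup>+r. ennreal (A (t,r)) \<partial>ivl a b) + ennreal (1 / (a * \<rho>)) * (\<integral>\<^sup>+r. ennreal (B (t,r)) \<partial>ivl a b)"
        unfolding A_def B_def fst_conv snd_conv
        using t lip
        by (intro ray_separation[where P="\<lambda>r. Vr (t,r) / V (t,r)" and g="twist_angle a b k" and c=c and j="m - k",
              OF a ab _ _ angle_ends(1) _ _ _ _ K \<rho>0 \<rho>1 \<rho>2]) blast+
    qed
    from nn_integral_mono_AE[OF this]
    have "(\<integral>\<^sup>+t. 1 \<partial>ivl 0 (2*pi)) \<le> (\<integral>\<^sup>+t. ennreal (1 / K) * (\<integral>\<^sup>+r. ennreal (A (t,r)) \<partial>ivl a b) + ennreal (1 / (a * \<rho>)) * (\<integral>\<^sup>+r. ennreal (B (t,r)) \<partial>ivl a b) \<partial>ivl 0 (2*pi))" .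
    also have "\<dots> = ennreal (1 / K) * ?NA + ennreal (1 / (a * \<rho>)) * ?NB"
      using fubm[OF e[OF mA]] fubm[OF e[OF mB]]
      by (simp add: nn_integral_add nn_integral_cmult fub[OF e[OF mA]] fub[OF e[OF mB]])
    also have "(\<integral>\<^sup>+t. 1 \<partial>ivl 0 (2*pi)) = ennreal (2 * pi)" by (simp add: emeasure_restrict_space)
    finally have total: "ennreal (2 * pi) \<le> ennreal (1 / K) * ?NA + ennreal (1 / (a * \<rho>)) * ?NB" .
    have NA: "?NA \<le> ennreal (2 * E0 / a)"
    proof -
      let ?I = "LINT p|?R. pa.log_energy_density p"
      have "ennreal (?I / 2) < ennreal E0" using less unfolding energy_minimal_winding(1)[OF pa E] .
      then have "\<not> E0 \<le> ?I / 2" using ennreal_leI[of E0 "?I / 2"] by (auto simp only: not_le[symmetric])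
      then have I: "?I < 2 * E0" by simp
      have "?NA \<le> (\<integral>\<^sup>+p. ennreal ((1 / a) * pa.log_energy_density p) \<partial>?R)"
      proof (rule nn_integral_mono)
        fix p assume p: "p \<in> space ?R"
        have "A p * a \<le> A p * snd p" using pa.snd_bounds(1)[OF p] by (intro mult_left_mono) (auto simp: A_def)
        also have "\<dots> \<le> pa.log_energy_density p"
          unfolding pa.log_energy_density_def A_def using pa.snd_bounds(3)[OF p] by simp
        finally show "ennreal (A p) \<le> ennreal ((1 / a) * pa.log_energy_density p)"
          using a by (intro ennreal_leI) (simp add: pos_le_divide_eq)
      qed
      also have "\<dots> = ennreal ((1 / a) * ?I)"
        using nn_integral_eq_integral[OF integrable_mult_right[OF pa.log_energy_density_integrable, of "1 / a"]] pa.log_energy_density_nonneg a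
        by (simp add: AE_I2)
      also have "\<dots> \<le> ennreal (2 * E0 / a)" using I a by (intro ennreal_leI) (simp add: divide_right_mono)
      finally show ?thesis .
    qed
    define N where "N = (LINT x|lebesgue_on X. norm (v x - u x))"
    have NB: "?NB \<le> ennreal (N / a)"
    proof -
      have XB: "X \<in> sets borel" using open_annulus by auto
      have fm: "finite_measure (lebesgue_on X)" using XB by (intro finite_measure_lebesgue_on bounded_annulus) simp
      have "square_integrable (lebesgue_on X) v" using v unfolding admissible_def W12_def by blast
      then have i: "integrable (lebesgue_on X) (\<lambda>x. norm (v x - u x))"
        by (intro integrable_norm Bochner_Integration.integrable_diff square_integrable_imp_integrable[OF fm]
            square_integrable_continuous[OF open_annulus bounded_annulus u_continuous])
      obtain g where g: "g \<in> borel_measurable borel" "AE x in lborel. x \<in> X \<longrightarrow> norm (v x - u x) = g x"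
        by (rule borel_representative[OF XB borel_measurable_integrable[OF i]])
      have "ennreal N = (\<integral>\<^sup>+x. ennreal (g x) * indicator X x \<partial>lborel)"
        unfolding N_def by (rule LINT_lebesgue_on_eq_nn[OF XB i norm_ge_zero g])
      also have "\<dots> = (\<integral>\<^sup>+p. ennreal (g (polar (snd p) (fst p))) * ennreal (snd p) \<partial>?R)"
        by (rule nn_integral_annulus_polar[OF a ab measurable_compose[OF g(1) measurable_ennreal]])
      finally have N: "ennreal N = (\<integral>\<^sup>+p. ennreal (g (polar (snd p) (fst p))) * ennreal (snd p) \<partial>?R)" .
      have "(\<integral>\<^sup>+p. ennreal a * ennreal (B p) \<partial>?R) \<le> ennreal N"
        unfolding N
      proof (rule nn_integral_mono_AE)
        show "AE p in ?R. ennreal a * ennreal (B p) \<le> ennreal (g (polar (snd p) (fst p))) * ennreal (snd p)"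
          using AE_annulus_polar[OF a ab g(2)] V AE_space
        proof eventually_elim
          fix p assume g: "norm (v (polar (snd p) (fst p)) - u (polar (snd p) (fst p))) = g (polar (snd p) (fst p))"
            and V: "V p = to_complex (v (polar (snd p) (fst p)))" and p: "p \<in> space ?R"
          have r: "snd p \<in> {a..b}" using pa.snd_bounds(1,2)[OF p] by simp
          have "g (polar (snd p) (fst p)) = norm (to_complex (v (polar (snd p) (fst p)) - u (polar (snd p) (fst p))))"
            unfolding norm_to_complex g ..
          also have "\<dots> = B p" unfolding to_complex_diff u_polar[OF r] to_complex_polar V[symmetric] B_def ..
          finally have "g (polar (snd p) (fst p)) = B p" .
          then show "ennreal a * ennreal (B p) \<le> ennreal (g (polar (snd p) (fst p))) * ennreal (snd p)"
            using r by (subst mult.commute) (simp add: mult_left_mono ennreal_leI)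
        qed
      qed
      then have "ennreal (1 / a) * (ennreal a * ?NB) \<le> ennreal (1 / a) * ennreal N"
        unfolding nn_integral_cmult[OF e[OF mB]] by (intro mult_left_mono) auto
      moreover have "ennreal (1 / a) * (ennreal a * ?NB) = ?NB"
        using a by (simp add: mult.assoc[symmetric] ennreal_mult[symmetric])
      moreover have "ennreal (1 / a) * ennreal N = ennreal (N / a)"
        using a by (simp add: ennreal_mult'[symmetric])
      ultimately show ?thesis by simp
    qed
    have N0: "0 \<le> N" unfolding N_def by (rule Bochner_Integration.integral_nonneg) simp
    have "ennreal (2 * pi) \<le> ennreal (1 / K) * ennreal (2 * E0 / a) + ennreal (1 / (a * \<rho>)) * ennreal (N / a)"
      by (rule order_trans[OF total]) (intro add_mono mult_left_mono NA NB; simp)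
    also have "\<dots> = ennreal (1 / K * (2 * E0 / a) + 1 / (a * \<rho>) * (N / a))"
      using K E0 a \<rho>0 N0 by (simp add: ennreal_mult'[symmetric] ennreal_plus[symmetric] del: ennreal_plus)
    finally have "2 * pi \<le> 1 / K * (2 * E0 / a) + 1 / (a * \<rho>) * (N / a)"
      using K E0 a \<rho>0 N0 by (subst (asm) ennreal_le_iff) auto
    moreover have "1 / K * (2 * E0 / a) = pi" using E0 a by (simp add: K_def)
    moreover have "1 / (a * \<rho>) * (N / a) < pi"
      using near a \<rho>0 unfolding N_def[symmetric] \<delta>_def by (simp add: pos_divide_less_eq mult.commute mult.left_commute)
    ultimately show False by linarith
  qed
  moreover have "0 < \<delta>" using a \<rho>0 by (simp add: \<delta>_def)
  ultimately show ?thesis by blast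
qed

end

theorem mainTheorem1:
  fixes a b :: real and k :: int
  assumes "0 < a" and "a < b"
  defines "X \<equiv> annulus a b"
  defines "u \<equiv> twist (twist_angle a b k)"
  shows "u \<in> homotopy_class a b k
    \<and> energy X u = (INF v\<in>homotopy_class a b k. energy X v)
    \<and> (\<exists>\<delta>>0. \<forall>v\<in>admissible a b.
          (LINT x|lebesgue_on X. norm (v x - u x)) < \<delta> \<longrightarrow> energy X u \<le> energy X v)"
proof -
  interpret log_twist_map a b k by unfold_locales (use assms in auto)
  have "energy (annulus a b) (twist (twist_angle a b k)) = (INF v\<in>homotopy_class a b k. energy (annulus a b) v)"
  proof (rule antisym)
    show "energy (annulus a b) (twist (twist_angle a b k)) \<le> (INF v\<in>homotopy_class a b k. energy (annulus a b) v)"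
      by (rule INF_greatest) (rule u_minimises_homotopy_class)
    show "(INF v\<in>homotopy_class a b k. energy (annulus a b) v) \<le> energy (annulus a b) (twist (twist_angle a b k))"
      by (rule INF_lower) (rule u_homotopy_class)
  qed
  then show ?thesis unfolding X_def u_def using u_homotopy_class u_L1_local_minimiser by blast
qed

end
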